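(* The $K$-ring of the adelic Riemann sphere is $$K\left(\mathbb{C}P^1_{\mathbb{Q}}\right)\cong\frac{\mathbb{Z}[x^{q}\ /\ q\in\mathbb{Q}]}{\left\langle\,(x^{q}-1)(x^{p}-1)\ /\ q,p\in\mathbb{Q}\,\right\rangle}$$ (isomorphism of rings).
   Context: For integers $n,m\ge 1$ with $n\mid m$ let $p_{n,m}(z)=z^{m/n}$. The algebraic solenoid is the inverse limit $\mathbb{C}^*_{\mathbb{Q}}=\varprojlim \mathbb{C}^*$ over the maps $p_{n,m}:\mathbb{C}^*\to\mathbb{C}^*$ (index set: positive integers ordered by divisibility), a topological abelian group. The adelic Riemann sphere is the inverse limit $\mathbb{C}P^1_{\mathbb{Q}}=\varprojlim\mathbb{C}P^1$ over the ramified coverings $p_{n,m}:\mathbb{C}P^1\to\mathbb{C}P^1$; it is $\mathbb{C}^*_{\mathbb{Q}}$ together with two points (cusps) $0$ and $\infty$. Complex structure: let $\hat{\mathbb{Z}}=\varprojlim\mathbb{Z}/n\mathbb{Z}$ and define $\exp:\hat{\mathbb{Z}}\times\mathbb{C}\to\mathbb{C}^*_{\mathbb{Q}}$ by $\exp(a,z)=\big(e^{2\pi i a_n/n}e^{iz/n}\big)_{n\ge1}$, where $a=(a_n)_n$. A map from $\mathbb{C}^*_{\mathbb{Q}}$ to a complex manifold is holomorphic if it is continuous and, for each $a\in\hat{\mathbb{Z}}$, its composition with $z\mapsto\exp(a,z)$ is holomorphic on $\mathbb{C}$. A holomorphic vector bundle of rank $n$ over $\mathbb{C}P^1_{\mathbb{Q}}$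 is a vector bundle obtained by gluing trivial rank $n$ bundles over $\mathbb{C}P^1_{\mathbb{Q}}\setminus\{\infty\}$ and $\mathbb{C}P^1_{\mathbb{Q}}\setminus\{0\}$ along $\mathbb{C}^*_{\mathbb{Q}}$ by a clutching map $\mathbb{C}^*_{\mathbb{Q}}\to GL(n,\mathbb{C})$ that is holomorphic. Direct sums and tensor products correspond to block diagonal sums and Kronecker products of clutching maps. A holomorphic isotopy between holomorphic maps $f_0,f_1:\mathbb{C}^*_{\mathbb{Q}}\to GL(n,\mathbb{C})$ is a continuous map $H:\mathbb{C}^*_{\mathbb{Q}}\times[0,1]\to GL(n,\mathbb{C})$ with $H(\cdot,t)$ holomorphic for every $t$, $H(\cdot,0)=f_0$ and $H(\cdot,1)=f_1$. Two holomorphic vector bundles of the same rank are regarded as isomorphic when their clutching maps are holomorphically isotopic. $K(\mathbb{C}P^1_{\mathbb{Q}})$ is the Grothendieck ring of isomorphism classes of holomorphic vector bundles over $\mathbb{C}P^1_{\mathbb{Q}}$, with addition induced by $\oplus$ and multiplication induced by $\otimes$. $\mathbb{Z}[x^q\ /\ q\in\mathbb{Q}]$ denotes the ring of finite integer combinations of the symbols $x^q$, $q\in\mathbb{Q}$, with $x^px^q=x^{p+q}$ and $x^0=1$ (the integral group ring of $(\mathbb{Q},+)$), and $\langle\cdot\rangle$ denotes the ideal generated. *)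

theory Defs
  imports
    "HOL-Analysis.Analysis"
    "HOL-Algebra.QuotRing"
    "HOL-Algebra.Algebraic_Closure_Type"
    "HOL-Library.Poly_Mapping"
    "Jordan_Normal_Form.Matrix"
begin

text \<open>
  \<open>p n m\<close> is the bonding map from level \<open>m\<close> to level \<open>n\<close>, for \<open>n dvd m\<close>.  Points are
  families on \<open>{1..}\<close>, extensional (\<open>undefined\<close>) at the unused index \<open>0\<close>.
\<close>

definition divisibility_limit ::
    "(nat \<Rightarrow> 'a topology) \<Rightarrow> (nat \<Rightarrow> nat \<Rightarrow> 'a \<Rightarrow> 'a) \<Rightarrow> (nat \<Rightarrow> 'a) topology" where
  "divisibility_limit T p =
     subtopology (product_topology T {1..})
       {x. \<forall>n\<ge>1. \<forall>m\<ge>1. n dvd m \<longrightarrow> x n = p n m (x m)}"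

definition solenoid :: "(nat \<Rightarrow> complex) topology" where
  "solenoid =
     divisibility_limit (\<lambda>n. top_of_set (- {0})) (\<lambda>n m z. z ^ (m div n))"

text \<open>\<open>None\<close> is the point at infinity.\<close>

definition riemann_sphere :: "complex option topology" where
  "riemann_sphere = Alexandroff_compactification euclidean"

definition adelic_sphere :: "(nat \<Rightarrow> complex option) topology" where
  "adelic_sphere =
     divisibility_limit (\<lambda>n. riemann_sphere) (\<lambda>n m. map_option (\<lambda>z. z ^ (m div n)))"

definition solenoid_embed :: "(nat \<Rightarrow> complex) \<Rightarrow> (nat \<Rightarrow> complex option)" where
  "solenoid_embed x = (\<lambda>n\<in>{1..}. Some (x n))"

text \<open>The residue ring modulo \<open>n\<close> is represented by \<open>{0..<n}\<close>.\<close>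

definition profinite_integers :: "(nat \<Rightarrow> int) set" where
  "profinite_integers =
     topspace (divisibility_limit (\<lambda>n. discrete_topology {0..<int n}) (\<lambda>n m a. a mod int n))"

definition solenoid_exp :: "(nat \<Rightarrow> int) \<Rightarrow> complex \<Rightarrow> (nat \<Rightarrow> complex)" where
  "solenoid_exp a z =
     (\<lambda>n\<in>{1..}. exp (2 * of_real pi * \<i> * of_int (a n) / of_nat n) * exp (\<i> * z / of_nat n))"

definition vec_topology :: "nat \<Rightarrow> complex Matrix.vec topology" where
  "vec_topology n =
     pullback_topology (carrier_vec n) (\<lambda>v. \<lambda>i\<in>{..<n}. vec_index v i)
       (product_topology (\<lambda>_. euclidean) {..<n})"

definition GL :: "nat \<Rightarrow> complex Matrix.mat set" where
  "GL n = {A \<in> carrier_mat n n. invertible_mat A}"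

definition GL_topology :: "nat \<Rightarrow> complex Matrix.mat topology" where
  "GL_topology n =
     pullback_topology (GL n) (\<lambda>A. \<lambda>ij\<in>{..<n} \<times> {..<n}. A $$ ij)
       (product_topology (\<lambda>_. euclidean) ({..<n} \<times> {..<n}))"

definition solenoid_holomorphic ::
    "nat \<Rightarrow> ((nat \<Rightarrow> complex) \<Rightarrow> complex Matrix.mat) \<Rightarrow> bool" where
  "solenoid_holomorphic n f \<longleftrightarrow>
     continuous_map solenoid (GL_topology n) f \<and>
     (\<forall>a\<in>profinite_integers. \<forall>i<n. \<forall>j<n.
        (\<lambda>z. f (solenoid_exp a z) $$ (i, j)) holomorphic_on UNIV)"

definition holomorphic_isotopic ::
    "nat \<Rightarrow> ((nat \<Rightarrow> complex) \<Rightarrow> complex Matrix.mat) \<Rightarrow>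
     ((nat \<Rightarrow> complex) \<Rightarrow> complex Matrix.mat) \<Rightarrow> bool" where
  "holomorphic_isotopic n f\<^sub>0 f\<^sub>1 \<longleftrightarrow>
     (\<exists>H. continuous_map (prod_topology solenoid (top_of_set {0..1::real})) (GL_topology n) H \<and>
          (\<forall>t\<in>{0..1}. solenoid_holomorphic n (\<lambda>x. H (x, t))) \<and>
          (\<forall>x\<in>topspace solenoid. H (x, 0) = f\<^sub>0 x \<and> H (x, 1) = f\<^sub>1 x))"

datatype cusp = Zero_Cusp | Infinity_Cusp

fun cusp_point :: "cusp \<Rightarrow> (nat \<Rightarrow> complex option)" where
  "cusp_point Zero_Cusp = (\<lambda>n\<in>{1..}. Some 0)"
| "cusp_point Infinity_Cusp = (\<lambda>n\<in>{1..}. None)"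

definition chart_domain :: "cusp \<Rightarrow> (nat \<Rightarrow> complex option) topology" where
  "chart_domain c =
     subtopology adelic_sphere (- cusp_point ` (- {c}))"

definition quotient_topology :: "'a topology \<Rightarrow> ('a \<times> 'a) set \<Rightarrow> 'a set topology" where
  "quotient_topology T r = topology (\<lambda>U. U \<subseteq> topspace T // r \<and> openin T (\<Union>U))"

type_synonym local_point = "cusp \<times> (nat \<Rightarrow> complex option) \<times> complex Matrix.vec"

definition trivial_pieces :: "nat \<Rightarrow> local_point topology" where
  "trivial_pieces n = sum_topology (\<lambda>c. prod_topology (chart_domain c) (vec_topology n)) UNIV"

definition clutching_identification ::
    "nat \<Rightarrow> ((nat \<Rightarrow> complex) \<Rightarrow> complex Matrix.mat) \<Rightarrow> (local_point \<times> local_point) set" where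
  "clutching_identification n f =
     {((Zero_Cusp, solenoid_embed x, v), (Infinity_Cusp, solenoid_embed x, f x *\<^sub>v v)) | x v.
        x \<in> topspace solenoid \<and> v \<in> carrier_vec n}"

definition clutching_equivalence ::
    "nat \<Rightarrow> ((nat \<Rightarrow> complex) \<Rightarrow> complex Matrix.mat) \<Rightarrow> (local_point \<times> local_point) set" where
  "clutching_equivalence n f =
     Id_on (topspace (trivial_pieces n)) \<union>
     clutching_identification n f \<union> (clutching_identification n f)\<inverse>"

text \<open>The linear structure of the fibres is the one transported by the trivialisations.\<close>

record glued_bundle =
  bundle_rank :: nat
  total_space :: "local_point set topology"
  projection :: "local_point set \<Rightarrow> (nat \<Rightarrow> complex option)"
  trivialisation :: "cusp \<Rightarrow> (nat \<Rightarrow> complex option) \<times> complex Matrix.vec \<Rightarrow> local_point set"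

definition glue ::
    "nat \<Rightarrow> ((nat \<Rightarrow> complex) \<Rightarrow> complex Matrix.mat) \<Rightarrow> glued_bundle" where
  "glue n f =
     \<lparr> bundle_rank = n,
       total_space = quotient_topology (trivial_pieces n) (clutching_equivalence n f),
       projection = (\<lambda>e. THE x. \<exists>c v. (c, x, v) \<in> e),
       trivialisation = (\<lambda>c p. clutching_equivalence n f `` {(c, p)}) \<rparr>"

text \<open>
  Rank \<open>0\<close> is allowed, so that isomorphism classes have a zero for the direct sum; \<open>GL 0\<close> is the
  trivial group.
\<close>

definition holomorphic_bundles :: "glued_bundle set" where
  "holomorphic_bundles = {glue n f | n f. solenoid_holomorphic n f}"

text \<open>
  The transition function between the two trivialisations; for \<open>glue n f\<close> it agrees with \<open>f\<close> on
  the solenoid.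
\<close>

definition clutching_map :: "glued_bundle \<Rightarrow> (nat \<Rightarrow> complex) \<Rightarrow> complex Matrix.mat" where
  "clutching_map E x =
     (THE A. A \<in> GL (bundle_rank E) \<and>
        (\<forall>v\<in>carrier_vec (bundle_rank E).
           trivialisation E Zero_Cusp (solenoid_embed x, v) =
           trivialisation E Infinity_Cusp (solenoid_embed x, A *\<^sub>v v)))"

text \<open>
  Isomorphism of bundles means, by convention, holomorphic isotopy of clutching maps (not the
  existence of a fibrewise linear homeomorphism).
\<close>

definition bundle_iso :: "(glued_bundle \<times> glued_bundle) set" where
  "bundle_iso =
     {(E, F). E \<in> holomorphic_bundles \<and> F \<in> holomorphic_bundles \<and>
        bundle_rank E = bundle_rank F \<and>
        holomorphic_isotopic (bundle_rank E) (clutching_map E) (clutching_map F)}"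

definition kronecker_product ::
    "complex Matrix.mat \<Rightarrow> complex Matrix.mat \<Rightarrow> complex Matrix.mat" where
  "kronecker_product A B =
     Matrix.mat (dim_row A * dim_row B) (dim_col A * dim_col B)
       (\<lambda>(i, j). A $$ (i div dim_row B, j div dim_col B) * B $$ (i mod dim_row B, j mod dim_col B))"

definition trivial_bundle :: "nat \<Rightarrow> glued_bundle" where
  "trivial_bundle n = glue n (\<lambda>x. 1\<^sub>m n)"

definition bundle_sum :: "glued_bundle \<Rightarrow> glued_bundle \<Rightarrow> glued_bundle" where
  "bundle_sum E F =
     glue (bundle_rank E + bundle_rank F)
       (\<lambda>x. diag_block_mat [clutching_map E x, clutching_map F x])"

definition bundle_tensor :: "glued_bundle \<Rightarrow> glued_bundle \<Rightarrow> glued_bundle" where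
  "bundle_tensor E F =
     glue (bundle_rank E * bundle_rank F)
       (\<lambda>x. kronecker_product (clutching_map E x) (clutching_map F x))"

text \<open>
  The operation induced by \<open>f\<close> on the classes of \<open>r\<close>; the union is a class exactly when \<open>f\<close>
  respects \<open>r\<close>.
\<close>

definition lift_to_classes ::
    "('a \<times> 'a) set \<Rightarrow> ('a \<Rightarrow> 'a \<Rightarrow> 'a) \<Rightarrow> 'a set \<Rightarrow> 'a set \<Rightarrow> 'a set" where
  "lift_to_classes r f C D = (\<Union>x\<in>C. \<Union>y\<in>D. r `` {f x y})"

definition bundle_semiring :: "glued_bundle set ring" where
  "bundle_semiring =
     \<lparr> carrier = holomorphic_bundles // bundle_iso,
       mult = lift_to_classes bundle_iso bundle_tensor,
       one = bundle_iso `` {trivial_bundle 1},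
       zero = bundle_iso `` {trivial_bundle 0},
       add = lift_to_classes bundle_iso bundle_sum \<rparr>"

text \<open>The Grothendieck ring: the pair \<open>(a, b)\<close> stands for the formal difference \<open>a - b\<close>.\<close>

definition grothendieck_rel :: "('a, 'm) ring_scheme \<Rightarrow> (('a \<times> 'a) \<times> ('a \<times> 'a)) set" where
  "grothendieck_rel R =
     {((a, b), (c, d)) | a b c d.
        a \<in> carrier R \<and> b \<in> carrier R \<and> c \<in> carrier R \<and> d \<in> carrier R \<and>
        (\<exists>k\<in>carrier R. (a \<oplus>\<^bsub>R\<^esub> d) \<oplus>\<^bsub>R\<^esub> k = (c \<oplus>\<^bsub>R\<^esub> b) \<oplus>\<^bsub>R\<^esub> k)}"

definition grothendieck_ring :: "('a, 'm) ring_scheme \<Rightarrow> ('a \<times> 'a) set ring" where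
  "grothendieck_ring R =
     \<lparr> carrier = (carrier R \<times> carrier R) // grothendieck_rel R,
       mult = lift_to_classes (grothendieck_rel R)
         (\<lambda>(a, b) (c, d).
            ((a \<otimes>\<^bsub>R\<^esub> c) \<oplus>\<^bsub>R\<^esub> (b \<otimes>\<^bsub>R\<^esub> d), (a \<otimes>\<^bsub>R\<^esub> d) \<oplus>\<^bsub>R\<^esub> (b \<otimes>\<^bsub>R\<^esub> c))),
       one = grothendieck_rel R `` {(\<one>\<^bsub>R\<^esub>, \<zero>\<^bsub>R\<^esub>)},
       zero = grothendieck_rel R `` {(\<zero>\<^bsub>R\<^esub>, \<zero>\<^bsub>R\<^esub>)},
       add = lift_to_classes (grothendieck_rel R)
         (\<lambda>(a, b) (c, d). (a \<oplus>\<^bsub>R\<^esub> c, b \<oplus>\<^bsub>R\<^esub> d)) \<rparr>"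

definition K_adelic_sphere :: "(glued_bundle set \<times> glued_bundle set) set ring" where
  "K_adelic_sphere = grothendieck_ring bundle_semiring"

definition rat_group_ring :: "(rat \<Rightarrow>\<^sub>0 int) ring" where
  "rat_group_ring = ring_of_type_algebra"

definition xpow :: "rat \<Rightarrow> (rat \<Rightarrow>\<^sub>0 int)" where
  "xpow q = Poly_Mapping.single q 1"

end

theory Submission
  imports Defs "HOL-Complex_Analysis.Complex_Analysis" "HOL-Real_Asymp.Real_Asymp"
    "Jordan_Normal_Form.Determinant"
begin

text \<open>
  Two numbers decide everything: the rank of a bundle and a rational degree.  For a rational number
  \<open>q = a / b\<close> let \<open>chi q\<close> be the character \<open>x \<mapsto> x\<^sub>b\<^sup>a\<close> of the solenoid.  Every holomorphic clutching
  map of rank \<open>n \<ge> 1\<close> is holomorphically isotopic to \<open>diag(chi q, 1, \<dots>, 1)\<close> for exactly one \<open>q\<close>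
  (\<open>isotopic_std_exists\<close> and \<open>std_isotopic_imp_eq\<close>).  Rotating coordinate planes collects diagonal
  characters in one entry, so block sums and Kronecker products act on the pairs (rank, degree) by
  \<open>(n, q) + (m, p) = (n + m, q + p)\<close> and \<open>(n, q) (m, p) = (n m, m q + n p)\<close>.  Formal differences
  of such pairs are all of \<open>\<int> \<times> \<rat>\<close> with the multiplication of dual numbers
  (\<open>K_adelic_sphere_iso\<close>).  On the other side \<open>x\<^sup>q \<mapsto> (1, q)\<close> is a ring homomorphism from the group
  ring onto the same ring.  Its kernel is generated by the products \<open>(x\<^sup>q - 1) (x\<^sup>p - 1)\<close>: modulo
  them \<open>q \<mapsto> x\<^sup>q - 1\<close> is additive, so every element is congruent to an integer plus some
  \<open>x\<^sup>q - 1\<close> (\<open>group_ring_quotient_iso\<close>).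

  The degree is unique because an isotopy from \<open>chi q\<close> to \<open>chi q'\<close> changes the argument along the
  line \<open>s \<mapsto> exp (0, s)\<close>, which stays in a compact set, by a bounded amount, whereas the arguments of
  the two ends are \<open>q s\<close> and \<open>q' s\<close>.

  Existence is the analytic part.  On a compact shell \<open>1/R \<le> |x\<^sub>1| \<le> R\<close> a holomorphic function is
  uniformly close to a Laurent polynomial in one coordinate \<open>x\<^sub>m\<close> (\<open>shol_laurent_approximation\<close>).  A
  clutching map \<open>f\<close> is therefore close on the shell to a matrix of Laurent polynomials, which
  elimination over \<open>\<complex>[z]\<close> turns into a product of elementary matrices and a triangular matrix.  The
  diagonal polynomials have no zeros in the corresponding annulus, hence are close there to functions
  \<open>z\<^sup>k exp (q(z))\<close>, which are invertible everywhere.  This gives a clutching map \<open>F\<close> which is visibly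
  isotopic to a diagonal of characters and for which \<open>h = f\<^sup>-\<^sup>1 F\<close> is close to \<open>1\<close> on the shell.

  It remains to see that such an \<open>h\<close>, about which nothing is known away from the shell, is isotopic
  to \<open>1\<close> (\<open>isotopic_one_near_one\<close>).  Splitting \<open>h - 1\<close> approximately into a part which stays
  small up to the cusp \<open>0\<close> and a part which grows at most like \<open>|x\<^sub>1|\<close> towards the cusp \<open>\<infinity>\<close>
  replaces \<open>h\<close> by some \<open>A h B\<close> with half the error (\<open>factorisation_step\<close>).  Iterating yields infinite products of the factors \<open>A\<close> near one cusp and
  of the factors \<open>B\<close> near the other, and a factorisation \<open>h = a (a\<^sup>-\<^sup>1 h)\<close> into globally defined maps,
  each the inverse of one such infinite product on its side.  Every partial product is isotopic
  to \<open>1\<close>.  Translating towards the cusp while undoing one more factor in each time unit moves the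
  whole infinite product to \<open>1\<close> (\<open>slide\<close>).
\<close>

section \<open>The solenoid\<close>

definition sol :: "(nat \<Rightarrow> complex) set" where
  "sol = topspace solenoid"

lemma sol_eq:
  "sol = {x. x 0 = undefined \<and> (\<forall>n\<ge>1. x n \<noteq> 0)} \<inter>
     {x. \<forall>n\<ge>1. \<forall>m\<ge>1. n dvd m \<longrightarrow> x n = x m ^ (m div n)}"
proof -
  have "(PiE {1..} (\<lambda>n. - {0})) = {x::nat \<Rightarrow> complex. x 0 = undefined \<and> (\<forall>n\<ge>1. x n \<noteq> 0)}"
    by (auto simp: PiE_iff extensional_def) (metis not_less_eq_eq le_0_eq)
  then show ?thesis
    unfolding sol_def solenoid_def divisibility_limit_def by simp
qed

lemma sol_0: "x \<in> sol \<Longrightarrow> x 0 = undefined"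
  and sol_nonzero: "x \<in> sol \<Longrightarrow> n \<ge> 1 \<Longrightarrow> x n \<noteq> 0"
  unfolding sol_eq by blast+

lemma sol_coherent:
  assumes "x \<in> sol" and n: "n \<ge> 1" and k: "k \<ge> 1"
  shows "x n = x (n * k) ^ k"
proof -
  have "\<forall>m\<ge>1. n dvd m \<longrightarrow> x n = x m ^ (m div n)"
    using assms(1) unfolding sol_eq by (blast intro: n)
  from spec[OF this, of "n * k"] have "x n = x (n * k) ^ (n * k div n)" using n k by simp
  then show ?thesis using n by (simp only: nonzero_mult_div_cancel_left)
qed

lemma solI:
  assumes "x 0 = undefined" "\<And>n. n \<ge> 1 \<Longrightarrow> x n \<noteq> 0"
    and "\<And>n k. n \<ge> 1 \<Longrightarrow> k \<ge> 1 \<Longrightarrow> x n = x (n * k) ^ k"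
  shows "x \<in> sol"
proof -
  have "x n = x m ^ (m div n)" if nm: "n \<ge> 1" "m \<ge> 1" "n dvd m" for n m
  proof -
    from nm(3) obtain k where k: "m = n * k" by blast
    with nm have "k \<ge> 1" by (cases k) auto
    have "m div n = k" using k nm by simp
    with assms(3)[OF nm(1) \<open>k \<ge> 1\<close>] k show ?thesis by (simp only:)
  qed
  then show ?thesis using assms(1,2) unfolding sol_eq by blast
qed

lemma continuous_on_coordinate: "continuous_on S (\<lambda>x::nat \<Rightarrow> complex. x n)"
  by (rule continuous_on_subset[OF continuous_on_product_coordinates]) auto

lemma continuous_on_coordinate_of:
  "continuous_on S g \<Longrightarrow> continuous_on S (\<lambda>p. (g p :: nat \<Rightarrow> complex) n)"
  by (rule continuous_on_compose2[OF continuous_on_coordinate[of UNIV]]) auto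

text \<open>
  The inverse limit carries the product topology, and so does the function type.  The solenoid is thus
  a subspace of a metrisable space, where sequences detect compactness and continuity.
\<close>

lemma solenoid_eq: "solenoid = top_of_set sol"
proof -
  let ?T = "\<lambda>n::nat. top_of_set (- {0::complex})"
  have 1: "continuous_map solenoid (top_of_set sol) id"
  proof -
    have "continuous_map solenoid euclidean (\<lambda>x. x k)" for k
    proof (cases "k = 0")
      case True
      have "continuous_map solenoid euclidean (\<lambda>x. undefined :: complex)" by simp
      then show ?thesis
        by (rule continuous_map_eq) (use True sol_0 in \<open>force simp flip: sol_def\<close>)
    next
      case False
      have "continuous_map (product_topology ?T {1..}) (?T k) (\<lambda>x. x k)"
        by (rule continuous_map_product_projection) (use False in auto)
      then have "continuous_map solenoid (?T k) (\<lambda>x. x k)"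
        unfolding solenoid_def divisibility_limit_def
        by (rule continuous_map_from_subtopology)
      then show ?thesis by (simp add: continuous_map_in_subtopology)
    qed
    then have "continuous_map solenoid (product_topology (\<lambda>_. euclidean) UNIV) id"
      by (simp add: continuous_map_componentwise_UNIV id_def)
    then show ?thesis
      by (auto simp: continuous_map_in_subtopology euclidean_product_topology sol_def)
  qed
  have 2: "continuous_map (top_of_set sol) solenoid id"
  proof -
    have "continuous_map (top_of_set sol) (?T k) (\<lambda>x. x k)" if "k \<in> {1..}" for k
      using that sol_nonzero
      by (auto simp: continuous_map_in_subtopology continuous_on_coordinate)
    then have "continuous_map (top_of_set sol) (product_topology ?T {1..}) id"
      using sol_0 by (auto simp: continuous_map_componentwise extensional_def not_less_eq_eq)
    then show ?thesis
      unfolding solenoid_def divisibility_limit_def continuous_map_in_subtopology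
      using equalityD1[OF sol_eq] by (simp add: id_def image_subset_iff_funcset del: One_nat_def) blast
  qed
  have "homeomorphic_maps solenoid (top_of_set sol) id id"
    using 1 2 by (simp add: homeomorphic_maps_def)
  then have "homeomorphic_map solenoid (top_of_set sol) id"
    using homeomorphic_maps_map by blast
  then show ?thesis by simp
qed

subsection \<open>Leaves and scaling\<close>

lemma profinite_mod:
  assumes "a \<in> profinite_integers" "n \<ge> 1" "k \<ge> 1"
  shows "a n = a (n * k) mod int n"
proof -
  have "\<forall>n\<ge>1. \<forall>m\<ge>1. n dvd m \<longrightarrow> a n = a m mod int n"
    using assms(1) unfolding profinite_integers_def divisibility_limit_def topspace_subtopology by blast
  from this[THEN spec, THEN mp, OF assms(2), THEN spec, of "n * k"]
  show ?thesis using assms(2,3) by simp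
qed

text \<open>
  The leaf through the neutral element.  It meets every fibre of every coordinate, so that it
  suffices for all approximation arguments.
\<close>

definition zero_leaf :: "nat \<Rightarrow> int" where
  "zero_leaf = (\<lambda>n\<in>{1..}. 0)"

lemma zero_leaf_profinite: "zero_leaf \<in> profinite_integers"
  unfolding profinite_integers_def divisibility_limit_def
  by (auto simp: zero_leaf_def)

lemma solenoid_exp_nth:
  "n \<ge> 1 \<Longrightarrow> solenoid_exp a z n = exp (2 * of_real pi * \<i> * of_int (a n) / of_nat n + \<i> * z / of_nat n)"
  by (simp add: solenoid_exp_def exp_add)

lemma solenoid_exp_in_sol:
  assumes "a \<in> profinite_integers"
  shows "solenoid_exp a z \<in> sol"
proof -
  have "solenoid_exp a z n = solenoid_exp a z (n * k) ^ k"
    if n1: "n \<ge> 1" and k1: "k \<ge> 1" for n k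
  proof -
    obtain j where j: "a (n * k) = a n + int n * j"
      using profinite_mod[OF assms n1 k1] by (metis mod_mult_div_eq)
    have "solenoid_exp a z (n * k) ^ k =
        exp (of_nat k * (2 * of_real pi * \<i> * of_int (a (n * k)) / of_nat (n * k) + \<i> * z / of_nat (n * k)))"
      using n1 k1 by (subst solenoid_exp_nth) (auto simp: exp_of_nat_mult)
    also have "of_nat k * (2 * of_real pi * \<i> * of_int (a (n * k)) / of_nat (n * k) + \<i> * z / of_nat (n * k)) =
        (2 * of_real pi * \<i> * of_int (a n) / of_nat n + \<i> * z / of_nat n) + 2 * of_int j * of_real pi * \<i>"
      unfolding j using n1 k1 by (simp add: field_simps)
    also have "exp \<dots> = solenoid_exp a z n"
    proof -
      have e: "exp (2 * of_int j * of_real pi * \<i>) = 1" using exp_integer_2pi[of "of_int j"] by (simp add: mult_ac)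
      show ?thesis using n1 by (subst exp_add) (simp add: e solenoid_exp_nth)
    qed
    finally show ?thesis by (rule sym)
  qed
  then show ?thesis by (rule solI[rotated 2]) (auto simp: solenoid_exp_def)
qed

abbreviation leaf :: "complex \<Rightarrow> (nat \<Rightarrow> complex)" where
  "leaf \<equiv> solenoid_exp zero_leaf"

lemma leaf_in_sol [simp]: "leaf z \<in> sol"
  by (rule solenoid_exp_in_sol[OF zero_leaf_profinite])

lemma leaf_nth: "n \<ge> 1 \<Longrightarrow> leaf z n = exp (\<i> * z / of_nat n)"
  by (simp add: solenoid_exp_nth zero_leaf_def)

definition height :: "(nat \<Rightarrow> complex) \<Rightarrow> real" where
  "height x = norm (x 1)"

lemma height_pos: "x \<in> sol \<Longrightarrow> height x > 0"
  by (simp add: height_def sol_nonzero)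

lemma height_root: "x \<in> sol \<Longrightarrow> m \<ge> 1 \<Longrightarrow> height x = norm (x m) ^ m"
  using sol_coherent[of x 1 m] by (simp add: height_def norm_power)

lemma norm_coordinate: "x \<in> sol \<Longrightarrow> m \<ge> 1 \<Longrightarrow> norm (x m) = height x powr (1 / real m)"
  using height_root[of x m] sol_nonzero[of x m]
  by (simp add: powr_powr flip: powr_realpow)

lemma height_solenoid_exp [simp]: "height (solenoid_exp a z) = exp (- Im z)"
  by (simp add: height_def solenoid_exp_nth norm_exp_eq_Re)

lemma continuous_on_height [continuous_intros]:
  "continuous_on S g \<Longrightarrow> continuous_on S (\<lambda>x. height (g x))"
  unfolding height_def
  by (intro continuous_on_norm continuous_on_coordinate_of)

text \<open>
  Translation by the positive real one-parameter subgroup.  It moves along the leaves, hence preserves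
  holomorphy, and pushes points towards the cusps.
\<close>

definition rescale :: "real \<Rightarrow> (nat \<Rightarrow> complex) \<Rightarrow> (nat \<Rightarrow> complex)" where
  "rescale s x = (\<lambda>n\<in>{1..}. of_real (s powr (1 / real n)) * x n)"

lemma rescale_nth: "n \<ge> 1 \<Longrightarrow> rescale s x n = of_real (s powr (1 / real n)) * x n"
  by (simp add: rescale_def)

lemma rescale_solenoid_exp:
  assumes "s > 0"
  shows "rescale s (solenoid_exp a z) = solenoid_exp a (z - \<i> * of_real (ln s))"
proof
  fix n
  show "rescale s (solenoid_exp a z) n = solenoid_exp a (z - \<i> * of_real (ln s)) n"
  proof (cases "n \<ge> 1")
    case True
    have "s powr (1 / real n) = exp (ln s / real n)" using assms by (simp add: powr_def)
    then have "complex_of_real (s powr (1 / real n)) = exp (of_real (ln s) / of_nat n)"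
      by (simp flip: exp_of_real)
    then show ?thesis using True
      by (simp add: rescale_nth solenoid_exp_nth diff_divide_distrib add_divide_distrib algebra_simps flip: exp_add)
  qed (auto simp: rescale_def solenoid_exp_def)
qed

lemma rescale_in_sol: 
  assumes "s > 0" "x \<in> sol" shows "rescale s x \<in> sol"
proof -
  have "rescale s x n = rescale s x (n * k) ^ k" if n1: "n \<ge> 1" and k1: "k \<ge> 1" for n k
  proof -
    have "(s powr (1 / real (n * k))) ^ k = s powr (1 / real n)"
      using assms(1) n1 k1 by (simp add: powr_powr flip: powr_realpow)
    moreover have "rescale s x (n * k) ^ k = of_real ((s powr (1 / real (n * k))) ^ k) * x (n * k) ^ k"
      using n1 k1 by (subst rescale_nth) (auto simp: power_mult_distrib)
    ultimately show ?thesis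
      using n1 sol_coherent[OF assms(2) n1 k1] by (simp add: rescale_nth)
  qed
  moreover have "rescale s x n \<noteq> 0" if "n \<ge> 1" for n
    using assms that by (simp add: rescale_nth sol_nonzero)
  ultimately show ?thesis by (intro solI) (simp add: rescale_def, blast+)
qed

lemma height_rescale: "s > 0 \<Longrightarrow> height (rescale s x) = s * height x"
  by (simp add: height_def rescale_nth norm_mult)

lemma rescale_1: "x \<in> sol \<Longrightarrow> rescale 1 x = x"
  by (rule ext) (auto simp: rescale_def sol_0 not_less_eq_eq)

lemma continuous_on_rescale:
  assumes "continuous_on S s" "continuous_on S g" "\<And>p. p \<in> S \<Longrightarrow> s p > 0"
  shows "continuous_on S (\<lambda>p. rescale (s p) (g p))"
proof (rule continuous_on_coordinatewise_then_product)
  fix n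
  show "continuous_on S (\<lambda>p. rescale (s p) (g p) n)"
  proof (cases "n \<ge> 1")
    case True
    have "continuous_on S (\<lambda>p. of_real (s p powr (1 / real n)) * g p n)"
      using assms
      by (intro continuous_on_mult continuous_on_of_real continuous_on_powr continuous_on_coordinate_of
          continuous_on_const) (auto dest: assms(3))
    then show ?thesis using True by (simp add: rescale_def)
  qed (simp add: rescale_def)
qed

lemma continuous_on_solenoid_exp: "continuous_on S (\<lambda>z. solenoid_exp a z)"
proof (rule continuous_on_coordinatewise_then_product)
  fix n
  show "continuous_on S (\<lambda>z. solenoid_exp a z n)"
  proof (cases "n \<ge> 1")
    case True
    have "continuous_on S (\<lambda>z. exp (2 * of_real pi * \<i> * of_int (a n) / of_nat n + \<i> * z / of_nat n))"
      using True by (intro continuous_intros) auto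
    then show ?thesis using True by (simp add: solenoid_exp_nth)
  qed (simp add: solenoid_exp_def)
qed

subsection \<open>Compactness\<close>

definition shell :: "real \<Rightarrow> (nat \<Rightarrow> complex) set" where
  "shell R = {x \<in> sol. 1 / R \<le> height x \<and> height x \<le> R}"

text \<open>
  A shell is closed in a product of compact annuli, one in each coordinate.
\<close>

lemma compact_shell: 
  assumes "R \<ge> 1" shows "compact (shell R)"
proof -
  define A where "A n = {z::complex. 1 / R powr (1 / real n) \<le> norm z \<and> norm z \<le> R powr (1 / real n)}" for n
  define C where "C n = (if n = 0 then {undefined} else A n)" for n :: nat
  have "compact (A n)" for n
  proof -
    have "A n = cball 0 (R powr (1 / real n)) - ball 0 (1 / R powr (1 / real n))"
      by (auto simp: A_def)
    then show ?thesis by (simp add: compact_diff)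
  qed
  then have "compact (C n)" for n by (simp add: C_def)
  then have "compactin (product_topology (\<lambda>_. euclidean) UNIV) (PiE UNIV C)"
    by (subst compactin_PiE) auto
  then have 1: "compact (PiE UNIV C)" by (simp add: euclidean_product_topology)
  have 2: "closed {x::nat \<Rightarrow> complex. x n = x m ^ k}" for n m k
    by (intro closed_Collect_eq continuous_on_power continuous_on_coordinate)
  have 3: "closed (\<Inter>n\<in>{1..}. \<Inter>m\<in>{m. m \<ge> 1 \<and> n dvd m}. {x::nat \<Rightarrow> complex. x n = x m ^ (m div n)})"
    by (intro closed_INT ballI 2)
  have "shell R = PiE UNIV C \<inter> (\<Inter>n\<in>{1..}. \<Inter>m\<in>{m. m \<ge> 1 \<and> n dvd m}. {x. x n = x m ^ (m div n)})"
    (is "_ = ?B")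
  proof (intro equalityI subsetI)
    fix x assume x: "x \<in> shell R"
    then have xs: "x \<in> sol" and h: "1 / R \<le> height x" "height x \<le> R" by (auto simp: shell_def)
    have "x n \<in> A n" if n: "n \<ge> 1" for n
    proof -
      have "height x powr (1 / real n) \<le> R powr (1 / real n)"
        using h height_pos[OF xs] by (intro powr_mono2) auto
      moreover have "(1 / R) powr (1 / real n) \<le> height x powr (1 / real n)"
        using h assms by (intro powr_mono2) auto
      ultimately show ?thesis using xs n assms
        by (simp add: A_def norm_coordinate powr_divide)
    qed
    moreover have "x \<in> (\<Inter>n\<in>{1..}. \<Inter>m\<in>{m. m \<ge> 1 \<and> n dvd m}. {x. x n = x m ^ (m div n)})"
      using xs unfolding sol_eq by blast
    ultimately show "x \<in> ?B" using sol_0[OF xs] by (simp add: C_def PiE_iff)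
  next
    fix x assume x: "x \<in> ?B"
    then have a: "x n \<in> C n" for n by (blast dest: PiE_mem)
    have a0: "x 0 = undefined" using a[of 0] by (simp add: C_def)
    have an: "x n \<in> A n" if "n \<ge> 1" for n using a[of n] that by (simp add: C_def split: if_splits)
    have "x n \<noteq> 0" if "n \<ge> 1" for n using an[OF that] assms by (auto simp: A_def)
    then have "x \<in> sol" using x a0 unfolding sol_eq by blast
    moreover have "1 / R \<le> height x \<and> height x \<le> R"
      using an[of 1] assms by (simp add: A_def height_def)
    ultimately show "x \<in> shell R" by (simp add: shell_def)
  qed
  then show ?thesis using compact_Int_closed[OF 1 3] by simp
qed

text \<open>
  A solution \<open>w\<close> of \<open>exp (i w / m) = x\<^sub>m\<close> exists because \<open>x\<^sub>m\<close> is nonzero.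
\<close>

lemma coordinate_on_leaf:
  assumes "x \<in> sol" "m \<ge> 1"
  obtains w where "leaf w m = x m" "height (leaf w) = height x"
proof -
  define w where "w = - \<i> * of_nat m * Ln (x m)"
  have "leaf w m = x m" using assms sol_nonzero[OF assms] by (simp add: leaf_nth w_def)
  moreover have "height (leaf w) = height x"
    using height_root[OF assms] height_root[of "leaf w" m] assms \<open>leaf w m = x m\<close> by simp
  ultimately show ?thesis using that by blast
qed

text \<open>
  A continuous function on a compact shell almost factors through a finite level.  Otherwise there
  are pairs of points which agree in the coordinate \<open>k!\<close>, for every \<open>k\<close>, with values at distance
  more than \<open>e\<close>; limits of the two sequences agree in all coordinates.
\<close>

lemma level_oscillation:
  fixes f :: "(nat \<Rightarrow> complex) \<Rightarrow> complex"
  assumes f: "continuous_on sol f" and R: "R \<ge> 1" and e: "e > 0"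
  obtains M where "M \<ge> 1" and
    "\<And>m x y. m \<ge> 1 \<Longrightarrow> M dvd m \<Longrightarrow> x \<in> shell R \<Longrightarrow> y \<in> shell R \<Longrightarrow> x m = y m \<Longrightarrow> norm (f x - f y) \<le> e"
proof -
  have "\<exists>M\<ge>1. \<forall>x\<in>shell R. \<forall>y\<in>shell R. x M = y M \<longrightarrow> norm (f x - f y) \<le> e"
  proof (rule ccontr)
    assume "\<not> ?thesis"
    then have "\<forall>k. \<exists>x y. x \<in> shell R \<and> y \<in> shell R \<and> x (fact k) = y (fact k) \<and> norm (f x - f y) > e"
      by (metis fact_ge_1 linorder_not_le)
    then obtain u v where uv: "\<And>k. u k \<in> shell R" "\<And>k. v k \<in> shell R"
        "\<And>k. u k (fact k) = v k (fact k)" "\<And>k. norm (f (u k) - f (v k)) > e"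
      by metis
    have cs: "seq_compact (shell R)" using compact_shell[OF R] by (simp add: compact_eq_seq_compact_metric)
    obtain x r where x: "x \<in> shell R" and r: "strict_mono r" and ur: "(u \<circ> r) \<longlonglongrightarrow> x"
      using seq_compactE[OF cs, of u] uv by metis
    obtain y q where y: "y \<in> shell R" and q: "strict_mono q" and vq: "((v \<circ> r) \<circ> q) \<longlonglongrightarrow> y"
      using seq_compactE[OF cs, of "v \<circ> r"] uv by (metis comp_apply)
    define p where "p = r \<circ> q"
    have p: "strict_mono p" using r q by (simp add: p_def strict_mono_o)
    have up: "(\<lambda>k. u (p k)) \<longlonglongrightarrow> x" 
      using LIMSEQ_subseq_LIMSEQ[OF ur q] by (simp add: p_def o_def)
    have vp: "(\<lambda>k. v (p k)) \<longlonglongrightarrow> y" using vq by (simp add: p_def o_def)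
    have co: "(\<lambda>k. Z k n) \<longlonglongrightarrow> z n" if "Z \<longlonglongrightarrow> z" for Z and z :: "nat \<Rightarrow> complex" and n
      using continuous_on_tendsto_compose[OF continuous_on_coordinate[of UNIV n] that] by auto
    have "x n = y n" for n
    proof (cases "n \<ge> 1")
      case True
      have "eventually (\<lambda>k. u (p k) n = v (p k) n) sequentially"
        using eventually_ge_at_top[of n]
      proof eventually_elim
        case (elim k)
        then have "n \<le> p k" using seq_suble[OF p, of k] by linarith
        then have "n dvd fact (p k)" using True by (intro dvd_fact) auto
        then obtain j where j: "fact (p k) = n * j" by blast
        have "j \<ge> 1" using j by (metis fact_nonzero less_one linorder_not_le mult_0_right)
        have "u (p k) \<in> sol" "v (p k) \<in> sol" using uv(1,2) by (auto simp: shell_def)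
        then have "u (p k) n = u (p k) (n * j) ^ j" "v (p k) n = v (p k) (n * j) ^ j"
          using True \<open>j \<ge> 1\<close> by (auto intro: sol_coherent)
        then show ?case using uv(3)[of "p k"] unfolding j by (simp only:)
      qed
      then have "(\<lambda>k. v (p k) n) \<longlonglongrightarrow> x n"
        using co[OF up, of n] by (simp add: tendsto_cong)
      then show ?thesis using co[OF vp, of n] LIMSEQ_unique by blast
    next
      case False
      then have "n = 0" by simp
      then show ?thesis using x y by (auto simp: shell_def sol_0)
    qed
    then have xy: "x = y" by auto
    have fx: "(\<lambda>k. f (Z k)) \<longlonglongrightarrow> f x" if "Z \<longlonglongrightarrow> x" "\<And>k. Z k \<in> shell R" for Z
      using that f x by (intro continuous_on_tendsto_compose[OF f]) (auto simp: shell_def)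
    have "(\<lambda>k. norm (f (u (p k)) - f (v (p k)))) \<longlonglongrightarrow> norm (f x - f x)"
      using fx[OF up] fx[of "\<lambda>k. v (p k)"] vp xy uv by (intro tendsto_intros) auto
    then have "eventually (\<lambda>k. norm (f (u (p k)) - f (v (p k))) < e) sequentially"
      using e by (intro order_tendstoD) auto
    then obtain k where "norm (f (u (p k)) - f (v (p k))) < e"
      using eventually_happens by force
    then show False using uv(4)[of "p k"] by simp
  qed
  then obtain M where M: "M \<ge> 1" "\<forall>x\<in>shell R. \<forall>y\<in>shell R. x M = y M \<longrightarrow> norm (f x - f y) \<le> e" by blast
  show ?thesis
  proof (rule that[of M])
    fix m x y assume "m \<ge> 1" "M dvd m" and xy: "x \<in> shell R" "y \<in> shell R" "x m = y m"
    then obtain k where k: "m = M * k" "k \<ge> 1" by (auto elim!: dvdE)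
    have "x \<in> sol" "y \<in> sol" using xy by (auto simp: shell_def)
    from this[THEN sol_coherent, OF M(1) k(2)] have "x M = y M" using xy(3) unfolding k(1) by (simp only:)
    then show "norm (f x - f y) \<le> e" using M xy by blast
  qed (use M in auto)
qed

section \<open>Leafwise holomorphic families\<close>

text \<open>
  Time enters as a parameter from the start: holomorphic maps, isotopies and the local pieces
  from which they are glued are all families over a subset \<open>D\<close> of the solenoid times the time axis.
  Continuity is required jointly, holomorphy along each leaf at each fixed time.
\<close>

definition lh :: "((nat \<Rightarrow> complex) \<times> real) set \<Rightarrow> ((nat \<Rightarrow> complex) \<times> real \<Rightarrow> complex) \<Rightarrow> bool" where
  "lh D f \<longleftrightarrow> D \<subseteq> sol \<times> UNIV \<and> continuous_on D f \<and>
     (\<forall>a\<in>profinite_integers. \<forall>t.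
        (\<lambda>z. f (solenoid_exp a z, t)) holomorphic_on {z. (solenoid_exp a z, t) \<in> D})"

lemma lhD:
  assumes "lh D f"
  shows "continuous_on D f"
    "a \<in> profinite_integers \<Longrightarrow> (\<lambda>z. f (solenoid_exp a z, t)) holomorphic_on {z. (solenoid_exp a z, t) \<in> D}"
    "D \<subseteq> sol \<times> UNIV"
  using assms by (auto simp: lh_def)

lemma lh_subset: "lh D f \<Longrightarrow> D' \<subseteq> D \<Longrightarrow> lh D' f"
  unfolding lh_def by (blast intro: continuous_on_subset holomorphic_on_subset)

lemma lh_cong: "lh D f \<Longrightarrow> (\<And>p. p \<in> D \<Longrightarrow> f p = g p) \<Longrightarrow> lh D g"
  unfolding lh_def
  by (auto cong: continuous_on_cong dest!: bspec spec elim!: holomorphic_transform)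

lemma lh_const [intro]: "D \<subseteq> sol \<times> UNIV \<Longrightarrow> lh D (\<lambda>p. c)"
  by (auto simp: lh_def)

lemma lh_add: "lh D f \<Longrightarrow> lh D g \<Longrightarrow> lh D (\<lambda>p. f p + g p)"
  and lh_diff: "lh D f \<Longrightarrow> lh D g \<Longrightarrow> lh D (\<lambda>p. f p - g p)"
  and lh_mult: "lh D f \<Longrightarrow> lh D g \<Longrightarrow> lh D (\<lambda>p. f p * g p)"
  and lh_uminus: "lh D f \<Longrightarrow> lh D (\<lambda>p. - f p)"
  and lh_power: "lh D f \<Longrightarrow> lh D (\<lambda>p. f p ^ k)"
  and lh_exp: "lh D f \<Longrightarrow> lh D (\<lambda>p. exp (f p))"
  by (auto simp: lh_def intro!: continuous_intros holomorphic_intros)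

lemma lh_divide: "lh D f \<Longrightarrow> lh D g \<Longrightarrow> (\<And>p. p \<in> D \<Longrightarrow> g p \<noteq> 0) \<Longrightarrow> lh D (\<lambda>p. f p / g p)"
  and lh_power_int: "lh D f \<Longrightarrow> (\<And>p. p \<in> D \<Longrightarrow> f p \<noteq> 0) \<Longrightarrow> lh D (\<lambda>p. f p powi j)"
  by (auto simp: lh_def intro!: continuous_intros holomorphic_intros)

lemma lh_sum: "D \<subseteq> sol \<times> UNIV \<Longrightarrow> (\<And>i. i \<in> I \<Longrightarrow> lh D (f i)) \<Longrightarrow> lh D (\<lambda>p. \<Sum>i\<in>I. f i p)"
  by (induction I rule: infinite_finite_induct) (auto intro: lh_add)

lemma lh_prod: "D \<subseteq> sol \<times> UNIV \<Longrightarrow> (\<And>i. i \<in> I \<Longrightarrow> lh D (f i)) \<Longrightarrow> lh D (\<lambda>p. \<Prod>i\<in>I. f i p)"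
  by (induction I rule: infinite_finite_induct) (auto intro: lh_mult)

lemma lh_time:
  assumes "D \<subseteq> sol \<times> T" "continuous_on T g" 
  shows "lh D (\<lambda>p. g (snd p))"
proof -
  have "continuous_on D (\<lambda>p. g (snd p))"
    using assms by (intro continuous_on_compose2[OF assms(2)] continuous_intros) auto
  then show ?thesis using assms by (auto simp: lh_def)
qed

lemma lh_coordinate:
  assumes "D \<subseteq> sol \<times> UNIV" shows "lh D (\<lambda>p. fst p n)"
proof -
  have "continuous_on D (\<lambda>p. fst p n)"
    by (intro continuous_on_coordinate_of continuous_on_fst continuous_on_id)
  moreover have "(\<lambda>z. solenoid_exp a z n) holomorphic_on A" for a A
  proof (cases "n \<ge> 1")
    case True
    have "(\<lambda>z. exp (2 * of_real pi * \<i> * of_int (a n) / of_nat n + \<i> * z / of_nat n)) holomorphic_on A"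
      using True by (intro holomorphic_intros) auto
    then show ?thesis using True by (simp add: solenoid_exp_nth)
  qed (simp add: solenoid_exp_def)
  ultimately show ?thesis using assms by (auto simp: lh_def)
qed

text \<open>
  A rescaling that depends on time only is a translation of the leaf parameter at each fixed time, so
  leafwise holomorphy survives.
\<close>

lemma lh_reparam:
  assumes f: "lh D f" and D': "D' \<subseteq> sol \<times> T"
    and s: "continuous_on T s" "\<And>t. t \<in> T \<Longrightarrow> s t > (0::real)"
    and \<tau>: "continuous_on T \<tau>"
    and sub: "\<And>x t. (x, t) \<in> D' \<Longrightarrow> (rescale (s t) x, \<tau> t) \<in> D"
  shows "lh D' (\<lambda>p. f (rescale (s (snd p)) (fst p), \<tau> (snd p)))"
  unfolding lh_def
proof (intro conjI ballI allI)
  show "D' \<subseteq> sol \<times> UNIV" using D' by auto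
  show "continuous_on D' (\<lambda>p. f (rescale (s (snd p)) (fst p), \<tau> (snd p)))"
    using D' s(2) sub
    by (intro continuous_on_compose2[OF lhD(1)[OF f]] continuous_on_Pair continuous_on_rescale
        continuous_on_compose2[OF s(1)] continuous_on_compose2[OF \<tau>] continuous_intros) force+
next
  fix a t assume a: "a \<in> profinite_integers"
  show "(\<lambda>z. f (rescale (s (snd (solenoid_exp a z, t))) (fst (solenoid_exp a z, t)), \<tau> (snd (solenoid_exp a z, t))))
     holomorphic_on {z. (solenoid_exp a z, t) \<in> D'}"
  proof (cases "t \<in> T")
    case True
    have r: "rescale (s t) (solenoid_exp a z) = solenoid_exp a (z - \<i> * of_real (ln (s t)))" for z
      using s(2)[OF True] by (rule rescale_solenoid_exp)
    have "((\<lambda>z. f (solenoid_exp a z, \<tau> t)) \<circ> (\<lambda>z. z - \<i> * of_real (ln (s t))))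
        holomorphic_on {z. (solenoid_exp a z, t) \<in> D'}"
    proof (rule holomorphic_on_compose_gen[OF _ lhD(2)[OF f a]])
      show "(\<lambda>z. z - \<i> * of_real (ln (s t))) ` {z. (solenoid_exp a z, t) \<in> D'}
         \<subseteq> {z. (solenoid_exp a z, \<tau> t) \<in> D}" using sub r by force
    qed (intro holomorphic_intros)
    then show ?thesis by (simp add: o_def r)
  next
    case False
    then have "{z. (solenoid_exp a z, t) \<in> D'} = {}" using D' by auto
    then show ?thesis by (simp only: holomorphic_on_empty)
  qed
qed

lemma open_leaf_slice:
  assumes "openin (top_of_set (sol \<times> T)) D" "a \<in> profinite_integers"
  shows "open {z. (solenoid_exp a z, t) \<in> D}"
proof (cases "t \<in> T")
  case True
  obtain U where U: "open U" "D = (sol \<times> T) \<inter> U" using assms(1) by (auto simp: openin_open)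
  have "{z. (solenoid_exp a z, t) \<in> D} = (\<lambda>z. (solenoid_exp a z, t)) -` U"
    using U True solenoid_exp_in_sol[OF assms(2)] by auto
  also have "open \<dots>"
    by (intro open_vimage U continuous_intros continuous_on_solenoid_exp)
  finally show ?thesis .
next
  case False
  then have "{z. (solenoid_exp a z, t) \<in> D} = {}" using openin_imp_subset[OF assms(1)] by auto
  then show ?thesis by simp
qed

lemma lh_local:
  assumes sub: "D \<subseteq> sol \<times> UNIV"
    and loc: "\<And>p. p \<in> D \<Longrightarrow> \<exists>D'. p \<in> D' \<and> openin (top_of_set D) D' \<and> lh D' f"
  shows "lh D f"
  unfolding lh_def
proof (intro conjI ballI allI sub)
  show "continuous_on D f"
    unfolding continuous_on_eq_continuous_within
  proof
    fix p assume "p \<in> D"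
    then obtain D' where D': "p \<in> D'" "openin (top_of_set D) D'" "lh D' f" using loc by blast
    then obtain U where U: "open U" "D' = D \<inter> U" by (auto simp: openin_open)
    have "continuous (at p within D') f"
      using lhD(1)[OF D'(3)] D'(1) by (simp add: continuous_on_eq_continuous_within)
    moreover have "at p within D' = at p within D"
      using U D' by (intro at_within_nhd[of p U]) auto
    ultimately show "continuous (at p within D) f" by simp
  qed
next
  fix a t assume a: "a \<in> profinite_integers"
  show "(\<lambda>z. f (solenoid_exp a z, t)) holomorphic_on {z. (solenoid_exp a z, t) \<in> D}" (is "_ holomorphic_on ?L D")
    unfolding holomorphic_on_def
  proof
    fix z assume z: "z \<in> {z. (solenoid_exp a z, t) \<in> D}"
    then obtain D' where D': "(solenoid_exp a z, t) \<in> D'" "openin (top_of_set D) D'" "lh D' f" using loc by blast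
    then obtain U where U: "open U" "D' = D \<inter> U" by (auto simp: openin_open)
    have "open ((\<lambda>z. (solenoid_exp a z, t)) -` U)"
      by (intro open_vimage U continuous_intros continuous_on_solenoid_exp)
    then have "at z within ?L D' = at z within ?L D"
      using U D' by (intro at_within_nhd[of z "(\<lambda>z. (solenoid_exp a z, t)) -` U"]) auto
    moreover have "(\<lambda>z. f (solenoid_exp a z, t)) field_differentiable at z within ?L D'"
      using lhD(2)[OF D'(3) a, of t] D'(1) by (simp add: holomorphic_on_def)
    ultimately show "(\<lambda>z. f (solenoid_exp a z, t)) field_differentiable at z within ?L D" by simp
  qed
qed

text \<open>
  At each fixed time a relatively open set meets a leaf in an open set, where Weierstrass' theorem on
  uniform limits applies.
\<close>

lemma lh_uniform_limit:
  assumes D: "openin (top_of_set (sol \<times> T)) D" and f: "\<And>k::nat. lh D (f k)"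
    and lim: "uniform_limit D f g sequentially"
  shows "lh D g"
  unfolding lh_def
proof (intro conjI ballI allI)
  show "D \<subseteq> sol \<times> UNIV" using openin_imp_subset[OF D] by auto
  show "continuous_on D g"
    by (rule uniform_limit_theorem[OF _ lim]) (use lhD(1)[OF f] in auto)
next
  fix a t assume a: "a \<in> profinite_integers"
  let ?L = "{z. (solenoid_exp a z, t) \<in> D}"
  show "(\<lambda>z. g (solenoid_exp a z, t)) holomorphic_on ?L"
  proof (rule holomorphic_uniform_sequence)
    show op: "open ?L" by (rule open_leaf_slice[OF D a])
    show "(\<lambda>z. f k (solenoid_exp a z, t)) holomorphic_on ?L" for k by (rule lhD(2)[OF f a])
    fix x assume "x \<in> ?L"
    then obtain d where d: "d > 0" "cball x d \<subseteq> ?L" using op open_contains_cball by blast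
    have "uniform_limit (cball x d) (\<lambda>k z. f k (solenoid_exp a z, t)) (\<lambda>z. g (solenoid_exp a z, t)) sequentially"
      using d(2) by (intro uniform_limit_compose'[OF lim]) auto
    then show "\<exists>d>0. cball x d \<subseteq> ?L \<and>
       uniform_limit (cball x d) (\<lambda>k z. f k (solenoid_exp a z, t)) (\<lambda>z. g (solenoid_exp a z, t)) sequentially"
      using d by blast
  qed
qed

section \<open>Holomorphic matrix families and isotopies\<close>

lemma lh_retime:
  assumes f: "lh D f" and D': "D' \<subseteq> sol \<times> T" and \<tau>: "continuous_on T \<tau>"
    and sub: "\<And>x t. (x, t) \<in> D' \<Longrightarrow> (x, \<tau> t) \<in> D"
  shows "lh D' (\<lambda>p. f (fst p, \<tau> (snd p)))"
proof -
  have r: "rescale 1 x = x" if "(x, t) \<in> D'" for x t using that D' rescale_1 by auto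
  have "lh D' (\<lambda>p. f (rescale ((\<lambda>_. 1) (snd p)) (fst p), \<tau> (snd p)))"
    using D' sub by (intro lh_reparam[OF f D' _ _ \<tau>]) (auto simp: r)
  then show ?thesis by (rule lh_cong) (auto simp: r)
qed

lemma lh_cases_time:
  assumes D: "D \<subseteq> sol \<times> UNIV"
    and f: "lh {p \<in> D. snd p \<le> c} f" and g: "lh {p \<in> D. c \<le> snd p} g"
    and eq: "\<And>p. p \<in> D \<Longrightarrow> snd p = c \<Longrightarrow> f p = g p"
  shows "lh D (\<lambda>p. if snd p \<le> c then f p else g p)"
  unfolding lh_def
proof (intro conjI ballI allI D)
  show "continuous_on D (\<lambda>p. if snd p \<le> c then f p else g p)"
    using lhD(1)[OF f] lhD(1)[OF g] eq
    by (intro continuous_on_cases_le continuous_intros) auto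
next
  fix a t assume a: "a \<in> profinite_integers"
  show "(\<lambda>z. if snd (solenoid_exp a z, t) \<le> c then f (solenoid_exp a z, t) else g (solenoid_exp a z, t))
      holomorphic_on {z. (solenoid_exp a z, t) \<in> D}"
    using lhD(2)[OF f a, of t] lhD(2)[OF g a, of t] by (cases "t \<le> c") auto
qed

abbreviation cyl :: "((nat \<Rightarrow> complex) \<times> real) set" where
  "cyl \<equiv> sol \<times> {0..1}"

text \<open>
  Infinitely many homotopies are run one after the other, the \<open>k\<close>-th during
  \<open>k \<le> t / (1 - t) \<le> k + 1\<close>.  Continuity at the end time is the uniform convergence on shells, since
  the shells exhaust the solenoid.
\<close>

lemma lh_concat_infinite:
  fixes h :: "nat \<Rightarrow> (nat \<Rightarrow> complex) \<times> real \<Rightarrow> complex"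
  assumes h: "\<And>k. lh cyl (h k)"
    and join: "\<And>k x. x \<in> sol \<Longrightarrow> h k (x, 1) = h (Suc k) (x, 0)"
    and lim: "\<And>R e. R \<ge> 1 \<Longrightarrow> e > 0 \<Longrightarrow> \<exists>K. \<forall>k\<ge>K. \<forall>x\<in>shell R. \<forall>t\<in>{0..1}. norm (h k (x, t) - c) \<le> e"
  shows "lh cyl (\<lambda>p. if snd p < 1 then
      h (nat \<lfloor>snd p / (1 - snd p)\<rfloor>) (fst p, frac (snd p / (1 - snd p))) else c)" (is "lh _ ?F")
proof -
  \<comment> \<open>the concatenation over the time axis \<open>[0, \<infinity>)\<close>\<close>
  define G where "G p = h (nat \<lfloor>snd p\<rfloor>) (fst p, frac (snd p))" for p
  have hN: "lh (sol \<times> {real N..real N + 1}) G" for N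
  proof -
    have "lh (sol \<times> {real N..real N + 1}) (\<lambda>p. h N (fst p, (\<lambda>t. t - real N) (snd p)))"
      by (intro lh_retime[OF h[of N], where T = UNIV] continuous_intros) auto
    then show ?thesis
    proof (rule lh_cong)
      fix p assume p: "p \<in> sol \<times> {real N..real N + 1}"
      show "h N (fst p, snd p - real N) = G p"
      proof (cases "snd p = real N + 1")
        case True
        then have "\<lfloor>snd p\<rfloor> = int N + 1" "frac (snd p) = 0" by (auto simp: frac_def)
        then have "G p = h (Suc N) (fst p, 0)" by (simp add: G_def nat_add_distrib frac_def True)
        then show ?thesis using True p join[of "fst p" N] by auto
      next
        case False
        then have "\<lfloor>snd p\<rfloor> = int N" using p by (auto simp: floor_eq_iff)
        then show ?thesis by (simp add: G_def frac_def)
      qed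
    qed
  qed
  have GN: "lh (sol \<times> {0..real N}) G" for N
  proof (induction N)
    case 0
    then show ?case by (rule lh_subset[OF hN[of 0]]) auto
  next
    case (Suc N)
    have "lh (sol \<times> {0..real (Suc N)}) (\<lambda>p. if snd p \<le> real N then G p else G p)"
      by (rule lh_cases_time) (auto intro: lh_subset[OF Suc] lh_subset[OF hN[of N]])
    then show ?case by simp
  qed
  have G: "lh (sol \<times> {0..}) G"
  proof (rule lh_local)
    fix p assume "p \<in> sol \<times> {0::real..}"
    obtain N where N: "snd p < real N" using reals_Archimedean2 by blast
    have "openin (top_of_set (sol \<times> {0..})) (sol \<times> {0..<real N})"
      unfolding openin_open by (intro exI[of _ "UNIV \<times> {..<real N}"]) (auto intro: open_Times)
    moreover have "lh (sol \<times> {0..<real N}) G" by (rule lh_subset[OF GN[of N]]) auto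
    ultimately show "\<exists>D'. p \<in> D' \<and> openin (top_of_set (sol \<times> {0..})) D' \<and> lh D' G"
      using N \<open>p \<in> _\<close> by (intro exI[of _ "sol \<times> {0..<real N}"]) (auto simp: mem_Times_iff)
  qed auto
  have F1: "lh (sol \<times> {0..<1}) ?F"
  proof -
    have "lh (sol \<times> {0..<1}) (\<lambda>p. G (fst p, (\<lambda>t. t / (1 - t)) (snd p)))"
      by (intro lh_retime[OF G, where T = "{0..<1}"] continuous_intros) auto
    then show ?thesis by (rule lh_cong) (auto simp: G_def)
  qed
  show ?thesis
    unfolding lh_def
  proof (intro conjI ballI allI)
    show "continuous_on cyl ?F"
      unfolding continuous_on_eq_continuous_within
    proof
      fix p assume p: "p \<in> cyl"
      show "continuous (at p within cyl) ?F"
      proof (cases "snd p < 1")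
        case True
        have "continuous (at p within sol \<times> {0..<1}) ?F"
          using lhD(1)[OF F1] p True unfolding continuous_on_eq_continuous_within
          by (elim ballE[of _ _ p]) (auto simp: mem_Times_iff)
        moreover have "at p within sol \<times> {0..<1} = at p within cyl"
          using True by (intro at_within_nhd[of p "UNIV \<times> {..<1}"]) (auto intro: open_Times simp: mem_Times_iff)
        ultimately show ?thesis by simp
      next
        case False
        then have p1: "snd p = 1" "fst p \<in> sol" using p by auto
        define R where "R = max 1 (max (2 * height (fst p)) (2 / height (fst p)))"
        have hp: "height (fst p) > 0" using p1 height_pos by auto
        have R1: "R \<ge> 1" by (simp add: R_def)
        have "height (fst p) < R" using hp by (simp add: R_def)
        have "2 / height (fst p) \<le> R" by (simp add: R_def)
        then have "1 / R < height (fst p)" using hp R1 by (simp add: field_simps)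
        show ?thesis
          unfolding continuous_within
        proof (rule tendstoI)
          fix e :: real assume "e > 0"
          then obtain K where K: "\<forall>k\<ge>K. \<forall>x\<in>shell R. \<forall>t\<in>{0..1}. norm (h k (x, t) - c) \<le> e / 2"
            using lim[OF R1, of "e / 2"] by auto
          define U where "U = {q. 1 / R < height (fst q)} \<inter> {q. height (fst q) < R} \<inter> {q. 1 - 1 / (real K + 1) < snd q}"
          have "open U" unfolding U_def
            by (intro open_Int open_Collect_less continuous_intros)
          moreover have "p \<in> U" using p1 \<open>height (fst p) < R\<close> \<open>1 / R < height (fst p)\<close> by (auto simp: U_def)
          ultimately have "eventually (\<lambda>q. q \<in> U \<and> q \<in> cyl) (at p within cyl)"
            by (auto simp: eventually_at_topological)
          then show "eventually (\<lambda>q. dist (?F q) (?F p) < e) (at p within cyl)"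
          proof eventually_elim
            case (elim q)
            have sh: "fst q \<in> shell R" using elim by (auto simp: U_def shell_def)
            show ?case
            proof (cases "snd q < 1")
              case True
              have "1 - snd q < 1 / (real K + 1)" using elim by (auto simp: U_def)
              then have "(real K + 1) * (1 - snd q) \<le> 1" by (simp add: field_simps)
              then have "real K \<le> snd q / (1 - snd q)" using True by (simp add: field_simps)
              then have "K \<le> nat \<lfloor>snd q / (1 - snd q)\<rfloor>" by (simp add: le_nat_floor)
              moreover have "frac (snd q / (1 - snd q)) \<in> {0..1}"
                using frac_lt_1 frac_ge_0 by (auto intro: less_imp_le)
              ultimately have "norm (?F q - c) \<le> e / 2" using K sh True by auto
              then show ?thesis using p1 \<open>e > 0\<close> by (simp add: dist_norm)
            qed (use p1 \<open>e > 0\<close> in auto)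
          qed
        qed
      qed
    qed
  next
    fix a t assume a: "a \<in> profinite_integers"
    show "(\<lambda>z. ?F (solenoid_exp a z, t)) holomorphic_on {z. (solenoid_exp a z, t) \<in> cyl}"
    proof (cases "t < 1")
      case True
      then have "{z. (solenoid_exp a z, t) \<in> cyl} = {z. (solenoid_exp a z, t) \<in> sol \<times> {0..<1}}" by auto
      then show ?thesis using lhD(2)[OF F1 a, of t] by (simp only:)
    qed auto
  qed auto
qed

subsection \<open>Matrices\<close>

lemma mat_mult_index:
  "A \<in> carrier_mat n n \<Longrightarrow> B \<in> carrier_mat n n \<Longrightarrow> i < n \<Longrightarrow> j < n \<Longrightarrow>
     (A * B) $$ (i, j) = (\<Sum>k<n. A $$ (i, k) * B $$ (k, j))"
  by (auto simp: scalar_prod_def lessThan_atLeast0 intro!: sum.cong)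

definition mat_inv :: "complex mat \<Rightarrow> complex mat" where
  "mat_inv A = (1 / det A) \<cdot>\<^sub>m adj_mat A"

lemma mat_inv:
  assumes "A \<in> carrier_mat n n" "det A \<noteq> 0"
  shows "mat_inv A \<in> carrier_mat n n" "A * mat_inv A = 1\<^sub>m n" "mat_inv A * A = 1\<^sub>m n" "det (mat_inv A) \<noteq> 0"
proof -
  note a = adj_mat[OF assms(1)]
  show c: "mat_inv A \<in> carrier_mat n n" using a by (simp add: mat_inv_def)
  have "A * mat_inv A = (1 / det A) \<cdot>\<^sub>m (A * adj_mat A)"
    unfolding mat_inv_def by (rule mult_smult_distrib[OF assms(1) a(1)])
  also have "\<dots> = 1\<^sub>m n" using assms unfolding a by (intro eq_matI) auto
  finally show r: "A * mat_inv A = 1\<^sub>m n" .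
  have "mat_inv A * A = (1 / det A) \<cdot>\<^sub>m (adj_mat A * A)"
    unfolding mat_inv_def by (rule mult_smult_assoc_mat[OF a(1) assms(1)])
  also have "\<dots> = 1\<^sub>m n" using assms unfolding a by (intro eq_matI) auto
  finally show "mat_inv A * A = 1\<^sub>m n" .
  have "det A * det (mat_inv A) = 1" using det_mult[OF assms(1) c] r by simp
  then show "det (mat_inv A) \<noteq> 0" by auto
qed

lemma mat_right_inverse_unique:
  fixes A :: "complex mat"
  assumes "A \<in> carrier_mat n n" "B \<in> carrier_mat n n" "C \<in> carrier_mat n n" "A * B = 1\<^sub>m n" "C * A = 1\<^sub>m n"
  shows "B = C"
proof -
  have "B = (C * A) * B" using assms by simp
  also have "\<dots> = C * (A * B)" using assms by (intro assoc_mult_mat) auto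
  finally show ?thesis using assms by simp
qed

lemma det_nonzero_of_mult_eq_1:
  fixes A :: "complex mat"
  assumes "A \<in> carrier_mat n n" "B \<in> carrier_mat n n" "A * B = 1\<^sub>m n"
  shows "det A \<noteq> 0"
  using det_mult[OF assms(1,2)] assms(3) by auto

lemma mat_inv_eqI:
  assumes A: "A \<in> carrier_mat n n" and B: "B \<in> carrier_mat n n" and "A * B = 1\<^sub>m n"
  shows "mat_inv A = B"
  using mat_right_inverse_unique[OF A B _ assms(3)] mat_inv[OF A det_nonzero_of_mult_eq_1[OF assms]] by metis

lemma GL_iff: "A \<in> GL n \<longleftrightarrow> A \<in> carrier_mat n n \<and> det A \<noteq> 0"
proof
  assume "A \<in> GL n"
  then obtain B where A: "A \<in> carrier_mat n n" and AB: "A * B = 1\<^sub>m n" and BA: "B * A = 1\<^sub>m (dim_row B)"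
    by (auto simp: GL_def invertible_mat_def inverts_mat_def)
  have "dim_col B = n" using arg_cong[OF AB, of dim_col] by simp
  moreover have "dim_row B = n" using arg_cong[OF BA, of dim_col] A by simp
  ultimately have "B \<in> carrier_mat n n" by auto
  then show "A \<in> carrier_mat n n \<and> det A \<noteq> 0" using A AB det_nonzero_of_mult_eq_1 by blast
next
  assume A: "A \<in> carrier_mat n n \<and> det A \<noteq> 0"
  then have "mat_inv A \<in> carrier_mat n n" "A * mat_inv A = 1\<^sub>m n" "mat_inv A * A = 1\<^sub>m n" using mat_inv by blast+
  then show "A \<in> GL n"
    using A unfolding GL_def invertible_mat_def inverts_mat_def by auto
qed

text \<open>
  The initial letters of \<open>mlh\<close> and \<open>glh\<close> stand for matrices and for the general linear group.
\<close>

definition mlh :: "nat \<Rightarrow> ((nat \<Rightarrow> complex) \<times> real) set \<Rightarrow> ((nat \<Rightarrow> complex) \<times> real \<Rightarrow> complex mat) \<Rightarrow> bool" where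
  "mlh n D F \<longleftrightarrow> D \<subseteq> sol \<times> UNIV \<and> (\<forall>p\<in>D. F p \<in> carrier_mat n n) \<and> (\<forall>i<n. \<forall>j<n. lh D (\<lambda>p. F p $$ (i, j)))"

definition glh :: "nat \<Rightarrow> ((nat \<Rightarrow> complex) \<times> real) set \<Rightarrow> ((nat \<Rightarrow> complex) \<times> real \<Rightarrow> complex mat) \<Rightarrow> bool" where
  "glh n D F \<longleftrightarrow> mlh n D F \<and> (\<forall>p\<in>D. det (F p) \<noteq> 0)"

lemma mlhD:
  assumes "mlh n D F"
  shows "D \<subseteq> sol \<times> UNIV" "p \<in> D \<Longrightarrow> F p \<in> carrier_mat n n" "i < n \<Longrightarrow> j < n \<Longrightarrow> lh D (\<lambda>p. F p $$ (i, j))"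
  using assms by (auto simp: mlh_def)

lemma glhD:
  assumes "glh n D F"
  shows "mlh n D F" "D \<subseteq> sol \<times> UNIV" "p \<in> D \<Longrightarrow> F p \<in> carrier_mat n n" "p \<in> D \<Longrightarrow> det (F p) \<noteq> 0"
    "i < n \<Longrightarrow> j < n \<Longrightarrow> lh D (\<lambda>p. F p $$ (i, j))"
  using assms by (auto simp: glh_def mlh_def)

lemma mlhI:
  assumes "D \<subseteq> sol \<times> UNIV" "\<And>p. p \<in> D \<Longrightarrow> F p \<in> carrier_mat n n"
    "\<And>i j. i < n \<Longrightarrow> j < n \<Longrightarrow> lh D (\<lambda>p. F p $$ (i, j))"
  shows "mlh n D F"
  using assms by (simp add: mlh_def)

lemma mlh_cong:
  assumes F: "mlh n D F" and eq: "\<And>p. p \<in> D \<Longrightarrow> F p = G p"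
  shows "mlh n D G"
proof (rule mlhI)
  show "G p \<in> carrier_mat n n" if "p \<in> D" for p using mlhD(2)[OF F that] eq[OF that] by simp
  show "lh D (\<lambda>p. G p $$ (i, j))" if "i < n" "j < n" for i j
    using eq by (intro lh_cong[OF mlhD(3)[OF F that]]) simp
qed (rule mlhD[OF F])

lemma glh_cong:
  assumes F: "glh n D F" and eq: "\<And>p. p \<in> D \<Longrightarrow> F p = G p"
  shows "glh n D G"
  unfolding glh_def using mlh_cong[OF glhD(1)[OF F] eq] glhD(4)[OF F] eq by simp

lemma mlh_mat:
  "D \<subseteq> sol \<times> UNIV \<Longrightarrow> (\<And>i j. i < n \<Longrightarrow> j < n \<Longrightarrow> lh D (\<lambda>p. f i j p)) \<Longrightarrow> mlh n D (\<lambda>p. mat n n (\<lambda>(i, j). f i j p))"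
  by (auto simp: mlh_def)

lemma mlh_mult:
  assumes "mlh n D F" "mlh n D G" shows "mlh n D (\<lambda>p. F p * G p)"
  unfolding mlh_def
proof (intro conjI allI impI ballI)
  show "D \<subseteq> sol \<times> UNIV" by (rule mlhD[OF assms(1)])
  show "F p * G p \<in> carrier_mat n n" if "p \<in> D" for p using mlhD(2)[OF assms(1) that] mlhD(2)[OF assms(2) that] by simp
  fix i j assume ij: "i < n" "j < n"
  have "lh D (\<lambda>p. \<Sum>k<n. F p $$ (i, k) * G p $$ (k, j))"
    by (intro lh_sum lh_mult mlhD[OF assms(1)] mlhD[OF assms(2)] ij) auto
  then show "lh D (\<lambda>p. (F p * G p) $$ (i, j))"
    by (rule lh_cong) (use mlhD(2)[OF assms(1)] mlhD(2)[OF assms(2)] ij in \<open>simp add: mat_mult_index[of _ n]\<close>)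
qed

lemma lh_det:
  assumes "mlh n D F" shows "lh D (\<lambda>p. det (F p))"
proof -
  have "lh D (\<lambda>p. \<Sum>\<pi> | \<pi> permutes {0..<n}. signof \<pi> * (\<Prod>i = 0..<n. F p $$ (i, \<pi> i)))"
  proof (intro lh_sum lh_mult lh_prod lh_const mlhD[OF assms])
    fix \<pi> i assume "\<pi> \<in> {\<pi>. \<pi> permutes {0..<n}}" "i \<in> {0..<n}"
    then show "i < n" "\<pi> i < n" using permutes_in_image[of \<pi> "{0..<n}" i] by auto
  qed
  then show ?thesis by (rule lh_cong) (simp add: det_def'[OF mlhD(2)[OF assms]])
qed

lemma mlh_mat_inv:
  assumes F: "glh n D F" shows "mlh n D (\<lambda>p. mat_inv (F p))"
  unfolding mlh_def
proof (intro conjI allI impI ballI)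
  show D: "D \<subseteq> sol \<times> UNIV" by (rule glhD[OF F])
  show "mat_inv (F p) \<in> carrier_mat n n" if "p \<in> D" for p by (rule mat_inv(1)[OF glhD(3)[OF F that] glhD(4)[OF F that]])
  fix i j assume ij: "i < n" "j < n"
  have del: "mlh (n - 1) D (\<lambda>p. mat_delete (F p) j i)"
  proof -
    have "mlh (n - 1) D (\<lambda>p. mat (n - 1) (n - 1) (\<lambda>(i', j').
        F p $$ (if i' < j then i' else Suc i', if j' < i then j' else Suc j')))"
      by (intro mlh_mat D glhD(5)[OF F]) auto
    then show ?thesis
      by (rule mlh_cong) (simp add: mat_delete_def carrier_matD[OF glhD(3)[OF F]])
  qed
  have "lh D (\<lambda>p. (1 / det (F p)) * ((-1) ^ (j + i) * det (mat_delete (F p) j i)))"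
    by (intro lh_mult lh_divide lh_const lh_det[OF del] lh_det[OF glhD(1)[OF F]] D glhD(4)[OF F])
  then show "lh D (\<lambda>p. mat_inv (F p) $$ (i, j))"
    by (rule lh_cong) (simp add: ij mat_inv_def adj_mat_def cofactor_def carrier_matD[OF glhD(3)[OF F]])
qed

lemma glh_mult:
  assumes F: "glh n D F" and G: "glh n D G" shows "glh n D (\<lambda>p. F p * G p)"
  unfolding glh_def using mlh_mult[OF glhD(1)[OF F] glhD(1)[OF G]]
  by (simp add: det_mult[OF glhD(3)[OF F] glhD(3)[OF G]] glhD(4)[OF F] glhD(4)[OF G])

lemma glh_mat_inv: "glh n D F \<Longrightarrow> glh n D (\<lambda>p. mat_inv (F p))"
  unfolding glh_def[of n D "\<lambda>p. mat_inv (F p)"]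
  by (intro conjI ballI mlh_mat_inv mat_inv(4)) (auto dest: glhD(3) glhD(4))

lemma mlh_const: "A \<in> carrier_mat n n \<Longrightarrow> D \<subseteq> sol \<times> UNIV \<Longrightarrow> mlh n D (\<lambda>p. A)"
  by (auto simp: mlh_def)

lemma glh_one: "D \<subseteq> sol \<times> UNIV \<Longrightarrow> glh n D (\<lambda>p. 1\<^sub>m n)"
  by (simp add: glh_def mlh_const)

lemma glh_transpose:
  assumes F: "glh n D F" shows "glh n D (\<lambda>p. transpose_mat (F p))"
proof -
  have "mlh n D (\<lambda>p. transpose_mat (F p))"
  proof (rule mlhI)
    show "lh D (\<lambda>p. transpose_mat (F p) $$ (i, j))" if "i < n" "j < n" for i j
      by (rule lh_cong[OF glhD(5)[OF F that(2,1)]]) (use that glhD(3)[OF F] in force)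
  qed (use glhD(2,3)[OF F] in auto)
  then show ?thesis using glhD(4)[OF F] by (simp add: glh_def det_transpose[OF glhD(3)[OF F]])
qed

lemma glh_reparam:
  assumes F: "glh n D F" and D': "D' \<subseteq> sol \<times> T"
    and s: "continuous_on T s" "\<And>t. t \<in> T \<Longrightarrow> s t > (0::real)"
    and \<tau>: "continuous_on T \<tau>"
    and sub: "\<And>x t. (x, t) \<in> D' \<Longrightarrow> (rescale (s t) x, \<tau> t) \<in> D"
  shows "glh n D' (\<lambda>p. F (rescale (s (snd p)) (fst p), \<tau> (snd p)))"
  unfolding glh_def mlh_def
proof (intro conjI ballI allI impI)
  show "D' \<subseteq> sol \<times> UNIV" using D' by auto
  show "lh D' (\<lambda>p. F (rescale (s (snd p)) (fst p), \<tau> (snd p)) $$ (i, j))" if "i < n" "j < n" for i j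
    by (rule lh_reparam[OF glhD(5)[OF F that] D' s \<tau> sub])
qed (use sub glhD(3,4)[OF F] in auto)

lemma glh_retime:
  assumes F: "glh n D F" and D': "D' \<subseteq> sol \<times> T" and \<tau>: "continuous_on T \<tau>"
    and sub: "\<And>x t. (x, t) \<in> D' \<Longrightarrow> (x, \<tau> t) \<in> D"
  shows "glh n D' (\<lambda>p. F (fst p, \<tau> (snd p)))"
  unfolding glh_def mlh_def
proof (intro conjI ballI allI impI)
  show "D' \<subseteq> sol \<times> UNIV" using D' by auto
  show "lh D' (\<lambda>p. F (fst p, \<tau> (snd p)) $$ (i, j))" if "i < n" "j < n" for i j
    by (rule lh_retime[OF glhD(5)[OF F that] D' \<tau> sub])
qed (use sub glhD(3,4)[OF F] in auto)

subsection \<open>Isotopy\<close>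

text \<open>
  A single map is regarded as a family that does not depend on time, so that one set of closure
  properties serves for maps and for isotopies.
\<close>

definition hol :: "nat \<Rightarrow> ((nat \<Rightarrow> complex) \<Rightarrow> complex mat) \<Rightarrow> bool" where
  "hol n f \<longleftrightarrow> glh n cyl (\<lambda>p. f (fst p))"

definition isotopic :: "nat \<Rightarrow> ((nat \<Rightarrow> complex) \<Rightarrow> complex mat) \<Rightarrow> ((nat \<Rightarrow> complex) \<Rightarrow> complex mat) \<Rightarrow> bool" where
  "isotopic n f g \<longleftrightarrow> (\<exists>H. glh n cyl H \<and> (\<forall>x\<in>sol. H (x, 0) = f x \<and> H (x, 1) = g x))"

lemma isotopicI: "glh n cyl H \<Longrightarrow> (\<And>x. x \<in> sol \<Longrightarrow> H (x, 0) = f x) \<Longrightarrow> (\<And>x. x \<in> sol \<Longrightarrow> H (x, 1) = g x) \<Longrightarrow> isotopic n f g"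
  by (auto simp: isotopic_def)

lemma glh_slice:
  assumes "glh n D H" "D' \<subseteq> sol \<times> UNIV" "\<And>x t. (x, t) \<in> D' \<Longrightarrow> (x, t0) \<in> D"
  shows "glh n D' (\<lambda>p. H (fst p, t0))"
  using glh_retime[OF assms(1), of D' UNIV "\<lambda>_. t0"] assms by auto

lemma hol_slice: "glh n cyl H \<Longrightarrow> t \<in> {0..1} \<Longrightarrow> hol n (\<lambda>x. H (x, t))"
  unfolding hol_def by (rule glh_slice) auto

lemma hol_glh: "hol n f \<Longrightarrow> D \<subseteq> sol \<times> UNIV \<Longrightarrow> glh n D (\<lambda>p. f (fst p))"
  using glh_slice[of n cyl "\<lambda>p. f (fst p)" D 0] by (auto simp: hol_def)

lemma hol_cong: "hol n f \<Longrightarrow> (\<And>x. x \<in> sol \<Longrightarrow> f x = g x) \<Longrightarrow> hol n g"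
  unfolding hol_def by (erule glh_cong) auto

lemma holD:
  assumes "hol n f" "x \<in> sol"
  shows "f x \<in> carrier_mat n n" "det (f x) \<noteq> 0"
  using glhD(3,4)[OF assms(1)[unfolded hol_def], of "(x, 0)"] assms(2) by auto

lemma isotopic_hol: 
  assumes "isotopic n f g" shows "hol n f" "hol n g"
proof -
  obtain H where H: "glh n cyl H" "\<And>x. x \<in> sol \<Longrightarrow> H (x, 0) = f x" "\<And>x. x \<in> sol \<Longrightarrow> H (x, 1) = g x"
    using assms by (auto simp: isotopic_def)
  show "hol n f" using hol_slice[OF H(1), of 0] by (rule hol_cong) (auto simp: H)
  show "hol n g" using hol_slice[OF H(1), of 1] by (rule hol_cong) (auto simp: H)
qed

lemma isotopic_refl: "hol n f \<Longrightarrow> isotopic n f f"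
  unfolding hol_def by (rule isotopicI) auto

lemma isotopic_cong:
  "isotopic n f g \<Longrightarrow> (\<And>x. x \<in> sol \<Longrightarrow> f x = f' x) \<Longrightarrow> (\<And>x. x \<in> sol \<Longrightarrow> g x = g' x) \<Longrightarrow> isotopic n f' g'"
  by (force simp: isotopic_def)

lemma isotopic_sym: assumes "isotopic n f g" shows "isotopic n g f"
proof -
  obtain H where H: "glh n cyl H" "\<And>x. x \<in> sol \<Longrightarrow> H (x, 0) = f x" "\<And>x. x \<in> sol \<Longrightarrow> H (x, 1) = g x"
    using assms by (auto simp: isotopic_def)
  have "glh n cyl (\<lambda>p. H (fst p, (\<lambda>t. 1 - t) (snd p)))"
    by (intro glh_retime[OF H(1), where T = "{0..1}"] continuous_intros) auto
  then show ?thesis by (rule isotopicI) (auto simp: H)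
qed

lemma isotopic_trans:
  assumes "isotopic n f g" "isotopic n g h" shows "isotopic n f h"
proof -
  obtain H where H: "glh n cyl H" "\<And>x. x \<in> sol \<Longrightarrow> H (x, 0) = f x" "\<And>x. x \<in> sol \<Longrightarrow> H (x, 1) = g x"
    using assms by (auto simp: isotopic_def)
  obtain G where G: "glh n cyl G" "\<And>x. x \<in> sol \<Longrightarrow> G (x, 0) = g x" "\<And>x. x \<in> sol \<Longrightarrow> G (x, 1) = h x"
    using assms by (auto simp: isotopic_def)
  let ?F = "\<lambda>p. if snd p \<le> 1 / 2 then H (fst p, 2 * snd p) else G (fst p, 2 * snd p - 1)"
  have 1: "glh n (sol \<times> {0..1/2}) (\<lambda>p. H (fst p, (\<lambda>t. 2 * t) (snd p)))"
    by (intro glh_retime[OF H(1), where T = UNIV] continuous_intros) auto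
  have 2: "glh n (sol \<times> {1/2..1}) (\<lambda>p. G (fst p, (\<lambda>t. 2 * t - 1) (snd p)))"
    by (intro glh_retime[OF G(1), where T = UNIV] continuous_intros) auto
  have "glh n cyl ?F"
    unfolding glh_def mlh_def
  proof (intro conjI allI impI ballI)
    fix i j assume ij: "i < n" "j < n"
    have "lh cyl (\<lambda>p. if snd p \<le> 1 / 2 then H (fst p, 2 * snd p) $$ (i, j) else G (fst p, 2 * snd p - 1) $$ (i, j))"
    proof (rule lh_cases_time)
      show "lh {p \<in> cyl. snd p \<le> 1 / 2} (\<lambda>p. H (fst p, 2 * snd p) $$ (i, j))"
        by (rule lh_subset[OF glhD(5)[OF 1 ij]]) auto
      show "lh {p \<in> cyl. 1 / 2 \<le> snd p} (\<lambda>p. G (fst p, 2 * snd p - 1) $$ (i, j))"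
        by (rule lh_subset[OF glhD(5)[OF 2 ij]]) auto
    next
      fix p assume p: "p \<in> cyl" "snd p = 1 / 2"
      then have "fst p \<in> sol" by auto
      then show "H (fst p, 2 * snd p) $$ (i, j) = G (fst p, 2 * snd p - 1) $$ (i, j)"
        unfolding p(2) by (simp add: H G)
    qed auto
    then show "lh cyl (\<lambda>p. ?F p $$ (i, j))" by (rule lh_cong) auto
  qed (use glhD(3,4)[OF H(1)] glhD(3,4)[OF G(1)] in auto)
  then show ?thesis by (rule isotopicI) (auto simp: H G)
qed

lemma hol_mult: "hol n f \<Longrightarrow> hol n g \<Longrightarrow> hol n (\<lambda>x. f x * g x)"
  unfolding hol_def by (rule glh_mult)

lemma hol_mat_inv: "hol n f \<Longrightarrow> hol n (\<lambda>x. mat_inv (f x))"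
  unfolding hol_def by (rule glh_mat_inv)

lemma hol_one: "hol n (\<lambda>x. 1\<^sub>m n)"
  unfolding hol_def by (rule glh_one) auto

lemma isotopic_mult: "isotopic n f f' \<Longrightarrow> isotopic n g g' \<Longrightarrow> isotopic n (\<lambda>x. f x * g x) (\<lambda>x. f' x * g' x)"
  unfolding isotopic_def
proof (elim exE conjE)
  fix H G
  assume "glh n cyl H" "glh n cyl G" "\<forall>x\<in>sol. H (x, 0) = f x \<and> H (x, 1) = f' x" "\<forall>x\<in>sol. G (x, 0) = g x \<and> G (x, 1) = g' x"
  then show "\<exists>K. glh n cyl K \<and> (\<forall>x\<in>sol. K (x, 0) = f x * g x \<and> K (x, 1) = f' x * g' x)"
    by (intro exI[of _ "\<lambda>p. H p * G p"]) (auto intro: glh_mult)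
qed

lemma isotopic_transpose: "isotopic n f f' \<Longrightarrow> isotopic n (\<lambda>x. transpose_mat (f x)) (\<lambda>x. transpose_mat (f' x))"
  unfolding isotopic_def
proof (elim exE conjE)
  fix H
  assume "glh n cyl H" "\<forall>x\<in>sol. H (x, 0) = f x \<and> H (x, 1) = f' x"
  then show "\<exists>K. glh n cyl K \<and> (\<forall>x\<in>sol. K (x, 0) = transpose_mat (f x) \<and> K (x, 1) = transpose_mat (f' x))"
    by (intro exI[of _ "\<lambda>p. transpose_mat (H p)"]) (auto intro: glh_transpose)
qed

lemma isotopic_concat_infinite:
  assumes H: "\<And>k. glh n cyl (H k)"
    and join: "\<And>k x. x \<in> sol \<Longrightarrow> H k (x, 1) = H (Suc k) (x, 0)"
    and lim: "\<And>R e. R \<ge> 1 \<Longrightarrow> e > 0 \<Longrightarrow> \<exists>K. \<forall>k\<ge>K. \<forall>x\<in>shell R. \<forall>t\<in>{0..1}. \<forall>i<n. \<forall>j<n.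
      norm (H k (x, t) $$ (i, j) - 1\<^sub>m n $$ (i, j)) \<le> e"
  shows "isotopic n (\<lambda>x. H 0 (x, 0)) (\<lambda>x. 1\<^sub>m n)"
proof -
  let ?F = "\<lambda>p. if snd p < 1 then H (nat \<lfloor>snd p / (1 - snd p)\<rfloor>) (fst p, frac (snd p / (1 - snd p))) else 1\<^sub>m n"
  have fr: "frac r \<in> {0..1}" for r :: real using frac_lt_1[of r] frac_ge_0[of r] by auto
  have "glh n cyl ?F"
    unfolding glh_def mlh_def
  proof (intro conjI allI impI ballI)
    fix i j assume ij: "i < n" "j < n"
    have "lh cyl (\<lambda>p. if snd p < 1 then
        (\<lambda>k q. H k q $$ (i, j)) (nat \<lfloor>snd p / (1 - snd p)\<rfloor>) (fst p, frac (snd p / (1 - snd p))) else 1\<^sub>m n $$ (i, j))"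
    proof (rule lh_concat_infinite)
      fix R e :: real assume "R \<ge> 1" "e > 0"
      from lim[OF this] ij show "\<exists>K. \<forall>k\<ge>K. \<forall>x\<in>shell R. \<forall>t\<in>{0..1}. norm (H k (x, t) $$ (i, j) - 1\<^sub>m n $$ (i, j)) \<le> e"
        by blast
    qed (use ij join glhD(5)[OF H] in auto)
    then show "lh cyl (\<lambda>p. ?F p $$ (i, j))" by (rule lh_cong) auto
  qed (use fr in \<open>auto intro!: glhD(3,4)[OF H]\<close>)
  then show ?thesis by (rule isotopicI) auto
qed

subsection \<open>Translation of the topological definitions\<close>

lemma continuous_map_GL_iff:
  "continuous_map T (GL_topology n) F \<longleftrightarrow>
     (\<forall>p\<in>topspace T. F p \<in> GL n) \<and> (\<forall>i<n. \<forall>j<n. continuous_map T euclidean (\<lambda>p. F p $$ (i, j)))"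
proof (intro iffI conjI ballI allI impI)
  assume c: "continuous_map T (GL_topology n) F"
  show "F p \<in> GL n" if "p \<in> topspace T" for p
    using continuous_map_image_subset_topspace[OF c] that by (auto simp: GL_topology_def topspace_pullback_topology)
  fix i j assume ij: "i < n" "j < n"
  have "continuous_map (product_topology (\<lambda>_. euclidean) ({..<n} \<times> {..<n})) (euclidean :: complex topology) (\<lambda>v. v (i, j))"
    using continuous_map_product_projection[of "(i, j)" "{..<n} \<times> {..<n}" "\<lambda>_. euclidean :: complex topology"] ij by simp
  from continuous_map_pullback[OF this]
  have "continuous_map (GL_topology n) euclidean ((\<lambda>v. v (i, j)) \<circ> (\<lambda>A. \<lambda>ij\<in>{..<n} \<times> {..<n}. A $$ ij))"
    unfolding GL_topology_def .
  from continuous_map_compose[OF c this] show "continuous_map T euclidean (\<lambda>p. F p $$ (i, j))"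
    using ij by (simp add: o_def)
next
  assume a: "(\<forall>p\<in>topspace T. F p \<in> GL n) \<and> (\<forall>i<n. \<forall>j<n. continuous_map T euclidean (\<lambda>p. F p $$ (i, j)))"
  show "continuous_map T (GL_topology n) F"
    unfolding GL_topology_def
  proof (rule continuous_map_pullback')
    show "continuous_map T (product_topology (\<lambda>_. euclidean) ({..<n} \<times> {..<n})) ((\<lambda>A. \<lambda>ij\<in>{..<n} \<times> {..<n}. A $$ ij) \<circ> F)"
      using a by (auto simp: continuous_map_componentwise)
  qed (use a in auto)
qed

lemma prod_solenoid_eq: "prod_topology solenoid (top_of_set {0..1::real}) = top_of_set cyl"
  unfolding solenoid_eq by (rule prod_topology_subtopology_eu)

lemma solenoid_holomorphic_iff: "solenoid_holomorphic n f \<longleftrightarrow> hol n f"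
proof
  assume h: "solenoid_holomorphic n f"
  then have c: "\<forall>x\<in>sol. f x \<in> GL n" "\<And>i j. i < n \<Longrightarrow> j < n \<Longrightarrow> continuous_on sol (\<lambda>x. f x $$ (i, j))"
    unfolding solenoid_holomorphic_def solenoid_eq by (auto simp: continuous_map_GL_iff)
  have "lh cyl (\<lambda>p. f (fst p) $$ (i, j))" if ij: "i < n" "j < n" for i j
    unfolding lh_def
  proof (intro conjI ballI allI)
    show "continuous_on cyl (\<lambda>p. f (fst p) $$ (i, j))"
      by (rule continuous_on_compose2[OF c(2)[OF ij]]) (auto intro: continuous_intros)
    show "(\<lambda>z. f (fst (solenoid_exp a z, t)) $$ (i, j)) holomorphic_on {z. (solenoid_exp a z, t) \<in> cyl}"
      if "a \<in> profinite_integers" for a t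
      using h that ij by (auto simp: solenoid_holomorphic_def intro: holomorphic_on_subset[of _ UNIV])
  qed auto
  then show "hol n f" using c(1) by (auto simp: hol_def glh_def mlh_def GL_iff)
next
  assume h: "hol n f"
  have l: "lh (sol \<times> {0}) (\<lambda>p. f (fst p) $$ (i, j))" if ij: "i < n" "j < n" for i j
    by (rule glhD(5)[OF hol_glh[OF h] ij]) auto
  have "continuous_on sol (\<lambda>x. f x $$ (i, j))" if ij: "i < n" "j < n" for i j
  proof -
    have "continuous_on sol (\<lambda>x. f (fst (x, 0::real)) $$ (i, j))"
      by (rule continuous_on_compose2[OF lhD(1)[OF l[OF ij]]]) (auto intro: continuous_intros)
    then show ?thesis by simp
  qed
  moreover have "(\<lambda>z. f (solenoid_exp a z) $$ (i, j)) holomorphic_on UNIV"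
    if "a \<in> profinite_integers" "i < n" "j < n" for a i j
    using lhD(2)[OF l[OF that(2,3)] that(1), of 0] solenoid_exp_in_sol[OF that(1)] by simp
  ultimately show "solenoid_holomorphic n f"
    using holD[OF h] unfolding solenoid_holomorphic_def solenoid_eq by (auto simp: continuous_map_GL_iff GL_iff)
qed

lemma holomorphic_isotopic_iff: "holomorphic_isotopic n f g \<longleftrightarrow> isotopic n f g"
proof
  assume "holomorphic_isotopic n f g"
  then obtain H where H: "continuous_map (top_of_set cyl) (GL_topology n) H"
      "\<And>t. t \<in> {0..1} \<Longrightarrow> hol n (\<lambda>x. H (x, t))"
      "\<And>x. x \<in> sol \<Longrightarrow> H (x, 0) = f x \<and> H (x, 1) = g x"
    by (auto simp: holomorphic_isotopic_def solenoid_holomorphic_iff prod_solenoid_eq simp flip: sol_def)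
  have "lh cyl (\<lambda>p. H p $$ (i, j))" if ij: "i < n" "j < n" for i j
    unfolding lh_def
  proof (intro conjI ballI allI)
    show "continuous_on cyl (\<lambda>p. H p $$ (i, j))" using H(1) ij by (auto simp: continuous_map_GL_iff)
    fix a t assume a: "a \<in> profinite_integers"
    show "(\<lambda>z. H (solenoid_exp a z, t) $$ (i, j)) holomorphic_on {z. (solenoid_exp a z, t) \<in> cyl}"
    proof (cases "t \<in> {0..1}")
      case True
      show ?thesis
        using lhD(2)[OF glhD(5)[OF H(2)[OF True, unfolded hol_def] ij] a, of t] by simp
    next
      case False
      then have "{z. (solenoid_exp a z, t) \<in> cyl} = {}" by auto
      then show ?thesis by (simp only: holomorphic_on_empty)
    qed
  qed auto
  then have "glh n cyl H" using holD[OF H(2)] by (auto simp: glh_def mlh_def)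
  then show "isotopic n f g" using H(3) by (auto intro: isotopicI)
next
  assume "isotopic n f g"
  then obtain H where H: "glh n cyl H" "\<forall>x\<in>sol. H (x, 0) = f x \<and> H (x, 1) = g x" by (auto simp: isotopic_def)
  have "continuous_map (top_of_set cyl) (GL_topology n) H"
    unfolding continuous_map_GL_iff using glhD(3,4)[OF H(1)] lhD(1)[OF glhD(5)[OF H(1)]] by (auto simp: GL_iff)
  then show "holomorphic_isotopic n f g"
    using H hol_slice[OF H(1)] unfolding holomorphic_isotopic_def
    by (intro exI[of _ H]) (auto simp: solenoid_holomorphic_iff prod_solenoid_eq simp flip: sol_def)
qed

section \<open>Approximation by Laurent polynomials in one coordinate\<close>

text \<open>
  The value at \<open>0\<close> is left open, so that equations between Laurent polynomials need to be checked on
  the punctured plane only.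
\<close>

definition laurent :: "(complex \<Rightarrow> complex) \<Rightarrow> bool" where
  "laurent P \<longleftrightarrow> (\<exists>D c. \<forall>z. z \<noteq> 0 \<longrightarrow> P z = (\<Sum>k\<in>{-int D..int D}. c k * z powi k))"

lemma laurentI:
  "(\<And>z. z \<noteq> 0 \<Longrightarrow> P z = (\<Sum>k\<in>{-int D..int D}. c k * z powi k)) \<Longrightarrow> laurent P"
  unfolding laurent_def by (intro exI[of _ D] exI[of _ c]) simp

lemma laurent_monomial: "laurent (\<lambda>z. c * z powi k)"
proof -
  have "c * z powi k = (\<Sum>j\<in>{-int (nat \<bar>k\<bar>)..int (nat \<bar>k\<bar>)}. (if j = k then c else 0) * z powi j)" for z
  proof -
    have "(\<Sum>j\<in>{-int (nat \<bar>k\<bar>)..int (nat \<bar>k\<bar>)}. (if j = k then c else 0) * z powi j) =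
        (\<Sum>j\<in>{-int (nat \<bar>k\<bar>)..int (nat \<bar>k\<bar>)}. if j = k then c * z powi j else 0)"
      by (intro sum.cong) auto
    moreover have "k \<in> {-int (nat \<bar>k\<bar>)..int (nat \<bar>k\<bar>)}" by auto
    ultimately show ?thesis by (simp only: sum.delta[OF finite_atLeastAtMost_int] if_True)
  qed
  then show ?thesis by (rule laurentI)
qed

lemma laurent_pad:
  fixes P :: "complex \<Rightarrow> complex"
  assumes "\<And>z. z \<noteq> 0 \<Longrightarrow> P z = (\<Sum>k\<in>{-int D..int D}. c k * z powi k)" "D \<le> D'" "z \<noteq> 0"
  shows "P z = (\<Sum>k\<in>{-int D'..int D'}. (if \<bar>k\<bar> \<le> int D then c k else 0) * z powi k)"
proof -
  have "(\<Sum>k\<in>{-int D'..int D'}. (if \<bar>k\<bar> \<le> int D then c k else 0) * z powi k) =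
      (\<Sum>k\<in>{-int D..int D}. (if \<bar>k\<bar> \<le> int D then c k else 0) * z powi k)"
    using assms(2) by (intro sum.mono_neutral_right) auto
  also have "\<dots> = (\<Sum>k\<in>{-int D..int D}. c k * z powi k)" by (intro sum.cong) auto
  finally show ?thesis using assms(1)[OF assms(3)] by simp
qed

lemma laurent_add: 
  assumes "laurent P" "laurent Q" shows "laurent (\<lambda>z. P z + Q z)"
proof -
  obtain D c where P: "\<And>z. z \<noteq> 0 \<Longrightarrow> P z = (\<Sum>k\<in>{-int D..int D}. c k * z powi k)"
    using assms by (auto simp: laurent_def)
  obtain E d where Q: "\<And>z. z \<noteq> 0 \<Longrightarrow> Q z = (\<Sum>k\<in>{-int E..int E}. d k * z powi k)"
    using assms by (auto simp: laurent_def)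
  define c' where "c' k = (if \<bar>k\<bar> \<le> int D then c k else 0)" for k
  define d' where "d' k = (if \<bar>k\<bar> \<le> int E then d k else 0)" for k
  have "P z + Q z = (\<Sum>k\<in>{-int (max D E)..int (max D E)}. (c' k + d' k) * z powi k)" if "z \<noteq> 0" for z
  proof -
    have "P z = (\<Sum>k\<in>{-int (max D E)..int (max D E)}. c' k * z powi k)"
      unfolding c'_def by (rule laurent_pad[OF P]) (use that in auto)
    moreover have "Q z = (\<Sum>k\<in>{-int (max D E)..int (max D E)}. d' k * z powi k)"
      unfolding d'_def by (rule laurent_pad[OF Q]) (use that in auto)
    ultimately show ?thesis by (simp only: sum.distrib distrib_right)
  qed
  then show ?thesis by (rule laurentI)
qed

lemma laurent_sum: "(\<And>i. i \<in> I \<Longrightarrow> laurent (P i)) \<Longrightarrow> laurent (\<lambda>z. \<Sum>i\<in>I. P i z)"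
proof (induction I rule: infinite_finite_induct)
  case (insert x F)
  then show ?case by (auto intro: laurent_add)
qed (use laurent_monomial[of 0 0] in auto)

lemma lh_laurent:
  assumes "laurent P" "m \<ge> 1" "D \<subseteq> sol \<times> UNIV"
  shows "lh D (\<lambda>p. P (fst p m))"
proof -
  obtain E c where P: "\<And>z. z \<noteq> 0 \<Longrightarrow> P z = (\<Sum>k\<in>{-int E..int E}. c k * z powi k)"
    using assms by (auto simp: laurent_def)
  have "lh D (\<lambda>p. \<Sum>k\<in>{-int E..int E}. c k * fst p m powi k)"
    using assms sol_nonzero by (intro lh_sum lh_mult lh_const lh_power_int lh_coordinate) auto
  then show ?thesis by (rule lh_cong) (use P sol_nonzero assms in auto)
qed

subsection \<open>Periodic entire functions\<close>

text \<open>
  The Fourier integral over a horizontal segment of length \<open>2 \<pi>\<close>, starting anywhere in the plane.  Its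
  dependence on the starting point \<open>u\<close> is exactly \<open>exp (i k u)\<close>, because the integrand times
  \<open>exp (- i k u)\<close> has a primitive whose increment over one period is constant.
\<close>

lemma periodic_fourier_coefficient:
  fixes g :: "complex \<Rightarrow> complex" and k :: int
  assumes g: "g holomorphic_on UNIV" and per: "\<And>u. g (u + of_real (2 * pi)) = g u"
  obtains c where "\<And>u. ((\<lambda>s. g (u + of_real s) * exp (- \<i> * of_int k * of_real s)) has_integral (c * exp (\<i> * of_int k * u))) {0..2 * pi}"
proof -
  define \<psi> where "\<psi> v = g v * exp (- \<i> * of_int k * v)" for v
  have "\<psi> holomorphic_on UNIV" unfolding \<psi>_def by (intro holomorphic_intros g)
  then obtain \<Psi> where \<Psi>: "\<And>v. (\<Psi> has_field_derivative \<psi> v) (at v)"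
    using holomorphic_convex_primitive'[OF convex_UNIV open_UNIV, of \<psi>] by auto
  have e1: "exp (- (\<i> * of_int k * of_real (2 * pi))) = 1"
    using exp_integer_2pi[of "- of_int k"] by (simp add: mult_ac)
  have per\<psi>: "\<psi> (v + of_real (2 * pi)) = \<psi> v" for v
  proof -
    have "- \<i> * of_int k * (v + of_real (2 * pi)) = - \<i> * of_int k * v + - (\<i> * of_int k * of_real (2 * pi))"
      by (simp add: distrib_left)
    then show ?thesis unfolding \<psi>_def per exp_add by (simp only: exp_add e1 mult_1_right)
  qed
  have "((\<lambda>v. \<Psi> (v + of_real (2 * pi)) - \<Psi> v) has_field_derivative 0) (at v)" for v
  proof -
    have "((\<lambda>v. \<Psi> (v + of_real (2 * pi))) has_field_derivative \<psi> (v + of_real (2 * pi))) (at v)"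
      using \<Psi>[of "v + of_real (2 * pi)"] by (subst DERIV_shift[symmetric]) simp
    from DERIV_diff[OF this \<Psi>[of v]] show ?thesis by (simp only: per\<psi> diff_self)
  qed
  then obtain c where c: "\<And>v. \<Psi> (v + of_real (2 * pi)) - \<Psi> v = c"
    using has_field_derivative_zero_constant[of UNIV "\<lambda>v. \<Psi> (v + of_real (2 * pi)) - \<Psi> v"] by auto
  have int: "((\<lambda>s. \<psi> (u + of_real s)) has_integral c) {0..2 * pi}" for u
  proof -
    have "((\<lambda>s. \<Psi> (u + of_real s)) has_vector_derivative \<psi> (u + of_real s)) (at s within {0..2 * pi})" for s :: real
    proof -
      have "((\<lambda>v. \<Psi> (u + v)) has_field_derivative \<psi> (u + of_real s)) (at (of_real s))"
        using \<Psi>[of "u + of_real s"] DERIV_shift[of \<Psi> _ "of_real s" u] by (simp add: add.commute)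
      then show ?thesis
        using has_vector_derivative_real_field[of "\<lambda>v. \<Psi> (u + v)"] by blast
    qed
    then have "((\<lambda>s. \<psi> (u + of_real s)) has_integral (\<Psi> (u + of_real (2 * pi)) - \<Psi> (u + of_real 0))) {0..2 * pi}"
      by (intro fundamental_theorem_of_calculus) auto
    then show ?thesis using c[of u] by simp
  qed
  show ?thesis
  proof (rule that[of c])
    fix u
    have "((\<lambda>s. exp (\<i> * of_int k * u) * \<psi> (u + of_real s)) has_integral (exp (\<i> * of_int k * u) * c)) {0..2 * pi}"
      by (intro has_integral_mult_right int)
    moreover have "exp (\<i> * of_int k * u) * \<psi> (u + of_real s) = g (u + of_real s) * exp (- \<i> * of_int k * of_real s)" for s
      by (simp add: \<psi>_def algebra_simps exp_add exp_diff exp_minus divide_inverse)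
    ultimately show "((\<lambda>s. g (u + of_real s) * exp (- \<i> * of_int k * of_real s)) has_integral (c * exp (\<i> * of_int k * u))) {0..2 * pi}"
      by (simp add: mult.commute)
  qed
qed

lemma integral_exp_int:
  fixes k :: int
  shows "((\<lambda>s. exp (- \<i> * of_int k * of_real s)) has_integral (if k = 0 then 2 * of_real pi else 0)) {0..2 * pi}"
proof (cases "k = 0")
  case True
  then show ?thesis using has_integral_const_real[of "1::complex" 0 "2 * pi"] by (simp add: scaleR_conv_of_real)
next
  case False
  obtain c where c: "\<And>u. ((\<lambda>s. 1 * exp (- \<i> * of_int k * of_real s)) has_integral (c * exp (\<i> * of_int k * u))) {0..2 * pi}"
    by (rule periodic_fourier_coefficient[of "\<lambda>_. 1" k]) auto
  have "c * exp (\<i> * of_int k * 0) = c * exp (\<i> * of_int k * (of_real pi / of_int k))"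
    using has_integral_unique[OF c c] by blast
  then have "c = 0" using False by simp
  then show ?thesis using c[of 0] False by simp
qed

text \<open>
  Convolution with the Fejer kernel \<open>\<kappa>\<close>, which is nonnegative with mean one and concentrates at the
  multiples of \<open>2 \<pi>\<close>.  The integration runs in the real direction, so the estimate is uniform on
  horizontal strips, and the convolution is a Laurent polynomial in \<open>exp (i u)\<close>.
\<close>

lemma fejer_approximation:
  fixes g :: "complex \<Rightarrow> complex"
  assumes g: "g holomorphic_on UNIV" and per: "\<And>u. g (u + of_real (2 * pi)) = g u" and e: "e > 0"
  obtains P where "laurent P" "\<And>u. \<bar>Im u\<bar> \<le> \<rho> \<Longrightarrow> norm (g u - P (exp (\<i> * u))) \<le> e"
proof -
  have contg: "continuous_on S g" for S
    using holomorphic_on_imp_continuous_on[OF g] continuous_on_subset by blast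
  \<comment> \<open>wide enough to contain \<open>u\<close>, \<open>u + s\<close> and \<open>u + s - 2 \<pi>\<close> for \<open>u\<close> and \<open>s\<close> within one period\<close>
  define K where "K = cbox (Complex (-20) (-\<rho>)) (Complex 20 \<rho>)"
  have cK: "compact K" by (simp add: K_def)
  have Kiff: "u \<in> K \<longleftrightarrow> \<bar>Re u\<bar> \<le> 20 \<and> \<bar>Im u\<bar> \<le> \<rho>" for u
    by (auto simp: K_def in_cbox_complex_iff)
  obtain B where B: "B > 0" "\<And>u. u \<in> K \<Longrightarrow> norm (g u) \<le> B"
    using compact_imp_bounded[OF compact_continuous_image[OF contg cK]] by (auto simp: bounded_pos)
  obtain d0 where d0: "d0 > 0" "\<And>u v. u \<in> K \<Longrightarrow> v \<in> K \<Longrightarrow> dist v u < d0 \<Longrightarrow> dist (g v) (g u) < e / 2"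
    using compact_uniformly_continuous[OF contg cK] e unfolding uniformly_continuous_on_def by (meson half_gt_zero)
  define d where "d = min d0 1 / 2"
  have d: "d > 0" "d < d0" "d < 1" using d0 by (auto simp: d_def)
  have nz: "1 - exp (\<i> * of_real s) \<noteq> 0" if "s \<in> {d..2 * pi - d}" for s :: real
  proof
    assume "1 - exp (\<i> * of_real s) = 0"
    then have "exp (\<i> * of_real s) = 1" by simp
    then obtain j :: int where j: "s = of_int (2 * j) * pi" by (auto simp: exp_eq_1)
    have "0 < s" "s < 2 * pi" using that d by auto
    then have "0 < j \<and> j < 1" using j by (auto simp: zero_less_mult_iff)
    then show False by auto
  qed
  obtain c0 where c0: "c0 > 0" "\<And>s. s \<in> {d..2 * pi - d} \<Longrightarrow> c0 \<le> norm (1 - exp (\<i> * of_real s))"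
  proof -
    have ne: "{d..2 * pi - d} \<noteq> {}" using d pi_gt3 by auto
    have "continuous_on {d..2 * pi - d} (\<lambda>s. norm (1 - exp (\<i> * of_real s)))" by (intro continuous_intros)
    from continuous_attains_inf[OF compact_Icc ne this]
    obtain s0 where "s0 \<in> {d..2 * pi - d}" "\<forall>s\<in>{d..2 * pi - d}. norm (1 - exp (\<i> * of_real s0)) \<le> norm (1 - exp (\<i> * of_real s))"
      by blast
    then show ?thesis using nz[of s0] by (intro that[of "norm (1 - exp (\<i> * of_real s0))"]) auto
  qed
  obtain N :: nat where N: "2 * B * (4 / c0\<^sup>2) / (e / 2) < real N" using reals_Archimedean2 by blast
  have "0 < 2 * B * (4 / c0\<^sup>2) / (e / 2)" using B(1) c0(1) e by simp
  then have N0: "N > 0" using N by (cases N) auto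
  have tail: "2 * B * (4 / c0\<^sup>2 / real N) \<le> e / 2"
  proof -
    have "\<xi> / real N \<le> e / 2" if "\<xi> / (e / 2) < real N" for \<xi>
      using that N0 e by (simp add: field_simps)
    from this[OF N] show ?thesis by simp
  qed
  define S where "S s = (\<Sum>l<N. exp (\<i> * of_real s) ^ l)" for s :: real
  define \<kappa> where "\<kappa> s = (norm (S s))\<^sup>2 / real N" for s
  have \<kappa>0: "\<kappa> s \<ge> 0" for s by (simp add: \<kappa>_def)
  have \<kappa>_eq: "of_real (\<kappa> s) = (\<Sum>a<N. \<Sum>b<N. exp (- \<i> * of_int (int b - int a) * of_real s) / of_nat N)" for s
  proof -
    have "of_real ((norm (S s))\<^sup>2) = S s * cnj (S s)" by (rule complex_norm_square)
    also have "cnj (S s) = (\<Sum>b<N. exp (- \<i> * of_real s) ^ b)" by (simp add: S_def exp_cnj)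
    also have "S s * \<dots> = (\<Sum>a<N. \<Sum>b<N. exp (\<i> * of_real s) ^ a * exp (- \<i> * of_real s) ^ b)"
      by (simp add: S_def sum_product)
    also have "\<dots> = (\<Sum>a<N. \<Sum>b<N. exp (- \<i> * of_int (int b - int a) * of_real s))"
      by (intro sum.cong refl) (simp add: algebra_simps flip: exp_of_nat_mult exp_add)
    finally show ?thesis by (simp add: \<kappa>_def sum_divide_distrib)
  qed
  have \<kappa>_int: "((\<lambda>s. of_real (\<kappa> s) :: complex) has_integral (2 * of_real pi)) {0..2 * pi}"
  proof -
    have "((\<lambda>s. \<Sum>a<N. \<Sum>b<N. exp (- \<i> * of_int (int b - int a) * of_real s) / of_nat N) has_integral
        (\<Sum>a<N. \<Sum>b<N. (if int b - int a = 0 then 2 * of_real pi else 0) / of_nat N)) {0..2 * pi}"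
      by (intro has_integral_sum has_integral_divide integral_exp_int) auto
    moreover have "(\<Sum>a<N. \<Sum>b<N. (if int b - int a = 0 then 2 * complex_of_real pi else 0) / of_nat N) = 2 * of_real pi"
    proof -
      have "(\<Sum>b<N. (if int b - int a = 0 then 2 * complex_of_real pi else 0) / of_nat N) = 2 * of_real pi / of_nat N"
        if "a < N" for a
      proof -
        have "(\<Sum>b<N. (if int b - int a = 0 then 2 * complex_of_real pi else 0) / of_nat N) =
           (\<Sum>b<N. if b = a then 2 * complex_of_real pi / of_nat N else 0)" by (intro sum.cong) auto
        then show ?thesis using that by (simp add: sum.delta)
      qed
      then show ?thesis using N0 by simp
    qed
    ultimately show ?thesis by (simp only: \<kappa>_eq)
  qed
  have \<kappa>_small: "\<kappa> s \<le> 4 / c0\<^sup>2 / real N" if "s \<in> {d..2 * pi - d}" for s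
  proof -
    have "S s * (1 - exp (\<i> * of_real s)) = 1 - exp (\<i> * of_real s) ^ N"
      unfolding S_def by (metis mult.commute one_diff_power_eq)
    then have "norm (S s) * norm (1 - exp (\<i> * of_real s)) \<le> 1 + 1"
      using norm_triangle_ineq4[of 1 "exp (\<i> * of_real s) ^ N"] by (simp flip: norm_mult add: norm_power)
    moreover have "norm (S s) * c0 \<le> norm (S s) * norm (1 - exp (\<i> * of_real s))"
      using c0(2)[OF that] by (intro mult_left_mono) auto
    ultimately have "norm (S s) * c0 \<le> 2" by simp
    then have "(norm (S s) * c0)\<^sup>2 \<le> 2\<^sup>2" using c0 by (intro power_mono) auto
    then have "(norm (S s))\<^sup>2 \<le> 4 / c0\<^sup>2" using c0 by (simp add: field_simps)
    then show ?thesis unfolding \<kappa>_def by (intro divide_right_mono) auto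
  qed
  define c where "c k = (SOME c. \<forall>u. ((\<lambda>s. g (u + of_real s) * exp (- \<i> * of_int k * of_real s)) has_integral
      (c * exp (\<i> * of_int k * u))) {0..2 * pi})" for k :: int
  have c: "((\<lambda>s. g (u + of_real s) * exp (- \<i> * of_int k * of_real s)) has_integral
      (c k * exp (\<i> * of_int k * u))) {0..2 * pi}" for k u
  proof -
    have "\<exists>c. \<forall>u. ((\<lambda>s. g (u + of_real s) * exp (- \<i> * of_int k * of_real s)) has_integral
      (c * exp (\<i> * of_int k * u))) {0..2 * pi}"
      using periodic_fourier_coefficient[OF g per, of k] by metis
    from someI_ex[OF this] show ?thesis unfolding c_def by blast
  qed
  define P where "P z = (\<Sum>a<N. \<Sum>b<N. (c (int b - int a) / (of_nat N * (2 * of_real pi))) * z powi (int b - int a))" for z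
  have P: "laurent P" unfolding P_def by (intro laurent_sum laurent_monomial)
  have Pint: "((\<lambda>s. g (u + of_real s) * of_real (\<kappa> s)) has_integral (2 * of_real pi * P (exp (\<i> * u)))) {0..2 * pi}" for u
  proof -
    have "((\<lambda>s. \<Sum>a<N. \<Sum>b<N. g (u + of_real s) * exp (- \<i> * of_int (int b - int a) * of_real s) / of_nat N) has_integral
        (\<Sum>a<N. \<Sum>b<N. c (int b - int a) * exp (\<i> * of_int (int b - int a) * u) / of_nat N)) {0..2 * pi}"
      by (intro has_integral_sum has_integral_divide c) auto
    moreover have "(\<Sum>a<N. \<Sum>b<N. c (int b - int a) * exp (\<i> * of_int (int b - int a) * u) / of_nat N) =
        2 * of_real pi * P (exp (\<i> * u))"
    proof -
      have "exp (\<i> * of_int j * u) = exp (\<i> * u) powi j" for j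
        using exp_power_int[of "\<i> * u" j] by (simp add: mult_ac)
      then show ?thesis by (simp add: P_def sum_distrib_left del: of_int_diff)
    qed
    ultimately show ?thesis by (simp add: \<kappa>_eq sum_distrib_left)
  qed
  have main: "norm (g u - P (exp (\<i> * u))) \<le> e" if u: "0 \<le> Re u" "Re u \<le> 2 * pi" "\<bar>Im u\<bar> \<le> \<rho>" for u
  proof -
    have pi4: "pi < 4" by (rule pi_less_4)
    have "((\<lambda>s. g u * of_real (\<kappa> s)) has_integral (g u * (2 * of_real pi))) {0..2 * pi}"
      by (intro has_integral_mult_right \<kappa>_int)
    from has_integral_diff[OF this Pint[of u]]
    have D: "((\<lambda>s. g u * of_real (\<kappa> s) - g (u + of_real s) * of_real (\<kappa> s)) has_integral
        (2 * of_real pi * (g u - P (exp (\<i> * u))))) {0..2 * pi}" by (simp add: algebra_simps)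
    have \<kappa>r: "(\<kappa> has_integral (2 * pi)) {0..2 * pi}"
      using has_integral_linear[OF \<kappa>_int bounded_linear_Re] by (simp add: o_def)
    have M: "((\<lambda>s. (e / 2) * \<kappa> s + e / 2) has_integral ((e / 2) * (2 * pi) + (2 * pi) * (e / 2))) {0..2 * pi}"
      using has_integral_const_real[of "e / 2" 0 "2 * pi"]
      by (intro has_integral_add has_integral_mult_right \<kappa>r) simp
    have "norm (2 * of_real pi * (g u - P (exp (\<i> * u)))) \<le> ((e / 2) * (2 * pi) + (2 * pi) * (e / 2)) \<bullet> 1"
    proof (rule has_integral_norm_bound_integral_component[OF D M])
      fix s assume s: "s \<in> {0..2 * pi}"
      have "norm (g u - g (u + of_real s)) * \<kappa> s \<le> (e / 2) * \<kappa> s + e / 2"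
      proof (cases "s \<in> {d..2 * pi - d}")
        case True
        have "u \<in> K" "u + of_real s \<in> K" using u s pi4 by (auto simp: Kiff)
        then have "norm (g u - g (u + of_real s)) \<le> 2 * B"
          using B(2)[of u] B(2)[of "u + of_real s"] norm_triangle_ineq4[of "g u" "g (u + of_real s)"] by linarith
        then have "norm (g u - g (u + of_real s)) * \<kappa> s \<le> 2 * B * (4 / c0\<^sup>2 / real N)"
          using \<kappa>_small[OF True] \<kappa>0 B by (intro mult_mono) auto
        also have "\<dots> \<le> e / 2" by (rule tail)
        also have "\<dots> \<le> (e / 2) * \<kappa> s + e / 2" using \<kappa>0[of s] e by simp
        finally show ?thesis .
      next
        case False
        have "norm (g u - g (u + of_real s)) \<le> e / 2"
        proof (cases "s < d")
          case True
          have "u \<in> K" "u + of_real s \<in> K" using u s pi4 by (auto simp: Kiff)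
          moreover have "dist (u + of_real s) u < d0" using True d s by (simp add: dist_norm)
          ultimately show ?thesis using d0(2)[of u "u + of_real s"] by (simp add: dist_norm norm_minus_commute)
        next
          case F: False
          define v where "v = u + of_real (s - 2 * pi)"
          have sd: "2 * pi - d < s" using False F s by auto
          have "u \<in> K" "v \<in> K" using u s pi4 sd d by (auto simp: Kiff v_def)
          moreover have "dist v u < d0"
          proof -
            have "dist v u = \<bar>s - 2 * pi\<bar>" unfolding v_def dist_norm by (simp only: add_diff_cancel_left' norm_of_real)
            then show ?thesis using sd d s by auto
          qed
          moreover have "g (u + of_real s) = g v"
            using per[of v] by (simp add: v_def algebra_simps)
          ultimately show ?thesis using d0(2)[of u v] by (simp add: dist_norm norm_minus_commute)
        qed
        then have "norm (g u - g (u + of_real s)) * \<kappa> s \<le> (e / 2) * \<kappa> s"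
          using \<kappa>0 by (intro mult_right_mono)
        then show ?thesis using e by simp
      qed
      moreover have "norm (g u * of_real (\<kappa> s) - g (u + of_real s) * of_real (\<kappa> s)) = norm (g u - g (u + of_real s)) * \<kappa> s"
        using \<kappa>0[of s] by (simp flip: left_diff_distrib add: norm_mult)
      ultimately show "norm (g u * of_real (\<kappa> s) - g (u + of_real s) * of_real (\<kappa> s)) \<le> ((e / 2) * \<kappa> s + e / 2) \<bullet> 1"
        by simp
    qed
    moreover have "norm (2 * of_real pi * (g u - P (exp (\<i> * u)))) = 2 * pi * norm (g u - P (exp (\<i> * u)))"
      by (simp add: norm_mult)
    ultimately have "2 * pi * norm (g u - P (exp (\<i> * u))) \<le> 2 * pi * e"
      by (simp add: algebra_simps)
    then show ?thesis using pi_gt_zero by simp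
  qed
  show ?thesis
  proof (rule that[OF P])
    fix u assume u: "\<bar>Im u\<bar> \<le> \<rho>"
    define j where "j = \<lfloor>Re u / (2 * pi)\<rfloor>"
    define v where "v = u - of_int j * of_real (2 * pi)"
    have "of_int j * (2 * pi) \<le> Re u" "Re u \<le> (of_int j + 1) * (2 * pi)"
      using floor_divide_lower[of "2 * pi" "Re u"] floor_divide_upper[of "2 * pi" "Re u"] by (auto simp: j_def)
    then have "0 \<le> Re v" "Re v \<le> 2 * pi" "\<bar>Im v\<bar> \<le> \<rho>" using u by (auto simp: v_def algebra_simps)
    then have "norm (g v - P (exp (\<i> * v))) \<le> e" by (rule main)
    moreover have "exp (\<i> * v) = exp (\<i> * u)"
    proof -
      have "exp (- (\<i> * (of_int j * of_real (2 * pi)))) = 1"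
        using exp_integer_2pi[of "- of_int j"] by (simp add: mult_ac)
      moreover have "\<i> * v = \<i> * u + - (\<i> * (of_int j * of_real (2 * pi)))"
        unfolding v_def by (simp add: right_diff_distrib)
      ultimately show ?thesis by (simp only: exp_add mult_1_right)
    qed
    moreover have "g v = g u"
    proof -
      have nat: "g (w + of_nat k * of_real (2 * pi)) = g w" for w k
      proof (induction k)
        case (Suc k)
        have "w + of_nat (Suc k) * of_real (2 * pi) = (w + of_nat k * of_real (2 * pi)) + of_real (2 * pi)"
          by (simp add: algebra_simps)
        then show ?case using per Suc by metis
      qed simp
      show ?thesis
      proof (cases "j \<ge> 0")
        case True
        then have "u = v + of_nat (nat j) * of_real (2 * pi)" by (simp add: v_def)
        then show ?thesis using nat by metis
      next
        case False
        then have "v = u + of_nat (nat (- j)) * of_real (2 * pi)" by (simp add: v_def)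
        then show ?thesis using nat by metis
      qed
    qed
    ultimately show "norm (g u - P (exp (\<i> * u))) \<le> e" by simp
  qed
qed

subsection \<open>Holomorphic functions on the solenoid\<close>

abbreviation shol :: "((nat \<Rightarrow> complex) \<Rightarrow> complex) \<Rightarrow> bool" where
  "shol f \<equiv> lh cyl (\<lambda>p. f (fst p))"

lemma shol_continuous:
  assumes "shol f" shows "continuous_on sol f"
proof -
  have "continuous_on sol (\<lambda>x. f (fst (x, 0::real)))"
    by (rule continuous_on_compose2[OF lhD(1)[OF assms]])
       (auto intro: continuous_on_Pair continuous_on_id continuous_on_const)
  then show ?thesis by simp
qed

lemma shol_leaf: "shol f \<Longrightarrow> (\<lambda>w. f (leaf w)) holomorphic_on UNIV"
  using lhD(2)[of cyl "\<lambda>p. f (fst p)" zero_leaf 0] zero_leaf_profinite by simp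

text \<open>
  Along the leaf the function becomes an entire function \<open>F\<close>, bounded on horizontal strips.  A
  translation by \<open>L = 2 \<pi> m\<close> does not change the coordinate \<open>x\<^sub>m\<close>, so by \<open>level_oscillation\<close> it
  changes \<open>F\<close> only little if \<open>m\<close> is sufficiently divisible.  The averages of \<open>F\<close> over the
  translates by \<open>0, L, \<dots>, N L\<close> stay close to \<open>F\<close>; by Montel's theorem a subsequence converges, and
  the limit \<open>G\<close> is periodic with period \<open>L\<close>, hence close to a Laurent polynomial in \<open>x\<^sub>m\<close>.
\<close>

lemma shol_laurent_approximation:
  assumes f: "shol f" and R: "R \<ge> 1" and e: "e > 0"
  obtains M where "M \<ge> 1" "\<And>m. m \<ge> 1 \<Longrightarrow> M dvd m \<Longrightarrow>
    \<exists>P. laurent P \<and> (\<forall>x\<in>shell R. norm (f x - P (x m)) \<le> e)"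
proof -
  note contf = shol_continuous[OF f]
  define F where "F w = f (leaf w)" for w
  have Fhol: "F holomorphic_on UNIV" unfolding F_def by (rule shol_leaf[OF f])
  obtain M where M: "M \<ge> 1" and osc: "\<And>m x y. m \<ge> 1 \<Longrightarrow> M dvd m \<Longrightarrow> x \<in> shell R \<Longrightarrow> y \<in> shell R \<Longrightarrow>
      x m = y m \<Longrightarrow> norm (f x - f y) \<le> e / 4"
    using level_oscillation[OF contf R, of "e / 4"] e by (metis divide_pos_pos zero_less_numeral)
  show ?thesis
  proof (rule that[OF M])
    fix m assume m: "m \<ge> 1" "M dvd m"
    define L where "L = 2 * pi * real m"
    define \<rho> where "\<rho> = ln R"
    have shell_iff: "leaf w \<in> shell (exp r) \<longleftrightarrow> \<bar>Im w\<bar> \<le> r" for w r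
      by (auto simp: shell_def abs_le_iff simp flip: exp_minus inverse_eq_divide)
    have shellR: "shell R = shell (exp \<rho>)" using R by (simp add: \<rho>_def)
    have leafL: "leaf (w + of_nat k * of_real L) m = leaf w m" for w k
    proof -
      have "leaf (w + of_nat k * of_real L) m = exp (\<i> * w / of_nat m + \<i> * (of_nat k * of_real L) / of_nat m)"
        using m by (simp add: leaf_nth distrib_left add_divide_distrib)
      also have "\<i> * (of_nat k * of_real L) / of_nat m = (2 * of_nat k * of_real pi) * \<i>"
        using m by (simp add: L_def)
      also have "exp (\<i> * w / of_nat m + (2 * of_nat k * of_real pi) * \<i>) = exp (\<i> * w / of_nat m)"
        using exp_integer_2pi[of "of_nat k"] by (simp add: exp_add)
      finally show ?thesis using m by (simp add: leaf_nth)
    qed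
    have Fk: "norm (F (w + of_nat k * of_real L) - F w) \<le> e / 4" if "\<bar>Im w\<bar> \<le> \<rho>" for w k
      unfolding F_def
      by (rule osc[OF m]) (use that leafL in \<open>auto simp: shellR shell_iff\<close>)
    have bounded: "\<exists>B>0. \<forall>w. \<bar>Im w\<bar> \<le> r \<longrightarrow> norm (F w) \<le> B" if "r \<ge> 0" for r
    proof -
      have "compact (f ` shell (exp r))"
        by (rule compact_continuous_image[OF continuous_on_subset[OF contf] compact_shell])
           (use that in \<open>auto simp: shell_def\<close>)
      then obtain B where "B > 0" "\<forall>y\<in>f ` shell (exp r). norm y \<le> B"
        using compact_imp_bounded bounded_pos by metis
      then show ?thesis using shell_iff by (intro exI[of _ B]) (auto simp: F_def)
    qed
    define A where "A N w = (\<Sum>k\<le>N. F (w + of_nat k * of_real L)) / of_nat (Suc N)" for N :: nat and w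
    have Ahol: "A N holomorphic_on UNIV" for N
    proof -
      have "(F \<circ> (\<lambda>w. w + of_nat k * of_real L)) holomorphic_on UNIV" for k :: nat
        by (rule holomorphic_on_compose) (auto intro: holomorphic_intros holomorphic_on_subset[OF Fhol])
      then show ?thesis unfolding A_def o_def by (intro holomorphic_intros) auto
    qed
    have Abound: "norm (A N w) \<le> B" if "\<forall>w. \<bar>Im w\<bar> \<le> r \<longrightarrow> norm (F w) \<le> B" "\<bar>Im w\<bar> \<le> r" for N w B r
    proof -
      have "norm (\<Sum>k\<le>N. F (w + of_nat k * of_real L)) \<le> (\<Sum>k\<le>N. B)"
        using that by (intro sum_norm_le) auto
      then show ?thesis unfolding A_def norm_divide norm_of_nat by (simp add: divide_le_eq mult.commute del: of_nat_Suc)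
    qed
    obtain G r where Ghol: "G holomorphic_on UNIV" and r: "strict_mono r" and lim: "\<And>w. (\<lambda>N. A (r N) w) \<longlonglongrightarrow> G w"
    proof (rule Montel[of UNIV "range A" A])
      fix K :: "complex set" assume "compact K"
      then obtain b where b: "\<forall>w\<in>K. norm w \<le> b" "b > 0" using compact_imp_bounded bounded_pos by metis
      obtain B where B: "\<forall>w. \<bar>Im w\<bar> \<le> b \<longrightarrow> norm (F w) \<le> B" using bounded[of b] b(2) by auto
      have "norm (A N w) \<le> B" if "w \<in> K" for N w
        using b that abs_Im_le_cmod[of w] by (intro Abound[OF B]) force
      then show "\<exists>B. \<forall>h\<in>range A. \<forall>z\<in>K. norm (h z) \<le> B" by auto
    qed (use Ahol in auto)
    have GF: "norm (G w - F w) \<le> e / 4" if "\<bar>Im w\<bar> \<le> \<rho>" for w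
    proof (rule Lim_norm_ubound)
      show "(\<lambda>N. A (r N) w - F w) \<longlonglongrightarrow> G w - F w" by (intro tendsto_intros lim)
      have "norm (A N w - F w) \<le> e / 4" for N
      proof -
        have "A N w - F w = (\<Sum>k\<le>N. F (w + of_nat k * of_real L) - F w) / of_nat (Suc N)"
          by (simp add: A_def sum_subtractf field_simps del: of_nat_Suc)
        moreover have "norm (\<Sum>k\<le>N. F (w + of_nat k * of_real L) - F w) \<le> (\<Sum>k\<le>N. e / 4)"
          by (intro sum_norm_le Fk that)
        ultimately show ?thesis by (simp add: norm_divide divide_le_eq mult.commute del: of_nat_Suc)
      qed
      then show "eventually (\<lambda>N. norm (A (r N) w - F w) \<le> e / 4) sequentially" by simp
    qed simp
    have Gper: "G (w + of_real L) = G w" for w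
    proof -
      obtain B where B: "B > 0" "\<forall>v. \<bar>Im v\<bar> \<le> \<bar>Im w\<bar> \<longrightarrow> norm (F v) \<le> B" using bounded[of "\<bar>Im w\<bar>"] by auto
      have diff: "A N (w + of_real L) - A N w = (F (w + of_nat (Suc N) * of_real L) - F w) / of_nat (Suc N)" for N
      proof -
        have "(\<Sum>k\<le>N. F (w + of_real L + of_nat k * of_real L)) = (\<Sum>k\<le>N. F (w + of_nat (Suc k) * of_real L))"
          by (intro sum.cong refl arg_cong[of _ _ F]) (simp add: algebra_simps)
        moreover have "(\<Sum>k\<le>N. F (w + of_nat (Suc k) * of_real L)) + F w = (\<Sum>k\<le>N. F (w + of_nat k * of_real L)) + F (w + of_nat (Suc N) * of_real L)"
          using sum.atMost_Suc_shift[of "\<lambda>k. F (w + of_nat k * of_real L)" N] by simp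
        ultimately have eq: "(\<Sum>k\<le>N. F (w + of_real L + of_nat k * of_real L)) + F w =
            (\<Sum>k\<le>N. F (w + of_nat k * of_real L)) + F (w + of_nat (Suc N) * of_real L)" by (simp only:)
        have arith: "a - c = d - b" if "a + b = c + d" for a b c d :: complex
        proof -
          have "a - c = (a + b) - (b + c)" by simp
          then show ?thesis unfolding that by simp
        qed
        show ?thesis unfolding A_def diff_divide_distrib[symmetric] arith[OF eq] ..
      qed
      have "(\<lambda>N. A N (w + of_real L) - A N w) \<longlonglongrightarrow> 0"
      proof (rule Lim_null_comparison)
        show "eventually (\<lambda>N. norm (A N (w + of_real L) - A N w) \<le> 2 * B / real (Suc N)) sequentially"
        proof (rule always_eventually, rule allI)
          fix N
          have "norm (F (w + of_nat (Suc N) * of_real L) - F w) \<le> 2 * B"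
            using B(2)[rule_format, of "w + of_nat (Suc N) * of_real L"] B(2)[rule_format, of w]
              norm_triangle_ineq4[of "F (w + of_nat (Suc N) * of_real L)" "F w"] by simp
          then show "norm (A N (w + of_real L) - A N w) \<le> 2 * B / real (Suc N)"
            unfolding diff norm_divide norm_of_nat by (intro divide_right_mono) auto
        qed
        show "(\<lambda>N. 2 * B / real (Suc N)) \<longlonglongrightarrow> 0" by (rule lim_const_over_n[THEN LIMSEQ_Suc])
      qed
      from LIMSEQ_subseq_LIMSEQ[OF this r] have "(\<lambda>N. A (r N) (w + of_real L) - A (r N) w) \<longlonglongrightarrow> 0" by (simp add: o_def)
      moreover have "(\<lambda>N. A (r N) (w + of_real L) - A (r N) w) \<longlonglongrightarrow> G (w + of_real L) - G w" by (intro tendsto_intros lim)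
      ultimately show ?thesis using LIMSEQ_unique by force
    qed
    define g where "g u = G (of_nat m * u)" for u
    have ghol: "g holomorphic_on UNIV"
    proof -
      have "(G \<circ> (\<lambda>u. of_nat m * u)) holomorphic_on UNIV"
        by (rule holomorphic_on_compose) (auto intro: holomorphic_intros holomorphic_on_subset[OF Ghol])
      then show ?thesis by (simp add: g_def[abs_def] o_def)
    qed
    have gper: "g (u + of_real (2 * pi)) = g u" for u
      using Gper[of "of_nat m * u"] by (simp add: g_def L_def algebra_simps)
    obtain P where P: "laurent P" "\<And>u. \<bar>Im u\<bar> \<le> \<rho> / real m \<Longrightarrow> norm (g u - P (exp (\<i> * u))) \<le> e / 4"
      using fejer_approximation[OF ghol gper, of "e / 4" "\<rho> / real m"] e by auto
    have "norm (f x - P (x m)) \<le> e" if x: "x \<in> shell R" for x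
    proof -
      have xs: "x \<in> sol" using x by (simp add: shell_def)
      obtain w where w: "leaf w m = x m" "height (leaf w) = height x" using coordinate_on_leaf[OF xs m(1)] .
      have lw: "leaf w \<in> shell R" using x w by (simp add: shell_def)
      then have Imw: "\<bar>Im w\<bar> \<le> \<rho>" by (simp add: shellR shell_iff)
      have 1: "norm (f x - F w) \<le> e / 4" unfolding F_def using w lw x by (intro osc[OF m]) auto
      have 2: "norm (G w - F w) \<le> e / 4" by (rule GF[OF Imw])
      have 3: "norm (G w - P (x m)) \<le> e / 4"
        using P(2)[of "w / of_nat m"] Imw m w(1) by (simp add: g_def leaf_nth divide_right_mono)
      have "f x - P (x m) = (f x - F w) - (G w - F w) + (G w - P (x m))" by simp
      also have "norm \<dots> \<le> norm (f x - F w) + norm (G w - F w) + norm (G w - P (x m))"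
        by (meson add_mono_thms_linordered_semiring(3) norm_triangle_ineq norm_triangle_ineq4 order_trans)
      finally show ?thesis using 1 2 3 e by simp
    qed
    then show "\<exists>P. laurent P \<and> (\<forall>x\<in>shell R. norm (f x - P (x m)) \<le> e)" using P(1) by blast
  qed
qed

section \<open>Additive splitting with uniform bounds\<close>

definition qsum :: "int set \<Rightarrow> (int \<Rightarrow> complex) \<Rightarrow> complex \<Rightarrow> complex" where
  "qsum A c z = (\<Sum>k\<in>A. c k * z powi k)"

lemma laurent_qsum: "laurent (qsum A c)"
  unfolding qsum_def by (intro laurent_sum laurent_monomial)

text \<open>
  Dividing by \<open>z\<^sup>s\<close> leaves a polynomial, to which the maximum principle applies on the disc.
\<close>

lemma qsum_growth:
  assumes A: "finite A" "\<And>k. k \<in> A \<Longrightarrow> s \<le> k" and r: "r > 0"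
    and B: "\<And>z. norm z = r \<Longrightarrow> norm (qsum A c z) \<le> B" and z: "0 < norm z" "norm z \<le> r"
  shows "norm (qsum A c z) \<le> B * (norm z / r) powi s"
proof -
  define h where "h w = (\<Sum>k\<in>A. c k * w ^ nat (k - s))" for w
  have h: "qsum A c w = w powi s * h w" if "w \<noteq> 0" for w
  proof -
    have tm: "c k * w powi k = w powi s * (c k * w ^ nat (k - s))" if "k \<in> A" for k
    proof -
      have "w powi k = w powi s * w powi (k - s)" using \<open>w \<noteq> 0\<close> by (simp flip: power_int_add)
      also have "w powi (k - s) = w ^ nat (k - s)" using A(2)[OF that] by (simp add: power_int_def)
      finally show ?thesis by simp
    qed
    show ?thesis unfolding qsum_def h_def sum_distrib_left by (rule sum.cong[OF refl tm])
  qed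
  have hz: "norm (h z) \<le> B / r powi s"
  proof (rule maximum_modulus_frontier[of h "cball 0 r"])
    show "h holomorphic_on interior (cball 0 r)" unfolding h_def by (intro holomorphic_intros)
    show "continuous_on (closure (cball 0 r)) h" unfolding h_def by (intro continuous_intros)
    fix w :: complex assume "w \<in> frontier (cball 0 r)"
    then have w: "norm w = r" using r by simp
    then have "norm w powi s * norm (h w) \<le> B"
      using B[of w] h[of w] r by (auto simp: norm_mult norm_power_int)
    then show "norm (h w) \<le> B / r powi s" using w r by (simp add: pos_le_divide_eq mult.commute)
  qed (use z in auto)
  have "norm (qsum A c z) = norm z powi s * norm (h z)"
    using h[of z] z by (auto simp: norm_mult norm_power_int)
  also have "\<dots> \<le> norm z powi s * (B / r powi s)"
    by (rule mult_left_mono[OF hz]) simp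
  finally have "norm (qsum A c z) \<le> norm z powi s * (B / r powi s)" .
  then show ?thesis using r by (simp add: power_int_divide_distrib mult.commute)
qed

text \<open>
  The previous estimate after the substitution \<open>z \<mapsto> 1 / z\<close>.
\<close>

lemma qsum_growth_outer:
  assumes A: "finite A" "\<And>k. k \<in> A \<Longrightarrow> k \<le> s" and r: "r > 0"
    and B: "\<And>z. norm z = r \<Longrightarrow> norm (qsum A c z) \<le> B" and z: "r \<le> norm z"
  shows "norm (qsum A c z) \<le> B * (norm z / r) powi s"
proof -
  have q: "qsum A c w = qsum (uminus ` A) (\<lambda>k. c (- k)) (inverse w)" for w
    by (simp add: qsum_def sum.reindex power_int_minus power_int_inverse)
  have "norm (qsum (uminus ` A) (\<lambda>k. c (- k)) (inverse z)) \<le> B * (norm (inverse z) / (1 / r)) powi (- s)"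
  proof (rule qsum_growth)
    fix w :: complex assume w: "norm w = 1 / r"
    then have "norm (inverse w) = r" using r by (simp add: norm_inverse)
    then show "norm (qsum (uminus ` A) (\<lambda>k. c (- k)) w) \<le> B" using B[of "inverse w"] q[of "inverse w"] by simp
  next
    have "z \<noteq> 0" using r z by auto
    then show "0 < norm (inverse z)" "norm (inverse z) \<le> 1 / r"
      using r z by (simp_all add: norm_inverse divide_inverse le_imp_inverse_le)
  qed (use A r in auto)
  moreover have "(norm (inverse z) / (1 / r)) powi (- s) = (norm z / r) powi s"
    using r z by (simp add: norm_inverse power_int_minus power_int_inverse[symmetric] divide_inverse mult.commute)
  ultimately show ?thesis using q[of z] by simp
qed

lemma cis_sum_orthogonal:
  fixes d :: int
  assumes N: "N > 0" and d: "\<bar>d\<bar> < int N"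
  shows "(\<Sum>l<N. cis (2 * pi / real N) powi (d * int l)) = (if d = 0 then of_nat N else 0)"
proof (cases "d = 0")
  case False
  define \<omega> where "\<omega> = cis (2 * pi / real N)"
  have \<omega>0: "\<omega> \<noteq> 0" by (simp add: \<omega>_def)
  have p: "\<omega> powi j = cis (2 * pi * of_int j / real N)" for j
    by (simp add: \<omega>_def cis_power_int mult_ac)
  have ne: "\<omega> powi d \<noteq> 1"
  proof
    assume "\<omega> powi d = 1"
    then have "cis (2 * pi * of_int d / real N) = 1" by (simp add: p)
    then obtain j :: int where "2 * pi * of_int d / real N = of_int (2 * j) * pi"
      by (auto simp: cis_conv_exp exp_eq_1)
    then have "of_int d = real_of_int (j * int N)" using N by (simp add: field_simps)
    then have "d = j * int N" by linarith
    then have "\<bar>d\<bar> = \<bar>j\<bar> * int N" by (simp add: abs_mult)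
    moreover have "\<bar>j\<bar> \<ge> 1" using \<open>d = j * int N\<close> False by auto
    ultimately show False using d mult_right_mono[of 1 "\<bar>j\<bar>" "int N"] by simp
  qed
  have "(\<Sum>l<N. \<omega> powi (d * int l)) = (\<Sum>l<N. (\<omega> powi d) ^ l)"
    by (intro sum.cong refl) (simp add: power_int_mult)
  also have "\<dots> = ((\<omega> powi d) ^ N - 1) / (\<omega> powi d - 1)" using ne by (rule geometric_sum)
  also have "(\<omega> powi d) ^ N = 1"
  proof -
    have "(\<omega> powi d) ^ N = \<omega> powi (int N * d)" by (simp add: power_int_mult mult.commute flip: power_int_of_nat)
    also have "\<dots> = cis (2 * pi * of_int d)" using N by (simp add: p field_simps)
    also have "\<dots> = 1" using cis_multiple_2pi[of "of_int d"] by simp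
    finally show ?thesis .
  qed
  finally show ?thesis using False by (simp add: \<omega>_def)
qed auto

text \<open>
  \<open>block m j\<close> is the multiplier cutting out the exponents near \<open>j * m\<close>: as a function of
  \<open>k / m\<close> it is the tent of width \<open>2\<close> around \<open>j\<close>, written as a counting function.  The tents form a
  partition of unity, and the tent at \<open>0\<close> is the Fejer multiplier, whose kernel is nonnegative with
  mean one.
\<close>

definition block :: "nat \<Rightarrow> int \<Rightarrow> int \<Rightarrow> complex" where
  "block m j k = of_nat (card {a. a < m \<and> (int a + k) div int m = j}) / of_nat m"

lemma block_nonzero:
  assumes "m > 0" "block m j k \<noteq> 0"
  shows "(j - 1) * int m < k" "k < (j + 1) * int m"
proof -
  have "{a. a < m \<and> (int a + k) div int m = j} \<noteq> {}"
    using assms by (auto simp: block_def)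
  then obtain a where a: "a < m" "(int a + k) div int m = j" by blast
  have "j * int m \<le> int a + k" "int a + k < j * int m + int m"
    using a assms(1) by (metis mult.commute mult_div_mod_eq le_add_same_cancel1 pos_mod_sign of_nat_0_less_iff)
      (metis a(2) assms(1) mult.commute mult_div_mod_eq add_strict_left_mono pos_mod_bound of_nat_0_less_iff)
  then show "(j - 1) * int m < k" "k < (j + 1) * int m" using a by (auto simp: algebra_simps)
qed

lemma block_partition:
  assumes m: "m > 0" and J: "\<bar>k\<bar> \<le> int D" "int D + 1 \<le> J"
  shows "(\<Sum>j\<in>{-J..J}. block m j k) = 1"
proof -
  have "(\<Sum>j\<in>{-J..J}. card {a. a < m \<and> (int a + k) div int m = j}) = card (\<Union>j\<in>{-J..J}. {a. a < m \<and> (int a + k) div int m = j})"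
    by (intro card_UN_disjoint[symmetric]) auto
  also have "(\<Union>j\<in>{-J..J}. {a. a < m \<and> (int a + k) div int m = j}) = {..<m}"
  proof -
    have "(int a + k) div int m \<in> {-J..J}" if "a < m" for a
    proof -
      define q where "q = (int a + k) div int m"
      have "int a + k = q * int m + (int a + k) mod int m" by (simp add: q_def)
      moreover have "0 \<le> (int a + k) mod int m" "(int a + k) mod int m < int m" using m by simp_all
      ultimately have q: "q * int m \<le> int a + k" "int a + k < (q + 1) * int m" by (simp_all add: algebra_simps)
      have "k * 1 \<le> int D * int m" "- k * 1 \<le> int D * int m" using J(1) m by (intro mult_mono; simp)+
      then have ak: "int a + k < (int D + 1) * int m" "- int D * int m \<le> int a + k"
        using that by (simp_all add: algebra_simps)
      have "q < int D + 1"
        using q(1) ak(1) mult_right_mono[of "int D + 1" q "int m"] by linarith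
      moreover have "- int D < q + 1"
        using q(2) ak(2) mult_right_mono[of "q + 1" "- int D" "int m"] by linarith
      ultimately have "- J \<le> q" "q \<le> J" using J(2) by linarith+
      then show ?thesis by (simp add: q_def)
    qed
    then show ?thesis by auto
  qed
  finally have "(\<Sum>j\<in>{-J..J}. of_nat (card {a. a < m \<and> (int a + k) div int m = j})) = (of_nat m :: complex)"
    by (simp flip: of_nat_sum)
  then show ?thesis using m unfolding block_def by (simp flip: sum_divide_distrib)
qed

text \<open>
  The tent is the convolution of two indicator functions of length \<open>m\<close>; this is the form in which
  it appears as coefficients of a squared modulus.
\<close>

lemma block_pairs:
  assumes m: "m > 0"
  shows "(\<Sum>a<m. \<Sum>b<m. if k - j * int m + int a - int b = 0 then 1 else 0) = of_nat m * block m j k"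
proof -
  have "(\<Sum>b<m. if k - j * int m + int a - int b = 0 then 1 else 0) = (if (int a + k) div int m = j then 1 else (0::complex))" for a
  proof (cases "(int a + k) div int m = j")
    case True
    define b where "b = nat ((int a + k) mod int m)"
    have b: "b < m" "int b = (int a + k) mod int m" using m by (auto simp: b_def nat_less_iff)
    have "int a + k = j * int m + int b" using True b(2) by (metis mult.commute mult_div_mod_eq)
    then have "(k - j * int m + int a - int b' = 0) = (b' = b)" for b' by auto
    then show ?thesis using b True by (simp add: sum.delta)
  next
    case False
    have "k - j * int m + int a - int b \<noteq> 0" if "b < m" for b
    proof
      assume "k - j * int m + int a - int b = 0"
      then have "int a + k = int b + j * int m" by simp
      then have "(int a + k) div int m = j" using that m by simp
      then show False using False by blast
    qed
    then show ?thesis using False by simp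
  qed
  then have "(\<Sum>a<m. \<Sum>b<m. if k - j * int m + int a - int b = 0 then 1 else 0) =
      (\<Sum>a<m. if (int a + k) div int m = j then 1 else (0::complex))" by simp
  also have "\<dots> = of_nat (card {a. a < m \<and> (int a + k) div int m = j})"
    by (simp flip: sum.inter_filter)
  finally show ?thesis using m by (simp add: block_def)
qed

text \<open>
  Multiplying coefficients by the tent is averaging over rotations of \<open>z\<close>, with weights
  \<open>|S l|\<^sup>2 / (N m)\<close> of total mass one, after shifting the exponents by \<open>j m\<close>.  A finite average over
  \<open>N\<close>-th roots of unity suffices as soon as \<open>N\<close> exceeds every exponent that occurs.
\<close>

lemma block_bound:
  assumes m: "m > 0" and z: "z \<noteq> 0"
    and B: "\<And>w. norm w = norm z \<Longrightarrow> norm (qsum {-int D..int D} c w) \<le> B"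
  shows "norm (qsum {-int D..int D} (\<lambda>k. block m j k * c k) z) \<le> B"
proof -
  \<comment> \<open>larger than every \<open>k - j m + a - b\<close> with \<open>a, b < m\<close>, so that orthogonality isolates its vanishing\<close>
  define N where "N = D + nat \<bar>j * int m\<bar> + m + 1"
  define \<omega> where "\<omega> = cis (2 * pi / real N)"
  have N: "N > 0" by (simp add: N_def)
  have \<omega>0: "\<omega> \<noteq> 0" and n\<omega>: "norm \<omega> = 1" by (simp_all add: \<omega>_def)
  define S where "S l = (\<Sum>a<m. \<omega> powi (int a * int l))" for l :: nat
  have SS: "of_real ((norm (S l))\<^sup>2) = (\<Sum>a<m. \<Sum>b<m. \<omega> powi ((int a - int b) * int l))" for l
  proof -
    have "cnj (S l) = (\<Sum>b<m. \<omega> powi (- int b * int l))"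
      by (simp add: S_def \<omega>_def cis_power_int cis_cnj)
    then have "of_real ((norm (S l))\<^sup>2) = S l * (\<Sum>b<m. \<omega> powi (- int b * int l))"
      using complex_norm_square[of "S l"] by simp
    also have "\<dots> = (\<Sum>a<m. \<Sum>b<m. \<omega> powi (int a * int l) * \<omega> powi (- int b * int l))"
      unfolding S_def by (rule sum_product)
    finally show ?thesis using \<omega>0 by (simp add: left_diff_distrib flip: power_int_add)
  qed
  have orth: "(\<Sum>l<N. \<omega> powi (d * int l)) = (if d = 0 then of_nat N else 0)" if "\<bar>d\<bar> < int N" for d
    unfolding \<omega>_def by (rule cis_sum_orthogonal[OF N that])
  have mean: "(\<Sum>l<N. (norm (S l))\<^sup>2) = real N * real m"
  proof -
    have "complex_of_real (\<Sum>l<N. (norm (S l))\<^sup>2) = (\<Sum>l<N. \<Sum>a<m. \<Sum>b<m. \<omega> powi ((int a - int b) * int l))"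
      by (simp add: SS del: of_real_power)
    also have "\<dots> = (\<Sum>a<m. \<Sum>b<m. \<Sum>l<N. \<omega> powi ((int a - int b) * int l))"
      by (subst sum.swap, rule sum.cong[OF refl], rule sum.swap)
    also have "\<dots> = (\<Sum>a<m. \<Sum>b<m. if b = a then of_nat N else 0)"
      by (intro sum.cong refl, subst orth) (auto simp: N_def)
    also have "\<dots> = (\<Sum>a<m. of_nat N)" by (intro sum.cong refl) (simp add: sum.delta)
    finally have "complex_of_real (\<Sum>l<N. (norm (S l))\<^sup>2) = complex_of_real (real N * real m)" by (simp add: mult.commute)
    then show ?thesis by (simp only: of_real_eq_iff)
  qed
  let ?A = "{-int D..int D}"
  have avg: "of_nat (N * m) * qsum ?A (\<lambda>k. block m j k * c k) z =
      (\<Sum>l<N. qsum ?A c (z * \<omega> powi int l) * \<omega> powi (- (j * int m) * int l) * of_real ((norm (S l))\<^sup>2))"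
  proof -
    have "(\<Sum>l<N. qsum ?A c (z * \<omega> powi int l) * \<omega> powi (- (j * int m) * int l) * of_real ((norm (S l))\<^sup>2)) =
        (\<Sum>l<N. \<Sum>k\<in>?A. c k * z powi k * (\<Sum>a<m. \<Sum>b<m. \<omega> powi ((k - j * int m + int a - int b) * int l)))"
    proof (intro sum.cong refl)
      fix l
      have "qsum ?A c (z * \<omega> powi int l) = (\<Sum>k\<in>?A. c k * z powi k * \<omega> powi (k * int l))"
        unfolding qsum_def using \<omega>0 by (intro sum.cong refl) (simp add: power_int_mult_distrib power_int_mult mult.commute[of _ "int l"])
      then have "qsum ?A c (z * \<omega> powi int l) * \<omega> powi (- (j * int m) * int l) * of_real ((norm (S l))\<^sup>2) =
          (\<Sum>k\<in>?A. c k * z powi k * (\<omega> powi (k * int l) * (\<omega> powi (- (j * int m) * int l) * (\<Sum>a<m. \<Sum>b<m. \<omega> powi ((int a - int b) * int l)))))"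
        by (simp only: SS sum_distrib_right mult.assoc)
      moreover have "\<omega> powi (k * int l) * (\<omega> powi (- (j * int m) * int l) * (\<Sum>a<m. \<Sum>b<m. \<omega> powi ((int a - int b) * int l))) =
          (\<Sum>a<m. \<Sum>b<m. \<omega> powi ((k - j * int m + int a - int b) * int l))" for k
      proof -
        have e: "\<omega> powi (k * int l) * (\<omega> powi (- (j * int m) * int l) * \<omega> powi ((int a - int b) * int l)) =
            \<omega> powi ((k - j * int m + int a - int b) * int l)" for a b
          using \<omega>0 by (simp add: algebra_simps flip: power_int_add)
        show ?thesis unfolding sum_distrib_left e ..
      qed
      ultimately show "qsum ?A c (z * \<omega> powi int l) * \<omega> powi (- (j * int m) * int l) * of_real ((norm (S l))\<^sup>2) =
          (\<Sum>k\<in>?A. c k * z powi k * (\<Sum>a<m. \<Sum>b<m. \<omega> powi ((k - j * int m + int a - int b) * int l)))"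
        by (simp only:)
    qed
    also have "\<dots> = (\<Sum>k\<in>?A. c k * z powi k * (\<Sum>a<m. \<Sum>b<m. \<Sum>l<N. \<omega> powi ((k - j * int m + int a - int b) * int l)))"
      by (subst sum.swap, intro sum.cong refl)
         (simp add: sum_distrib_left sum.swap[of _ "{..<N}" "{..<m}"])
    also have "\<dots> = (\<Sum>k\<in>?A. c k * z powi k * (\<Sum>a<m. \<Sum>b<m. of_nat N * (if k - j * int m + int a - int b = 0 then 1 else 0)))"
    proof (intro sum.cong refl arg_cong[of _ _ "\<lambda>v. _ * v"])
      fix k a b assume "k \<in> ?A" "a \<in> {..<m}" "b \<in> {..<m}"
      then have "\<bar>k - j * int m + int a - int b\<bar> < int N" by (auto simp: N_def)
      then show "(\<Sum>l<N. \<omega> powi ((k - j * int m + int a - int b) * int l)) = of_nat N * (if k - j * int m + int a - int b = 0 then 1 else 0)"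
        by (subst orth) auto
    qed
    also have "\<dots> = (\<Sum>k\<in>?A. c k * z powi k * (of_nat N * (of_nat m * block m j k)))"
      by (simp only: sum_distrib_left[symmetric] block_pairs[OF m])
    finally show ?thesis by (simp add: qsum_def sum_distrib_left mult_ac)
  qed
  have "real (N * m) * norm (qsum ?A (\<lambda>k. block m j k * c k) z) = norm (of_nat (N * m) * qsum ?A (\<lambda>k. block m j k * c k) z)"
    by (simp only: norm_mult norm_of_nat)
  also have "\<dots> \<le> (\<Sum>l<N. B * (norm (S l))\<^sup>2)"
    unfolding avg
  proof (rule sum_norm_le)
    fix l
    have "norm (qsum ?A c (z * \<omega> powi int l)) \<le> B" by (rule B) (simp add: norm_mult norm_power_int norm_power n\<omega>)
    then show "norm (qsum ?A c (z * \<omega> powi int l) * \<omega> powi (- (j * int m) * int l) * of_real ((norm (S l))\<^sup>2)) \<le> B * (norm (S l))\<^sup>2"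
      by (simp add: norm_mult norm_power_int n\<omega> norm_power mult_right_mono)
  qed
  also have "\<dots> = B * real (N * m)" by (simp add: mean flip: sum_distrib_left)
  finally have "real (N * m) * norm (qsum ?A (\<lambda>k. block m j k * c k) z) \<le> real (N * m) * B" by (simp only: mult.commute)
  then show ?thesis using N m by simp
qed

text \<open>
  \<open>U\<close> collects the blocks with \<open>j \<ge> 1\<close> and \<open>V\<close> those with \<open>j \<le> 0\<close>.  Each block is bounded by \<open>B\<close> on
  both boundary circles of the annulus.  The block at \<open>j\<close> of \<open>V\<close> has exponents below \<open>(j + 1) m\<close>, so
  going from the inner to the outer circle, where the \<open>m\<close>-th power of the modulus quadruples, it gains
  at most a factor \<open>4\<^sup>j\<^sup>+\<^sup>1\<close>; the geometric series bounds \<open>V\<close> on the outer circle, hence \<open>U = P - V\<close> there and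
  inside.  The exponents of \<open>V\<close> are below \<open>m\<close>, which gives linear growth in \<open>|z|\<^sup>m\<close> outside.  A sharp
  cut between positive and negative exponents would not give a bound independent of the number of terms.
\<close>

lemma laurent_split:
  assumes m: "m > 0" and P: "laurent P"
    and B: "\<And>z. 1 / 2 \<le> norm z ^ m \<Longrightarrow> norm z ^ m \<le> 2 \<Longrightarrow> norm (P z) \<le> B"
  obtains U V where "laurent U" "laurent V" "\<And>z. z \<noteq> 0 \<Longrightarrow> P z = U z + V z"
    "\<And>z. z \<noteq> 0 \<Longrightarrow> norm z ^ m \<le> 2 \<Longrightarrow> norm (U z) \<le> 7 * B"
    "\<And>z. 1 / 2 \<le> norm z ^ m \<Longrightarrow> norm (V z) \<le> 16 * B * norm z ^ m"
proof -
  obtain D c where P: "\<And>z. z \<noteq> 0 \<Longrightarrow> P z = qsum {-int D..int D} c z"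
    using P by (auto simp: laurent_def qsum_def)
  \<comment> \<open>the annulus has the radii \<open>1 / \<rho>\<close> and \<open>\<rho>\<close>\<close>
  define \<rho> where "\<rho> = root m 2"
  have \<rho>: "\<rho> > 0" "\<rho> ^ m = 2" "\<rho> > 1" using m by (simp_all add: \<rho>_def)
  define A where "A = {-int D..int D}"
  define J where "J = int D + 1"
  define pj where "pj j = qsum A (\<lambda>k. block m j k * c k)" for j
  define U where "U z = (\<Sum>j\<in>{1..J}. pj j z)" for z
  define V where "V z = (\<Sum>j\<in>{-J..0}. pj j z)" for z
  have B': "norm (qsum A c w) \<le> B" if "norm w = \<rho> \<or> norm w = 1 / \<rho>" for w
  proof -
    have "w \<noteq> 0" using that \<rho> by auto
    moreover have "norm w ^ m = 2 \<or> norm w ^ m = 1 / 2" using that \<rho> by (auto simp: power_divide)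
    ultimately show ?thesis using B[of w] P[of w] by (auto simp: A_def)
  qed
  have "norm (qsum A c (of_real \<rho>)) \<le> B" by (rule B') (use \<rho> in simp)
  then have B0: "B \<ge> 0" by (rule order_trans[OF norm_ge_zero])
  have finA: "finite {k \<in> A. Q k}" for Q by (rule finite_subset[of _ A]) (auto simp: A_def)
  have PUV: "P z = U z + V z" if "z \<noteq> 0" for z
  proof -
    have "U z + V z = (\<Sum>j\<in>{-J..J}. pj j z)"
    proof -
      have "{-J..J} = {-J..0} \<union> {1..J}" by (auto simp: J_def)
      then show ?thesis by (simp add: U_def V_def sum.union_disjoint add.commute)
    qed
    also have "\<dots> = (\<Sum>k\<in>A. \<Sum>j\<in>{-J..J}. block m j k * (c k * z powi k))"
      unfolding pj_def qsum_def by (subst sum.swap) (simp add: mult.assoc)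
    also have "\<dots> = (\<Sum>k\<in>A. c k * z powi k)"
    proof (intro sum.cong refl)
      fix k assume "k \<in> A"
      then have "(\<Sum>j\<in>{-J..J}. block m j k) = 1" by (intro block_partition[OF m, of k D]) (auto simp: A_def J_def)
      then show "(\<Sum>j\<in>{-J..J}. block m j k * (c k * z powi k)) = c k * z powi k"
        by (simp flip: sum_distrib_right)
    qed
    finally show ?thesis using P[OF that] by (simp add: qsum_def A_def)
  qed
  have pj_restrict: "pj j = qsum {k \<in> A. block m j k \<noteq> 0} (\<lambda>k. block m j k * c k)" for j
    unfolding pj_def qsum_def by (intro ext sum.mono_neutral_right) (auto simp: A_def)
  have U_qsum: "U = qsum {k \<in> A. k > 0} (\<lambda>k. (\<Sum>j\<in>{1..J}. block m j k) * c k)"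
  proof
    fix z
    have "U z = (\<Sum>k\<in>A. (\<Sum>j\<in>{1..J}. block m j k) * c k * z powi k)"
      unfolding U_def pj_def qsum_def by (subst sum.swap) (simp add: sum_distrib_right)
    also have "\<dots> = qsum {k \<in> A. k > 0} (\<lambda>k. (\<Sum>j\<in>{1..J}. block m j k) * c k) z"
      unfolding qsum_def
    proof (rule sum.mono_neutral_right)
      show "\<forall>k\<in>A - {k \<in> A. 0 < k}. (\<Sum>j\<in>{1..J}. block m j k) * c k * z powi k = 0"
      proof
        fix k assume k: "k \<in> A - {k \<in> A. 0 < k}"
        have "block m j k = 0" if "j \<in> {1..J}" for j
        proof (rule ccontr)
          assume "block m j k \<noteq> 0"
          from block_nonzero(1)[OF m this] have "(j - 1) * int m < k" .
          moreover have "(j - 1) * int m \<ge> 0" using that by simp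
          ultimately show False using k by auto
        qed
        then show "(\<Sum>j\<in>{1..J}. block m j k) * c k * z powi k = 0" by simp
      qed
    qed (auto simp: A_def)
    finally show "U z = qsum {k \<in> A. k > 0} (\<lambda>k. (\<Sum>j\<in>{1..J}. block m j k) * c k) z" .
  qed
  have V_qsum: "V = qsum {k \<in> A. k < int m} (\<lambda>k. (\<Sum>j\<in>{-J..0}. block m j k) * c k)"
  proof
    fix z
    have "V z = (\<Sum>k\<in>A. (\<Sum>j\<in>{-J..0}. block m j k) * c k * z powi k)"
      unfolding V_def pj_def qsum_def by (subst sum.swap) (simp add: sum_distrib_right)
    also have "\<dots> = qsum {k \<in> A. k < int m} (\<lambda>k. (\<Sum>j\<in>{-J..0}. block m j k) * c k) z"
      unfolding qsum_def
    proof (rule sum.mono_neutral_right)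
      show "\<forall>k\<in>A - {k \<in> A. k < int m}. (\<Sum>j\<in>{-J..0}. block m j k) * c k * z powi k = 0"
      proof
        fix k assume k: "k \<in> A - {k \<in> A. k < int m}"
        have "block m j k = 0" if "j \<in> {-J..0}" for j
        proof (rule ccontr)
          assume "block m j k \<noteq> 0"
          from block_nonzero(2)[OF m this] have "k < (j + 1) * int m" .
          moreover have "(j + 1) * int m \<le> 1 * int m" using that by (intro mult_right_mono) auto
          ultimately show False using k by auto
        qed
        then show "(\<Sum>j\<in>{-J..0}. block m j k) * c k * z powi k = 0" by simp
      qed
    qed (auto simp: A_def)
    finally show "V z = qsum {k \<in> A. k < int m} (\<lambda>k. (\<Sum>j\<in>{-J..0}. block m j k) * c k) z" .
  qed
  have Vouter: "norm (V z) \<le> 6 * B" if z: "norm z = \<rho>" for z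
  proof -
    have pb: "norm (pj j z) \<le> B * 4 powi (j + 1)" for j
    proof -
      have "norm (pj j z) \<le> B * (norm z / (1 / \<rho>)) powi ((j + 1) * int m)"
        unfolding pj_restrict
      proof (rule qsum_growth_outer)
        fix w :: complex assume w: "norm w = 1 / \<rho>"
        then have "w \<noteq> 0" using \<rho> by auto
        then have "norm (pj j w) \<le> B"
          unfolding pj_def A_def using w B' by (intro block_bound m) (auto simp: A_def)
        then show "norm (qsum {k \<in> A. block m j k \<noteq> 0} (\<lambda>k. block m j k * c k) w) \<le> B" by (simp only: pj_restrict)
      next
        have "1 / \<rho> \<le> 1" using \<rho> by simp
        then show "1 / \<rho> \<le> norm z" using z \<rho> by linarith
      next
        show "finite {k \<in> A. block m j k \<noteq> 0}" by (rule finA)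
      qed (use block_nonzero(2)[OF m] \<rho> in \<open>auto intro: less_imp_le\<close>)
      also have "(norm z / (1 / \<rho>)) powi ((j + 1) * int m) = ((\<rho> * \<rho>) ^ m) powi (j + 1)"
        using z by (simp add: power_int_mult mult.commute[of "j + 1"])
      also have "(\<rho> * \<rho>) ^ m = 4" using \<rho> by (simp add: power_mult_distrib)
      finally show ?thesis .
    qed
    have "norm (V z) \<le> (\<Sum>j\<in>{-J..0}. B * 4 powi (j + 1))" unfolding V_def by (intro sum_norm_le pb)
    also have "\<dots> = (\<Sum>i\<le>nat J. B * 4 powi (- int i + 1))"
      by (rule sum.reindex_bij_witness[of _ "\<lambda>i. - int i" "\<lambda>j. nat (- j)"]) (auto simp: J_def)
    also have "\<dots> = (\<Sum>i\<le>nat J. B * (4 * (1 / 4) ^ i))"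
    proof (intro sum.cong refl arg_cong[of _ _ "\<lambda>v. B * v"])
      fix i
      have "(4::real) powi (- int i + 1) = 4 powi (- int i) * 4" by (subst power_int_add) auto
      then show "(4::real) powi (- int i + 1) = 4 * (1 / 4) ^ i"
        by (simp only: power_int_minus power_int_of_nat power_one_over inverse_eq_divide mult.commute)
    qed
    also have "\<dots> = B * 4 * (\<Sum>i\<le>nat J. (1 / 4) ^ i)" by (simp add: sum_distrib_left mult.assoc)
    also have "(\<Sum>i\<le>nat J. (1 / 4 :: real) ^ i) \<le> 3 / 2"
    proof -
      have "(\<Sum>i\<le>K. (1 / 4 :: real) ^ i) = 4 / 3 - (1 / 3) * (1 / 4) ^ K" for K by (induction K) auto
      from this[of "nat J"] show ?thesis using zero_le_power[of "1 / 4 :: real" "nat J"] by linarith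
    qed
    then have "B * 4 * (\<Sum>i\<le>nat J. (1 / 4) ^ i) \<le> B * 4 * (3 / 2)" using B0 by (intro mult_left_mono) auto
    finally show ?thesis by simp
  qed
  have Uouter: "norm (U z) \<le> 7 * B" if z: "norm z = \<rho>" for z
  proof -
    have z0: "z \<noteq> 0" using z \<rho> by auto
    have "U z = qsum A c z - V z" using PUV[OF z0] P[OF z0] by (simp add: A_def)
    then show ?thesis using norm_triangle_ineq4[of "qsum A c z" "V z"] B'[of z] Vouter[OF z] z by auto
  qed
  have root_le: "norm z \<le> \<rho>" if "norm z ^ m \<le> 2" for z :: complex
    using that m \<rho> by (metis power_le_imp_le_base power_mono_iff norm_ge_zero less_imp_le)
  have Ubound: "norm (U z) \<le> 7 * B" if z: "z \<noteq> 0" "norm z ^ m \<le> 2" for z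
  proof -
    have "norm (U z) \<le> 7 * B * (norm z / \<rho>) powi 0"
      unfolding U_qsum by (rule qsum_growth) (use z root_le \<rho> Uouter finA in \<open>auto simp: U_qsum\<close>)
    then show ?thesis by simp
  qed
  have Vinner: "norm (V z) \<le> 8 * B" if z: "norm z = 1 / \<rho>" for z
  proof -
    have z0: "z \<noteq> 0" using z \<rho> by auto
    have "norm z ^ m \<le> 2" using z \<rho> by (simp add: power_divide)
    then have "norm (U z) \<le> 7 * B" using Ubound z0 by blast
    moreover have "V z = qsum A c z - U z" using PUV[OF z0] P[OF z0] by (simp add: A_def)
    ultimately show ?thesis using norm_triangle_ineq4[of "qsum A c z" "U z"] B'[of z] z by auto
  qed
  have Vbound: "norm (V z) \<le> 16 * B * norm z ^ m" if z: "1 / 2 \<le> norm z ^ m" for z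
  proof -
    have "(1 / \<rho>) ^ m \<le> norm z ^ m" using z \<rho> by (simp add: power_divide)
    then have "1 / \<rho> \<le> norm z" using m \<rho> by (metis power_mono_iff norm_ge_zero less_imp_le zero_le_divide_1_iff)
    then have "norm (V z) \<le> 8 * B * (norm z / (1 / \<rho>)) powi int m"
      unfolding V_qsum by (intro qsum_growth_outer) (use \<rho> Vinner finA \<open>1 / \<rho> \<le> norm z\<close> in \<open>auto simp: V_qsum\<close>)
    also have "(norm z / (1 / \<rho>)) powi int m = norm z ^ m * 2" using \<rho> by (simp add: power_mult_distrib)
    finally show ?thesis by simp
  qed
  show ?thesis
    by (rule that[of U V]) (use laurent_qsum PUV Ubound Vbound in \<open>auto simp: U_qsum V_qsum\<close>)
qed

text \<open>
  The constants do not depend on the level at which the function is approximated; this is what makes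
  the splitting usable in an iteration where the level grows from step to step.
\<close>

lemma shol_split:
  assumes f: "shol f" and \<epsilon>: "\<And>x. x \<in> shell 2 \<Longrightarrow> norm (f x) \<le> \<epsilon>" and \<eta>: "\<eta> > 0"
  obtains u v where "shol u" "shol v" "\<And>x. x \<in> shell 2 \<Longrightarrow> norm (f x - u x - v x) \<le> \<eta>"
    "\<And>x. x \<in> sol \<Longrightarrow> height x \<le> 2 \<Longrightarrow> norm (u x) \<le> 7 * (\<epsilon> + \<eta>)"
    "\<And>x. x \<in> sol \<Longrightarrow> 1 / 2 \<le> height x \<Longrightarrow> norm (v x) \<le> 16 * (\<epsilon> + \<eta>) * height x"
proof -
  obtain m where M: "m \<ge> 1" "\<And>k. k \<ge> 1 \<Longrightarrow> m dvd k \<Longrightarrow> \<exists>P. laurent P \<and> (\<forall>x\<in>shell 2. norm (f x - P (x k)) \<le> \<eta>)"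
    using shol_laurent_approximation[OF f _ \<eta>, of 2] by auto
  from M(2)[OF M(1)] obtain P where P: "laurent P" "\<And>x. x \<in> shell 2 \<Longrightarrow> norm (f x - P (x m)) \<le> \<eta>" by auto
  have bound: "norm (P z) \<le> \<epsilon> + \<eta>" if z: "1 / 2 \<le> norm z ^ m" "norm z ^ m \<le> 2" for z
  proof -
    have "z \<noteq> 0" using z M(1) by (auto simp: power_0_left)
    define w where "w = - \<i> * of_nat m * Ln z"
    have lw: "leaf w m = z" using M(1) \<open>z \<noteq> 0\<close> by (simp add: leaf_nth w_def)
    have "leaf w \<in> shell 2" using z height_root[of "leaf w" m] M(1) lw by (simp add: shell_def)
    then have "norm (f (leaf w) - P z) \<le> \<eta>" "norm (f (leaf w)) \<le> \<epsilon>" using P(2)[of "leaf w"] \<epsilon> lw by auto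
    then show ?thesis using norm_triangle_ineq4[of "f (leaf w)" "f (leaf w) - P z"] by simp
  qed
  obtain U V where UV: "laurent U" "laurent V" "\<And>z. z \<noteq> 0 \<Longrightarrow> P z = U z + V z"
    "\<And>z. z \<noteq> 0 \<Longrightarrow> norm z ^ m \<le> 2 \<Longrightarrow> norm (U z) \<le> 7 * (\<epsilon> + \<eta>)"
    "\<And>z. 1 / 2 \<le> norm z ^ m \<Longrightarrow> norm (V z) \<le> 16 * (\<epsilon> + \<eta>) * norm z ^ m"
    using laurent_split[OF _ P(1) bound, of m] M(1) by auto
  show ?thesis
  proof (rule that[of "\<lambda>x. U (x m)" "\<lambda>x. V (x m)"])
    show "shol (\<lambda>x. U (x m))" "shol (\<lambda>x. V (x m))"
      by (auto intro: lh_laurent[OF UV(1) M(1)] lh_laurent[OF UV(2) M(1)])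
    show "norm (f x - U (x m) - V (x m)) \<le> \<eta>" if "x \<in> shell 2" for x
    proof -
      have "x m \<noteq> 0" using that sol_nonzero M(1) by (auto simp: shell_def)
      from UV(3)[OF this] P(2)[OF that] show ?thesis by (simp add: diff_diff_eq)
    qed
    fix x assume x: "x \<in> sol"
    show "norm (U (x m)) \<le> 7 * (\<epsilon> + \<eta>)" if "height x \<le> 2"
      using UV(4)[of "x m"] sol_nonzero[OF x M(1)] height_root[OF x M(1)] that by simp
    show "norm (V (x m)) \<le> 16 * (\<epsilon> + \<eta>) * height x" if "1 / 2 \<le> height x"
      using UV(5)[of "x m"] height_root[OF x M(1)] that by simp
  qed
qed

section \<open>Functions close to the identity are isotopic to the identity\<close>

subsection \<open>Matrix norm\<close>

definition nrm :: "nat \<Rightarrow> complex mat \<Rightarrow> real" where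
  "nrm n A = (\<Sum>i<n. \<Sum>j<n. norm (A $$ (i, j)))"

lemma nrm_nonneg [simp]: "nrm n A \<ge> 0"
  unfolding nrm_def by (intro sum_nonneg) auto

lemma nrm_entry: "i < n \<Longrightarrow> j < n \<Longrightarrow> norm (A $$ (i, j)) \<le> nrm n A"
  unfolding nrm_def
  by (rule order_trans[OF member_le_sum[of j "{..<n}" "\<lambda>j. norm (A $$ (i, j))"]
        member_le_sum[of i "{..<n}" "\<lambda>i. \<Sum>j<n. norm (A $$ (i, j))"]]) (auto intro: sum_nonneg)

lemma nrm_le:
  "(\<And>i j. i < n \<Longrightarrow> j < n \<Longrightarrow> norm (A $$ (i, j)) \<le> c) \<Longrightarrow> nrm n A \<le> real (n * n) * c"
  unfolding nrm_def
  by (rule order_trans[OF sum_mono[OF sum_mono[where g = "\<lambda>_. c"]]]) auto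

lemma nrm_add: "A \<in> carrier_mat n n \<Longrightarrow> B \<in> carrier_mat n n \<Longrightarrow> nrm n (A + B) \<le> nrm n A + nrm n B"
  unfolding nrm_def sum.distrib[symmetric]
  by (intro sum_mono) (auto intro: norm_triangle_ineq)

lemma nrm_diff: "A \<in> carrier_mat n n \<Longrightarrow> B \<in> carrier_mat n n \<Longrightarrow> nrm n (A - B) \<le> nrm n A + nrm n B"
  unfolding nrm_def sum.distrib[symmetric]
  by (intro sum_mono) (auto intro: norm_triangle_ineq4)

lemma nrm_mult:
  assumes A: "A \<in> carrier_mat n n" and B: "B \<in> carrier_mat n n"
  shows "nrm n (A * B) \<le> nrm n A * nrm n B"
proof -
  have "nrm n (A * B) = (\<Sum>i<n. \<Sum>j<n. norm (\<Sum>k<n. A $$ (i, k) * B $$ (k, j)))"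
    unfolding nrm_def by (intro sum.cong refl) (simp add: mat_mult_index[OF A B])
  also have "\<dots> \<le> (\<Sum>i<n. \<Sum>j<n. \<Sum>k<n. norm (A $$ (i, k)) * norm (B $$ (k, j)))"
    by (intro sum_mono order_trans[OF norm_sum]) (simp add: norm_mult)
  also have "\<dots> = (\<Sum>i<n. \<Sum>k<n. norm (A $$ (i, k)) * (\<Sum>j<n. norm (B $$ (k, j))))"
    by (rule sum.cong[OF refl], subst sum.swap) (simp add: sum_distrib_left)
  also have "\<dots> \<le> (\<Sum>i<n. \<Sum>k<n. norm (A $$ (i, k)) * nrm n B)"
    unfolding nrm_def
    by (intro sum_mono mult_left_mono member_le_sum[of _ "{..<n}" "\<lambda>k. \<Sum>j<n. norm (B $$ (k, j))"])
       (auto intro: sum_nonneg)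
  also have "\<dots> = nrm n A * nrm n B" by (simp add: nrm_def[of n A] sum_distrib_right)
  finally show ?thesis .
qed

lemma nrm_one: "nrm n (1\<^sub>m n) = real n"
proof -
  have "(\<Sum>j<n. norm ((1\<^sub>m n :: complex mat) $$ (i, j))) = (\<Sum>j<n. if j = i then 1 else 0)" if "i < n" for i
    using that by (intro sum.cong refl) auto
  then show ?thesis by (simp add: nrm_def sum.delta)
qed

lemma nrm_transpose: "A \<in> carrier_mat n n \<Longrightarrow> nrm n (transpose_mat A) = nrm n A"
  unfolding nrm_def by (subst sum.swap, intro sum.cong refl) auto

lemma nrm_le_one_plus:
  assumes "A \<in> carrier_mat n n" shows "nrm n A \<le> real n + nrm n (A - 1\<^sub>m n)"
proof -
  have "1\<^sub>m n + (A - 1\<^sub>m n) = A" using assms by (intro eq_matI) auto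
  moreover have "nrm n (1\<^sub>m n + (A - 1\<^sub>m n)) \<le> nrm n (1\<^sub>m n) + nrm n (A - 1\<^sub>m n)"
    using assms by (intro nrm_add) auto
  ultimately show ?thesis by (simp add: nrm_one)
qed

lemma mat_mult_minus_one:
  assumes "A \<in> carrier_mat n n" "B \<in> carrier_mat n n"
  shows "A * B - 1\<^sub>m n = (A - 1\<^sub>m n) + (B - 1\<^sub>m n) + (A - 1\<^sub>m n) * (B - (1\<^sub>m n :: complex mat))"
proof -
  have "(A - 1\<^sub>m n) * (B - 1\<^sub>m n) = (A - 1\<^sub>m n) * B - (A - 1\<^sub>m n) * 1\<^sub>m n"
    using assms by (intro mult_minus_distrib_mat) auto
  also have "(A - 1\<^sub>m n) * B = A * B - B"
    using assms by (subst minus_mult_distrib_mat[of _ n n]) auto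
  finally show ?thesis using assms by (intro eq_matI) auto
qed

lemma nrm_mult_minus_one:
  assumes A: "A \<in> carrier_mat n n" and B: "B \<in> carrier_mat n n"
  shows "nrm n (A * B - 1\<^sub>m n) \<le> nrm n (A - 1\<^sub>m n) + nrm n (B - 1\<^sub>m n) + nrm n (A - 1\<^sub>m n) * nrm n (B - 1\<^sub>m n)"
proof -
  have "nrm n (A * B - 1\<^sub>m n) \<le> nrm n ((A - 1\<^sub>m n) + (B - 1\<^sub>m n)) + nrm n ((A - 1\<^sub>m n) * (B - 1\<^sub>m n))"
    unfolding mat_mult_minus_one[OF A B] using A B by (intro nrm_add) auto
  also have "nrm n ((A - 1\<^sub>m n) + (B - 1\<^sub>m n)) \<le> nrm n (A - 1\<^sub>m n) + nrm n (B - 1\<^sub>m n)"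
    using A B by (intro nrm_add) auto
  also have "nrm n ((A - 1\<^sub>m n) * (B - 1\<^sub>m n)) \<le> nrm n (A - 1\<^sub>m n) * nrm n (B - 1\<^sub>m n)"
    using A B by (intro nrm_mult) auto
  finally show ?thesis by simp
qed

lemma det_nonzero_near_one:
  assumes A: "A \<in> carrier_mat n n" and s: "nrm n (A - 1\<^sub>m n) < 1"
  shows "det A \<noteq> 0"
proof
  assume "det A = 0"
  then obtain v where v: "v \<in> carrier_vec n" "v \<noteq> 0\<^sub>v n" "A *\<^sub>v v = 0\<^sub>v n"
    using det_0_iff_vec_prod_zero[OF A] by blast
  define S where "S = (\<Sum>i<n. norm (vec_index v i))"
  have "norm (vec_index v i) \<le> (\<Sum>j<n. norm ((A - 1\<^sub>m n) $$ (i, j))) * S" if i: "i < n" for i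
  proof -
    have "vec_index (A *\<^sub>v v) i = (\<Sum>j<n. A $$ (i, j) * vec_index v j)"
      using A v(1) i by (auto simp: scalar_prod_def lessThan_atLeast0 intro!: sum.cong)
    then have "0 = (\<Sum>j<n. A $$ (i, j) * vec_index v j)" using i by (simp add: v(3))
    moreover have "(\<Sum>j<n. (A - 1\<^sub>m n) $$ (i, j) * vec_index v j) = (\<Sum>j<n. A $$ (i, j) * vec_index v j - (if j = i then vec_index v j else 0))"
      using A i by (intro sum.cong refl) (auto simp: left_diff_distrib)
    ultimately have "vec_index v i = - (\<Sum>j<n. (A - 1\<^sub>m n) $$ (i, j) * vec_index v j)"
      using i by (simp add: sum_subtractf sum.delta)
    then have "norm (vec_index v i) \<le> (\<Sum>j<n. norm ((A - 1\<^sub>m n) $$ (i, j)) * norm (vec_index v j))"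
      using norm_sum[of "\<lambda>j. (A - 1\<^sub>m n) $$ (i, j) * vec_index v j" "{..<n}"] by (simp add: norm_mult)
    also have "\<dots> \<le> (\<Sum>j<n. norm ((A - 1\<^sub>m n) $$ (i, j)) * S)"
      unfolding S_def by (intro sum_mono mult_left_mono member_le_sum) auto
    finally show ?thesis by (simp add: sum_distrib_right)
  qed
  then have "S \<le> (\<Sum>i<n. (\<Sum>j<n. norm ((A - 1\<^sub>m n) $$ (i, j))) * S)"
    unfolding S_def by (intro sum_mono) auto
  then have "S \<le> nrm n (A - 1\<^sub>m n) * S" by (simp add: nrm_def sum_distrib_right)
  moreover have "S > 0"
  proof -
    obtain i where i: "i < n" "vec_index v i \<noteq> 0" using v(1,2) by (metis eq_vecI carrier_vecD index_zero_vec(1,2))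
    then have "0 < norm (vec_index v i)" by simp
    also have "\<dots> \<le> S" unfolding S_def using i by (intro member_le_sum) auto
    finally show ?thesis .
  qed
  ultimately show False using s by (simp add: mult_less_cancel_right1 leD)
qed

subsection \<open>Entrywise limits and products\<close>

definition mconv :: "nat \<Rightarrow> (nat \<Rightarrow> complex mat) \<Rightarrow> complex mat \<Rightarrow> bool" where
  "mconv n F L \<longleftrightarrow> (\<forall>i<n. \<forall>j<n. (\<lambda>k. F k $$ (i, j)) \<longlonglongrightarrow> L $$ (i, j))"

lemma mconv_mult:
  assumes "mconv n F L" "mconv n G M" "\<And>k. F k \<in> carrier_mat n n" "\<And>k. G k \<in> carrier_mat n n"
    "L \<in> carrier_mat n n" "M \<in> carrier_mat n n"
  shows "mconv n (\<lambda>k. F k * G k) (L * M)"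
  unfolding mconv_def
proof (intro allI impI)
  fix i j assume ij: "i < n" "j < n"
  have "(\<lambda>k. \<Sum>l<n. F k $$ (i, l) * G k $$ (l, j)) \<longlonglongrightarrow> (\<Sum>l<n. L $$ (i, l) * M $$ (l, j))"
    using assms(1,2) ij by (intro tendsto_sum tendsto_mult) (auto simp: mconv_def)
  then show "(\<lambda>k. (F k * G k) $$ (i, j)) \<longlonglongrightarrow> (L * M) $$ (i, j)"
    using ij by (simp add: mat_mult_index[OF assms(3,4)] mat_mult_index[OF assms(5,6)])
qed

lemma mconv_const: "mconv n (\<lambda>k. A) A"
  by (simp add: mconv_def)

lemma mconv_unique:
  assumes "mconv n F L" "mconv n F M" "L \<in> carrier_mat n n" "M \<in> carrier_mat n n"
  shows "L = M"
proof (rule eq_matI)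
  fix i j assume "i < dim_row M" "j < dim_col M"
  then have "i < n" "j < n" using assms(4) by auto
  then show "L $$ (i, j) = M $$ (i, j)" using assms(1,2) unfolding mconv_def by (blast intro: LIMSEQ_unique)
qed (use assms(3,4) in auto)

lemma mconv_transpose:
  assumes "mconv n F L" "\<And>k. F k \<in> carrier_mat n n" "L \<in> carrier_mat n n"
  shows "mconv n (\<lambda>k. transpose_mat (F k)) (transpose_mat L)"
  unfolding mconv_def
proof (intro allI impI)
  fix i j assume "i < n" "j < n"
  then show "(\<lambda>k. transpose_mat (F k) $$ (i, j)) \<longlonglongrightarrow> transpose_mat L $$ (i, j)"
    using assms(1) by (simp add: mconv_def carrier_matD[OF assms(2)] carrier_matD[OF assms(3)])
qed

lemma mconv_shift: "mconv n (\<lambda>l. F (l + k)) L \<longleftrightarrow> mconv n F L"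
proof
  assume "mconv n (\<lambda>l. F (l + k)) L"
  then show "mconv n F L"
    unfolding mconv_def using LIMSEQ_offset[where k = k and f = "\<lambda>l. F l $$ (_, _)"] by simp
next
  assume "mconv n F L"
  then show "mconv n (\<lambda>l. F (l + k)) L"
    unfolding mconv_def using LIMSEQ_ignore_initial_segment[where k = k and f = "\<lambda>l. F l $$ (_, _)"] by simp
qed

lemma mconv_nrm:
  assumes "mconv n F L" "\<And>k. F k \<in> carrier_mat n n" "L \<in> carrier_mat n n"
  shows "(\<lambda>k. nrm n (F k - L)) \<longlonglongrightarrow> 0"
proof -
  have "(\<lambda>k. \<Sum>i<n. \<Sum>j<n. norm (F k $$ (i, j) - L $$ (i, j))) \<longlonglongrightarrow> (\<Sum>i<n. \<Sum>j<n. norm (L $$ (i, j) - L $$ (i, j)))"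
    using assms(1) by (intro tendsto_sum tendsto_norm tendsto_diff tendsto_const) (auto simp: mconv_def)
  moreover have "nrm n (F k - L) = (\<Sum>i<n. \<Sum>j<n. norm (F k $$ (i, j) - L $$ (i, j)))" for k
    unfolding nrm_def using assms(2)[of k] assms(3) by (intro sum.cong refl) auto
  ultimately show ?thesis by simp
qed

lemma mconv_of_nrm:
  assumes "(\<lambda>k. nrm n (F k - L)) \<longlonglongrightarrow> 0" "\<And>k. F k \<in> carrier_mat n n" "L \<in> carrier_mat n n"
  shows "mconv n F L"
  unfolding mconv_def
proof (intro allI impI)
  fix i j assume ij: "i < n" "j < n"
  have "norm (F k $$ (i, j) - L $$ (i, j)) \<le> nrm n (F k - L)" for k
    using nrm_entry[OF ij, of "F k - L"] assms(2)[of k] assms(3) ij by simp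
  then have "(\<lambda>k. F k $$ (i, j) - L $$ (i, j)) \<longlonglongrightarrow> 0"
    by (intro Lim_null_comparison[OF always_eventually assms(1)]) auto
  then show "(\<lambda>k. F k $$ (i, j)) \<longlonglongrightarrow> L $$ (i, j)" by (rule LIM_zero_cancel)
qed

fun tail_prod :: "nat \<Rightarrow> (nat \<Rightarrow> complex mat) \<Rightarrow> nat \<Rightarrow> nat \<Rightarrow> complex mat" where
  "tail_prod n B k 0 = 1\<^sub>m n"
| "tail_prod n B k (Suc l) = tail_prod n B k l * B (k + l)"

lemma tail_prod_carrier: "(\<And>j. B j \<in> carrier_mat n n) \<Longrightarrow> tail_prod n B k l \<in> carrier_mat n n"
  by (induction l) (auto intro: mult_carrier_mat)

lemma tail_prod_append:
  assumes "\<And>j. B j \<in> carrier_mat n n"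
  shows "tail_prod n B k (l + l') = tail_prod n B k l * tail_prod n B (k + l) l'"
proof (induction l')
  case 0
  then show ?case using right_mult_one_mat[OF tail_prod_carrier[of B, OF assms]] by simp
next
  case (Suc l')
  then show ?case
    using assoc_mult_mat[OF tail_prod_carrier[of B, OF assms] tail_prod_carrier[of B, OF assms] assms]
    by (simp add: add.assoc)
qed

lemma tail_prod_near_one:
  assumes "\<And>j. B j \<in> carrier_mat n n" "\<And>j. j < l \<Longrightarrow> nrm n (B (k + j) - 1\<^sub>m n) \<le> d j" "(\<Sum>j<l. d j) \<le> 1 / 2"
  shows "nrm n (tail_prod n B k l - 1\<^sub>m n) \<le> 2 * (\<Sum>j<l. d j)"
  using assms(2,3)
proof (induction l)
  case 0
  then show ?case by (simp add: nrm_def)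
next
  case (Suc l)
  have d0: "d j \<ge> 0" if "j < Suc l" for j using Suc.prems(1)[OF that] nrm_nonneg order_trans by blast
  let ?S = "\<Sum>j<l. d j"
  have "0 \<le> ?S" by (intro sum_nonneg d0) auto
  moreover have "?S + d l \<le> 1 / 2" using Suc.prems(2) by simp
  ultimately have S: "0 \<le> ?S" "?S \<le> 1 / 2" using d0[of l] by auto
  have IH: "nrm n (tail_prod n B k l - 1\<^sub>m n) \<le> 2 * ?S" using S Suc.prems(1) by (intro Suc.IH) auto
  have "nrm n (tail_prod n B k (Suc l) - 1\<^sub>m n) \<le> nrm n (tail_prod n B k l - 1\<^sub>m n) + nrm n (B (k + l) - 1\<^sub>m n) +
      nrm n (tail_prod n B k l - 1\<^sub>m n) * nrm n (B (k + l) - 1\<^sub>m n)"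
    using nrm_mult_minus_one[OF tail_prod_carrier[of B, OF assms(1)] assms(1)] by simp
  also have "\<dots> \<le> 2 * ?S + d l + (2 * ?S) * d l"
    using IH Suc.prems(1)[of l] S d0[of l] by (intro add_mono mult_mono) auto
  also have "(2 * ?S) * d l \<le> 1 * d l" using S d0[of l] by (intro mult_right_mono) auto
  finally show ?case by simp
qed

lemma sum_geometric_le: "c \<ge> 0 \<Longrightarrow> (\<Sum>j<l. c / 2 ^ (k + j)) \<le> 2 * c / 2 ^ k" for c :: real
proof -
  assume c: "c \<ge> 0"
  have "(\<Sum>j<l. (1 / 2 :: real) ^ j) = 2 - 2 * (1 / 2) ^ l" by (induction l) auto
  then have "(\<Sum>j<l. (1 / 2 :: real) ^ j) \<le> 2" by simp
  then have "c / 2 ^ k * (\<Sum>j<l. (1 / 2 :: real) ^ j) \<le> c / 2 ^ k * 2" using c by (intro mult_left_mono) auto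
  moreover have "(\<Sum>j<l. c / 2 ^ (k + j)) = c / 2 ^ k * (\<Sum>j<l. (1 / 2 :: real) ^ j)"
    unfolding sum_distrib_left by (intro sum.cong refl) (simp add: power_add power_one_over)
  ultimately show ?thesis by (simp only: mult.commute times_divide_eq_right)
qed

text \<open>
  \<open>side False\<close> looks towards the cusp at infinity, \<open>side True\<close> towards the cusp at zero.
\<close>

definition side :: "bool \<Rightarrow> (nat \<Rightarrow> complex) \<Rightarrow> real" where
  "side b x = (if b then 1 / height x else height x)"

lemma side_pos: "x \<in> sol \<Longrightarrow> side b x > 0"
  by (simp add: side_def height_pos)

definition half :: "bool \<Rightarrow> (nat \<Rightarrow> complex) set" where
  "half b = {x \<in> sol. side b x > 1 / 2}"

lemma open_half: "openin (top_of_set sol) (half b)"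
proof -
  have "openin (top_of_set sol) {x \<in> sol. height x > 1 / 2}" "openin (top_of_set sol) {x \<in> sol. height x < 2}"
    unfolding openin_open
    by (rule exI[of _ "{x. height x > 1 / 2}"] exI[of _ "{x. height x < 2}"];
        force intro!: open_Collect_less continuous_intros)+
  moreover have "half True = {x \<in> sol. height x < 2}"
    using height_pos by (auto simp: half_def side_def field_simps)
  moreover have "half False = {x \<in> sol. height x > 1 / 2}" by (auto simp: half_def side_def)
  ultimately show ?thesis by (cases b) auto
qed

text \<open>
  Families \<open>B k\<close> that start at the identity at time \<open>0\<close> and are summably close to it on one half of
  the solenoid, with a bound proportional to \<open>side b\<close>.  Their values at time \<open>1\<close> have a
  convergent infinite product on that half.
\<close>

locale telescope =
  fixes n :: nat and b :: bool and B :: "nat \<Rightarrow> (nat \<Rightarrow> complex) \<times> real \<Rightarrow> complex mat" and c :: real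
  assumes B: "\<And>k. glh n cyl (B k)"
    and B0: "\<And>k x. x \<in> sol \<Longrightarrow> B k (x, 0) = 1\<^sub>m n"
    and c: "c > 0"
    and small: "\<And>k x t. x \<in> half b \<Longrightarrow> t \<in> {0..1} \<Longrightarrow> c / 2 ^ k * side b x \<le> 1 \<Longrightarrow>
      nrm n (B k (x, t) - 1\<^sub>m n) \<le> c / 2 ^ k * side b x"
begin

definition w :: "nat \<Rightarrow> real" where
  "w k = c / 2 ^ k"

lemma w_pos: "w k > 0"
  using c by (simp add: w_def)

lemma w_antimono: "w (k + j) \<le> w k"
  unfolding w_def using c by (intro divide_left_mono) auto

lemma w_sum: "(\<Sum>j<l. w (k + j)) \<le> 2 * w k"
  using sum_geometric_le[of c k l] c by (simp add: w_def)

definition C :: "(nat \<Rightarrow> complex) \<Rightarrow> nat \<Rightarrow> complex mat" where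
  "C x j = (if x \<in> sol then B j (x, 1) else 1\<^sub>m n)"

abbreviation Q :: "(nat \<Rightarrow> complex) \<Rightarrow> nat \<Rightarrow> complex mat" where
  "Q x k \<equiv> tail_prod n (C x) 0 k"

lemma C_carrier: "C x j \<in> carrier_mat n n"
  using glhD(3)[OF B] by (auto simp: C_def)

lemma Q_carrier: "tail_prod n (C x) k l \<in> carrier_mat n n"
  by (rule tail_prod_carrier[OF C_carrier])

lemmas C_append = tail_prod_append[of "C x" for x, OF C_carrier]

lemma tail_small:
  assumes x: "x \<in> half b" and k: "2 * w k * side b x \<le> 1 / 2"
  shows "nrm n (tail_prod n (C x) k l - 1\<^sub>m n) \<le> 4 * w k * side b x"
proof -
  have s: "side b x > 0" using x side_pos by (auto simp: half_def)
  have "(\<Sum>j<l. w (k + j) * side b x) \<le> 2 * w k * side b x"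
    using mult_right_mono[OF w_sum[where k = k and l = l], of "side b x"] s by (simp add: sum_distrib_right)
  moreover have "nrm n (C x (k + j) - 1\<^sub>m n) \<le> w (k + j) * side b x" for j
  proof -
    have "w (k + j) \<le> 2 * w k" using w_antimono[of k j] w_pos[of k] by linarith
    then have "w (k + j) * side b x \<le> 2 * w k * side b x" using s by (intro mult_right_mono) auto
    then have "w (k + j) * side b x \<le> 1" using k by simp
    then show ?thesis using small[of x 1 "k + j"] x by (auto simp: C_def half_def w_def)
  qed
  ultimately have "nrm n (tail_prod n (C x) k l - 1\<^sub>m n) \<le> 2 * (\<Sum>j<l. w (k + j) * side b x)"
    using k by (intro tail_prod_near_one C_carrier) auto
  then show ?thesis using \<open>(\<Sum>j<l. w (k + j) * side b x) \<le> _\<close> by simp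
qed

lemma glh_C: "D \<subseteq> sol \<times> UNIV \<Longrightarrow> glh n D (\<lambda>p. C (fst p) j)"
proof -
  assume D: "D \<subseteq> sol \<times> UNIV"
  have "glh n D (\<lambda>p. B j (fst p, 1))" by (rule glh_slice[OF B]) (use D in auto)
  then show ?thesis by (rule glh_cong) (use D in \<open>auto simp: C_def\<close>)
qed

lemma glh_tail: "D \<subseteq> sol \<times> UNIV \<Longrightarrow> glh n D (\<lambda>p. tail_prod n (C (fst p)) k l)"
  by (induction l) (auto intro: glh_one glh_mult glh_C)

lemma tails_vanish: "\<exists>k. \<forall>k'\<ge>k. w k' * r \<le> e" if "e > 0" "r > 0" for e r :: real
proof -
  have "(\<lambda>k. c * r * (1 / 2) ^ k) \<longlonglongrightarrow> c * r * 0" by (intro tendsto_intros) auto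
  then have "eventually (\<lambda>k. c * r * (1 / 2) ^ k < e) sequentially" using that by (intro order_tendstoD) auto
  then show ?thesis unfolding eventually_sequentially
    by (auto simp: w_def power_one_over field_simps intro: less_imp_le)
qed

definition L :: "(nat \<Rightarrow> complex) \<Rightarrow> complex mat" where
  "L x = mat n n (\<lambda>(i, j). lim (\<lambda>k. Q x k $$ (i, j)))"

text \<open>
  On a set bounded towards the cusp the factors from some index \<open>k0\<close> on satisfy the smallness
  condition, so the tail products are uniformly Cauchy and stay within \<open>1 / 2\<close> of the identity; the
  limit is leafwise holomorphic and invertible.
\<close>

lemma L_local:
  assumes r: "r > 0"
  defines "D \<equiv> {x \<in> half b. side b x < r} \<times> {0..1::real}"
  shows "glh n D (\<lambda>p. L (fst p))" "\<And>p. p \<in> D \<Longrightarrow> mconv n (Q (fst p)) (L (fst p))"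
proof -
  have Dsol: "D \<subseteq> sol \<times> UNIV" by (auto simp: D_def half_def)
  have Dopen: "openin (top_of_set (sol \<times> {0..1})) D"
  proof -
    have "openin (top_of_set sol) {x \<in> sol. side b x < r}"
    proof (cases b)
      case True
      have "{x \<in> sol. side b x < r} = sol \<inter> {x. height x > 1 / r}"
        using True r height_pos by (auto simp: side_def field_simps)
      then show ?thesis unfolding openin_open
        by (intro exI[of _ "{x. height x > 1 / r}"]) (auto intro!: open_Collect_less continuous_intros)
    next
      case False
      have "{x \<in> sol. side b x < r} = sol \<inter> {x. height x < r}" using False by (auto simp: side_def)
      then show ?thesis unfolding openin_open
        by (intro exI[of _ "{x. height x < r}"]) (auto intro!: open_Collect_less continuous_intros)
    qed
    then have "openin (top_of_set sol) (half b \<inter> {x \<in> sol. side b x < r})" using open_half by (rule openin_Int[rotated])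
    moreover have "half b \<inter> {x \<in> sol. side b x < r} = {x \<in> half b. side b x < r}" by (auto simp: half_def)
    ultimately show ?thesis unfolding D_def by (auto intro: openin_Times)
  qed
  obtain k0 where k0: "\<And>k. k \<ge> k0 \<Longrightarrow> w k * r \<le> 1 / 8" using tails_vanish[of "1 / 8" r] r by auto
  have side: "4 * w k * side b (fst p) \<le> 1 / 2" if "p \<in> D" "k \<ge> k0" for p k
  proof -
    have "w k * side b (fst p) \<le> w k * r" using that w_pos[of k] by (intro mult_left_mono) (auto simp: D_def)
    then show ?thesis using k0[OF that(2)] by simp
  qed
  have w_side: "w k * side b (fst p) > 0" if "p \<in> D" for p k
    using that Dsol side_pos[of "fst p" b] w_pos[of k] by (auto simp: D_def)
  have T1: "nrm n (tail_prod n (C (fst p)) k0 l - 1\<^sub>m n) \<le> 1 / 2" if p: "p \<in> D" for p l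
  proof -
    have "fst p \<in> half b" "2 * w k0 * side b (fst p) \<le> 1 / 2"
      using side[OF p, of k0] w_side[OF p, of k0] p by (auto simp: D_def)
    from tail_small[OF this, of l] side[OF p, of k0] show ?thesis by simp
  qed
  have T2: "nrm n (tail_prod n (C (fst p)) k0 (l + l') - tail_prod n (C (fst p)) k0 l) \<le> (real n + 1) * (4 * w (k0 + l) * r)"
    if p: "p \<in> D" for p l l'
  proof -
    let ?T = "tail_prod n (C (fst p)) k0 l" and ?T' = "tail_prod n (C (fst p)) (k0 + l) l'"
    have eq: "tail_prod n (C (fst p)) k0 (l + l') - ?T = ?T * (?T' - 1\<^sub>m n)"
      using right_mult_one_mat[OF Q_carrier[of "fst p" k0 l]]
      by (subst mult_minus_distrib_mat[OF Q_carrier Q_carrier]) (auto simp: C_append)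
    have "nrm n (tail_prod n (C (fst p)) k0 (l + l') - ?T) \<le> nrm n ?T * nrm n (?T' - 1\<^sub>m n)"
      unfolding eq by (rule nrm_mult) (use Q_carrier in auto)
    also have "\<dots> \<le> (real n + 1) * (4 * w (k0 + l) * r)"
    proof (intro mult_mono)
      show "nrm n ?T \<le> real n + 1" using nrm_le_one_plus[OF Q_carrier, of "fst p" k0 l] T1[OF p, of l] by simp
      have "fst p \<in> half b" "2 * w (k0 + l) * side b (fst p) \<le> 1 / 2"
        using side[OF p, of "k0 + l"] w_side[OF p, of "k0 + l"] p by (auto simp: D_def)
      from tail_small[OF this, of l'] have "nrm n (?T' - 1\<^sub>m n) \<le> 4 * w (k0 + l) * side b (fst p)" .
      also have "\<dots> \<le> 4 * w (k0 + l) * r" using p w_pos[of "k0 + l"] by (intro mult_left_mono) (auto simp: D_def)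
      finally show "nrm n (?T' - 1\<^sub>m n) \<le> 4 * w (k0 + l) * r" .
    qed auto
    finally show ?thesis .
  qed
  define T where "T p = mat n n (\<lambda>(i, j). lim (\<lambda>l. tail_prod n (C (fst p)) k0 l $$ (i, j)))" for p :: "(nat \<Rightarrow> complex) \<times> real"
  have unif: "uniform_limit D (\<lambda>l p. tail_prod n (C (fst p)) k0 l $$ (i, j)) (\<lambda>p. T p $$ (i, j)) sequentially"
    if ij: "i < n" "j < n" for i j
  proof -
    have "uniformly_Cauchy_on D (\<lambda>l p. tail_prod n (C (fst p)) k0 l $$ (i, j))"
    proof (rule uniformly_Cauchy_onI)
      fix e :: real assume e: "e > 0"
      obtain M where M: "\<And>k. k \<ge> M \<Longrightarrow> w k * ((real n + 1) * 4 * r) \<le> e / 2"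
        using tails_vanish[of "e / 2" "(real n + 1) * 4 * r"] e r by (auto simp: add_pos_nonneg)
      have *: "dist (tail_prod n (C (fst p)) k0 l $$ (i, j)) (tail_prod n (C (fst p)) k0 l' $$ (i, j)) < e"
        if pl: "p \<in> D" "M \<le> l" "l \<le> l'" for p l l'
      proof -
        obtain d where d: "l' = l + d" using pl(3) le_Suc_ex by blast
        let ?A = "tail_prod n (C (fst p)) k0 l'" and ?B = "tail_prod n (C (fst p)) k0 l"
        have "norm ((?A - ?B) $$ (i, j)) \<le> nrm n (?A - ?B)" by (rule nrm_entry[OF ij])
        also have "\<dots> \<le> (real n + 1) * (4 * w (k0 + l) * r)" unfolding d by (rule T2[OF pl(1)])
        also have "\<dots> = w (k0 + l) * ((real n + 1) * 4 * r)" by simp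
        also have "\<dots> \<le> e / 2" using pl by (intro M) auto
        finally show ?thesis using e ij Q_carrier[of "fst p" k0 l'] Q_carrier[of "fst p" k0 l]
          by (simp add: dist_norm norm_minus_commute carrier_matD)
      qed
      show "\<exists>M. \<forall>x\<in>D. \<forall>m\<ge>M. \<forall>n'\<ge>M. dist (tail_prod n (C (fst x)) k0 m $$ (i, j)) (tail_prod n (C (fst x)) k0 n' $$ (i, j)) < e"
      proof (intro exI ballI allI impI)
        fix p l l' assume "p \<in> D" "M \<le> l" "M \<le> l'"
        then show "dist (tail_prod n (C (fst p)) k0 l $$ (i, j)) (tail_prod n (C (fst p)) k0 l' $$ (i, j)) < e"
          using *[of p l l'] *[of p l' l] by (cases "l \<le> l'") (auto simp: dist_commute)
      qed
    qed
    then have "uniform_limit D (\<lambda>l p. tail_prod n (C (fst p)) k0 l $$ (i, j))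
        (\<lambda>p. lim (\<lambda>l. tail_prod n (C (fst p)) k0 l $$ (i, j))) sequentially"
      using Cauchy_uniformly_convergent uniformly_convergent_uniform_limit_iff by blast
    then show ?thesis using ij by (simp add: T_def)
  qed
  have Tc: "T p \<in> carrier_mat n n" for p by (simp add: T_def)
  have Tconv: "mconv n (tail_prod n (C (fst p)) k0) (T p)" if "p \<in> D" for p
    unfolding mconv_def using tendsto_uniform_limitI[OF unif that] by auto
  have Tnear: "nrm n (T p - 1\<^sub>m n) \<le> 1 / 2" if p: "p \<in> D" for p
  proof (rule LIMSEQ_le_const2)
    have "mconv n (\<lambda>l. tail_prod n (C (fst p)) k0 l) (T p)" using Tconv[OF p] .
    then have "(\<lambda>l. \<Sum>i<n. \<Sum>j<n. norm (tail_prod n (C (fst p)) k0 l $$ (i, j) - 1\<^sub>m n $$ (i, j))) \<longlonglongrightarrow>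
        (\<Sum>i<n. \<Sum>j<n. norm (T p $$ (i, j) - 1\<^sub>m n $$ (i, j)))"
      by (intro tendsto_sum tendsto_norm tendsto_diff tendsto_const) (auto simp: mconv_def)
    moreover have "nrm n (A - 1\<^sub>m n) = (\<Sum>i<n. \<Sum>j<n. norm (A $$ (i, j) - 1\<^sub>m n $$ (i, j)))" if "A \<in> carrier_mat n n" for A
      unfolding nrm_def using that by (intro sum.cong refl) auto
    ultimately show "(\<lambda>l. nrm n (tail_prod n (C (fst p)) k0 l - 1\<^sub>m n)) \<longlonglongrightarrow> nrm n (T p - 1\<^sub>m n)"
      using Q_carrier Tc by simp
    show "\<exists>N. \<forall>l\<ge>N. nrm n (tail_prod n (C (fst p)) k0 l - 1\<^sub>m n) \<le> 1 / 2" using T1[OF p] by auto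
  qed
  have Tglh: "glh n D T"
    unfolding glh_def
  proof (intro conjI ballI mlhI)
    show "lh D (\<lambda>p. T p $$ (i, j))" if "i < n" "j < n" for i j
      by (rule lh_uniform_limit[OF Dopen _ unif[OF that]]) (rule glhD(5)[OF glh_tail[OF Dsol] that])
    fix p assume "p \<in> D"
    then show "det (T p) \<noteq> 0" using Tnear[of p] by (intro det_nonzero_near_one[OF Tc]) auto
  qed (use Dsol Tc in auto)
  have conv: "mconv n (Q (fst p)) (Q (fst p) k0 * T p)" if p: "p \<in> D" for p
  proof -
    have "mconv n (\<lambda>l. Q (fst p) k0 * tail_prod n (C (fst p)) k0 l) (Q (fst p) k0 * T p)"
      by (intro mconv_mult mconv_const Tconv[OF p] Q_carrier Tc)
    moreover have "Q (fst p) k0 * tail_prod n (C (fst p)) k0 l = Q (fst p) (l + k0)" for l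
      using C_append[of "fst p" 0 k0 l] by (simp add: add.commute)
    ultimately have "mconv n (\<lambda>l. Q (fst p) (l + k0)) (Q (fst p) k0 * T p)" by simp
    then show ?thesis by (simp only: mconv_shift)
  qed
  have L_eq: "L (fst p) = Q (fst p) k0 * T p" if p: "p \<in> D" for p
  proof (rule eq_matI)
    have cM: "Q (fst p) k0 * T p \<in> carrier_mat n n" using Q_carrier Tc by (rule mult_carrier_mat)
    fix i j assume "i < dim_row (Q (fst p) k0 * T p)" "j < dim_col (Q (fst p) k0 * T p)"
    then have ij: "i < n" "j < n" using cM by auto
    then show "L (fst p) $$ (i, j) = (Q (fst p) k0 * T p) $$ (i, j)"
      using conv[OF p] unfolding L_def mconv_def by (auto intro: limI)
  qed (use carrier_matD[OF mult_carrier_mat[OF Q_carrier Tc]] in \<open>auto simp: L_def\<close>)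
  show "mconv n (Q (fst p)) (L (fst p))" if "p \<in> D" for p using conv[OF that] L_eq[OF that] by simp
  have "glh n D (\<lambda>p. Q (fst p) k0 * T p)" by (intro glh_mult glh_tail Dsol Tglh)
  then show "glh n D (\<lambda>p. L (fst p))" by (rule glh_cong) (simp add: L_eq)
qed

lemma L_conv: "x \<in> half b \<Longrightarrow> mconv n (Q x) (L x)"
  using L_local(2)[of "side b x + 1" "(x, 0)"] side_pos[of x b] by (auto simp: half_def)

lemma glh_L: "glh n (half b \<times> {0..1}) (\<lambda>p. L (fst p))"
proof -
  have loc: "\<exists>D'. p \<in> D' \<and> openin (top_of_set (half b \<times> {0..1})) D' \<and> glh n D' (\<lambda>p. L (fst p))"
    if p: "p \<in> half b \<times> {0..1::real}" for p
  proof (intro exI conjI)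
    let ?D = "{x \<in> half b. side b x < side b (fst p) + 1} \<times> {0..1::real}"
    show "p \<in> ?D" using p by (cases p) auto
    have "side b (fst p) + 1 > 0" using p side_pos[of "fst p" b] by (auto simp: half_def)
    then show "glh n ?D (\<lambda>p. L (fst p))" by (rule L_local(1))
    let ?r = "side b (fst p) + 1"
    have r0: "?r > 0" by fact
    have "openin (top_of_set (half b)) {x \<in> half b. side b x < ?r}"
    proof (cases b)
      case True
      have "{x \<in> half b. side b x < ?r} = half b \<inter> {x. height x > 1 / ?r}"
        using True r0 height_pos by (auto simp: side_def field_simps half_def)
      then show ?thesis unfolding openin_open
        by (intro exI[of _ "{x. height x > 1 / ?r}"]) (auto intro!: open_Collect_less continuous_intros)
    next
      case False
      have "{x \<in> half b. side b x < ?r} = half b \<inter> {x. height x < ?r}" using False by (auto simp: side_def)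
      then show ?thesis unfolding openin_open
        by (intro exI[of _ "{x. height x < ?r}"]) (auto intro!: open_Collect_less continuous_intros)
    qed
    then show "openin (top_of_set (half b \<times> {0..1})) ?D" by (intro openin_Times) auto
  qed
  show ?thesis
    unfolding glh_def
  proof (intro conjI ballI mlhI)
    show sub: "half b \<times> {0..1::real} \<subseteq> sol \<times> UNIV" by (auto simp: half_def)
    show "lh (half b \<times> {0..1}) (\<lambda>p. L (fst p) $$ (i, j))" if "i < n" "j < n" for i j
    proof (rule lh_local[OF sub])
      fix p :: "(nat \<Rightarrow> complex) \<times> real" assume "p \<in> half b \<times> {0..1}"
      from loc[OF this] obtain D' where "p \<in> D'" "openin (top_of_set (half b \<times> {0..1})) D'" "glh n D' (\<lambda>p. L (fst p))"
        by blast
      then show "\<exists>D'. p \<in> D' \<and> openin (top_of_set (half b \<times> {0..1})) D' \<and> lh D' (\<lambda>p. L (fst p) $$ (i, j))"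
        using glhD(5)[OF _ that] by blast
    qed
  next
    fix p :: "(nat \<Rightarrow> complex) \<times> real" assume "p \<in> half b \<times> {0..1}"
    from loc[OF this] obtain D' where "p \<in> D'" "glh n D' (\<lambda>p. L (fst p))" by blast
    then show "L (fst p) \<in> carrier_mat n n" "det (L (fst p)) \<noteq> 0" using glhD(3,4) by blast+
  qed
qed

text \<open>
  On the half, \<open>f\<close> is the inverse of the infinite product, so \<open>f\<close> times the first \<open>k\<close> factors is the
  inverse of the \<open>k\<close>-th tail.  In the \<open>k\<close>-th time unit the homotopy switches on the \<open>k\<close>-th factor
  while \<open>side b\<close> of the argument is raised from \<open>k + 1\<close> to \<open>k + 2\<close> times its original value.  The factor \<open>k + 1\<close>
  brings any given shell into the half eventually, and it grows more slowly than the \<open>k\<close>-th tail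
  decays, so the homotopy tends to the identity uniformly on shells.
\<close>

lemma slide:
  assumes f: "hol n f" and fL: "\<And>x. x \<in> half b \<Longrightarrow> f x * L x = 1\<^sub>m n"
  shows "isotopic n f (\<lambda>x. 1\<^sub>m n)"
proof -
  \<comment> \<open>the scaling that multiplies \<open>side b\<close> by \<open>1 + k + t\<close>; it is continuous from one time unit to the next\<close>
  define \<sigma> where "\<sigma> k t = (if b then 1 / (1 + real k + t) else 1 + real k + t)" for k t
  have \<sigma>pos: "t \<ge> 0 \<Longrightarrow> \<sigma> k t > 0" for k t by (simp add: \<sigma>_def)
  have \<sigma>cont: "continuous_on {0..1} (\<sigma> k)" for k
    unfolding \<sigma>_def by (cases b) (auto intro!: continuous_intros)
  have \<sigma>side: "side b (rescale (\<sigma> k t) x) = (1 + real k + t) * side b x" if "t \<ge> 0" for k t x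
    using that \<sigma>pos[OF that, of k] by (auto simp: side_def height_rescale \<sigma>_def)
  define H where "H k p = f (rescale (\<sigma> k (snd p)) (fst p)) * Q (rescale (\<sigma> k (snd p)) (fst p)) k *
      B k (rescale (\<sigma> k (snd p)) (fst p), snd p)" for k p
  have resol: "rescale (\<sigma> k t) x \<in> sol" if "x \<in> sol" "t \<in> {0..1}" for k t x
    using that \<sigma>pos[of t k] by (intro rescale_in_sol) auto
  have "isotopic n (\<lambda>x. H 0 (x, 0)) (\<lambda>x. 1\<^sub>m n)"
  proof (rule isotopic_concat_infinite)
    fix k
    have "glh n cyl (\<lambda>p. (\<lambda>q. f (fst q) * Q (fst q) k) (rescale (\<sigma> k (snd p)) (fst p), id (snd p)))"
      by (rule glh_reparam[where T = "{0..1}" and D = cyl])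
         (use \<sigma>cont \<sigma>pos resol in \<open>auto intro!: glh_mult glh_tail hol_glh[OF f] continuous_intros\<close>)
    moreover have "glh n cyl (\<lambda>p. B k (rescale (\<sigma> k (snd p)) (fst p), id (snd p)))"
      by (rule glh_reparam[OF B, where T = "{0..1}"])
         (use \<sigma>cont \<sigma>pos resol in \<open>auto intro!: continuous_intros\<close>)
    ultimately show "glh n cyl (H k)" unfolding H_def using glh_mult by fastforce
  next
    fix k x assume x: "x \<in> sol"
    have s: "\<sigma> k 1 = \<sigma> (Suc k) 0" by (simp add: \<sigma>_def add.commute)
    define y where "y = rescale (\<sigma> (Suc k) 0) x"
    have y: "y \<in> sol" unfolding y_def by (rule resol[OF x]) simp
    have "H k (x, 1) = f y * Q y k * B k (y, 1)" by (simp add: H_def s y_def)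
    also have "\<dots> = f y * (Q y k * C y k)"
      using y holD(1)[OF f y] Q_carrier[of y 0 k] C_carrier[of y k] by (simp add: C_def assoc_mult_mat)
    also have "\<dots> = H (Suc k) (x, 0)"
      using y holD(1)[OF f y] Q_carrier[of y 0 "Suc k"] B0[OF y]
      by (simp add: H_def flip: y_def) (metis mult_carrier_mat right_mult_one_mat)
    finally show "H k (x, 1) = H (Suc k) (x, 0)" .
  next
    fix R e :: real assume R: "R \<ge> 1" and e: "e > 0"
    have "(\<lambda>k. (2 + real k) * (1 / 2) ^ k) \<longlonglongrightarrow> 0"
      by real_asymp
    then have "(\<lambda>k. c * R * 4 * ((2 + real k) * (1 / 2) ^ k)) \<longlonglongrightarrow> c * R * 4 * 0" by (intro tendsto_intros)
    moreover define e' where "e' = min (1 / 4) (e / (2 * (real n + 1) * 2))"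
    moreover have e': "e' > 0" using e by (simp add: e'_def)
    ultimately have "eventually (\<lambda>k. c * R * 4 * ((2 + real k) * (1 / 2) ^ k) < e') sequentially"
      by (intro order_tendstoD) auto
    then obtain K0 where K0: "\<And>k. k \<ge> K0 \<Longrightarrow> c * R * 4 * ((2 + real k) * (1 / 2) ^ k) < e'"
      unfolding eventually_sequentially by blast
    obtain K1 :: nat where K1: "R \<le> real K1" using real_arch_simple by blast
    show "\<exists>K. \<forall>k\<ge>K. \<forall>x\<in>shell R. \<forall>t\<in>{0..1}. \<forall>i<n. \<forall>j<n. norm (H k (x, t) $$ (i, j) - 1\<^sub>m n $$ (i, j)) \<le> e"
    proof (intro exI[of _ "max K0 K1"] allI impI ballI)
      fix k x t i j assume k: "max K0 K1 \<le> k" and x: "x \<in> shell R" and t: "t \<in> {0..1::real}" and ij: "i < n" "j < n"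
      define y where "y = rescale (\<sigma> k t) x"
      have xs: "x \<in> sol" using x by (simp add: shell_def)
      have ys: "y \<in> sol" unfolding y_def by (rule resol[OF xs t])
      have sx: "1 / R \<le> side b x" "side b x \<le> R"
        using x R height_pos[OF xs] by (auto simp: shell_def side_def field_simps)
      have sy: "side b y = (1 + real k + t) * side b x" using t by (simp add: y_def \<sigma>side)
      have "1 \<le> (1 + real k + t) * (1 / R)" using k K1 R t by (simp add: field_simps)
      also have "\<dots> \<le> side b y" unfolding sy using sx t by (intro mult_left_mono) auto
      finally have yhalf: "y \<in> half b" using ys by (simp add: half_def)
      have "side b y \<le> (2 + real k) * R" unfolding sy using t sx R side_pos[OF xs, of b] by (intro mult_mono) auto
      then have "w k * side b y \<le> w k * ((2 + real k) * R)" using w_pos[of k] by (intro mult_left_mono) auto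
      moreover
      have "c * R * 4 * ((2 + real k) * (1 / 2) ^ k) = 4 * (w k * ((2 + real k) * R))"
        by (simp add: w_def power_one_over)
      from K0[of k, unfolded this] have "4 * (w k * ((2 + real k) * R)) < e'" using k by simp
      ultimately have \<theta>: "4 * w k * side b y \<le> e'" by linarith
      define \<theta> where "\<theta> = 4 * w k * side b y"
      have \<theta>4: "0 \<le> \<theta>" "\<theta> \<le> 1 / 4" "\<theta> \<le> e'" using \<theta> side_pos[OF ys, of b] w_pos[of k] by (auto simp: \<theta>_def e'_def)
      have wy: "w k * side b y > 0" using side_pos[OF ys, of b] w_pos[of k] by simp
      define M where "M = f y * Q y k"
      have Mc: "M \<in> carrier_mat n n" unfolding M_def using holD(1)[OF f ys] Q_carrier by (rule mult_carrier_mat)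
      have T: "nrm n (tail_prod n (C y) k l - 1\<^sub>m n) \<le> \<theta>" for l
        unfolding \<theta>_def using \<theta>4 by (intro tail_small[OF yhalf]) (simp add: \<theta>_def)
      have fL': "mconv n (\<lambda>l. M * tail_prod n (C y) k l) (1\<^sub>m n)"
      proof -
        have "mconv n (\<lambda>l. f y * Q y l) (f y * L y)"
          using glhD(3)[OF glh_L, of "(y, 0)"] yhalf
          by (intro mconv_mult mconv_const L_conv[OF yhalf] Q_carrier holD(1)[OF f ys]) auto
        then have "mconv n (\<lambda>l. f y * Q y (l + k)) (1\<^sub>m n)"
          unfolding fL[OF yhalf] by (rule iffD2[OF mconv_shift[of n "\<lambda>l. f y * Q y l"]])
        moreover have "f y * Q y (l + k) = M * tail_prod n (C y) k l" for l
          unfolding M_def add.commute[of l k] using C_append[of y 0 k l]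
            assoc_mult_mat[OF holD(1)[OF f ys] Q_carrier[of y 0 k] Q_carrier[of y k l]] by simp
        ultimately show ?thesis by simp
      qed
      have M1: "nrm n (M - 1\<^sub>m n) \<le> (real n + nrm n (M - 1\<^sub>m n)) * \<theta>"
      proof (rule LIMSEQ_le_const)
        let ?E = "\<lambda>l. nrm n (M * tail_prod n (C y) k l - 1\<^sub>m n) + nrm n M * \<theta>"
        have "(\<lambda>l. nrm n (M * tail_prod n (C y) k l - 1\<^sub>m n)) \<longlonglongrightarrow> 0"
          by (intro mconv_nrm fL' mult_carrier_mat[OF Mc] Q_carrier) auto
        then have "(\<lambda>l. ?E l + (real n + nrm n (M - 1\<^sub>m n) - nrm n M) * \<theta>) \<longlonglongrightarrow> 0 + nrm n M * \<theta> + (real n + nrm n (M - 1\<^sub>m n) - nrm n M) * \<theta>"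
          by (intro tendsto_intros)
        then show "(\<lambda>l. ?E l + (real n + nrm n (M - 1\<^sub>m n) - nrm n M) * \<theta>) \<longlonglongrightarrow> (real n + nrm n (M - 1\<^sub>m n)) * \<theta>"
          by (simp add: algebra_simps)
        show "\<exists>N. \<forall>l\<ge>N. nrm n (M - 1\<^sub>m n) \<le> ?E l + (real n + nrm n (M - 1\<^sub>m n) - nrm n M) * \<theta>"
        proof (intro exI allI impI)
          fix l
          let ?T = "tail_prod n (C y) k l"
          have Tc: "?T \<in> carrier_mat n n" by (rule Q_carrier)
          have eq: "M - 1\<^sub>m n = (M * ?T - 1\<^sub>m n) - M * (?T - 1\<^sub>m n)"
            using Mc Tc by (subst mult_minus_distrib_mat[of _ n n]) (auto intro!: eq_matI)
          have "nrm n (M - 1\<^sub>m n) \<le> nrm n (M * ?T - 1\<^sub>m n) + nrm n (M * (?T - 1\<^sub>m n))"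
            unfolding eq by (rule nrm_diff) (use Mc Tc in auto)
          also have "nrm n (M * (?T - 1\<^sub>m n)) \<le> nrm n M * nrm n (?T - 1\<^sub>m n)"
            using Mc Tc by (intro nrm_mult) auto
          also have "nrm n M * nrm n (?T - 1\<^sub>m n) \<le> nrm n M * \<theta>" using T by (intro mult_left_mono) auto
          finally have "nrm n (M - 1\<^sub>m n) \<le> ?E l" by simp
          moreover have "(real n + nrm n (M - 1\<^sub>m n) - nrm n M) * \<theta> \<ge> 0"
            using nrm_le_one_plus[OF Mc] \<theta>4 by (intro mult_nonneg_nonneg) auto
          ultimately show "nrm n (M - 1\<^sub>m n) \<le> ?E l + (real n + nrm n (M - 1\<^sub>m n) - nrm n M) * \<theta>" by linarith
        qed
      qed
      have "nrm n (M - 1\<^sub>m n) * \<theta> \<le> nrm n (M - 1\<^sub>m n) * (1 / 4)" using \<theta>4 by (intro mult_left_mono) auto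
      then have M2: "nrm n (M - 1\<^sub>m n) \<le> 2 * real n * \<theta>"
      proof -
        have "nrm n (M - 1\<^sub>m n) \<le> real n * \<theta> + nrm n (M - 1\<^sub>m n) * \<theta>" using M1 by (simp only: distrib_right)
        moreover have "real n * \<theta> \<ge> 0" using \<theta>4 by simp
        ultimately show ?thesis using \<open>nrm n (M - 1\<^sub>m n) * \<theta> \<le> _\<close> by linarith
      qed
      have "w k * side b y \<le> 1" using \<theta>4 wy by (simp add: \<theta>_def)
      then have "nrm n (B k (y, t) - 1\<^sub>m n) \<le> w k * side b y" using small[OF yhalf t, of k] by (simp add: w_def)
      also have "\<dots> \<le> \<theta>" unfolding \<theta>_def using wy by linarith
      finally have Bk: "nrm n (B k (y, t) - 1\<^sub>m n) \<le> \<theta>" .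
      have Bc: "B k (y, t) \<in> carrier_mat n n" using glhD(3)[OF B] ys t by auto
      have Hk: "H k (x, t) = M * B k (y, t)" by (simp add: H_def M_def y_def)
      have "norm (H k (x, t) $$ (i, j) - 1\<^sub>m n $$ (i, j)) \<le> nrm n (H k (x, t) - 1\<^sub>m n)"
        using nrm_entry[OF ij, of "H k (x, t) - 1\<^sub>m n"] ij Hk by simp
      also have "\<dots> \<le> nrm n (M - 1\<^sub>m n) + nrm n (B k (y, t) - 1\<^sub>m n) + nrm n (M - 1\<^sub>m n) * nrm n (B k (y, t) - 1\<^sub>m n)"
        unfolding Hk by (rule nrm_mult_minus_one[OF Mc Bc])
      also have "\<dots> \<le> 2 * real n * \<theta> + \<theta> + 2 * real n * \<theta> * (1 / 4)"
        using M2 Bk \<theta>4 by (intro add_mono mult_mono) auto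
      also have "\<dots> \<le> 2 * (real n + 1) * 2 * \<theta>" using \<theta>4 by (simp add: algebra_simps)
      also have "\<dots> \<le> 2 * (real n + 1) * 2 * (e / (2 * (real n + 1) * 2))"
        using \<theta>4 by (intro mult_left_mono) (auto simp: e'_def)
      also have "\<dots> = e" by (simp add: field_simps)
      finally show "norm (H k (x, t) $$ (i, j) - 1\<^sub>m n $$ (i, j)) \<le> e" .
    qed
  qed
  then show ?thesis
  proof (rule isotopic_cong)
    fix x assume x: "x \<in> sol"
    have "\<sigma> 0 0 = 1" by (simp add: \<sigma>_def)
    then show "H 0 (x, 0) = f x" using x holD(1)[OF f x] by (simp add: H_def rescale_1 B0)
  qed auto
qed

end

subsection \<open>Elementary factors\<close>

definition elementary :: "nat \<Rightarrow> nat \<Rightarrow> nat \<Rightarrow> complex \<Rightarrow> complex mat" where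
  "elementary n i j c = mat n n (\<lambda>(a, b). (if a = b then 1 else 0) + (if a = i \<and> b = j then c else 0))"

lemma elem_carrier [simp]: "elementary n i j c \<in> carrier_mat n n"
  by (simp add: elementary_def)

lemma elem_mult:
  assumes "i < n" "j < n"
  shows "elementary n i j c * elementary n i j d = elementary n i j (c + d + (if i = j then c * d else 0))"
proof (rule eq_matI)
  fix a b assume "a < dim_row (elementary n i j (c + d + (if i = j then c * d else 0)))"
    "b < dim_col (elementary n i j (c + d + (if i = j then c * d else 0)))"
  then have ab: "a < n" "b < n" by (auto simp: elementary_def)
  have "(elementary n i j c * elementary n i j d) $$ (a, b) =
      (\<Sum>k<n. (if k = a then (if a = b then 1 else 0) + (if a = i \<and> b = j then d else 0) else 0) +
             (if k = j then (if a = i then c * ((if j = b then 1 else 0) + (if j = i \<and> b = j then d else 0)) else 0) else 0))"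
    unfolding mat_mult_index[OF elem_carrier elem_carrier ab]
    by (intro sum.cong refl) (use ab assms in \<open>auto simp: elementary_def algebra_simps\<close>)
  also have "\<dots> = (if a = b then 1 else 0) + (if a = i \<and> b = j then d else 0) +
      (if a = i then c * ((if j = b then 1 else 0) + (if j = i \<and> b = j then d else 0)) else 0)"
    using ab assms by (simp only: sum.distrib sum.delta[OF finite_lessThan] lessThan_iff if_True)
  also have "\<dots> = elementary n i j (c + d + (if i = j then c * d else 0)) $$ (a, b)"
    using ab by (auto simp: elementary_def algebra_simps)
  finally show "(elementary n i j c * elementary n i j d) $$ (a, b) = elementary n i j (c + d + (if i = j then c * d else 0)) $$ (a, b)" .
qed (auto simp: elementary_def)

lemma elem_0: "elementary n i j 0 = 1\<^sub>m n"
  by (rule eq_matI) (auto simp: elementary_def)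

lemma det_elem:
  assumes "i < n" "j < n" "i = j \<Longrightarrow> c \<noteq> -1"
  shows "det (elementary n i j c) \<noteq> 0"
proof -
  define d where "d = (if i = j then - c / (1 + c) else - c)"
  have "c + d + (if i = j then c * d else 0) = 0"
  proof (cases "i = j")
    case True
    then have "1 + c \<noteq> 0" using assms(3) by (simp add: add_eq_0_iff)
    then have "d * (1 + c) = - c" using True by (simp add: d_def)
    moreover have "c + d + c * d = c + d * (1 + c)" by (simp add: algebra_simps)
    ultimately show ?thesis using True by simp
  qed (simp add: d_def)
  then have "elementary n i j c * elementary n i j d = 1\<^sub>m n" using elem_mult[OF assms(1,2), of c d] elem_0 by simp
  then show ?thesis by (rule det_nonzero_of_mult_eq_1[OF elem_carrier elem_carrier])
qed

lemma nrm_elem_minus_one: "i < n \<Longrightarrow> j < n \<Longrightarrow> nrm n (elementary n i j c - 1\<^sub>m n) = norm c"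
proof -
  assume ij: "i < n" "j < n"
  have "nrm n (elementary n i j c - 1\<^sub>m n) = (\<Sum>a<n. \<Sum>b<n. if a = i then (if b = j then norm c else 0) else 0)"
    unfolding nrm_def by (intro sum.cong refl) (auto simp: elementary_def)
  also have "\<dots> = (\<Sum>a<n. if a = i then norm c else 0)"
    using ij by (intro sum.cong refl) (auto simp: sum.delta)
  finally show ?thesis using ij by (simp add: sum.delta)
qed

lemma glh_elem:
  assumes f: "lh D f" and "i < n" "j < n" and ne: "\<And>p. p \<in> D \<Longrightarrow> i = j \<Longrightarrow> f p \<noteq> -1"
  shows "glh n D (\<lambda>p. elementary n i j (f p))"
  unfolding glh_def
proof (intro conjI ballI mlhI)
  show "D \<subseteq> sol \<times> UNIV" by (rule lhD(3)[OF f])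
  show "lh D (\<lambda>p. elementary n i j (f p) $$ (a, b))" if ab: "a < n" "b < n" for a b
  proof -
    have "lh D (\<lambda>p. (if a = b then 1 else 0) + (if a = i \<and> b = j then 1 else 0) * f p)"
      by (intro lh_add lh_mult lh_const f lhD(3)[OF f])
    then show ?thesis by (rule lh_cong) (use ab in \<open>auto simp: elementary_def\<close>)
  qed
  show "det (elementary n i j (f p)) \<noteq> 0" if "p \<in> D" for p using assms(2,3) ne[OF that] by (rule det_elem)
qed simp

text \<open>
  A product of one elementary factor for every position, which agrees with \<open>1 - P\<close> up to a
  quadratic error.  It is invertible whatever the entries of \<open>P\<close> are, because the factors on the
  diagonal are exponentials.
\<close>

definition entry_factor :: "(nat \<Rightarrow> nat \<Rightarrow> complex) \<Rightarrow> nat \<times> nat \<Rightarrow> complex" where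
  "entry_factor P ij = (if fst ij = snd ij then exp (- P (fst ij) (snd ij)) - 1 else - P (fst ij) (snd ij))"

fun elem_prod :: "nat \<Rightarrow> (nat \<times> nat \<Rightarrow> complex) \<Rightarrow> (nat \<times> nat) list \<Rightarrow> complex mat" where
  "elem_prod n c [] = 1\<^sub>m n"
| "elem_prod n c (ij # xs) = elementary n (fst ij) (snd ij) (c ij) * elem_prod n c xs"

abbreviation positions :: "nat \<Rightarrow> (nat \<times> nat) list" where
  "positions n \<equiv> List.product [0..<n] [0..<n]"

definition quasi_exp :: "nat \<Rightarrow> (nat \<Rightarrow> nat \<Rightarrow> complex) \<Rightarrow> complex mat" where
  "quasi_exp n P = elem_prod n (entry_factor P) (positions n)"

lemma elem_prod_carrier [simp]: "elem_prod n c xs \<in> carrier_mat n n"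
  by (induction xs) (auto intro!: mult_carrier_mat)

definition unit_sum :: "nat \<Rightarrow> (nat \<times> nat \<Rightarrow> complex) \<Rightarrow> (nat \<times> nat) list \<Rightarrow> complex mat" where
  "unit_sum n c xs = mat n n (\<lambda>(a, b). \<Sum>ij\<leftarrow>xs. if ij = (a, b) then c ij else 0)"

lemma elem_prod_estimate:
  assumes "set xs \<subseteq> {..<n} \<times> {..<n}" "(\<Sum>ij\<leftarrow>xs. norm (c ij)) \<le> 1"
  shows "nrm n (elem_prod n c xs - 1\<^sub>m n - unit_sum n c xs) \<le> (\<Sum>ij\<leftarrow>xs. norm (c ij))\<^sup>2 \<and>
    nrm n (unit_sum n c xs) \<le> (\<Sum>ij\<leftarrow>xs. norm (c ij))"
  using assms
proof (induction xs)
  case Nil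
  then show ?case by (simp add: nrm_def unit_sum_def)
next
  case (Cons ij xs)
  obtain i j where ij: "ij = (i, j)" by (cases ij)
  have ijn: "i < n" "j < n" using Cons.prems ij by auto
  let ?S = "\<Sum>ij\<leftarrow>xs. norm (c ij)"
  have S0: "?S \<ge> 0" by (intro sum_list_nonneg) auto
  have S1: "norm (c ij) + ?S \<le> 1" using Cons.prems by simp
  have IH: "nrm n (elem_prod n c xs - 1\<^sub>m n - unit_sum n c xs) \<le> ?S\<^sup>2" "nrm n (unit_sum n c xs) \<le> ?S"
  proof -
    have "set xs \<subseteq> {..<n} \<times> {..<n}" "?S \<le> 1" using Cons.prems(1) S1 norm_ge_zero[of "c ij"] by (simp, linarith)
    from Cons.IH[OF this] show "nrm n (elem_prod n c xs - 1\<^sub>m n - unit_sum n c xs) \<le> ?S\<^sup>2" "nrm n (unit_sum n c xs) \<le> ?S"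
      by blast+
  qed
  let ?E = "elementary n i j (c ij)" and ?P = "elem_prod n c xs" and ?U = "unit_sum n c xs"
  have U: "?U \<in> carrier_mat n n" by (simp add: unit_sum_def)
  have E: "?E \<in> carrier_mat n n" by simp
  have P: "?P \<in> carrier_mat n n" by simp
  have Ucons: "unit_sum n c (ij # xs) = (?E - 1\<^sub>m n) + ?U"
    by (rule eq_matI) (auto simp: unit_sum_def elementary_def ij)
  have E1: "nrm n (?E - 1\<^sub>m n) = norm (c ij)" by (rule nrm_elem_minus_one[OF ijn])
  have "nrm n (unit_sum n c (ij # xs)) \<le> norm (c ij) + ?S"
  proof -
    have "nrm n ((?E - 1\<^sub>m n) + ?U) \<le> nrm n (?E - 1\<^sub>m n) + nrm n ?U" using U by (intro nrm_add) auto
    then show ?thesis unfolding Ucons using E1 IH by linarith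
  qed
  moreover have "nrm n (elem_prod n c (ij # xs) - 1\<^sub>m n - unit_sum n c (ij # xs)) \<le> (norm (c ij) + ?S)\<^sup>2"
  proof -
    have "?E * ?P - 1\<^sub>m n = (?E - 1\<^sub>m n) + (?P - 1\<^sub>m n) + (?E - 1\<^sub>m n) * (?P - 1\<^sub>m n)"
      by (rule mat_mult_minus_one) auto
    then have "elem_prod n c (ij # xs) - 1\<^sub>m n - unit_sum n c (ij # xs) =
        (?P - 1\<^sub>m n - ?U) + (?E - 1\<^sub>m n) * (?P - 1\<^sub>m n)"
      unfolding Ucons using E P U by (intro eq_matI) (auto simp: ij)
    also have "nrm n \<dots> \<le> nrm n (?P - 1\<^sub>m n - ?U) + nrm n ((?E - 1\<^sub>m n) * (?P - 1\<^sub>m n))"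
      using U by (intro nrm_add) auto
    also have "nrm n ((?E - 1\<^sub>m n) * (?P - 1\<^sub>m n)) \<le> nrm n (?E - 1\<^sub>m n) * nrm n (?P - 1\<^sub>m n)"
      by (intro nrm_mult) auto
    also have "nrm n (?P - 1\<^sub>m n) \<le> ?S\<^sup>2 + ?S"
    proof -
      have "?P - 1\<^sub>m n = (?P - 1\<^sub>m n - ?U) + ?U" using U P by (intro eq_matI) auto
      then have "nrm n (?P - 1\<^sub>m n) = nrm n ((?P - 1\<^sub>m n - ?U) + ?U)" by (rule arg_cong)
      also have "\<dots> \<le> nrm n (?P - 1\<^sub>m n - ?U) + nrm n ?U" using U by (intro nrm_add) auto
      finally show ?thesis using IH by linarith
    qed
    also have "?S\<^sup>2 + ?S \<le> 2 * ?S"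
    proof -
      have "?S \<le> 1" using S1 norm_ge_zero[of "c ij"] by linarith
      then have "?S * ?S \<le> 1 * ?S" using S0 by (intro mult_right_mono)
      then show ?thesis by (simp only: power2_eq_square)
    qed
    finally have "nrm n (elem_prod n c (ij # xs) - 1\<^sub>m n - unit_sum n c (ij # xs)) \<le> ?S\<^sup>2 + norm (c ij) * (2 * ?S)"
      using IH E1 by (simp add: mult_left_mono)
    also have "\<dots> \<le> (norm (c ij) + ?S)\<^sup>2" by (simp add: power2_sum)
    finally show ?thesis .
  qed
  ultimately show ?case by simp
qed

lemma norm_exp_minus_one_bounds:
  fixes z :: complex
  assumes "norm z \<le> 1"
  shows "norm (exp z - 1) \<le> 3 * norm z" "norm (exp z - 1 - z) \<le> 3 * (norm z)\<^sup>2"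
proof -
  have "\<bar>Re z\<bar> \<le> 1" using abs_Re_le_cmod[of z] assms by linarith
  then have e: "exp \<bar>Re z\<bar> \<le> 3" using exp_le exp_le_cancel_iff order_trans by blast
  have "norm (exp z - 1) \<le> exp \<bar>Re z\<bar> * norm z" using Taylor_exp[of z 0] by simp
  also have "\<dots> \<le> 3 * norm z" using e by (intro mult_right_mono) auto
  finally show "norm (exp z - 1) \<le> 3 * norm z" .
  have "norm (exp z - 1 - z) \<le> exp \<bar>Re z\<bar> * (norm z)\<^sup>2"
    using Taylor_exp[of z 1] by (simp add: diff_diff_eq power2_eq_square)
  also have "\<dots> \<le> 3 * (norm z)\<^sup>2" using e by (intro mult_right_mono) auto
  finally show "norm (exp z - 1 - z) \<le> 3 * (norm z)\<^sup>2" .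
qed

lemma sum_positions: "(\<Sum>ij\<leftarrow>positions n. f ij) = (\<Sum>i<n. \<Sum>j<n. f (i, j))"
proof -
  have "(\<Sum>ij\<leftarrow>positions n. f ij) = sum f (set (positions n))"
    by (rule sum_list_distinct_conv_sum_set) (simp add: distinct_product)
  also have "\<dots> = (\<Sum>i<n. \<Sum>j<n. f (i, j))"
    by (simp add: sum.cartesian_product lessThan_atLeast0)
  finally show ?thesis .
qed

lemma quasi_exp_carrier [simp]: "quasi_exp n P \<in> carrier_mat n n"
  by (simp add: quasi_exp_def)

lemma quasi_exp_0: "quasi_exp n (\<lambda>i j. 0) = 1\<^sub>m n"
proof -
  have "elem_prod n (entry_factor (\<lambda>i j. 0)) xs = 1\<^sub>m n" for xs
    by (induction xs) (auto simp: entry_factor_def elem_0)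
  then show ?thesis by (simp add: quasi_exp_def)
qed

lemma quasi_exp_estimate:
  fixes P :: "nat \<Rightarrow> nat \<Rightarrow> complex" and n :: nat
  defines "s \<equiv> \<Sum>i<n. \<Sum>j<n. norm (P i j)"
  assumes s: "s \<le> 1 / 3"
  shows "nrm n (quasi_exp n P - 1\<^sub>m n) \<le> 6 * s"
    and "nrm n (quasi_exp n P - 1\<^sub>m n + mat n n (\<lambda>(i, j). P i j)) \<le> 12 * s\<^sup>2"
proof -
  let ?c = "entry_factor P" and ?U = "unit_sum n (entry_factor P) (positions n)" and ?P = "mat n n (\<lambda>(i, j). P i j)"
  let ?S = "\<Sum>ij\<leftarrow>positions n. norm (?c ij)"
  have s0: "s \<ge> 0" unfolding s_def by (intro sum_nonneg) auto
  have Ps: "norm (P i j) \<le> s" if "i < n" "j < n" for i j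
    unfolding s_def
    by (rule order_trans[OF member_le_sum[of j "{..<n}" "\<lambda>j. norm (P i j)"]
          member_le_sum[of i "{..<n}" "\<lambda>i. \<Sum>j<n. norm (P i j)"]]) (use that in \<open>auto intro: sum_nonneg\<close>)
  have c1: "norm (?c (i, j)) \<le> 3 * norm (P i j)" "norm (?c (i, j) + P i j) \<le> 3 * s * norm (P i j)" if ij: "i < n" "j < n" for i j
  proof -
    have P1: "norm (- P i j) \<le> 1" using Ps[OF ij] s by simp
    have "3 * (norm (P i j))\<^sup>2 \<le> 3 * s * norm (P i j)"
      using Ps[OF ij] by (simp add: power2_eq_square mult_right_mono)
    then show "norm (?c (i, j)) \<le> 3 * norm (P i j)" "norm (?c (i, j) + P i j) \<le> 3 * s * norm (P i j)"
      using norm_exp_minus_one_bounds[OF P1] s0 by (auto simp: entry_factor_def)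
  qed
  have S: "?S \<le> 3 * s"
    unfolding sum_positions s_def sum_distrib_left by (intro sum_mono c1) auto
  have S0: "?S \<ge> 0" by (intro sum_list_nonneg) auto
  have est: "nrm n (quasi_exp n P - 1\<^sub>m n - ?U) \<le> ?S\<^sup>2" "nrm n ?U \<le> ?S"
  proof -
    have "set (positions n) \<subseteq> {..<n} \<times> {..<n}" by auto
    moreover have "?S \<le> 1" using S s by linarith
    ultimately have "nrm n (elem_prod n ?c (positions n) - 1\<^sub>m n - ?U) \<le> ?S\<^sup>2 \<and> nrm n ?U \<le> ?S"
      by (rule elem_prod_estimate)
    then show "nrm n (quasi_exp n P - 1\<^sub>m n - ?U) \<le> ?S\<^sup>2" "nrm n ?U \<le> ?S"
      by (simp_all add: quasi_exp_def)
  qed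
  have "?S\<^sup>2 \<le> (3 * s)\<^sup>2" using S S0 by (intro power_mono) auto
  then have est1: "nrm n (quasi_exp n P - 1\<^sub>m n - ?U) \<le> 9 * s\<^sup>2" using est by (simp add: power_mult_distrib)
  have U: "?U \<in> carrier_mat n n" by (simp add: unit_sum_def)
  have Uij: "?U $$ (i, j) = ?c (i, j)" if "i < n" "j < n" for i j
  proof -
    have "?U $$ (i, j) = (\<Sum>a<n. \<Sum>b<n. if (a, b) = (i, j) then ?c (a, b) else 0)"
      using that sum_positions[of "\<lambda>ij. if ij = (i, j) then ?c ij else 0" n] by (simp add: unit_sum_def)
    also have "\<dots> = (\<Sum>a<n. if a = i then ?c (i, j) else 0)"
      using that by (intro sum.cong refl) (auto simp: sum.delta)
    finally show ?thesis using that by (simp add: sum.delta)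
  qed
  have "nrm n (?U + ?P) = (\<Sum>i<n. \<Sum>j<n. norm (?c (i, j) + P i j))"
    unfolding nrm_def using U by (intro sum.cong refl) (auto simp: Uij)
  also have "\<dots> \<le> (\<Sum>i<n. \<Sum>j<n. 3 * s * norm (P i j))" by (intro sum_mono c1) auto
  also have "\<dots> = 3 * s * (\<Sum>i<n. \<Sum>j<n. norm (P i j))" by (simp only: sum_distrib_left)
  also have "\<dots> = 3 * s\<^sup>2" by (simp add: power2_eq_square flip: s_def)
  finally have UP: "nrm n (?U + ?P) \<le> 3 * s\<^sup>2" .
  have eq: "(quasi_exp n P - 1\<^sub>m n - ?U) + ?U = quasi_exp n P - 1\<^sub>m n"
    using U quasi_exp_carrier[of n P] by (intro eq_matI) auto
  have "nrm n ((quasi_exp n P - 1\<^sub>m n - ?U) + ?U) \<le> nrm n (quasi_exp n P - 1\<^sub>m n - ?U) + nrm n ?U"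
    using U by (intro nrm_add) auto
  then have "nrm n (quasi_exp n P - 1\<^sub>m n) \<le> nrm n (quasi_exp n P - 1\<^sub>m n - ?U) + nrm n ?U"
    unfolding eq .
  also have "\<dots> \<le> 9 * s\<^sup>2 + 3 * s" using est est1 S by linarith
  also have "9 * s\<^sup>2 \<le> 3 * s" using s s0 mult_right_mono[of s "1 / 3" s] by (simp add: power2_eq_square)
  finally show "nrm n (quasi_exp n P - 1\<^sub>m n) \<le> 6 * s" by simp
  have eq2: "(quasi_exp n P - 1\<^sub>m n - ?U) + (?U + ?P) = quasi_exp n P - 1\<^sub>m n + ?P"
    using U quasi_exp_carrier[of n P] by (intro eq_matI) auto
  have "nrm n ((quasi_exp n P - 1\<^sub>m n - ?U) + (?U + ?P)) \<le> nrm n (quasi_exp n P - 1\<^sub>m n - ?U) + nrm n (?U + ?P)"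
    using U by (intro nrm_add) auto
  then have "nrm n (quasi_exp n P - 1\<^sub>m n + ?P) \<le> nrm n (quasi_exp n P - 1\<^sub>m n - ?U) + nrm n (?U + ?P)"
    unfolding eq2 .
  then show "nrm n (quasi_exp n P - 1\<^sub>m n + ?P) \<le> 12 * s\<^sup>2" using est1 UP by linarith
qed

lemma glh_quasi_exp:
  assumes D: "D \<subseteq> sol \<times> UNIV" and P: "\<And>i j. i < n \<Longrightarrow> j < n \<Longrightarrow> lh D (\<lambda>p. P p i j)"
  shows "glh n D (\<lambda>p. quasi_exp n (P p))"
proof -
  have "glh n D (\<lambda>p. elem_prod n (entry_factor (P p)) xs)" if "set xs \<subseteq> {..<n} \<times> {..<n}" for xs
    using that
  proof (induction xs)
    case Nil
    then show ?case using D by (simp add: glh_one)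
  next
    case (Cons ij xs)
    obtain i j where ij: "ij = (i, j)" by (cases ij)
    then have ijn: "i < n" "j < n" using Cons.prems by auto
    have "lh D (\<lambda>p. entry_factor (P p) (i, j))"
      using P[OF ijn] D by (cases "i = j") (auto simp: entry_factor_def intro!: lh_diff lh_exp lh_uminus)
    then have "glh n D (\<lambda>p. elementary n i j (entry_factor (P p) (i, j)))"
      by (rule glh_elem[OF _ ijn]) (simp add: entry_factor_def)
    then show ?case using Cons by (auto simp: ij intro: glh_mult)
  qed
  from this[of "positions n"] show ?thesis by (simp add: quasi_exp_def lessThan_atLeast0)
qed

subsection \<open>One step of the factorisation\<close>

text \<open>
  A generous bound for the number of entries times the constants of \<open>shol_split\<close>.
\<close>

definition kap :: "nat \<Rightarrow> real" where "kap n = 64 * (real (n * n) + 1)"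

lemma kap_ge: "kap n \<ge> 64" by (simp add: kap_def)

text \<open>
  Entrywise \<open>h - 1 = u + v\<close> up to a small error, and \<open>A\<close> and \<open>B\<close> agree with \<open>1 - u\<close> and \<open>1 - v\<close> up to
  quadratic errors.  In \<open>A h B\<close> the linear terms cancel, and the quadratic ones are at most \<open>\<epsilon> / 4\<close> by
  the assumption on \<open>\<epsilon>\<close>.
\<close>

lemma factorisation_step:
  assumes h: "hol n h" and \<epsilon>: "0 < \<epsilon>" "432 * (kap n)\<^sup>2 * \<epsilon> \<le> 1"
    and near: "\<And>x. x \<in> shell 2 \<Longrightarrow> nrm n (h x - 1\<^sub>m n) \<le> \<epsilon>"
  obtains A B where "glh n cyl A" "glh n cyl B"
    "\<And>x. x \<in> sol \<Longrightarrow> A (x, 0) = 1\<^sub>m n" "\<And>x. x \<in> sol \<Longrightarrow> B (x, 0) = 1\<^sub>m n"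
    "\<And>x t. x \<in> sol \<Longrightarrow> height x \<le> 2 \<Longrightarrow> t \<in> {0..1} \<Longrightarrow> nrm n (A (x, t) - 1\<^sub>m n) \<le> 6 * kap n * \<epsilon>"
    "\<And>x t. x \<in> sol \<Longrightarrow> 1 / 2 \<le> height x \<Longrightarrow> t \<in> {0..1} \<Longrightarrow> 6 * kap n * \<epsilon> * height x \<le> 1 \<Longrightarrow>
      nrm n (B (x, t) - 1\<^sub>m n) \<le> 6 * kap n * \<epsilon> * height x"
    "\<And>x. x \<in> shell 2 \<Longrightarrow> nrm n (A (x, 1) * h x * B (x, 1) - 1\<^sub>m n) \<le> \<epsilon> / 2"
proof -
  \<comment> \<open>the splitting errors of all entries together stay below \<open>\<epsilon> / 4\<close>\<close>
  define \<eta> where "\<eta> = \<epsilon> / (4 * (real (n * n) + 1))"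
  have \<eta>: "0 < \<eta>" "\<eta> \<le> \<epsilon>" "real (n * n) * \<eta> \<le> \<epsilon> / 4"
  proof -
    show "0 < \<eta>" using \<epsilon> by (simp add: \<eta>_def add_nonneg_pos)
    have N: "1 \<le> real (n * n) + 1" by simp
    have "4 * (real (n * n) + 1) * \<eta> = \<epsilon>" unfolding \<eta>_def using N by (simp del: of_nat_mult)
    then have eq: "4 * (real (n * n) * \<eta>) + 4 * \<eta> = \<epsilon>" by (simp only: distrib_left distrib_right mult.assoc mult_1)
    moreover have "real (n * n) * \<eta> \<ge> 0" using \<open>0 < \<eta>\<close> by simp
    ultimately show "\<eta> \<le> \<epsilon>" "real (n * n) * \<eta> \<le> \<epsilon> / 4" using \<open>0 < \<eta>\<close> by linarith+
  qed
  have hs: "shol (\<lambda>x. h x $$ (i, j))" if "i < n" "j < n" for i j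
    using glhD(5)[OF h[unfolded hol_def] that] .
  have gs: "shol (\<lambda>x. h x $$ (i, j) - 1\<^sub>m n $$ (i, j))" if "i < n" "j < n" for i j
    by (intro lh_diff hs that lh_const) auto
  define \<Phi> where "\<Phi> i j u v \<longleftrightarrow> shol u \<and> shol v \<and>
      (\<forall>x\<in>shell 2. norm ((h x $$ (i, j) - 1\<^sub>m n $$ (i, j)) - u x - v x) \<le> \<eta>) \<and>
      (\<forall>x\<in>sol. height x \<le> 2 \<longrightarrow> norm (u x) \<le> 14 * \<epsilon>) \<and>
      (\<forall>x\<in>sol. 1 / 2 \<le> height x \<longrightarrow> norm (v x) \<le> 32 * \<epsilon> * height x)" for i j u v
  have "\<exists>u v. \<Phi> i j u v" if ij: "i < n" "j < n" for i j
  proof -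
    have b: "norm (h x $$ (i, j) - 1\<^sub>m n $$ (i, j)) \<le> \<epsilon>" if "x \<in> shell 2" for x
    proof -
      have "x \<in> sol" using that by (simp add: shell_def)
      then have "norm ((h x - 1\<^sub>m n) $$ (i, j)) \<le> \<epsilon>"
        using nrm_entry[OF ij, of "h x - 1\<^sub>m n"] near[OF that] by linarith
      then show ?thesis using ij holD(1)[OF h \<open>x \<in> sol\<close>] by simp
    qed
    obtain u v where uv: "shol u" "shol v" "\<And>x. x \<in> shell 2 \<Longrightarrow> norm ((h x $$ (i, j) - 1\<^sub>m n $$ (i, j)) - u x - v x) \<le> \<eta>"
      "\<And>x. x \<in> sol \<Longrightarrow> height x \<le> 2 \<Longrightarrow> norm (u x) \<le> 7 * (\<epsilon> + \<eta>)"
      "\<And>x. x \<in> sol \<Longrightarrow> 1 / 2 \<le> height x \<Longrightarrow> norm (v x) \<le> 16 * (\<epsilon> + \<eta>) * height x"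
      using shol_split[OF gs[OF ij] b \<eta>(1)] by blast
    have "norm (v x) \<le> 32 * \<epsilon> * height x" if "x \<in> sol" "1 / 2 \<le> height x" for x
    proof -
      have "16 * (\<epsilon> + \<eta>) * height x \<le> 32 * \<epsilon> * height x"
        using \<eta>(2) that by (intro mult_right_mono) auto
      then show ?thesis using uv(5)[OF that] by linarith
    qed
    moreover have "norm (u x) \<le> 14 * \<epsilon>" if "x \<in> sol" "height x \<le> 2" for x
    proof -
      have "7 * (\<epsilon> + \<eta>) \<le> 14 * \<epsilon>" using \<eta>(2) by simp
      then show ?thesis using uv(4)[OF that] by (rule order_trans[rotated])
    qed
    ultimately show ?thesis using uv(1,2,3) unfolding \<Phi>_def by blast
  qed
  then obtain U V where UV0: "\<And>i j. i < n \<Longrightarrow> j < n \<Longrightarrow> \<Phi> i j (U i j) (V i j)"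
    by metis
  then have UV: "\<And>i j. i < n \<Longrightarrow> j < n \<Longrightarrow> shol (U i j)" "\<And>i j. i < n \<Longrightarrow> j < n \<Longrightarrow> shol (V i j)"
    "\<And>i j x. i < n \<Longrightarrow> j < n \<Longrightarrow> x \<in> shell 2 \<Longrightarrow> norm ((h x $$ (i, j) - 1\<^sub>m n $$ (i, j)) - U i j x - V i j x) \<le> \<eta>"
    "\<And>i j x. i < n \<Longrightarrow> j < n \<Longrightarrow> x \<in> sol \<Longrightarrow> height x \<le> 2 \<Longrightarrow> norm (U i j x) \<le> 14 * \<epsilon>"
    "\<And>i j x. i < n \<Longrightarrow> j < n \<Longrightarrow> x \<in> sol \<Longrightarrow> 1 / 2 \<le> height x \<Longrightarrow> norm (V i j x) \<le> 32 * \<epsilon> * height x"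
    by (simp_all add: \<Phi>_def)
  define A where "A p = quasi_exp n (\<lambda>i j. of_real (snd p) * U i j (fst p))" for p
  define B where "B p = quasi_exp n (\<lambda>i j. of_real (snd p) * V i j (fst p))" for p
  define su where "su x = (\<Sum>i<n. \<Sum>j<n. norm (U i j x))" for x
  define sv where "sv x = (\<Sum>i<n. \<Sum>j<n. norm (V i j x))" for x
  have sum_le: "(\<Sum>i<n. \<Sum>j<n. norm (F i j)) \<le> real (n * n) * c" if "\<And>i j. i < n \<Longrightarrow> j < n \<Longrightarrow> norm (F i j) \<le> c"
    for F :: "nat \<Rightarrow> nat \<Rightarrow> complex" and c
  proof -
    have "(\<Sum>i<n. \<Sum>j<n. norm (F i j)) \<le> (\<Sum>i<n. \<Sum>j<n. c)" using that by (intro sum_mono) auto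
    then show ?thesis by (simp add: mult.assoc)
  qed
  have kn: "real (n * n) * c \<le> kap n / 64 * c" if "c \<ge> 0" for c
    using that by (intro mult_right_mono) (auto simp: kap_def)
  have su: "su x \<le> kap n * \<epsilon>" if "x \<in> sol" "height x \<le> 2" for x
  proof -
    have "su x \<le> real (n * n) * (14 * \<epsilon>)" unfolding su_def using that UV(4) by (intro sum_le) auto
    also have "\<dots> \<le> kap n / 64 * (14 * \<epsilon>)" using \<epsilon> by (intro kn) auto
    also have "\<dots> \<le> kap n * \<epsilon>" using \<epsilon> kap_ge[of n] by simp
    finally show ?thesis .
  qed
  have sv: "sv x \<le> kap n * \<epsilon> * height x / 2" if "x \<in> sol" "1 / 2 \<le> height x" for x
  proof -
    have "sv x \<le> real (n * n) * (32 * \<epsilon> * height x)" unfolding sv_def using that UV(5) by (intro sum_le) auto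
    also have "\<dots> \<le> kap n / 64 * (32 * \<epsilon> * height x)" using \<epsilon> that by (intro kn) auto
    finally show ?thesis by (simp add: mult_ac)
  qed
  have scale: "(\<Sum>i<n. \<Sum>j<n. norm (of_real t * F i j)) \<le> (\<Sum>i<n. \<Sum>j<n. norm (F i j))" if "t \<in> {0..1}"
    for t and F :: "nat \<Rightarrow> nat \<Rightarrow> complex"
    using that by (intro sum_mono) (auto simp: norm_mult intro: mult_left_le_one_le)
  have ke: "kap n * \<epsilon> \<le> 1 / 432 / 64"
  proof -
    have "64 * (kap n * \<epsilon>) \<le> kap n * (kap n * \<epsilon>)" using kap_ge[of n] \<epsilon> by (intro mult_right_mono) auto
    then show ?thesis using \<epsilon>(2) by (simp add: power2_eq_square mult.assoc)
  qed
  have lhP: "lh cyl (\<lambda>p. of_real (snd p) * f (fst p))" if "shol f" for f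
    by (intro lh_mult that lh_time[where T = UNIV] continuous_intros) auto
  show ?thesis
  proof (rule that[of A B])
    show "glh n cyl A" "glh n cyl B" unfolding A_def B_def
      by (intro glh_quasi_exp lhP UV; auto)+
    show "A (x, 0) = 1\<^sub>m n" "B (x, 0) = 1\<^sub>m n" for x by (simp_all add: A_def B_def quasi_exp_0)
    show "nrm n (A (x, t) - 1\<^sub>m n) \<le> 6 * kap n * \<epsilon>" if "x \<in> sol" "height x \<le> 2" "t \<in> {0..1}" for x t
    proof -
      have s: "(\<Sum>i<n. \<Sum>j<n. norm (of_real t * U i j x)) \<le> kap n * \<epsilon>"
        using scale[OF that(3), of "\<lambda>i j. U i j x"] su[OF that(1,2)] unfolding su_def by linarith
      then have "nrm n (A (x, t) - 1\<^sub>m n) \<le> 6 * (\<Sum>i<n. \<Sum>j<n. norm (of_real t * U i j x))"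
        unfolding A_def fst_conv snd_conv using ke by (intro quasi_exp_estimate(1)) simp
      then show ?thesis using s by linarith
    qed
    show "nrm n (B (x, t) - 1\<^sub>m n) \<le> 6 * kap n * \<epsilon> * height x"
      if "x \<in> sol" "1 / 2 \<le> height x" "t \<in> {0..1}" "6 * kap n * \<epsilon> * height x \<le> 1" for x t
    proof -
      have s: "(\<Sum>i<n. \<Sum>j<n. norm (of_real t * V i j x)) \<le> kap n * \<epsilon> * height x / 2"
        using scale[OF that(3), of "\<lambda>i j. V i j x"] sv[OF that(1,2)] unfolding sv_def by linarith
      then have "nrm n (B (x, t) - 1\<^sub>m n) \<le> 6 * (\<Sum>i<n. \<Sum>j<n. norm (of_real t * V i j x))"
        unfolding B_def fst_conv snd_conv using that(4) by (intro quasi_exp_estimate(1)) simp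
      moreover have "kap n * \<epsilon> * height x \<ge> 0" using kap_ge[of n] \<epsilon> that(2) by simp
      ultimately show ?thesis using s by linarith
    qed
    fix x assume x: "x \<in> shell 2"
    then have xs: "x \<in> sol" "height x \<le> 2" "1 / 2 \<le> height x" by (auto simp: shell_def)
    define s where "s = kap n * \<epsilon>"
    have s0: "s > 0" using kap_ge[of n] \<epsilon> by (simp add: s_def)
    have \<epsilon>s: "\<epsilon> \<le> s" unfolding s_def using kap_ge[of n] \<epsilon> by simp
    have s13: "s \<le> 1 / 432 / 64" using ke by (simp add: s_def)
    have su': "su x \<le> s" using su xs by (simp add: s_def)
    have sv': "sv x \<le> s"
    proof -
      have "kap n * \<epsilon> * height x / 2 \<le> kap n * \<epsilon> * 2 / 2" using s0 xs(2) by (intro divide_right_mono mult_left_mono) (auto simp: s_def)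
      then show ?thesis using sv[OF xs(1,3)] by (simp add: s_def)
    qed
    define a where "a = A (x, 1) - 1\<^sub>m n"
    define g where "g = h x - 1\<^sub>m n"
    define b where "b = B (x, 1) - 1\<^sub>m n"
    define MU where "MU = mat n n (\<lambda>(i, j). U i j x)"
    define MV where "MV = mat n n (\<lambda>(i, j). V i j x)"
    have hx: "h x \<in> carrier_mat n n" by (rule holD(1)[OF h xs(1)])
    have car: "a \<in> carrier_mat n n" "g \<in> carrier_mat n n" "b \<in> carrier_mat n n" "MU \<in> carrier_mat n n" "MV \<in> carrier_mat n n"
      using hx by (auto simp: a_def b_def g_def MU_def MV_def A_def B_def)
    have Ax: "A (x, 1) \<in> carrier_mat n n" and Bx: "B (x, 1) \<in> carrier_mat n n" by (simp_all add: A_def B_def)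
    have su0: "su x \<ge> 0" "sv x \<ge> 0" by (auto simp: su_def sv_def intro!: sum_nonneg)
    have a: "nrm n a \<le> 6 * s" "nrm n (a + MU) \<le> 12 * s\<^sup>2"
    proof -
      have e: "nrm n a \<le> 6 * su x" "nrm n (a + MU) \<le> 12 * (su x)\<^sup>2"
        using quasi_exp_estimate[where P = "\<lambda>i j. U i j x" and n = n] su' s13 by (simp_all add: a_def A_def MU_def su_def)
      have "(su x)\<^sup>2 \<le> s\<^sup>2" using su' su0 by (intro power_mono) auto
      then show "nrm n a \<le> 6 * s" "nrm n (a + MU) \<le> 12 * s\<^sup>2" using e su' by linarith+
    qed
    have b: "nrm n b \<le> 6 * s" "nrm n (b + MV) \<le> 12 * s\<^sup>2"
    proof -
      have e: "nrm n b \<le> 6 * sv x" "nrm n (b + MV) \<le> 12 * (sv x)\<^sup>2"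
        using quasi_exp_estimate[where P = "\<lambda>i j. V i j x" and n = n] sv' s13 by (simp_all add: b_def B_def MV_def sv_def)
      have "(sv x)\<^sup>2 \<le> s\<^sup>2" using sv' su0 by (intro power_mono) auto
      then show "nrm n b \<le> 6 * s" "nrm n (b + MV) \<le> 12 * s\<^sup>2" using e sv' by linarith+
    qed
    have g: "nrm n g \<le> s" using near[OF x] \<epsilon>s by (simp add: g_def)
    have lin: "nrm n (g - MU - MV) \<le> \<epsilon> / 4"
    proof -
      have "nrm n (g - MU - MV) \<le> real (n * n) * \<eta>"
        using UV(3)[OF _ _ x] hx by (intro nrm_le) (auto simp: g_def MU_def MV_def)
      then show ?thesis using \<eta>(3) by linarith
    qed
    have "A (x, 1) * h x - 1\<^sub>m n = a + g + a * g"
      unfolding a_def g_def by (rule mat_mult_minus_one[OF Ax hx])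
    moreover have "A (x, 1) * h x * B (x, 1) - 1\<^sub>m n = (A (x, 1) * h x - 1\<^sub>m n) + b + (A (x, 1) * h x - 1\<^sub>m n) * b"
      unfolding b_def by (rule mat_mult_minus_one[OF mult_carrier_mat[OF Ax hx] Bx])
    ultimately have "A (x, 1) * h x * B (x, 1) - 1\<^sub>m n = (a + g + a * g) + b + (a + g + a * g) * b" by simp
    also have "\<dots> = (g - MU - MV) + (a + MU) + (b + MV) + (a * g + (a + g + a * g) * b)"
    proof -
      have c: "(a + g + a * g) * b \<in> carrier_mat n n" "a * g \<in> carrier_mat n n" using car by auto
      show ?thesis using car c by (intro eq_matI) auto
    qed
    also have "nrm n \<dots> \<le> nrm n (g - MU - MV) + nrm n (a + MU) + nrm n (b + MV) + (nrm n (a * g) + nrm n ((a + g + a * g) * b))"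
    proof -
      have c: "(a + g + a * g) * b \<in> carrier_mat n n" "a * g \<in> carrier_mat n n"
        "g - MU - MV \<in> carrier_mat n n" "a + MU \<in> carrier_mat n n" "b + MV \<in> carrier_mat n n" using car by auto
      have "nrm n ((g - MU - MV) + (a + MU) + (b + MV) + (a * g + (a + g + a * g) * b)) \<le>
          nrm n ((g - MU - MV) + (a + MU) + (b + MV)) + nrm n (a * g + (a + g + a * g) * b)"
        using c by (intro nrm_add) auto
      also have "nrm n (a * g + (a + g + a * g) * b) \<le> nrm n (a * g) + nrm n ((a + g + a * g) * b)"
        using c by (intro nrm_add) auto
      also have "nrm n ((g - MU - MV) + (a + MU) + (b + MV)) \<le> nrm n ((g - MU - MV) + (a + MU)) + nrm n (b + MV)"
        using c by (intro nrm_add) auto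
      also have "nrm n ((g - MU - MV) + (a + MU)) \<le> nrm n (g - MU - MV) + nrm n (a + MU)"
        using c by (intro nrm_add) auto
      finally show ?thesis by simp
    qed
    also have "\<dots> \<le> \<epsilon> / 4 + 12 * s\<^sup>2 + 12 * s\<^sup>2 + (6 * s\<^sup>2 + 78 * s\<^sup>2)"
    proof -
      have ag: "nrm n (a * g) \<le> 6 * s\<^sup>2"
      proof -
        have "nrm n (a * g) \<le> nrm n a * nrm n g" using car by (intro nrm_mult) auto
        also have "\<dots> \<le> (6 * s) * s" using a g s0 by (intro mult_mono) auto
        finally show ?thesis by (simp add: power2_eq_square)
      qed
      have "nrm n (a + g + a * g) \<le> nrm n (a + g) + nrm n (a * g)" using car by (intro nrm_add) auto
      also have "nrm n (a + g) \<le> nrm n a + nrm n g" using car by (intro nrm_add) auto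
      finally have "nrm n (a + g + a * g) \<le> 6 * s + s + 6 * s\<^sup>2" using a g ag by linarith
      also have "6 * s\<^sup>2 \<le> 6 * s" using s0 s13 mult_right_mono[of s 1 s] by (simp add: power2_eq_square)
      finally have q: "nrm n (a + g + a * g) \<le> 13 * s" by simp
      have "nrm n ((a + g + a * g) * b) \<le> nrm n (a + g + a * g) * nrm n b" using car by (intro nrm_mult) auto
      also have "\<dots> \<le> (13 * s) * (6 * s)" using q b s0 by (intro mult_mono) auto
      finally have "nrm n ((a + g + a * g) * b) \<le> 78 * s\<^sup>2" by (simp add: power2_eq_square)
      then show ?thesis using lin a(2) b(2) ag by linarith
    qed
    also have "\<dots> \<le> \<epsilon> / 2"
    proof -
      have "432 * s\<^sup>2 = (432 * (kap n)\<^sup>2 * \<epsilon>) * \<epsilon>" by (simp add: s_def power2_eq_square)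
      also have "\<dots> \<le> 1 * \<epsilon>" using \<epsilon> by (intro mult_right_mono) auto
      finally show ?thesis by linarith
    qed
    finally show "nrm n (A (x, 1) * h x * B (x, 1) - 1\<^sub>m n) \<le> \<epsilon> / 2" .
  qed
qed

subsection \<open>Iterating\<close>

text \<open>
  The steps give \<open>f k = (A\<^sub>k\<^sub>-\<^sub>1 \<cdots> A\<^sub>0) h (B\<^sub>0 \<cdots> B\<^sub>k\<^sub>-\<^sub>1)\<close>, tending to \<open>1\<close> on the shell.  In the limit
  \<open>LA h LB = 1\<close> there, where \<open>LA\<close> is defined near the cusp \<open>0\<close> and \<open>LB\<close> near the cusp \<open>\<infinity>\<close>.  Hence
  \<open>LA\<^sup>-\<^sup>1\<close> and \<open>h LB\<close> glue to a global map \<open>a\<close>.  Both \<open>a\<close> and \<open>a\<^sup>-\<^sup>1 h\<close> are inverse to an infinite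
  product on one half, so that each of them slides to \<open>1\<close>.  Transposition reverses the order of the
  factors \<open>A\<close> and makes the two cases alike.
\<close>

theorem isotopic_one_near_one:
  assumes h: "hol n h" and near: "\<And>x. x \<in> shell 2 \<Longrightarrow> nrm n (h x - 1\<^sub>m n) \<le> 1 / (432 * (kap n)\<^sup>2)"
  shows "isotopic n h (\<lambda>x. 1\<^sub>m n)"
proof -
  define \<epsilon>0 where "\<epsilon>0 = 1 / (432 * (kap n)\<^sup>2)"
  have k0: "kap n > 0" using kap_ge[of n] by linarith
  have \<epsilon>0: "\<epsilon>0 > 0" "432 * (kap n)\<^sup>2 * \<epsilon>0 = 1" using k0 by (simp_all add: \<epsilon>0_def)
  define c where "c = 6 * kap n * \<epsilon>0"
  have c: "c > 0" using k0 \<epsilon>0 by (simp add: c_def)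
  define good where "good k f \<longleftrightarrow> hol n f \<and> (\<forall>x\<in>shell 2. nrm n (f x - 1\<^sub>m n) \<le> \<epsilon>0 / 2 ^ k)" for k :: nat and f
  define step where "step k f f' A B \<longleftrightarrow> glh n cyl A \<and> glh n cyl B \<and>
      (\<forall>x\<in>sol. A (x, 0) = 1\<^sub>m n \<and> B (x, 0) = 1\<^sub>m n) \<and>
      (\<forall>x\<in>sol. \<forall>t\<in>{0..1}. height x \<le> 2 \<longrightarrow> nrm n (A (x, t) - 1\<^sub>m n) \<le> c / 2 ^ k) \<and>
      (\<forall>x\<in>sol. \<forall>t\<in>{0..1}. 1 / 2 \<le> height x \<longrightarrow> c / 2 ^ k * height x \<le> 1 \<longrightarrow>
         nrm n (B (x, t) - 1\<^sub>m n) \<le> c / 2 ^ k * height x) \<and>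
      (\<forall>x. f' x = A (x, 1) * f x * B (x, 1))" for k :: nat and f f' A B
  have "\<exists>f. \<forall>k. good k (f k) \<and> (f 0 = h \<and> (\<exists>A B. step k (f k) (f (Suc k)) A B))"
  proof -
    have "\<exists>f. \<forall>k. (good k (f k) \<and> (k = 0 \<longrightarrow> f k = h)) \<and> (\<exists>A B. step k (f k) (f (Suc k)) A B)"
    proof (rule dependent_nat_choice)
      show "\<exists>f. good 0 f \<and> (0 = 0 \<longrightarrow> f = h)" using h near by (auto simp: good_def \<epsilon>0_def)
      fix f k assume "good k f \<and> (k = 0 \<longrightarrow> f = h)"
      then have f: "hol n f" "\<And>x. x \<in> shell 2 \<Longrightarrow> nrm n (f x - 1\<^sub>m n) \<le> \<epsilon>0 / 2 ^ k" by (auto simp: good_def)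
      have e: "0 < \<epsilon>0 / 2 ^ k" "432 * (kap n)\<^sup>2 * (\<epsilon>0 / 2 ^ k) \<le> 1"
      proof -
        show "0 < \<epsilon>0 / 2 ^ k" using \<epsilon>0 by simp
        have "432 * (kap n)\<^sup>2 * (\<epsilon>0 / 2 ^ k) = 1 / 2 ^ k" using \<epsilon>0(2) by (metis times_divide_eq_right)
        then show "432 * (kap n)\<^sup>2 * (\<epsilon>0 / 2 ^ k) \<le> 1" by simp
      qed
      have ck: "6 * kap n * (\<epsilon>0 / 2 ^ k) = c / 2 ^ k" by (simp add: c_def)
      obtain A B where AB: "glh n cyl A" "glh n cyl B"
        "\<And>x. x \<in> sol \<Longrightarrow> A (x, 0) = 1\<^sub>m n" "\<And>x. x \<in> sol \<Longrightarrow> B (x, 0) = 1\<^sub>m n"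
        "\<And>x t. x \<in> sol \<Longrightarrow> height x \<le> 2 \<Longrightarrow> t \<in> {0..1} \<Longrightarrow> nrm n (A (x, t) - 1\<^sub>m n) \<le> c / 2 ^ k"
        "\<And>x t. x \<in> sol \<Longrightarrow> 1 / 2 \<le> height x \<Longrightarrow> t \<in> {0..1} \<Longrightarrow> c / 2 ^ k * height x \<le> 1 \<Longrightarrow>
          nrm n (B (x, t) - 1\<^sub>m n) \<le> c / 2 ^ k * height x"
        "\<And>x. x \<in> shell 2 \<Longrightarrow> nrm n (A (x, 1) * f x * B (x, 1) - 1\<^sub>m n) \<le> \<epsilon>0 / 2 ^ k / 2"
        by (rule factorisation_step[OF f(1) e f(2), unfolded ck]) (assumption | rule that)+
      define f' where "f' x = A (x, 1) * f x * B (x, 1)" for x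
      have "hol n f'" unfolding f'_def
        by (intro hol_mult f(1) hol_slice[OF AB(1), of 1] hol_slice[OF AB(2), of 1]) auto
      then have "good (Suc k) f'" using AB(7) by (auto simp: good_def f'_def mult.commute)
      moreover have "step k f f' A B" using AB(1-6) by (auto simp: step_def f'_def)
      ultimately show "\<exists>f'. (good (Suc k) f' \<and> (Suc k = 0 \<longrightarrow> f' = h)) \<and> (\<exists>A B. step k f f' A B)" by auto
    qed
    then show ?thesis by blast
  qed
  then obtain f where f: "\<And>k. good k (f k)" "f 0 = h" "\<And>k. \<exists>A B. step k (f k) (f (Suc k)) A B" by blast
  from f(3) obtain A B where AB: "\<And>k. step k (f k) (f (Suc k)) (A k) (B k)" by metis
  have A: "glh n cyl (A k)" and B: "glh n cyl (B k)" for k using AB[of k] by (auto simp: step_def)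
  interpret TB: telescope n False B c
  proof
    fix k x t
    show "glh n cyl (B k)" by (rule B)
    show "B k (x, 0) = 1\<^sub>m n" if "x \<in> sol" using AB[of k] that by (auto simp: step_def)
    show "0 < c" by (rule c)
    show "nrm n (B k (x, t) - 1\<^sub>m n) \<le> c / 2 ^ k * side False x"
      if "x \<in> half False" "t \<in> {0..1}" "c / 2 ^ k * side False x \<le> 1"
    proof -
      have "x \<in> sol" "1 / 2 \<le> height x" "c / 2 ^ k * height x \<le> 1" using that by (auto simp: half_def side_def)
      then have "nrm n (B k (x, t) - 1\<^sub>m n) \<le> c / 2 ^ k * height x" using AB[of k] that(2) unfolding step_def by blast
      then show ?thesis by (simp add: side_def)
    qed
  qed
  \<comment> \<open>the bound for \<open>A\<close> does not involve the height; doubling the constant makes up for the factor \<open>side True x > 1 / 2\<close>\<close>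
  define A' where "A' k p = transpose_mat (A k p)" for k p
  interpret TA: telescope n True A' "2 * c"
  proof
    fix k x t
    show "glh n cyl (A' k)" unfolding A'_def by (intro glh_transpose A)
    show "A' k (x, 0) = 1\<^sub>m n" if "x \<in> sol" using AB[of k] that by (auto simp: step_def A'_def transpose_one)
    show "0 < 2 * c" using c by simp
    show "nrm n (A' k (x, t) - 1\<^sub>m n) \<le> 2 * c / 2 ^ k * side True x" if "x \<in> half True" "t \<in> {0..1}"
    proof -
      have xs: "x \<in> sol" and s: "1 / 2 < side True x" using that by (auto simp: half_def)
      have hx: "height x \<le> 2" using s height_pos[OF xs] by (simp add: side_def field_simps)
      have Ac: "A k (x, t) \<in> carrier_mat n n" using glhD(3)[OF A] xs that(2) by auto
      have "A' k (x, t) - 1\<^sub>m n = transpose_mat (A k (x, t) - 1\<^sub>m n)"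
        unfolding A'_def using Ac by (intro eq_matI) auto
      then have "nrm n (A' k (x, t) - 1\<^sub>m n) = nrm n (A k (x, t) - 1\<^sub>m n)" using Ac by (simp add: nrm_transpose minus_carrier_mat)
      also have "\<dots> \<le> c / 2 ^ k" using AB[of k] xs hx that(2) unfolding step_def by blast
      also have "c / 2 ^ k \<le> 2 * c / 2 ^ k * side True x"
      proof -
        have "2 * c / 2 ^ k * (1 / 2) \<le> 2 * c / 2 ^ k * side True x" using s c by (intro mult_left_mono) auto
        then show ?thesis by simp
      qed
      finally show ?thesis .
    qed
  qed
  define LA where "LA x = transpose_mat (TA.L x)" for x
  define LB where "LB = TB.L"
  have LAc: "LA x \<in> carrier_mat n n" for x by (simp add: LA_def TA.L_def)
  have LBc: "LB x \<in> carrier_mat n n" for x by (simp add: LB_def TB.L_def)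
  have hc: "h x \<in> carrier_mat n n" if "x \<in> sol" for x by (rule holD(1)[OF h that])
  have fk: "f k x = transpose_mat (TA.Q x k) * h x * TB.Q x k" if x: "x \<in> sol" for k x
  proof (induction k)
    case 0
    then show ?case using hc[OF x] by (simp add: f(2) transpose_one)
  next
    case (Suc k)
    have Ac: "A k (x, 1) \<in> carrier_mat n n" and Bc: "B k (x, 1) \<in> carrier_mat n n"
      using glhD(3)[OF A] glhD(3)[OF B] x by auto
    note c1 = TA.Q_carrier[of x 0 k] TB.Q_carrier[of x 0 k] hc[OF x] Ac Bc
    have "TA.Q x (Suc k) = TA.Q x k * transpose_mat (A k (x, 1))" using x by (simp add: TA.C_def A'_def)
    then have "transpose_mat (TA.Q x (Suc k)) = transpose_mat (TA.Q x k * transpose_mat (A k (x, 1)))" by (rule arg_cong)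
    also have "\<dots> = A k (x, 1) * transpose_mat (TA.Q x k)"
      using c1 by (subst transpose_mult) (auto simp: transpose_transpose)
    finally have ta: "transpose_mat (TA.Q x (Suc k)) = A k (x, 1) * transpose_mat (TA.Q x k)" .
    have tb: "TB.Q x (Suc k) = TB.Q x k * B k (x, 1)" using x by (simp add: TB.C_def)
    have "f (Suc k) x = A k (x, 1) * (transpose_mat (TA.Q x k) * h x * TB.Q x k) * B k (x, 1)"
      using AB[of k] Suc by (auto simp: step_def)
    also have "\<dots> = A k (x, 1) * transpose_mat (TA.Q x k) * h x * (TB.Q x k * B k (x, 1))"
    proof -
      let ?q = "transpose_mat (TA.Q x k)"
      have q: "?q \<in> carrier_mat n n" using c1 by simp
      have "A k (x, 1) * (?q * h x * TB.Q x k) = A k (x, 1) * ?q * h x * TB.Q x k"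
        using q c1 by (simp add: assoc_mult_mat[of _ n n _ n _ n] mult_carrier_mat[of _ n n])
      then show ?thesis using q c1 by (simp add: assoc_mult_mat[of _ n n _ n _ n] mult_carrier_mat[of _ n n])
    qed
    finally show ?case by (simp only: ta tb)
  qed
  have both: "LA x * (h x * LB x) = 1\<^sub>m n" if x: "x \<in> half True" "x \<in> half False" for x
  proof -
    have xs: "x \<in> sol" using x by (simp add: half_def)
    have sh: "x \<in> shell 2" using x height_pos[OF xs] by (simp add: half_def shell_def side_def field_simps)
    have "mconv n (\<lambda>k. transpose_mat (TA.Q x k)) (LA x)"
      unfolding LA_def by (intro mconv_transpose TA.L_conv x(1) TA.Q_carrier) (simp add: TA.L_def)
    then have "mconv n (\<lambda>k. transpose_mat (TA.Q x k) * h x * TB.Q x k) (LA x * h x * LB x)"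
      unfolding LB_def using TA.Q_carrier TB.Q_carrier hc[OF xs] LAc LBc[unfolded LB_def]
      by (intro mconv_mult mconv_const TB.L_conv x(2))
         (auto intro!: mult_carrier_mat[of _ n n _ n] simp: transpose_carrier_mat)
    then have 1: "mconv n (\<lambda>k. f k x) (LA x * h x * LB x)" by (simp only: fk[OF xs])
    have 2: "mconv n (\<lambda>k. f k x) (1\<^sub>m n)"
    proof (rule mconv_of_nrm)
      have "nrm n (f k x - 1\<^sub>m n) \<le> \<epsilon>0 * (1 / 2) ^ k" for k
        using f(1)[of k] sh by (simp add: good_def power_one_over)
      moreover have "(\<lambda>k. \<epsilon>0 * (1 / 2) ^ k) \<longlonglongrightarrow> \<epsilon>0 * 0" by (intro tendsto_intros) auto
      ultimately show "(\<lambda>k. nrm n (f k x - 1\<^sub>m n)) \<longlonglongrightarrow> 0"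
        by (intro Lim_null_comparison[of "\<lambda>k. nrm n (f k x - 1\<^sub>m n)" "\<lambda>k. \<epsilon>0 * (1 / 2) ^ k"] always_eventually) auto
      show "f k x \<in> carrier_mat n n" for k using f(1)[of k] holD(1)[OF _ xs] by (auto simp: good_def)
    qed simp
    have "LA x * h x * LB x = 1\<^sub>m n"
      by (rule mconv_unique[OF 1 2]) (use LAc LBc hc[OF xs] in \<open>auto intro!: mult_carrier_mat\<close>)
    then show ?thesis using assoc_mult_mat[OF LAc hc[OF xs] LBc] by simp
  qed
  \<comment> \<open>both formulas are valid on the overlap of the two halves, so the cut at height \<open>1\<close> is arbitrary\<close>
  define a where "a x = (if height x \<le> 1 then mat_inv (LA x) else h x * LB x)" for x
  have cover: "x \<in> half True" if "x \<in> sol" "height x \<le> 1" for x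
    using that height_pos[OF that(1)] by (simp add: half_def side_def field_simps)
  have cover': "x \<in> half False" if "x \<in> sol" "height x \<ge> 1" for x
    using that by (simp add: half_def side_def)
  have inv_both: "mat_inv (LA x) = h x * LB x" if "x \<in> half True" "x \<in> half False" for x
    by (rule mat_inv_eqI[OF LAc _ both[OF that]]) (use that hc LBc in \<open>auto simp: half_def intro!: mult_carrier_mat\<close>)
  have aT: "a x = mat_inv (LA x)" if "x \<in> half True" for x
    using inv_both[OF that] cover'[of x] that by (auto simp: a_def half_def)
  have aF: "a x = h x * LB x" if "x \<in> half False" for x
    using inv_both[OF _ that] cover[of x] that by (auto simp: a_def half_def)
  have gT: "glh n (half True \<times> {0..1}) (\<lambda>p. LA (fst p))" unfolding LA_def by (intro glh_transpose TA.glh_L)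
  have gF: "glh n (half False \<times> {0..1}) (\<lambda>p. LB (fst p))" unfolding LB_def by (rule TB.glh_L)
  have glha: "glh n (half b \<times> {0..1}) (\<lambda>p. a (fst p))" for b
  proof (cases b)
    case True
    have "glh n (half True \<times> {0..1}) (\<lambda>p. mat_inv (LA (fst p)))" by (rule glh_mat_inv[OF gT])
    moreover have "b = True" using True by simp
    ultimately show ?thesis using aT by (auto intro: glh_cong)
  next
    case False
    have "glh n (half False \<times> {0..1}) (\<lambda>p. h (fst p) * LB (fst p))"
      by (intro glh_mult gF hol_glh[OF h]) (auto simp: half_def)
    then show ?thesis using False by (auto intro: glh_cong simp: aF)
  qed
  have cov: "\<exists>b. x \<in> half b" if "x \<in> sol" for x using cover[OF that] cover'[OF that] by (cases "height x \<le> 1") auto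
  have hola: "hol n a"
    unfolding hol_def glh_def
  proof (intro conjI ballI mlhI)
    fix i j assume ij: "i < n" "j < n"
    show "lh cyl (\<lambda>p. a (fst p) $$ (i, j))"
    proof (rule lh_local)
      fix p assume p: "p \<in> cyl"
      obtain b where b: "fst p \<in> half b" using cov[of "fst p"] p by (metis mem_Times_iff)
      have "openin (top_of_set cyl) (half b \<times> {0..1})" by (intro openin_Times open_half) auto
      moreover have "lh (half b \<times> {0..1}) (\<lambda>p. a (fst p) $$ (i, j))" by (rule glhD(5)[OF glha ij])
      ultimately show "\<exists>D'. p \<in> D' \<and> openin (top_of_set cyl) D' \<and> lh D' (\<lambda>p. a (fst p) $$ (i, j))"
        using b p by (intro exI[of _ "half b \<times> {0..1}"]) (auto simp: mem_Times_iff)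
    qed auto
  next
    fix p assume p: "p \<in> cyl"
    obtain b where b: "fst p \<in> half b" using cov[of "fst p"] p by (metis mem_Times_iff)
    then have "p \<in> half b \<times> {0..1}" using p by (auto simp: mem_Times_iff)
    from glhD(3)[OF glha this] glhD(4)[OF glha this]
    show "a (fst p) \<in> carrier_mat n n" "det (a (fst p)) \<noteq> 0" by auto
  qed auto
  have LAdet: "det (LA x) \<noteq> 0" if "x \<in> half True" for x using glhD(4)[OF gT, of "(x, 0)"] that by auto
  have "isotopic n (\<lambda>x. transpose_mat (a x)) (\<lambda>x. 1\<^sub>m n)"
  proof (rule TA.slide)
    show "hol n (\<lambda>x. transpose_mat (a x))" using hola unfolding hol_def by (rule glh_transpose)
    fix x assume x: "x \<in> half True"
    have "transpose_mat (a x) * TA.L x = transpose_mat (LA x * a x)"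
      using holD(1)[OF hola, of x] LAc[of x] x
      by (subst transpose_mult[of _ n n _ n]) (auto simp: LA_def transpose_transpose half_def)
    also have "LA x * a x = 1\<^sub>m n" unfolding aT[OF x] by (rule mat_inv(2)[OF LAc LAdet[OF x]])
    finally show "transpose_mat (a x) * TA.L x = 1\<^sub>m n" by (simp add: transpose_one)
  qed
  from isotopic_transpose[OF this] have ia: "isotopic n a (\<lambda>x. 1\<^sub>m n)"
    by (rule isotopic_cong) (auto simp: transpose_transpose transpose_one)
  have ib: "isotopic n (\<lambda>x. mat_inv (a x) * h x) (\<lambda>x. 1\<^sub>m n)"
  proof (rule TB.slide)
    show "hol n (\<lambda>x. mat_inv (a x) * h x)" by (intro hol_mult hol_mat_inv hola h)
    fix x assume x: "x \<in> half False"
    then have xs: "x \<in> sol" by (simp add: half_def)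
    have "mat_inv (a x) * h x * TB.L x = mat_inv (a x) * (h x * LB x)"
      unfolding LB_def[symmetric] using mat_inv(1)[OF holD[OF hola xs]] hc[OF xs] LBc by (rule assoc_mult_mat)
    also have "\<dots> = 1\<^sub>m n" unfolding aF[OF x, symmetric] by (rule mat_inv(3)[OF holD[OF hola xs]])
    finally show "mat_inv (a x) * h x * TB.L x = 1\<^sub>m n" .
  qed
  from isotopic_mult[OF ia ib] show ?thesis
  proof (rule isotopic_cong)
    fix x assume xs: "x \<in> sol"
    have "a x * (mat_inv (a x) * h x) = (a x * mat_inv (a x)) * h x"
      using holD(1)[OF hola xs] mat_inv(1)[OF holD[OF hola xs]] hc[OF xs] by (simp add: assoc_mult_mat)
    then show "a x * (mat_inv (a x) * h x) = h x" using mat_inv(2)[OF holD[OF hola xs]] hc[OF xs] by simp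
  qed simp
qed

section \<open>Classification up to isotopy\<close>

subsection \<open>Rational characters and diagonal matrices\<close>

text \<open>
  The character \<open>x \<mapsto> x\<^sup>q\<close> in lowest terms.
\<close>

definition chi :: "rat \<Rightarrow> (nat \<Rightarrow> complex) \<Rightarrow> complex" where
  "chi q x = x (nat (snd (quotient_of q))) powi (fst (quotient_of q))"

lemma chi_fraction:
  assumes x: "x \<in> sol" and m: "m \<ge> 1"
  shows "chi (of_int k / of_nat m) x = x m powi k"
proof -
  obtain a b where ab: "quotient_of (of_int k / of_nat m) = (a, b)" by fastforce
  have b: "b > 0" using quotient_of_denom_pos[OF ab] .
  have cop: "coprime a b" using quotient_of_coprime[OF ab] .
  have "(of_int k / of_nat m :: rat) = of_int a / of_int b" using quotient_of_div[OF ab] .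
  then have "(of_int (k * b) :: rat) = of_int (a * int m)" using b m by (simp add: field_simps)
  then have kb: "k * b = a * int m" by (simp only: of_int_eq_iff)
  have "b dvd int m"
  proof -
    have "b dvd a * int m" using kb by (metis dvd_triv_right)
    then show ?thesis using cop by (simp add: coprime_commute coprime_dvd_mult_right_iff)
  qed
  then obtain g where g: "int m = b * g" by blast
  have "0 < b * g" using g m by simp
  then have g0: "g > 0" using b by (simp add: zero_less_mult_iff)
  have mg: "m = nat b * nat g" using g b g0 by (metis nat_int nat_mult_distrib less_imp_le)
  have "x (nat b) = x (nat b * nat g) ^ nat g" using b g0 by (intro sol_coherent[OF x]) auto
  then have xb: "x (nat b) = x m ^ nat g" by (simp only: mg)
  have "k = g * a" using kb b by (simp add: g mult_ac)
  then have "x m powi k = (x m powi g) powi a" by (simp only: power_int_mult)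
  also have "x m powi g = x (nat b)" using g0 by (simp add: xb power_int_def)
  finally show ?thesis by (simp add: chi_def ab)
qed

lemma chi_nonzero: "x \<in> sol \<Longrightarrow> chi q x \<noteq> 0"
proof -
  assume "x \<in> sol"
  moreover have "nat (snd (quotient_of q)) \<ge> 1" using quotient_of_denom_pos'[of q] by linarith
  ultimately show ?thesis using sol_nonzero by (auto simp: chi_def)
qed

lemma rat_common_denominator:
  fixes p q :: rat
  obtains m k l where "m \<ge> 1" "p = of_int k / of_nat m" "q = of_int l / (of_nat m :: rat)"
proof -
  obtain a b where ab: "quotient_of p = (a, b)" by fastforce
  obtain c d where cd: "quotient_of q = (c, d)" by fastforce
  have pos: "b > 0" "d > 0" using quotient_of_denom_pos[OF ab] quotient_of_denom_pos[OF cd] .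
  have e: "of_nat (nat (b * d)) = (of_int b * of_int d :: rat)" using pos by (simp flip: of_int_mult)
  show ?thesis
  proof (rule that[of "nat (b * d)" "a * d" "c * b"])
    have "0 < b * d" using pos by simp
    then show "1 \<le> nat (b * d)" by linarith
    show "p = of_int (a * d) / of_nat (nat (b * d))" using quotient_of_div[OF ab] pos unfolding e by simp
    show "q = of_int (c * b) / of_nat (nat (b * d))" using quotient_of_div[OF cd] pos unfolding e by simp
  qed
qed

lemma chi_add: 
  assumes x: "x \<in> sol" shows "chi (p + q) x = chi p x * chi q x"
proof -
  obtain m k l where m: "m \<ge> 1" and pq: "p = of_int k / of_nat m" "q = of_int l / of_nat m"
    by (rule rat_common_denominator)
  have "p + q = of_int (k + l) / of_nat m" by (simp add: pq add_divide_distrib)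
  then show ?thesis using sol_nonzero[OF x m] by (simp only: pq chi_fraction[OF x m]) (simp add: power_int_add)
qed

lemma chi_0: "chi 0 x = 1"
  by (simp add: chi_def)

lemma lh_chi: "D \<subseteq> sol \<times> UNIV \<Longrightarrow> lh D (\<lambda>p. chi q (fst p))"
proof -
  assume D: "D \<subseteq> sol \<times> UNIV"
  have "nat (snd (quotient_of q)) \<ge> 1" using quotient_of_denom_pos'[of q] by linarith
  then show ?thesis unfolding chi_def using D sol_nonzero by (intro lh_power_int lh_coordinate) auto
qed

definition diag_of :: "nat \<Rightarrow> (nat \<Rightarrow> complex) \<Rightarrow> complex mat" where
  "diag_of n c = mat n n (\<lambda>(i, j). if i = j then c i else 0)"

lemma diag_of_carrier [simp]: "diag_of n c \<in> carrier_mat n n"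
  by (simp add: diag_of_def)

lemma det_diag_of: "det (diag_of n c) = (\<Prod>i<n. c i)"
proof -
  have "upper_triangular (diag_of n c)" by (auto simp: upper_triangular_def diag_of_def)
  then have "det (diag_of n c) = prod_list (diag_mat (diag_of n c))" by (rule det_upper_triangular[OF _ diag_of_carrier])
  also have "diag_mat (diag_of n c) = map c [0..<n]" by (simp add: diag_mat_def diag_of_def)
  also have "prod_list (map c [0..<n]) = (\<Prod>i<n. c i)" using prod.distinct_set_conv_list[of "[0..<n]" c] by (simp add: lessThan_atLeast0)
  finally show ?thesis .
qed

lemma diag_of_mult: "diag_of n c * diag_of n d = diag_of n (\<lambda>i. c i * d i)"
proof (rule eq_matI)
  fix i j assume "i < dim_row (diag_of n (\<lambda>i. c i * d i))" "j < dim_col (diag_of n (\<lambda>i. c i * d i))"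
  then have ij: "i < n" "j < n" by (auto simp: diag_of_def)
  have "(diag_of n c * diag_of n d) $$ (i, j) = (\<Sum>k<n. if k = i then (if i = j then c i * d i else 0) else 0)"
    unfolding mat_mult_index[OF diag_of_carrier diag_of_carrier ij] using ij by (intro sum.cong refl) (auto simp: diag_of_def)
  then show "(diag_of n c * diag_of n d) $$ (i, j) = diag_of n (\<lambda>i. c i * d i) $$ (i, j)"
    using ij by (simp add: sum.delta diag_of_def)
qed (auto simp: diag_of_def)

lemma diag_of_cong: "(\<And>i. i < n \<Longrightarrow> c i = d i) \<Longrightarrow> diag_of n c = diag_of n d"
  by (rule eq_matI) (auto simp: diag_of_def)

lemma glh_diag_of:
  assumes "D \<subseteq> sol \<times> UNIV" "\<And>i. i < n \<Longrightarrow> lh D (\<lambda>p. c p i)" "\<And>i p. i < n \<Longrightarrow> p \<in> D \<Longrightarrow> c p i \<noteq> 0"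
  shows "glh n D (\<lambda>p. diag_of n (c p))"
  unfolding glh_def
proof (intro conjI ballI mlhI assms(1))
  show "lh D (\<lambda>p. diag_of n (c p) $$ (i, j))" if "i < n" "j < n" for i j
  proof -
    have "lh D (\<lambda>p. if i = j then c p i else 0)" using assms that by (cases "i = j") auto
    then show ?thesis by (rule lh_cong) (use that in \<open>auto simp: diag_of_def\<close>)
  qed
qed (use assms(3) in \<open>auto simp: det_diag_of\<close>)

definition std :: "nat \<Rightarrow> rat \<Rightarrow> (nat \<Rightarrow> complex) \<Rightarrow> complex mat" where
  "std n q x = diag_of n (\<lambda>i. if i = 0 then chi q x else 1)"

lemma hol_chi_diag_of: "hol n (\<lambda>x. diag_of n (\<lambda>i. chi (q i) x))"
  unfolding hol_def by (intro glh_diag_of lh_chi chi_nonzero) auto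

lemma std_eq: "std n q x = diag_of n (\<lambda>i. chi (if i = 0 then q else 0) x)"
  unfolding std_def by (rule diag_of_cong) (simp add: chi_0)

lemma hol_std: "hol n (std n q)"
  unfolding std_eq[abs_def] by (rule hol_chi_diag_of)

lemma det_std: "n \<ge> 1 \<Longrightarrow> det (std n q x) = chi q x"
  unfolding std_def det_diag_of by (subst prod.remove[of _ 0]) auto

text \<open>
  Rotating the coordinate plane of the positions \<open>0\<close> and \<open>k\<close> by a right angle moves a diagonal
  entry from position \<open>k\<close> to position \<open>0\<close>.  Conjugating only the factor which carries this entry,
  the family is \<open>1 + (b - 1) v v\<^sup>T\<close> with a unit vector \<open>v\<close>.
\<close>

lemma isotopic_diag_of_collect:
  assumes k: "0 < k" "k < n" and c: "\<And>i. i < n \<Longrightarrow> shol (\<lambda>x. c x i)" "\<And>i x. i < n \<Longrightarrow> x \<in> sol \<Longrightarrow> c x i \<noteq> 0"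
  shows "isotopic n (\<lambda>x. diag_of n (c x)) (\<lambda>x. diag_of n ((c x)(0 := c x 0 * c x k, k := 1)))"
proof -
  \<comment> \<open>a unit vector turning from the \<open>k\<close>-th to the \<open>0\<close>-th coordinate axis\<close>
  define v where "v t i = (if i = 0 then sin (pi / 2 * t) else if i = k then cos (pi / 2 * t) else 0)" for t :: real and i
  define M where "M \<beta> t = mat n n (\<lambda>(i, j). (if i = j then 1 else 0) + \<beta> * complex_of_real (v t i * v t j))" for \<beta> t
  have Mc: "M \<beta> t \<in> carrier_mat n n" for \<beta> t by (simp add: M_def)
  have unit: "(\<Sum>l<n. complex_of_real (v t l * v t l)) = 1" for t
  proof -
    have "(\<Sum>l<n. v t l * v t l) = (\<Sum>l<n. (if l = 0 then (sin (pi / 2 * t))\<^sup>2 else 0) + (if l = k then (cos (pi / 2 * t))\<^sup>2 else 0))"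
      using k by (intro sum.cong refl) (auto simp: v_def power2_eq_square)
    also have "\<dots> = 1" using k by (simp add: sum.distrib sum.delta)
    finally show ?thesis by (simp only: of_real_sum[symmetric]) simp
  qed
  have MM: "M \<beta> t * M \<gamma> t = 1\<^sub>m n" if bg: "\<beta> + \<gamma> + \<beta> * \<gamma> = 0" for \<beta> \<gamma> t
  proof (rule eq_matI)
    fix i j assume "i < dim_row (1\<^sub>m n :: complex mat)" "j < dim_col (1\<^sub>m n :: complex mat)"
    then have ij: "i < n" "j < n" by auto
    let ?w = "\<lambda>i. complex_of_real (v t i)"
    have "(M \<beta> t * M \<gamma> t) $$ (i, j) = (\<Sum>l<n. (if l = i then (if i = j then 1 else 0) else 0) +
        (if l = i then \<gamma> * ?w i * ?w j else 0) + (if l = j then \<beta> * ?w i * ?w j else 0) +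
        \<beta> * \<gamma> * ?w i * ?w j * of_real (v t l * v t l))"
      unfolding mat_mult_index[OF Mc Mc ij] using ij by (intro sum.cong refl) (auto simp: M_def algebra_simps)
    also have "\<dots> = (if i = j then 1 else 0) + \<gamma> * ?w i * ?w j + \<beta> * ?w i * ?w j + \<beta> * \<gamma> * ?w i * ?w j * (\<Sum>l<n. of_real (v t l * v t l))"
      unfolding sum_distrib_left using ij by (simp add: sum.distrib sum.delta)
    also have "\<dots> = (if i = j then 1 else 0) + (\<beta> + \<gamma> + \<beta> * \<gamma>) * ?w i * ?w j"
      unfolding unit by (simp add: algebra_simps)
    finally show "(M \<beta> t * M \<gamma> t) $$ (i, j) = 1\<^sub>m n $$ (i, j)" using ij bg by simp
  qed (auto simp: M_def)
  define H where "H p = diag_of n ((c (fst p))(k := 1)) * M (c (fst p) k - 1) (snd p)" for p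
  have 1: "glh n cyl (\<lambda>p. diag_of n ((c (fst p))(k := 1)))"
  proof (rule glh_diag_of)
    show "lh cyl (\<lambda>p. ((c (fst p))(k := 1)) i)" if "i < n" for i using c(1)[OF that] by (cases "i = k") auto
  qed (use c(2) in auto)
  have 2: "glh n cyl (\<lambda>p. M (c (fst p) k - 1) (snd p))"
    unfolding glh_def
  proof (intro conjI ballI mlhI)
    fix i j assume ij: "i < n" "j < n"
    have vc: "continuous_on UNIV (\<lambda>t. complex_of_real (v t i * v t j))" for i j
    proof -
      have vi: "continuous_on UNIV (\<lambda>t. v t i)" for i
      proof -
        consider "i = 0" | "i \<noteq> 0" "i = k" | "i \<noteq> 0" "i \<noteq> k" by blast
        then show ?thesis by cases (simp_all add: v_def continuous_intros)
      qed
      show ?thesis by (intro continuous_on_of_real continuous_on_mult vi)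
    qed
    have "lh cyl (\<lambda>p. (if i = j then 1 else 0) + (c (fst p) k - 1) * complex_of_real (v (snd p) i * v (snd p) j))"
      by (intro lh_add lh_mult lh_diff lh_const c(1) k lh_time[where T = UNIV] vc) auto
    then show "lh cyl (\<lambda>p. M (c (fst p) k - 1) (snd p) $$ (i, j))"
      by (rule lh_cong) (use ij in \<open>simp add: M_def\<close>)
  next
    fix p assume p: "p \<in> cyl"
    let ?b = "c (fst p) k"
    have b: "?b \<noteq> 0" using c(2)[OF k(2), of "fst p"] p by auto
    have "(?b - 1) + (1 / ?b - 1) + (?b - 1) * (1 / ?b - 1) = 0" using b by (simp add: field_simps)
    from MM[OF this] show "det (M (?b - 1) (snd p)) \<noteq> 0" by (rule det_nonzero_of_mult_eq_1[OF Mc Mc])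
  qed (auto simp: M_def)
  show ?thesis
  proof (rule isotopicI)
    show "glh n cyl H" unfolding H_def by (rule glh_mult[OF 1 2])
    fix x assume x: "x \<in> sol"
    have "M (c x k - 1) 0 = diag_of n (\<lambda>i. if i = k then c x k else 1)"
      by (rule eq_matI) (use k in \<open>auto simp: M_def v_def diag_of_def\<close>)
    then show "H (x, 0) = diag_of n (c x)"
      unfolding H_def by (simp add: diag_of_mult) (rule diag_of_cong, use k in auto)
    have "M (c x k - 1) 1 = diag_of n (\<lambda>i. if i = 0 then c x k else 1)"
      by (rule eq_matI) (use k in \<open>auto simp: M_def v_def diag_of_def\<close>)
    then show "H (x, 1) = diag_of n ((c x)(0 := c x 0 * c x k, k := 1))"
      unfolding H_def by (simp add: diag_of_mult) (rule diag_of_cong, use k in auto)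
  qed
qed

lemma isotopic_chi_diag_of_std:
  "isotopic n (\<lambda>x. diag_of n (\<lambda>i. chi (q i) x)) (std n (\<Sum>i<n. q i))"
proof (cases "n = 0")
  case True
  show ?thesis
    by (rule isotopic_cong[OF isotopic_refl[OF hol_std[of n 0]]])
       (use True in \<open>auto simp: std_eq intro: diag_of_cong\<close>)
next
  case False
  then have n: "n \<ge> 1" by simp
  \<comment> \<open>the exponents after the first \<open>j\<close> of them have been collected in position \<open>0\<close>\<close>
  define r where "r j i = (if i = 0 then \<Sum>l<j. q l else if i < j then 0 else q i)" for j i
  have "isotopic n (\<lambda>x. diag_of n (\<lambda>i. chi (q i) x)) (\<lambda>x. diag_of n (\<lambda>i. chi (r (Suc j) i) x))" if "Suc j \<le> n" for j
    using that
  proof (induction j)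
    case 0
    have "diag_of n (\<lambda>i. chi (q i) x) = diag_of n (\<lambda>i. chi (r (Suc 0) i) x)" for x
      by (rule diag_of_cong) (auto simp: r_def)
    then show ?case using isotopic_refl[OF hol_chi_diag_of[of n q]] by simp
  next
    case (Suc j)
    let ?k = "Suc j"
    have "isotopic n (\<lambda>x. diag_of n (\<lambda>i. chi (r (Suc j) i) x))
        (\<lambda>x. diag_of n ((\<lambda>i. chi (r (Suc j) i) x)(0 := chi (r (Suc j) 0) x * chi (r (Suc j) ?k) x, ?k := 1)))"
      using Suc.prems by (intro isotopic_diag_of_collect lh_chi chi_nonzero) auto
    then have "isotopic n (\<lambda>x. diag_of n (\<lambda>i. chi (r (Suc j) i) x)) (\<lambda>x. diag_of n (\<lambda>i. chi (r (Suc (Suc j)) i) x))"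
    proof (rule isotopic_cong)
      fix x assume x: "x \<in> sol"
      show "diag_of n ((\<lambda>i. chi (r (Suc j) i) x)(0 := chi (r (Suc j) 0) x * chi (r (Suc j) ?k) x, ?k := 1)) =
          diag_of n (\<lambda>i. chi (r (Suc (Suc j)) i) x)"
        by (rule diag_of_cong) (auto simp: r_def chi_0 chi_add[OF x, symmetric])
    qed simp
    then show ?case using Suc by (auto intro: isotopic_trans)
  qed
  from this[of "n - 1"] n have "isotopic n (\<lambda>x. diag_of n (\<lambda>i. chi (q i) x)) (\<lambda>x. diag_of n (\<lambda>i. chi (r n i) x))" by simp
  then show ?thesis
  proof (rule isotopic_cong)
    fix x
    show "diag_of n (\<lambda>i. chi (r n i) x) = std n (\<Sum>i<n. q i) x"
      unfolding std_eq by (rule diag_of_cong) (auto simp: r_def)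
  qed simp
qed

subsection \<open>The degree is an isotopy invariant\<close>

lemma chi_leaf: "chi q (leaf z) = exp (\<i> * of_rat q * z)"
proof -
  obtain a b where ab: "quotient_of q = (a, b)" by fastforce
  have b: "b > 0" using quotient_of_denom_pos[OF ab] .
  have q: "of_rat q = (of_int a / of_int b :: complex)"
    using quotient_of_div[OF ab] by (simp add: of_rat_divide)
  have "chi q (leaf z) = exp (\<i> * z / of_nat (nat b)) powi a" using b by (simp add: chi_def ab leaf_nth)
  also have "\<dots> = exp (\<i> * of_rat q * z)" using b by (simp add: exp_power_int q mult_ac)
  finally show ?thesis .
qed

text \<open>
  By uniform continuity on a compact set the time interval can be cut into \<open>N\<close> steps on each of which
  the quotient of consecutive values stays in the disc of radius \<open>1 / 2\<close> around \<open>1\<close>.  The sum \<open>b\<close> of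
  the principal logarithms of these quotients is continuous along the leaf with bounded imaginary
  part, and it is a logarithm of \<open>exp (i (q' - q) s)\<close>.  Two continuous logarithms differ by a constant,
  so \<open>(q' - q) s\<close> is bounded in \<open>s\<close>.
\<close>

lemma chi_homotopic_imp_eq:
  fixes \<phi> :: "(nat \<Rightarrow> complex) \<times> real \<Rightarrow> complex"
  assumes cont: "continuous_on cyl \<phi>" and nz: "\<And>p. p \<in> cyl \<Longrightarrow> \<phi> p \<noteq> 0"
    and ends: "\<And>x. x \<in> sol \<Longrightarrow> \<phi> (x, 0) = chi q x" "\<And>x. x \<in> sol \<Longrightarrow> \<phi> (x, 1) = chi q' x"
  shows "q = q'"
proof -
  define K where "K = shell 1 \<times> {0..1::real}"
  have K: "compact K" unfolding K_def by (intro compact_Times compact_shell compact_Icc) simp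
  have Kcyl: "K \<subseteq> cyl" by (auto simp: K_def shell_def)
  have contK: "continuous_on K \<phi>" by (rule continuous_on_subset[OF cont Kcyl])
  have leafK: "(leaf (of_real s), t) \<in> K" if "t \<in> {0..1}" for s t using that by (simp add: K_def shell_def)
  obtain \<mu> where \<mu>: "\<mu> > 0" "\<And>p. p \<in> K \<Longrightarrow> \<mu> \<le> norm (\<phi> p)"
  proof -
    have "K \<noteq> {}" using leafK[of 0 0] by auto
    then obtain p0 where "p0 \<in> K" "\<forall>p\<in>K. norm (\<phi> p0) \<le> norm (\<phi> p)"
      using continuous_attains_inf[OF K _ continuous_on_norm[OF contK]] by blast
    then show ?thesis using nz Kcyl by (intro that[of "norm (\<phi> p0)"]) auto
  qed
  obtain d where d: "d > 0" "\<And>p p'. p \<in> K \<Longrightarrow> p' \<in> K \<Longrightarrow> dist p' p < d \<Longrightarrow> dist (\<phi> p') (\<phi> p) < \<mu> / 2"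
    using compact_uniformly_continuous[OF contK K] \<mu>(1) unfolding uniformly_continuous_on_def by (meson half_gt_zero)
  obtain N :: nat where N: "1 / d < real N" using reals_Archimedean2 by blast
  have N0: "N > 0" using N d(1) by (cases N) (auto simp: field_simps divide_less_0_iff)
  have Nd: "1 / real N < d" using N N0 d(1) by (simp add: field_simps)
  define \<rho> where "\<rho> j s = \<phi> (leaf (of_real s), real (Suc j) / real N) / \<phi> (leaf (of_real s), real j / real N)" for j :: nat and s :: real
  have mem: "(leaf (of_real s), real j / real N) \<in> K" if "j \<le> N" for j s
    using that N0 by (intro leafK) (auto simp: field_simps)
  have \<rho>1: "norm (\<rho> j s - 1) < 1 / 2" if j: "j < N" for j s
  proof -
    let ?a = "\<phi> (leaf (of_real s), real (Suc j) / real N)" and ?b = "\<phi> (leaf (of_real s), real j / real N)"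
    have m: "(leaf (of_real s), real j / real N) \<in> K" "(leaf (of_real s), real (Suc j) / real N) \<in> K"
      using j by (intro mem; simp)+
    have "dist (leaf (of_real s), real (Suc j) / real N) (leaf (of_real s), real j / real N) < d"
    proof -
      have "real (Suc j) / real N - real j / real N = 1 / real N"
        by (simp add: diff_divide_distrib[symmetric])
      then show ?thesis using Nd by (simp add: dist_Pair_Pair dist_real_def del: of_nat_Suc)
    qed
    then have ab: "norm (?a - ?b) < \<mu> / 2" using d(2)[OF m] by (simp add: dist_norm)
    have b: "?b \<noteq> 0" "\<mu> \<le> norm ?b" using \<mu> m(1) by force+
    have "\<rho> j s - 1 = (?a - ?b) / ?b" using b by (simp add: \<rho>_def diff_divide_distrib)
    then have "norm (\<rho> j s - 1) = norm (?a - ?b) / norm ?b" by (simp add: norm_divide)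
    also have "\<dots> < (\<mu> / 2) / \<mu>" using ab b \<mu>(1) by (intro frac_less) auto
    finally show ?thesis using \<mu>(1) by simp
  qed
  have Re\<rho>: "Re (\<rho> j s) > 0" if "j < N" for j s
    using \<rho>1[OF that, of s] abs_Re_le_cmod[of "\<rho> j s - 1"] by simp
  define b where "b s = (\<Sum>j<N. Ln (\<rho> j s))" for s
  have cont_leaf: "continuous_on UNIV (\<lambda>s. \<phi> (leaf (of_real s), t))" if "t \<in> {0..1}" for t
    using that
    by (intro continuous_on_compose2[OF cont] continuous_on_Pair continuous_on_const
        continuous_on_compose2[OF continuous_on_solenoid_exp[of UNIV]] continuous_intros) auto
  have contb: "continuous_on UNIV b"
    unfolding b_def
  proof (rule continuous_on_sum)
    fix j assume j: "j \<in> {..<N}"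
    then have j': "j < N" by simp
    then have t: "real (Suc j) / real N \<in> {0..1}" "real j / real N \<in> {0..1}" by (auto simp: field_simps)
    have "\<phi> (leaf (of_real s), real j / real N) \<noteq> 0" for s
      using nz mem[of j s] Kcyl j' by auto
    then have c: "continuous_on UNIV (\<lambda>s. \<rho> j s)"
      unfolding \<rho>_def by (intro continuous_on_divide cont_leaf t) auto
    have "\<rho> j s \<notin> \<real>\<^sub>\<le>\<^sub>0" for s using Re\<rho>[OF j', of s] by (auto simp: complex_nonpos_Reals_iff)
    then show "continuous_on UNIV (\<lambda>s. Ln (\<rho> j s))" by (rule continuous_on_Ln'[OF c])
  qed
  have expb: "exp (b s) = exp (\<i> * of_rat (q' - q) * of_real s)" for s
  proof -
    have nz': "\<phi> (leaf (of_real s), real j / real N) \<noteq> 0" if "j \<le> N" for j using nz mem[OF that] Kcyl by blast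
    have "exp (b s) = (\<Prod>j<N. \<rho> j s)"
      unfolding b_def exp_sum[OF finite_lessThan]
    proof (intro prod.cong refl)
      fix j assume "j \<in> {..<N}"
      then have "\<rho> j s \<noteq> 0" using Re\<rho>[of j s] by auto
      then show "exp (Ln (\<rho> j s)) = \<rho> j s" by simp
    qed
    also have "(\<Prod>j<M. \<rho> j s) = \<phi> (leaf (of_real s), real M / real N) / \<phi> (leaf (of_real s), 0)" if "M \<le> N" for M
      using that
    proof (induction M)
      case 0
      then show ?case using nz'[of 0] by simp
    next
      case (Suc M)
      then show ?case using nz'[of M] by (simp add: \<rho>_def del: of_nat_Suc)
    qed
    from this[of N] have "(\<Prod>j<N. \<rho> j s) = chi q' (leaf (of_real s)) / chi q (leaf (of_real s))"
      using N0 by (simp add: ends)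
    also have "\<dots> = exp (\<i> * of_rat (q' - q) * of_real s)"
      by (simp add: chi_leaf of_rat_diff algebra_simps flip: exp_diff)
    finally show ?thesis .
  qed
  define G where "G s = \<i> * of_rat (q' - q) * of_real s - b s" for s :: real
  have contG: "continuous_on UNIV G" unfolding G_def by (intro continuous_intros contb)
  have Gint: "\<exists>k::int. G s = of_int (2 * k) * of_real pi * \<i>" for s
  proof -
    have "exp (G s) = 1" by (simp add: G_def exp_diff expb)
    then have "Re (G s) = 0" "\<exists>k::int. Im (G s) = of_int (2 * k) * pi" by (simp_all add: exp_eq_1)
    then show ?thesis by (auto simp: complex_eq_iff)
  qed
  have "G constant_on UNIV"
  proof (rule continuous_discrete_range_constant)
    fix s :: real assume "s \<in> UNIV"
    obtain k :: int where k: "G s = of_int (2 * k) * of_real pi * \<i>" using Gint by blast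
    have "2 * pi \<le> norm (G s' - G s)" if "G s' \<noteq> G s" for s'
    proof -
      obtain k' :: int where k': "G s' = of_int (2 * k') * of_real pi * \<i>" using Gint by blast
      have "k' \<noteq> k" using that k k' by auto
      then have "1 \<le> \<bar>real_of_int (k' - k)\<bar>" by linarith
      moreover have "G s' - G s = of_real (2 * pi * real_of_int (k' - k)) * \<i>" by (simp add: k k' algebra_simps)
      then have "norm (G s' - G s) = 2 * pi * \<bar>real_of_int (k' - k)\<bar>"
        by (simp only: norm_mult norm_of_real abs_mult norm_ii) simp
      ultimately show ?thesis using mult_left_mono[of 1 "\<bar>real_of_int (k' - k)\<bar>" "2 * pi"] by simp
    qed
    then show "\<exists>e>0. \<forall>y. y \<in> UNIV \<and> G y \<noteq> G s \<longrightarrow> e \<le> norm (G y - G s)"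
      by (intro exI[of _ "2 * pi"]) auto
  qed (use contG in auto)
  then obtain C where C: "\<And>s. G s = C" by (auto simp: constant_on_def)
  have Imb: "\<bar>Im (b s)\<bar> \<le> real N * pi" for s
  proof -
    have "\<bar>Im (b s)\<bar> \<le> (\<Sum>j<N. \<bar>Im (Ln (\<rho> j s))\<bar>)" unfolding b_def Im_sum by (rule sum_abs)
    also have "\<dots> \<le> (\<Sum>j<N. pi)"
    proof (intro sum_mono)
      fix j assume "j \<in> {..<N}"
      then have "\<rho> j s \<noteq> 0" using Re\<rho>[of j s] by auto
      then show "\<bar>Im (Ln (\<rho> j s))\<bar> \<le> pi" using mpi_less_Im_Ln[of "\<rho> j s"] Im_Ln_le_pi[of "\<rho> j s"] by linarith
    qed
    finally show ?thesis by simp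
  qed
  define r where "r = (of_rat (q' - q) :: real)"
  have "\<bar>r * s\<bar> \<le> \<bar>Im C\<bar> + real N * pi" for s
  proof -
    have "of_rat (q' - q) = complex_of_real r" unfolding r_def by (cases "q' - q") (simp add: of_rat_rat)
    then have "Im (G s) = r * s - Im (b s)" by (simp add: G_def)
    then have "r * s = Im C + Im (b s)" using C[of s] by simp
    then show ?thesis using Imb[of s] by linarith
  qed
  moreover define B where "B = \<bar>Im C\<bar> + real N * pi"
  ultimately have B: "\<bar>r * s\<bar> \<le> B" for s by simp
  have "r = 0"
  proof (rule ccontr)
    assume "r \<noteq> 0"
    then have "r * ((\<bar>B\<bar> + 1) / r) = \<bar>B\<bar> + 1" by simp
    then have "\<bar>\<bar>B\<bar> + 1\<bar> \<le> B" using B[of "(\<bar>B\<bar> + 1) / r"] by (simp only:)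
    then show False by linarith
  qed
  then show ?thesis by (simp add: r_def)
qed

lemma std_isotopic_imp_eq:
  assumes "isotopic n (std n q) (std n q')" "n \<ge> 1" shows "q = q'"
proof -
  obtain H where H: "glh n cyl H" "\<And>x. x \<in> sol \<Longrightarrow> H (x, 0) = std n q x" "\<And>x. x \<in> sol \<Longrightarrow> H (x, 1) = std n q' x"
    using assms(1) by (auto simp: isotopic_def)
  show ?thesis
  proof (rule chi_homotopic_imp_eq)
    show "continuous_on cyl (\<lambda>p. det (H p))" using lh_det[OF glhD(1)[OF H(1)]] by (rule lhD)
  qed (use H glhD(4)[OF H(1)] det_std[OF assms(2)] in auto)
qed

subsection \<open>Triangular form over the polynomial ring\<close>

inductive elem_product :: "nat \<Rightarrow> 'a::comm_ring_1 mat \<Rightarrow> bool" for n where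
  one: "elem_product n (1\<^sub>m n)"
| step: "elem_product n E \<Longrightarrow> k < n \<Longrightarrow> l < n \<Longrightarrow> k \<noteq> l \<Longrightarrow> elem_product n (E * addrow_mat n a k l)"

lemma elem_product_carrier: "elem_product n E \<Longrightarrow> E \<in> carrier_mat n n"
  by (induction rule: elem_product.induct) auto

definition row_reduces :: "nat \<Rightarrow> 'a::comm_ring_1 mat \<Rightarrow> 'a mat \<Rightarrow> bool" where
  "row_reduces n A B \<longleftrightarrow> B \<in> carrier_mat n n \<and> (\<exists>E. elem_product n E \<and> A = E * B)"

lemma row_reduces_refl: "A \<in> carrier_mat n n \<Longrightarrow> row_reduces n A A"
  unfolding row_reduces_def by (auto intro!: exI[of _ "1\<^sub>m n"] elem_product.one)

lemma row_reduces_step: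
  assumes "row_reduces n A B" "k < n" "l < n" "k \<noteq> l"
  shows "row_reduces n A (addrow a k l B)"
proof -
  obtain E where E: "elem_product n E" "A = E * B" and B: "B \<in> carrier_mat n n" using assms(1) by (auto simp: row_reduces_def)
  note Ec = elem_product_carrier[OF E(1)]
  let ?M = "addrow_mat n a k l" and ?M' = "addrow_mat n (- a) k l"
  have inv: "?M' * ?M = 1\<^sub>m n" using addrow_mat_inv[OF assms(2-4), of "- a"] by simp
  have "(E * ?M') * (?M * B) = E * ((?M' * ?M) * B)"
    using Ec B by (simp add: assoc_mult_mat[of _ n n _ n _ n] mult_carrier_mat[of _ n n])
  also have "\<dots> = A" unfolding inv using E B by simp
  finally have "A = (E * ?M') * addrow a k l B" using addrow_mat[OF B assms(3), of a k] by simp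
  moreover have "elem_product n (E * ?M')" by (rule elem_product.step[OF E(1) assms(2-4)])
  ultimately show ?thesis using B unfolding row_reduces_def by auto
qed

definition triangular_upto :: "nat \<Rightarrow> nat \<Rightarrow> 'a::zero mat \<Rightarrow> bool" where
  "triangular_upto n c A \<longleftrightarrow> (\<forall>j<c. \<forall>i<n. j < i \<longrightarrow> A $$ (i, j) = 0)"

lemma triangular_upto_addrow:
  assumes "triangular_upto n c B" "B \<in> carrier_mat n n" "c \<le> k" "c \<le> l" "k < n" "l < n"
  shows "triangular_upto n c (addrow a k l B)"
  unfolding triangular_upto_def
proof (intro allI impI)
  fix i j assume j: "j < c" "i < n" "j < i"
  have "B $$ (l, j) = 0" "B $$ (i, j) = 0" using assms j by (auto simp: triangular_upto_def)
  then show "addrow a k l B $$ (i, j) = 0" using assms j by (subst index_mat_addrow) auto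
qed

text \<open>
  Euclid's algorithm in the column \<open>c\<close> on and below the diagonal: as long as two entries are nonzero,
  the one of larger degree is reduced modulo the other.  A single remaining entry is moved to the
  diagonal by two additions of rows, which avoids permutation matrices.
\<close>

lemma column_reduction:
  fixes A :: "complex poly mat"
  assumes c: "c < n" and "row_reduces n A B" "triangular_upto n c B"
  shows "\<exists>B'. row_reduces n A B' \<and> triangular_upto n (Suc c) B'"
  using assms(2,3)
proof (induction "\<Sum>i\<in>{c..<n}. if B $$ (i, c) = 0 then 0 else Suc (Polynomial.degree (B $$ (i, c)))" arbitrary: B rule: less_induct)
  case less
  have B: "B \<in> carrier_mat n n" using less.prems by (simp add: row_reduces_def)
  let ?\<mu> = "\<lambda>B i. if B $$ (i, c) = 0 then 0 else Suc (Polynomial.degree (B $$ (i, c)))"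
  show ?case
  proof (cases "\<exists>i k. i \<in> {c..<n} \<and> k \<in> {c..<n} \<and> i \<noteq> k \<and> B $$ (i, c) \<noteq> 0 \<and> B $$ (k, c) \<noteq> 0")
    case True
    then obtain i k where ik: "i \<in> {c..<n}" "k \<in> {c..<n}" "i \<noteq> k" "B $$ (i, c) \<noteq> 0" "B $$ (k, c) \<noteq> 0"
      "Polynomial.degree (B $$ (k, c)) \<le> Polynomial.degree (B $$ (i, c))" using linear by metis
    define B' where "B' = addrow (- (B $$ (i, c) div B $$ (k, c))) i k B"
    have r: "row_reduces n A B'" unfolding B'_def using ik by (intro row_reduces_step less.prems) auto
    have t: "triangular_upto n c B'" unfolding B'_def using ik B by (intro triangular_upto_addrow less.prems) auto
    have e1: "B' $$ (i, c) = B $$ (i, c) mod B $$ (k, c)"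
      unfolding B'_def using ik B c by (subst index_mat_addrow) (auto simp: minus_div_mult_eq_mod[symmetric])
    have e2: "B' $$ (i', c) = B $$ (i', c)" if "i' \<noteq> i" "i' < n" for i'
      unfolding B'_def using that B c by (subst index_mat_addrow) auto
    have "(\<Sum>i\<in>{c..<n}. ?\<mu> B' i) < (\<Sum>i\<in>{c..<n}. ?\<mu> B i)"
    proof (rule sum_strict_mono_ex1)
      have "?\<mu> B' i < ?\<mu> B i"
      proof (cases "B' $$ (i, c) = 0")
        case False
        then have "Polynomial.degree (B' $$ (i, c)) < Polynomial.degree (B $$ (k, c))"
          unfolding e1 using degree_mod_less[OF ik(5), of "B $$ (i, c)"] by auto
        then show ?thesis using False ik by simp
      qed (use ik in simp)
      then show "\<exists>i\<in>{c..<n}. ?\<mu> B' i < ?\<mu> B i" using ik(1) by blast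
      show "\<forall>i\<in>{c..<n}. ?\<mu> B' i \<le> ?\<mu> B i"
      proof
        fix i' assume "i' \<in> {c..<n}"
        then show "?\<mu> B' i' \<le> ?\<mu> B i'"
          using e2[of i'] \<open>?\<mu> B' i < ?\<mu> B i\<close> by (cases "i' = i") auto
      qed
    qed simp
    from less.hyps[OF this r t] show ?thesis .
  next
    case False
    show ?thesis
    proof (cases "\<exists>i. i \<in> {Suc c..<n} \<and> B $$ (i, c) \<noteq> 0")
      case True
      then obtain i where "i \<in> {Suc c..<n}" and iB: "B $$ (i, c) \<noteq> 0" by blast
      then have i: "c < i" "i < n" "B $$ (i, c) \<noteq> 0" by simp_all
      have z: "B $$ (k, c) = 0" if "k \<in> {c..<n}" "k \<noteq> i" for k using False that i c by auto
      define B1 where "B1 = addrow 1 c i B"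
      define B2 where "B2 = addrow (- 1) i c B1"
      have r1: "row_reduces n A B1" unfolding B1_def using i c by (intro row_reduces_step less.prems) auto
      have r2: "row_reduces n A B2" unfolding B2_def using i c by (intro row_reduces_step r1) auto
      have B1: "B1 \<in> carrier_mat n n" using r1 by (simp add: row_reduces_def)
      have t1: "triangular_upto n c B1" unfolding B1_def using i B c by (intro triangular_upto_addrow less.prems) auto
      have t2: "triangular_upto n c B2" unfolding B2_def using i B1 c by (intro triangular_upto_addrow t1) auto
      have b1: "B1 $$ (k, c) = (if k = c then B $$ (i, c) else B $$ (k, c))" if "k < n" for k
        unfolding B1_def using that B i c z[of c] by (subst index_mat_addrow) auto
      have "B2 $$ (k, c) = 0" if k: "k < n" "c < k" for k
        unfolding B2_def using k B1 i c z[of k] b1[of k] b1[of c] by (subst index_mat_addrow) auto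
      then have "triangular_upto n (Suc c) B2" using t2 by (auto simp: triangular_upto_def less_Suc_eq)
      then show ?thesis using r2 by blast
    next
      case F: False
      then have "triangular_upto n (Suc c) B" using less.prems(2) by (auto simp: triangular_upto_def less_Suc_eq)
      then show ?thesis using less.prems(1) by blast
    qed
  qed
qed

lemma polynomial_triangular_form:
  fixes A :: "complex poly mat"
  assumes A: "A \<in> carrier_mat n n"
  obtains E U where "elem_product n E" "U \<in> carrier_mat n n" "A = E * U" "\<And>i j. i < n \<Longrightarrow> j < i \<Longrightarrow> U $$ (i, j) = 0"
proof -
  have "\<exists>B. row_reduces n A B \<and> triangular_upto n c B" if "c \<le> n" for c
    using that
  proof (induction c)
    case 0
    then show ?case using row_reduces_refl[OF A] by (auto simp: triangular_upto_def)
  next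
    case (Suc c)
    then show ?case using column_reduction[of c n A] by auto
  qed
  from this[of n] obtain B where B: "row_reduces n A B" "triangular_upto n n B" by blast
  then obtain E where "elem_product n E" "A = E * B" "B \<in> carrier_mat n n" by (auto simp: row_reduces_def)
  then show ?thesis using B(2) by (intro that[of E B]) (auto simp: triangular_upto_def)
qed

abbreviation eval_mat :: "complex \<Rightarrow> complex poly mat \<Rightarrow> complex mat" where
  "eval_mat z A \<equiv> map_mat (\<lambda>p. poly p z) A"

lemma eval_mat_mult:
  assumes "A \<in> carrier_mat n n" "B \<in> carrier_mat n n"
  shows "eval_mat z (A * B) = eval_mat z A * eval_mat z B"
proof (rule eq_matI)
  fix i j assume "i < dim_row (eval_mat z A * eval_mat z B)" "j < dim_col (eval_mat z A * eval_mat z B)"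
  then have ij: "i < n" "j < n" using assms by auto
  have c: "eval_mat z A \<in> carrier_mat n n" "eval_mat z B \<in> carrier_mat n n" using assms by auto
  have "(A * B) $$ (i, j) = (\<Sum>k<n. A $$ (i, k) * B $$ (k, j))" by (rule mat_mult_index[OF assms ij])
  then show "eval_mat z (A * B) $$ (i, j) = (eval_mat z A * eval_mat z B) $$ (i, j)"
    unfolding mat_mult_index[OF c ij] using ij assms by (simp add: poly_sum)
qed (use assms in auto)

lemma shol_poly: "m \<ge> 1 \<Longrightarrow> D \<subseteq> sol \<times> UNIV \<Longrightarrow> lh D (\<lambda>p. poly q (fst p m))"
  unfolding poly_altdef by (intro lh_sum lh_mult lh_const lh_power lh_coordinate)

text \<open>
  Each elementary factor is contracted by scaling its off-diagonal entry to \<open>0\<close>.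
\<close>

lemma elem_product_isotopic:
  assumes "elem_product n E" and m: "m \<ge> 1"
  shows "isotopic n (\<lambda>x. eval_mat (x m) E) (\<lambda>x. 1\<^sub>m n)"
  using assms(1)
proof (induction rule: elem_product.induct)
  case one
  have "eval_mat z (1\<^sub>m n) = 1\<^sub>m n" for z by (rule eq_matI) auto
  then show ?case using isotopic_refl[OF hol_one] by simp
next
  case (step E k l a)
  have e: "eval_mat z (addrow_mat n a k l) = elementary n k l (poly a z)" for z
    by (rule eq_matI) (auto simp: elementary_def)
  have "glh n cyl (\<lambda>p. elementary n k l (of_real (1 - snd p) * poly a (fst p m)))"
  proof (rule glh_elem)
    show "lh cyl (\<lambda>p. of_real (1 - snd p) * poly a (fst p m))"
      by (intro lh_mult shol_poly m lh_time[where T = UNIV] continuous_intros) auto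
  qed (use step in auto)
  then have "isotopic n (\<lambda>x. elementary n k l (poly a (x m))) (\<lambda>x. 1\<^sub>m n)"
    by (rule isotopicI) (simp_all add: elem_0)
  from isotopic_mult[OF step.IH this] show ?case
    by (rule isotopic_cong)
       (simp_all add: eval_mat_mult[OF elem_product_carrier[OF step(1)] addrow_mat_carrier] e)
qed

subsection \<open>Polynomials without zeros on an annulus\<close>

text \<open>
  The partial sums of the logarithmic series converge uniformly on a closed disc inside the unit disc.
\<close>

lemma approximate_one_minus:
  assumes \<kappa>: "0 \<le> \<kappa>" "\<kappa> < 1" and e: "e > 0"
  obtains N :: nat and c :: "nat \<Rightarrow> complex"
    where "\<And>u::complex. norm u \<le> \<kappa> \<Longrightarrow> norm (1 - u - exp (\<Sum>k<N. c k * u ^ k)) \<le> (e::real)"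
proof -
  define f where "f k u = - (u ^ k) / of_nat k" for k :: nat and u :: complex
  have "uniform_limit (cball 0 \<kappa>) (\<lambda>N u. \<Sum>k<N. f k u) (\<lambda>u. suminf (\<lambda>k. f k u)) sequentially"
  proof (rule Weierstrass_m_test_ev[OF always_eventually])
    show "summable (\<lambda>k. \<kappa> ^ k)" using \<kappa> by (intro summable_geometric) auto
    show "\<forall>k. \<forall>u\<in>cball 0 \<kappa>. norm (f k u) \<le> \<kappa> ^ k"
    proof (intro allI ballI)
      fix k and u :: complex assume u: "u \<in> cball 0 \<kappa>"
      have "norm u ^ k / real k \<le> norm u ^ k / 1" if "k \<noteq> 0" using that by (intro divide_left_mono) auto
      then have "norm (f k u) \<le> norm u ^ k" by (cases "k = 0") (simp_all add: f_def norm_divide norm_power)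
      also have "\<dots> \<le> \<kappa> ^ k" using u by (intro power_mono) auto
      finally show "norm (f k u) \<le> \<kappa> ^ k" .
    qed
  qed
  moreover have "min 1 (e / 6) > 0" using e by simp
  ultimately have "eventually (\<lambda>N. \<forall>u\<in>cball 0 \<kappa>. dist (\<Sum>k<N. f k u) (suminf (\<lambda>k. f k u)) < min 1 (e / 6)) sequentially"
    by (rule uniform_limitD)
  then obtain N where N: "\<And>u. norm u \<le> \<kappa> \<Longrightarrow> dist (\<Sum>k<N. f k u) (suminf (\<lambda>k. f k u)) < min 1 (e / 6)"
    unfolding eventually_sequentially by (metis order_refl mem_cball dist_0_norm)
  show ?thesis
  proof (rule that[of "\<lambda>k. - 1 / of_nat k" N])
    fix u :: complex assume u: "norm u \<le> \<kappa>"
    let ?L = "suminf (\<lambda>k. f k u)" and ?S = "\<Sum>k<N. f k u"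
    have "norm (- u) < 1" using u \<kappa> by simp
    from Ln_series'[OF this] have "(\<lambda>k. f k u) sums ln (1 - u)" by (simp add: f_def)
    then have L: "?L = Ln (1 - u)" by (simp add: sums_iff)
    have "1 - u \<noteq> 0" using u \<kappa> by auto
    then have eL: "exp ?L = 1 - u" by (simp add: L)
    have d: "norm (?S - ?L) \<le> 1" "norm (?S - ?L) \<le> e / 6" using N[OF u] by (auto simp: dist_norm)
    have "norm (1 - u) \<le> 2" using norm_triangle_ineq4[of 1 u] u \<kappa> by simp
    moreover have "norm (exp (?S - ?L) - 1) \<le> 3 * (e / 6)" using norm_exp_minus_one_bounds(1)[OF d(1)] d(2) by linarith
    ultimately have "norm (1 - u) * norm (exp (?S - ?L) - 1) \<le> 2 * (3 * (e / 6))" using e by (intro mult_mono) auto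
    moreover have "1 - u - exp ?S = - ((1 - u) * (exp (?S - ?L) - 1))"
      by (simp add: exp_diff eL[symmetric] algebra_simps)
    then have "norm (1 - u - exp ?S) = norm (1 - u) * norm (exp (?S - ?L) - 1)" by (simp only: norm_minus_cancel norm_mult)
    ultimately show "norm (1 - u - exp (\<Sum>k<N. - 1 / of_nat k * u ^ k)) \<le> e" by (simp add: f_def)
  qed
qed

text \<open>
  Unlike a polynomial without zeros on \<open>S\<close>, the approximating functions have no zeros in the whole
  punctured plane, and the factor \<open>exp (q z)\<close> can be contracted to \<open>1\<close>.
\<close>

definition exp_approximable :: "complex set \<Rightarrow> (complex \<Rightarrow> complex) \<Rightarrow> bool" where
  "exp_approximable S d \<longleftrightarrow> (\<forall>e>0. \<exists>k q. laurent q \<and> (\<forall>z\<in>S. norm (d z - z powi k * exp (q z)) \<le> e))"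

lemma exp_approximable_mult:
  assumes S: "0 \<notin> S" "compact S" and cont: "continuous_on S c" "continuous_on S d"
    and "exp_approximable S c" "exp_approximable S d"
  shows "exp_approximable S (\<lambda>z. c z * d z)"
  unfolding exp_approximable_def
proof (intro allI impI)
  fix e :: real assume e: "e > 0"
  obtain B where B: "B > 0" "\<And>z. z \<in> S \<Longrightarrow> norm (c z) \<le> B"
    using compact_imp_bounded[OF compact_continuous_image[OF cont(1) S(2)]] by (auto simp: bounded_pos)
  obtain B' where B': "B' > 0" "\<And>z. z \<in> S \<Longrightarrow> norm (d z) \<le> B'"
    using compact_imp_bounded[OF compact_continuous_image[OF cont(2) S(2)]] by (auto simp: bounded_pos)
  define e1 where "e1 = min 1 (e / (2 * (B' + 1)))"
  define e2 where "e2 = min 1 (e / (2 * B))"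
  have pos: "e1 > 0" "e2 > 0" using e B B' by (simp_all add: e1_def e2_def)
  obtain k q where k: "laurent q" "\<And>z. z \<in> S \<Longrightarrow> norm (c z - z powi k * exp (q z)) \<le> e1"
    using assms(5) pos unfolding exp_approximable_def by blast
  obtain l r where l: "laurent r" "\<And>z. z \<in> S \<Longrightarrow> norm (d z - z powi l * exp (r z)) \<le> e2"
    using assms(6) pos unfolding exp_approximable_def by blast
  have "norm (c z * d z - z powi (k + l) * exp (q z + r z)) \<le> e" if z: "z \<in> S" for z
  proof -
    have z0: "z \<noteq> 0" using z S by auto
    let ?c = "z powi k * exp (q z)" and ?d = "z powi l * exp (r z)"
    have eq: "c z * d z - z powi (k + l) * exp (q z + r z) = c z * (d z - ?d) + (c z - ?c) * ?d"
      using z0 by (simp add: power_int_add exp_add algebra_simps)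
    have "norm ?d \<le> norm (d z) + norm (d z - ?d)" using norm_triangle_ineq4[of "d z" "d z - ?d"] by simp
    also have "\<dots> \<le> B' + 1" using B'(2)[OF z] l(2)[OF z] by (simp add: e2_def)
    finally have nd: "norm ?d \<le> B' + 1" .
    have "norm (c z * (d z - ?d) + (c z - ?c) * ?d) \<le> norm (c z) * norm (d z - ?d) + norm (c z - ?c) * norm ?d"
      using norm_triangle_ineq[of "c z * (d z - ?d)" "(c z - ?c) * ?d"] by (simp only: norm_mult)
    also have "\<dots> \<le> B * e2 + e1 * (B' + 1)"
      using B(2)[OF z] l(2)[OF z] k(2)[OF z] nd B(1) pos by (intro add_mono mult_mono) auto
    also have "\<dots> \<le> B * (e / (2 * B)) + (e / (2 * (B' + 1))) * (B' + 1)"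
      using B B' by (intro add_mono mult_left_mono mult_right_mono) (auto simp: e1_def e2_def)
    also have "\<dots> = e" using B B' by (simp add: field_simps)
    finally show ?thesis unfolding eq .
  qed
  then show "\<exists>k q. laurent q \<and> (\<forall>z\<in>S. norm (c z * d z - z powi k * exp (q z)) \<le> e)"
    using laurent_add[OF k(1) l(1)] by blast
qed

text \<open>
  A zero outside the annulus is handled by \<open>z - a = - a (1 - z / a)\<close>, one inside by
  \<open>z - a = z (1 - a / z)\<close>.
\<close>

lemma exp_approximable_linear:
  assumes r: "0 < r" "r \<le> R" and a: "\<not> (r \<le> norm a \<and> norm a \<le> R)"
  shows "exp_approximable {z. r \<le> norm z \<and> norm z \<le> R} (\<lambda>z. z - a)"
  unfolding exp_approximable_def
proof (intro allI impI)
  fix e :: real assume e: "e > 0"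
  let ?S = "{z::complex. r \<le> norm z \<and> norm z \<le> R}"
  have R: "R > 0" using r by linarith
  show "\<exists>k q. laurent q \<and> (\<forall>z\<in>?S. norm (z - a - z powi k * exp (q z)) \<le> e)"
  proof (cases "norm a > R")
    case True
    have a0: "a \<noteq> 0" using True R by auto
    have \<kappa>: "0 \<le> R / norm a" "R / norm a < 1" using True R by (auto simp: divide_less_eq)
    have "e / norm a > 0" using e a0 by simp
    from approximate_one_minus[OF \<kappa> this] obtain N :: nat and c :: "nat \<Rightarrow> complex"
      where Nc: "\<And>u::complex. norm u \<le> R / norm a \<Longrightarrow> norm (1 - u - exp (\<Sum>k<N. c k * u ^ k)) \<le> e / norm a" by blast
    define q where "q z = (Ln (- a) * z powi 0) + (\<Sum>k<N. (c k / a ^ k) * z powi int k)" for z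
    have q: "laurent q" unfolding q_def by (intro laurent_add laurent_sum laurent_monomial)
    have "norm (z - a - z powi 0 * exp (q z)) \<le> e" if z: "z \<in> ?S" for z
    proof -
      have "norm (z / a) \<le> R / norm a" using z by (simp add: norm_divide divide_right_mono)
      from Nc[OF this] have "norm (- a) * norm (1 - z / a - exp (\<Sum>k<N. c k * (z / a) ^ k)) \<le> norm (- a) * (e / norm a)"
        by (intro mult_left_mono) auto
      moreover have "z - a - z powi 0 * exp (q z) = - a * (1 - z / a - exp (\<Sum>k<N. c k * (z / a) ^ k))"
        using a0 by (simp add: q_def exp_add power_divide algebra_simps)
      ultimately show ?thesis using a0 by (simp add: norm_mult)
    qed
    then show ?thesis using q by blast
  next
    case False
    then have ar: "norm a < r" using a by auto
    have \<kappa>: "0 \<le> norm a / r" "norm a / r < 1" using ar r by (auto simp: divide_less_eq)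
    have "e / R > 0" using e R by simp
    from approximate_one_minus[OF \<kappa> this] obtain N :: nat and c :: "nat \<Rightarrow> complex"
      where Nc: "\<And>u::complex. norm u \<le> norm a / r \<Longrightarrow> norm (1 - u - exp (\<Sum>k<N. c k * u ^ k)) \<le> e / R" by blast
    define q where "q z = (\<Sum>k<N. (c k * a ^ k) * z powi (- int k))" for z
    have q: "laurent q" unfolding q_def by (intro laurent_sum laurent_monomial)
    have "norm (z - a - z powi 1 * exp (q z)) \<le> e" if z: "z \<in> ?S" for z
    proof -
      have z0: "z \<noteq> 0" using z r by auto
      have "norm (a / z) \<le> norm a / r" using z r by (simp add: norm_divide frac_le)
      from Nc[OF this] have "norm z * norm (1 - a / z - exp (\<Sum>k<N. c k * (a / z) ^ k)) \<le> R * (e / R)"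
        using z R by (intro mult_mono) auto
      moreover have "z - a - z powi 1 * exp (q z) = z * (1 - a / z - exp (\<Sum>k<N. c k * (a / z) ^ k))"
        using z0 by (simp add: q_def power_divide power_int_minus divide_inverse power_inverse algebra_simps)
      ultimately show ?thesis using R by (simp add: norm_mult)
    qed
    then show ?thesis using q by blast
  qed
qed

lemma exp_approximable_poly:
  fixes p :: "complex poly"
  assumes r: "0 < r" "r \<le> R" and nz: "\<And>z. r \<le> norm z \<Longrightarrow> norm z \<le> R \<Longrightarrow> poly p z \<noteq> 0"
  shows "exp_approximable {z. r \<le> norm z \<and> norm z \<le> R} (poly p)"
  using nz
proof (induction "Polynomial.degree p" arbitrary: p)
  case 0
  then obtain c where p: "p = [:c:]" by (metis degree_eq_zeroE)
  have "c \<noteq> 0" using 0(2)[of "of_real r"] r p by auto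
  then have "poly p z = z powi 0 * exp (Ln c * z powi 0)" for z by (simp add: p)
  then show ?case unfolding exp_approximable_def
    by (auto intro!: exI[of _ "0::int"] exI[of _ "\<lambda>z. Ln c * z powi 0"] laurent_monomial)
next
  case (Suc d)
  obtain a where a: "poly p a = 0"
    using Fundamental_Theorem_Algebra.fundamental_theorem_of_algebra[of p] Suc(2) by (metis constant_degree nat.distinct(1))
  then obtain q where q: "p = [:- a, 1:] * q" by (metis dvdE poly_eq_0_iff_dvd)
  have q0: "q \<noteq> 0" using q Suc(2) by auto
  then have "Polynomial.degree p = Suc (Polynomial.degree q)" unfolding q by (subst degree_mult_eq) auto
  then have "Polynomial.degree q = d" using Suc(2) by simp
  moreover have "poly q z \<noteq> 0" if "r \<le> norm z" "norm z \<le> R" for z using Suc(3)[OF that] q by auto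
  ultimately have "exp_approximable {z. r \<le> norm z \<and> norm z \<le> R} (poly q)" using Suc(1) by blast
  moreover have "exp_approximable {z. r \<le> norm z \<and> norm z \<le> R} (\<lambda>z. z - a)"
    using Suc(3)[of a] a by (intro exp_approximable_linear r) auto
  moreover have "compact {z::complex. r \<le> norm z \<and> norm z \<le> R}"
  proof -
    have "{z::complex. r \<le> norm z \<and> norm z \<le> R} = cball 0 R - ball 0 r" by auto
    then show ?thesis by (simp add: compact_diff)
  qed
  ultimately have "exp_approximable {z. r \<le> norm z \<and> norm z \<le> R} (\<lambda>z. (z - a) * poly q z)"
    using r by (intro exp_approximable_mult) (auto intro!: continuous_intros)
  then show ?case by (simp add: q exp_approximable_def algebra_simps)
qed

subsection \<open>Every map is isotopic to a standard one\<close>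

lemma laurent_polynomial:
  assumes "laurent P"
  obtains D0 where "\<And>D. D0 \<le> D \<Longrightarrow> \<exists>p. \<forall>z. z \<noteq> 0 \<longrightarrow> P z = z powi (- int D) * poly p z"
proof -
  obtain D0 c where P: "\<And>z. z \<noteq> 0 \<Longrightarrow> P z = (\<Sum>k\<in>{-int D0..int D0}. c k * z powi k)"
    using assms by (auto simp: laurent_def)
  have "\<exists>p. \<forall>z. z \<noteq> 0 \<longrightarrow> P z = z powi (- int D) * poly p z" if D: "D0 \<le> D" for D
  proof -
    define p where "p = (\<Sum>k\<in>{-int D0..int D0}. Polynomial.monom (c k) (nat (k + int D)))"
    have "P z = z powi (- int D) * poly p z" if z: "z \<noteq> 0" for z
      unfolding P[OF z] p_def poly_sum sum_distrib_left
    proof (rule sum.cong[OF refl])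
      fix k assume "k \<in> {-int D0..int D0}"
      then have "int (nat (k + int D)) = k + int D" using D by auto
      then have "z ^ nat (k + int D) = z powi (k + int D)" by (metis power_int_of_nat)
      also have "\<dots> = z powi k * z powi int D" using z by (simp add: power_int_add)
      finally have "z powi (- int D) * z ^ nat (k + int D) = z powi k * (z powi (- int D) * z powi int D)"
        by (simp only: mult_ac)
      also have "z powi (- int D) * z powi int D = 1" using z by (simp add: power_int_minus)
      finally show "c k * z powi k = z powi - int D * poly (Polynomial.monom (c k) (nat (k + int D))) z"
        by (simp add: poly_monom mult_ac)
    qed
    then show ?thesis by blast
  qed
  then show ?thesis by (rule that)
qed

text \<open>
  Approximation is possible at every multiple of some level, so the entries have a common level, and a
  power of the coordinate clears all denominators.
\<close>

lemma common_laurent_approximation: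
  fixes n :: nat
  assumes g: "\<And>i j. i < n \<Longrightarrow> j < n \<Longrightarrow> shol (g i j)" and e: "e > 0"
  obtains m D p where "m \<ge> 1"
    "\<And>i j x. i < n \<Longrightarrow> j < n \<Longrightarrow> x \<in> shell 2 \<Longrightarrow> norm (g i j x - x m powi (- int D) * poly (p i j) (x m)) \<le> e"
proof -
  have "\<exists>M\<ge>1. \<forall>m\<ge>1. M dvd m \<longrightarrow> (\<exists>P. laurent P \<and> (\<forall>x\<in>shell 2. norm (g i j x - P (x m)) \<le> e))"
    if "i < n" "j < n" for i j
  proof -
    have "(1::real) \<le> 2" by simp
    from shol_laurent_approximation[OF g[OF that] this e] show ?thesis by blast
  qed
  then obtain M where M: "\<And>i j. i < n \<Longrightarrow> j < n \<Longrightarrow> M i j \<ge> 1"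
    "\<And>i j m. i < n \<Longrightarrow> j < n \<Longrightarrow> m \<ge> 1 \<Longrightarrow> M i j dvd m \<Longrightarrow>
       \<exists>P. laurent P \<and> (\<forall>x\<in>shell 2. norm (g i j x - P (x m)) \<le> e)" by metis
  define m where "m = (\<Prod>i<n. \<Prod>j<n. M i j)"
  have "m \<noteq> 0" unfolding m_def using M(1) by force
  then have m: "m \<ge> 1" by simp
  have dvd: "M i j dvd m" if "i < n" "j < n" for i j
  proof -
    have "M i j dvd (\<Prod>j<n. M i j)" using that by (intro dvd_prodI) auto
    also have "\<dots> dvd m" unfolding m_def using that by (intro dvd_prodI) auto
    finally show ?thesis .
  qed
  have "\<exists>P D0. (\<forall>x\<in>shell 2. norm (g i j x - P (x m)) \<le> e) \<and>
      (\<forall>D\<ge>D0. \<exists>p. \<forall>z. z \<noteq> 0 \<longrightarrow> P z = z powi (- int D) * poly p z)" if ij: "i < n" "j < n" for i j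
  proof -
    obtain P where P: "laurent P" "\<forall>x\<in>shell 2. norm (g i j x - P (x m)) \<le> e"
      using M(2)[OF ij m dvd[OF ij]] by blast
    then show ?thesis using laurent_polynomial[OF P(1)] by metis
  qed
  then obtain P D0 where P: "\<And>i j x. i < n \<Longrightarrow> j < n \<Longrightarrow> x \<in> shell 2 \<Longrightarrow> norm (g i j x - P i j (x m)) \<le> e"
    and D0: "\<And>i j D. i < n \<Longrightarrow> j < n \<Longrightarrow> D0 i j \<le> D \<Longrightarrow> \<exists>p. \<forall>z. z \<noteq> 0 \<longrightarrow> P i j z = z powi (- int D) * poly p z"
    by metis
  define D where "D = (\<Sum>i<n. \<Sum>j<n. D0 i j)"
  have "D0 i j \<le> D" if "i < n" "j < n" for i j
  proof -
    have "D0 i j \<le> (\<Sum>j<n. D0 i j)" using that by (intro member_le_sum) auto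
    also have "\<dots> \<le> D" unfolding D_def using that by (intro member_le_sum) auto
    finally show ?thesis .
  qed
  then have "\<exists>p. \<forall>z. z \<noteq> 0 \<longrightarrow> P i j z = z powi (- int D) * poly p z" if "i < n" "j < n" for i j
    using D0 that by blast
  then obtain p where p: "\<And>i j z. i < n \<Longrightarrow> j < n \<Longrightarrow> z \<noteq> 0 \<Longrightarrow> P i j z = z powi (- int D) * poly (p i j) z" by metis
  show ?thesis
  proof (rule that[OF m])
    fix i j x assume ij: "i < n" "j < n" and x: "x \<in> shell 2"
    then have "x m \<noteq> 0" using sol_nonzero m by (simp add: shell_def)
    then show "norm (g i j x - x m powi (- int D) * poly (p i j) (x m)) \<le> e"
      using P[OF ij x] p[OF ij] by simp
  qed
qed

lemma mlh_bounded_on_shell: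
  assumes F: "mlh n cyl (\<lambda>p. F (fst p))"
  obtains C where "C > 0" "\<And>x. x \<in> shell 2 \<Longrightarrow> nrm n (F x) \<le> C"
proof -
  have cont: "continuous_on (shell 2) (\<lambda>x. nrm n (F x))"
    unfolding nrm_def
  proof (intro continuous_on_sum continuous_on_norm)
    fix i j assume "i \<in> {..<n}" "j \<in> {..<n}"
    then have "shol (\<lambda>x. F x $$ (i, j))" using mlhD(3)[OF F] by simp
    from shol_continuous[OF this] show "continuous_on (shell 2) (\<lambda>x. F x $$ (i, j))"
      by (rule continuous_on_subset) (auto simp: shell_def)
  qed
  have "compact (shell 2)" by (rule compact_shell) simp
  then have "bounded ((\<lambda>x. nrm n (F x)) ` shell 2)"
    using compact_continuous_image[OF cont] compact_imp_bounded by blast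
  then obtain C where C: "C > 0" "\<And>x. x \<in> shell 2 \<Longrightarrow> norm (nrm n (F x)) \<le> C" by (auto simp: bounded_pos)
  then show ?thesis by (intro that[of C]) auto
qed

lemma annulus_is_image_of_shell:
  assumes m: "m \<ge> 1"
  shows "(\<lambda>x. x m) ` shell 2 = {z. root m (1 / 2) \<le> norm z \<and> norm z \<le> root m 2}"
proof -
  have m0: "m > 0" using m by simp
  have iff: "root m (1 / 2) \<le> norm z \<and> norm z \<le> root m 2 \<longleftrightarrow> 1 / 2 \<le> norm z ^ m \<and> norm z ^ m \<le> 2" for z :: complex
  proof -
    have "norm z = root m (norm z ^ m)" using m0 by (simp add: real_root_power_cancel)
    then show ?thesis using real_root_le_iff[OF m0] by metis
  qed
  show ?thesis
  proof (intro equalityI subsetI)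
    fix z assume "z \<in> (\<lambda>x. x m) ` shell 2"
    then obtain x where "x \<in> shell 2" "z = x m" by blast
    then show "z \<in> {z. root m (1 / 2) \<le> norm z \<and> norm z \<le> root m 2}"
      unfolding iff using height_root[OF _ m, of x] by (simp add: shell_def)
  next
    fix z :: complex assume "z \<in> {z. root m (1 / 2) \<le> norm z \<and> norm z \<le> root m 2}"
    then have z: "1 / 2 \<le> norm z ^ m" "norm z ^ m \<le> 2" unfolding iff by auto
    then have z0: "z \<noteq> 0" using m0 by (auto simp: zero_power)
    define x where "x = leaf (- \<i> * of_nat m * Ln z)"
    have "x m = z" using m z0 by (simp add: x_def leaf_nth)
    moreover have "x \<in> shell 2"
      using z height_root[of x m] m \<open>x m = z\<close> by (simp add: shell_def x_def)
    ultimately show "z \<in> (\<lambda>x. x m) ` shell 2" by blast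
  qed
qed

lemma exp_approximable_powi_mult:
  assumes S: "0 \<notin> S" "compact S" "continuous_on S d" "exp_approximable S d"
  shows "exp_approximable S (\<lambda>z. z powi l * d z)"
proof (rule exp_approximable_mult[OF S(1,2) _ S(3) _ S(4)])
  show "continuous_on S (\<lambda>z. z powi l)" using S(1) by (intro continuous_intros) auto
  have "laurent (\<lambda>z. 0 * z powi 0)" by (rule laurent_monomial)
  then show "exp_approximable S (\<lambda>z. z powi l)"
    unfolding exp_approximable_def by (intro allI impI exI[of _ l] exI[of _ "\<lambda>z. 0 * z powi 0"]) auto
qed

text \<open>
  At time \<open>0\<close> the triangular matrix with the approximating diagonal, at time \<open>1\<close> the diagonal matrix
  of monomials.
\<close>

definition triangular_family where
  "triangular_family n m D U k q p = mat n n (\<lambda>(i, j).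
     if i = j then fst p m powi k i * exp (of_real (1 - snd p) * q i (fst p m))
     else if i < j then of_real (1 - snd p) * (fst p m powi (- int D) * poly (U $$ (i, j)) (fst p m)) else 0)"

lemma det_upper_triangular_mat:
  assumes "A \<in> carrier_mat n n" "\<And>i j. i < n \<Longrightarrow> j < i \<Longrightarrow> A $$ (i, j) = (0 :: complex)"
  shows "det A = (\<Prod>i<n. A $$ (i, i))"
proof -
  have "upper_triangular A" using assms by (auto simp: upper_triangular_def)
  from det_upper_triangular[OF this assms(1)] show ?thesis
    using assms(1) prod.distinct_set_conv_list[of "[0..<n]" "\<lambda>i. A $$ (i, i)"] by (simp add: diag_mat_def lessThan_atLeast0)
qed

lemma glh_triangular_family:
  assumes m: "m \<ge> 1" and q: "\<And>i. i < n \<Longrightarrow> laurent (q i)"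
  shows "glh n cyl (triangular_family n m D U k q)"
  unfolding glh_def
proof (intro conjI ballI mlhI)
  have nz: "fst p m \<noteq> 0" if "p \<in> cyl" for p :: "_ \<times> real" using that sol_nonzero m by auto
  fix i j assume ij: "i < n" "j < n"
  have s: "lh cyl (\<lambda>p. of_real (1 - snd p))" by (intro lh_time[where T = UNIV] continuous_intros) auto
  have pw: "lh cyl (\<lambda>p. fst p m powi l)" for l using nz by (intro lh_power_int lh_coordinate) auto
  have 1: "lh cyl (\<lambda>p. fst p m powi k i * exp (of_real (1 - snd p) * q i (fst p m)))"
    using m q ij by (intro lh_mult lh_exp s pw lh_laurent) auto
  have 2: "lh cyl (\<lambda>p. of_real (1 - snd p) * (fst p m powi (- int D) * poly (U $$ (i, j)) (fst p m)))"
    using m by (intro lh_mult s pw shol_poly) auto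
  consider "i = j" | "i < j" | "j < i" by linarith
  then show "lh cyl (\<lambda>p. triangular_family n m D U k q p $$ (i, j))"
  proof cases
    case 1
    show ?thesis by (rule lh_cong[OF \<open>lh cyl (\<lambda>p. fst p m powi k i * _ p)\<close>]) (use ij 1 in \<open>simp add: triangular_family_def\<close>)
  next
    case 2
    show ?thesis by (rule lh_cong[OF \<open>lh cyl (\<lambda>p. of_real (1 - snd p) * _ p)\<close>]) (use ij 2 in \<open>simp add: triangular_family_def\<close>)
  next
    case 3
    have "lh cyl (\<lambda>p. 0)" by auto
    then show ?thesis by (rule lh_cong) (use ij 3 in \<open>simp add: triangular_family_def\<close>)
  qed
next
  fix p :: "(nat \<Rightarrow> complex) \<times> real" assume "p \<in> cyl"
  then have "fst p m \<noteq> 0" using sol_nonzero m by auto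
  moreover have "det (triangular_family n m D U k q p) = (\<Prod>i<n. triangular_family n m D U k q p $$ (i, i))"
    by (rule det_upper_triangular_mat) (auto simp: triangular_family_def)
  ultimately show "det (triangular_family n m D U k q p) \<noteq> 0" by (simp add: triangular_family_def)
qed (auto simp: triangular_family_def)

lemma isotopic_of_near:
  assumes f: "hol n f" and F: "hol n F"
    and near: "\<And>x. x \<in> shell 2 \<Longrightarrow> nrm n (mat_inv (f x)) * nrm n (F x - f x) \<le> 1 / (432 * (kap n)\<^sup>2)"
  shows "isotopic n f F"
proof -
  have h: "hol n (\<lambda>x. mat_inv (f x) * F x)" by (intro hol_mult hol_mat_inv f F)
  have "isotopic n (\<lambda>x. mat_inv (f x) * F x) (\<lambda>x. 1\<^sub>m n)"
  proof (rule isotopic_one_near_one[OF h])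
    fix x assume x: "x \<in> shell 2"
    then have xs: "x \<in> sol" by (simp add: shell_def)
    note fx = holD[OF f xs] and Fx = holD[OF F xs]
    note i = mat_inv[OF fx]
    have "mat_inv (f x) * F x - 1\<^sub>m n = mat_inv (f x) * (F x - f x)"
      using mult_minus_distrib_mat[OF i(1) Fx(1) fx(1)] i(3) by simp
    then have "nrm n (mat_inv (f x) * F x - 1\<^sub>m n) \<le> nrm n (mat_inv (f x)) * nrm n (F x - f x)"
      using nrm_mult[OF i(1), of "F x - f x"] minus_carrier_mat[OF fx(1), of "F x"] by simp
    then show "nrm n (mat_inv (f x) * F x - 1\<^sub>m n) \<le> 1 / (432 * (kap n)\<^sup>2)" using near[OF x] by linarith
  qed
  from isotopic_mult[OF isotopic_refl[OF f] this]
  have "isotopic n (\<lambda>x. f x * (mat_inv (f x) * F x)) (\<lambda>x. f x * 1\<^sub>m n)" .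
  then have "isotopic n F f"
  proof (rule isotopic_cong)
    fix x assume x: "x \<in> sol"
    note fx = holD[OF f x] and Fx = holD[OF F x]
    note i = mat_inv[OF fx]
    show "f x * (mat_inv (f x) * F x) = F x"
      using assoc_mult_mat[OF fx(1) i(1) Fx(1)] i(2) Fx(1) by simp
    show "f x * 1\<^sub>m n = f x" using fx by simp
  qed
  then show ?thesis by (rule isotopic_sym)
qed

lemma nrm_diag_le:
  assumes "\<And>i. i < n \<Longrightarrow> norm (A $$ (i, i)) \<le> e" "\<And>i j. i < n \<Longrightarrow> j < n \<Longrightarrow> i \<noteq> j \<Longrightarrow> A $$ (i, j) = 0" "e \<ge> 0"
  shows "nrm n A \<le> real (n * n) * e"
proof (rule nrm_le)
  fix i j assume "i < n" "j < n"
  then show "norm (A $$ (i, j)) \<le> e" using assms by (cases "i = j") auto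
qed

lemma mat_diff_via:
  fixes A B C :: "complex mat"
  assumes "A \<in> carrier_mat n n" "B \<in> carrier_mat n n" "C \<in> carrier_mat n n"
  shows "A - B = (A - C) + (C - B)"
  by (rule eq_matI) (use assms in auto)

text \<open>
  \<open>L\<close> is the matrix of Laurent polynomials \<open>z\<^sup>-\<^sup>D A(z)\<close> close to \<open>f\<close>, and \<open>F\<close> the global map obtained from
  \<open>L\<close> by approximating the diagonal entries of its triangular factor.  The diagonal entries have no
  zeros in the annulus since \<open>L\<close> is invertible on the shell, being close to \<open>f\<close>.
\<close>

theorem isotopic_std_exists:
  assumes f: "hol n f" and n: "n \<ge> 1"
  obtains q where "isotopic n f (std n q)"
proof -
  define \<eta> where "\<eta> = 1 / (432 * (kap n)\<^sup>2)"
  have "64 * 64 \<le> (kap n)\<^sup>2" using mult_mono[OF kap_ge kap_ge, of n n] kap_ge[of n] by (simp add: power2_eq_square)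
  moreover have "kap n \<noteq> 0" using kap_ge[of n] by linarith
  ultimately have \<eta>: "0 < \<eta>" "\<eta> \<le> 1" by (simp_all add: \<eta>_def divide_le_eq)
  obtain K where K: "K > 0" "\<And>x. x \<in> shell 2 \<Longrightarrow> nrm n (mat_inv (f x)) \<le> K"
    using mlh_bounded_on_shell[OF glhD(1)[OF hol_mat_inv[OF f, unfolded hol_def]]] by blast
  \<comment> \<open>each of the two approximations may use up half of \<open>\<eta>\<close>\<close>
  define \<delta> where "\<delta> = \<eta> / (2 * K * real (n * n))"
  have nn: "real (n * n) > 0" using n by simp
  have \<delta>: "\<delta> > 0" "K * (real (n * n) * \<delta>) = \<eta> / 2" using \<eta> K n by (simp_all add: \<delta>_def)
  have g: "shol (\<lambda>x. f x $$ (i, j))" if "i < n" "j < n" for i j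
    using glhD(5)[OF f[unfolded hol_def] that] .
  obtain m D p where m: "m \<ge> 1" and p: "\<And>i j x. i < n \<Longrightarrow> j < n \<Longrightarrow> x \<in> shell 2 \<Longrightarrow>
      norm (f x $$ (i, j) - x m powi (- int D) * poly (p i j) (x m)) \<le> \<delta>"
    using common_laurent_approximation[of n "\<lambda>i j x. f x $$ (i, j)", OF g \<delta>(1)] by blast
  define A where "A = mat n n (\<lambda>(i, j). p i j)"
  have A: "A \<in> carrier_mat n n" by (simp add: A_def)
  obtain E U where E: "elem_product n E" and U: "U \<in> carrier_mat n n" and AEU: "A = E * U"
    and tri: "\<And>i j. i < n \<Longrightarrow> j < i \<Longrightarrow> U $$ (i, j) = 0" by (rule polynomial_triangular_form[OF A]) blast
  note Ec = elem_product_carrier[OF E]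
  define W where "W x = mat n n (\<lambda>(i, j). x m powi (- int D) * poly (U $$ (i, j)) (x m))" for x :: "nat \<Rightarrow> complex"
  define Q where "Q x = eval_mat (x m) E" for x :: "nat \<Rightarrow> complex"
  define L where "L x = Q x * W x" for x
  have W: "W x \<in> carrier_mat n n" and Qc: "Q x \<in> carrier_mat n n" for x using Ec by (auto simp: W_def Q_def)
  have Lc: "L x \<in> carrier_mat n n" for x unfolding L_def by (rule mult_carrier_mat[OF Qc W])
  have L: "L x $$ (i, j) = x m powi (- int D) * poly (p i j) (x m)" if ij: "i < n" "j < n" for x i j
  proof -
    have "p i j = (\<Sum>k<n. E $$ (i, k) * U $$ (k, j))"
      using mat_mult_index[OF Ec U ij] ij unfolding AEU[symmetric] by (simp add: A_def)
    moreover have "L x $$ (i, j) = (\<Sum>k<n. poly (E $$ (i, k)) (x m) * (x m powi (- int D) * poly (U $$ (k, j)) (x m)))"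
      unfolding L_def mat_mult_index[OF Qc W ij] using ij Ec by (intro sum.cong refl) (auto simp: Q_def W_def)
    ultimately show ?thesis by (simp add: poly_sum sum_distrib_left mult_ac)
  qed
  have Lf: "nrm n (L x - f x) \<le> real (n * n) * \<delta>" if x: "x \<in> shell 2" for x
  proof (rule nrm_le)
    have fx: "f x \<in> carrier_mat n n" using holD[OF f] x by (simp add: shell_def)
    fix i j assume ij: "i < n" "j < n"
    have "(L x - f x) $$ (i, j) = L x $$ (i, j) - f x $$ (i, j)" using ij fx Lc[of x] by auto
    then show "norm ((L x - f x) $$ (i, j)) \<le> \<delta>" using p[OF ij x] L[OF ij] by (simp add: norm_minus_commute)
  qed
  have Kn: "nrm n (mat_inv (f x)) * nrm n M \<le> K * c" if "x \<in> shell 2" "nrm n M \<le> c" for x M c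
    using K that by (intro mult_mono) auto
  have detL: "det (L x) \<noteq> 0" if x: "x \<in> shell 2" for x
  proof -
    have xs: "x \<in> sol" using x by (simp add: shell_def)
    note fx = holD[OF f xs]
    note i = mat_inv[OF fx]
    have "mat_inv (f x) * L x - 1\<^sub>m n = mat_inv (f x) * (L x - f x)"
      using mult_minus_distrib_mat[OF i(1) Lc fx(1)] i(3) by simp
    then have "nrm n (mat_inv (f x) * L x - 1\<^sub>m n) \<le> nrm n (mat_inv (f x)) * nrm n (L x - f x)"
      using nrm_mult[OF i(1), of "L x - f x"] minus_carrier_mat[OF fx(1), of "L x"] by simp
    also have "\<dots> \<le> \<eta> / 2" using Kn[OF x Lf[OF x]] \<delta>(2) by simp
    finally have "det (mat_inv (f x) * L x) \<noteq> 0"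
      using \<eta> by (intro det_nonzero_near_one[OF mult_carrier_mat[OF i(1) Lc]]) auto
    then show ?thesis by (simp add: det_mult[OF i(1) Lc])
  qed
  define S where "S = {z::complex. root m (1 / 2) \<le> norm z \<and> norm z \<le> root m 2}"
  have S_eq: "S = (\<lambda>x. x m) ` shell 2" unfolding S_def annulus_is_image_of_shell[OF m] ..
  have r: "0 < root m (1 / 2)" "root m (1 / 2) \<le> root m 2" using m by auto
  have S0: "0 \<notin> S" using r by (auto simp: S_def)
  have S: "compact S"
  proof -
    have "S = cball 0 (root m 2) - ball 0 (root m (1 / 2))" by (auto simp: S_def)
    then show ?thesis by (simp add: compact_diff)
  qed
  have diag: "poly (U $$ (i, i)) z \<noteq> 0" if i: "i < n" and z: "z \<in> S" for i z
  proof -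
    obtain x where x: "x \<in> shell 2" "z = x m" using z S_eq by auto
    have "det (W x) \<noteq> 0" using detL[OF x(1)] by (simp add: L_def det_mult[OF Qc W])
    moreover have "det (W x) = (\<Prod>i<n. W x $$ (i, i))"
      by (rule det_upper_triangular_mat[OF W]) (use tri in \<open>auto simp: W_def\<close>)
    ultimately have "W x $$ (i, i) \<noteq> 0" using i by auto
    then show ?thesis using i x by (simp add: W_def)
  qed
  have Qh: "hol n Q" using isotopic_hol(1)[OF elem_product_isotopic[OF E m]] by (simp add: Q_def[abs_def])
  obtain C where C: "C > 0" "\<And>x. x \<in> shell 2 \<Longrightarrow> nrm n (Q x) \<le> C"
    using mlh_bounded_on_shell[OF glhD(1)[OF Qh[unfolded hol_def]]] by blast
  define \<delta>' where "\<delta>' = \<eta> / (2 * K * C * real (n * n))"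
  have \<delta>': "\<delta>' > 0" "K * (C * (real (n * n) * \<delta>')) = \<eta> / 2" using \<eta> K C n by (simp_all add: \<delta>'_def)
  have "\<exists>k q. laurent q \<and> (\<forall>z\<in>S. norm (z powi (- int D) * poly (U $$ (i, i)) z - z powi k * exp (q z)) \<le> \<delta>')"
    if i: "i < n" for i
  proof -
    have "exp_approximable S (poly (U $$ (i, i)))"
      unfolding S_def by (rule exp_approximable_poly[OF r]) (use diag[OF i] in \<open>auto simp: S_def\<close>)
    then have "exp_approximable S (\<lambda>z. z powi (- int D) * poly (U $$ (i, i)) z)"
      by (intro exp_approximable_powi_mult S0 S) (auto intro!: continuous_intros)
    then show ?thesis using \<delta>'(1) unfolding exp_approximable_def by blast
  qed
  then obtain k q where q: "\<And>i. i < n \<Longrightarrow> laurent (q i)"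
    and kq: "\<And>i z. i < n \<Longrightarrow> z \<in> S \<Longrightarrow> norm (z powi (- int D) * poly (U $$ (i, i)) z - z powi k i * exp (q i z)) \<le> \<delta>'"
    by metis
  define V where "V = triangular_family n m D U k q"
  have V: "glh n cyl V" unfolding V_def by (rule glh_triangular_family[OF m q])
  have Vc: "V y \<in> carrier_mat n n" for y by (simp add: V_def triangular_family_def)
  define F where "F x = Q x * V (x, 0)" for x
  have V01: "isotopic n (\<lambda>x. V (x, 0)) (\<lambda>x. V (x, 1))" by (rule isotopicI[OF V]) auto
  have Fh: "hol n F" unfolding F_def[abs_def] by (intro hol_mult Qh isotopic_hol(1)[OF V01])
  have FL: "nrm n (F x - L x) \<le> C * (real (n * n) * \<delta>')" if x: "x \<in> shell 2" for x
  proof -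
    have "F x - L x = Q x * (V (x, 0) - W x)" unfolding F_def L_def by (rule mult_minus_distrib_mat[OF Qc Vc W, symmetric])
    then have 1: "nrm n (F x - L x) \<le> nrm n (Q x) * nrm n (V (x, 0) - W x)"
      using nrm_mult[OF Qc[of x], of "V (x, 0) - W x"] minus_carrier_mat[OF W, of "V (x, 0)" x] by simp
    have 2: "nrm n (V (x, 0) - W x) \<le> real (n * n) * \<delta>'"
    proof (rule nrm_diag_le)
      have idx: "(V (x, 0) - W x) $$ (i, j) = V (x, 0) $$ (i, j) - W x $$ (i, j)" if "i < n" "j < n" for i j
        using that W[of x] by auto
      have xS: "x m \<in> S" using x S_eq by auto
      show "norm ((V (x, 0) - W x) $$ (i, i)) \<le> \<delta>'" if i: "i < n" for i
        using kq[OF i xS] i by (simp add: idx V_def triangular_family_def W_def norm_minus_commute)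
      show "(V (x, 0) - W x) $$ (i, j) = 0" if "i < n" "j < n" "i \<noteq> j" for i j
        using that tri by (simp add: idx V_def triangular_family_def W_def)
    qed (use \<delta>' in simp)
    have "nrm n (Q x) * nrm n (V (x, 0) - W x) \<le> C * (real (n * n) * \<delta>')"
      using C(2)[OF x] C(1) 2 by (intro mult_mono) auto
    then show ?thesis using 1 by linarith
  qed
  have "isotopic n f F"
  proof (rule isotopic_of_near[OF f Fh])
    fix x assume x: "x \<in> shell 2"
    then have xs: "x \<in> sol" by (simp add: shell_def)
    note fx = holD[OF f xs] and Fx = holD[OF Fh xs]
    have "F x - f x = (F x - L x) + (L x - f x)"
      by (rule mat_diff_via[OF Fx(1) fx(1) Lc])
    moreover have "nrm n ((F x - L x) + (L x - f x)) \<le> nrm n (F x - L x) + nrm n (L x - f x)"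
      by (rule nrm_add[OF minus_carrier_mat[OF Lc] minus_carrier_mat[OF fx(1)]])
    ultimately have "nrm n (F x - f x) \<le> C * (real (n * n) * \<delta>') + real (n * n) * \<delta>"
      using FL[OF x] Lf[OF x] by simp
    from Kn[OF x this] show "nrm n (mat_inv (f x)) * nrm n (F x - f x) \<le> 1 / (432 * (kap n)\<^sup>2)"
      using \<delta>(2) \<delta>'(2) unfolding \<eta>_def[symmetric] distrib_left by linarith
  qed
  moreover have "isotopic n F (\<lambda>x. 1\<^sub>m n * V (x, 1))"
    unfolding F_def Q_def by (intro isotopic_mult elem_product_isotopic[OF E m] V01)
  then have "isotopic n F (\<lambda>x. diag_of n (\<lambda>i. chi (of_int (k i) / of_nat m) x))"
  proof (rule isotopic_cong)
    fix x assume x: "x \<in> sol"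
    have "V (x, 1) = diag_of n (\<lambda>i. x m powi k i)"
      by (rule eq_matI) (auto simp: V_def triangular_family_def diag_of_def)
    then show "1\<^sub>m n * V (x, 1) = diag_of n (\<lambda>i. chi (of_int (k i) / of_nat m) x)"
      using left_mult_one_mat[OF Vc, of "(x, 1)"] by (simp add: chi_fraction[OF x m])
  qed simp
  moreover note isotopic_chi_diag_of_std[of n "\<lambda>i. of_int (k i) / of_nat m"]
  ultimately show ?thesis using that isotopic_trans by blast
qed

section \<open>Bundles, their classes and the ring of formal differences\<close>

subsection \<open>Recovering the clutching map\<close>

lemma solenoid_embed_nth: "k \<ge> 1 \<Longrightarrow> solenoid_embed x k = Some (x k)"
  by (simp add: solenoid_embed_def)

lemma solenoid_embed_inj:
  assumes "x \<in> sol" "y \<in> sol" "solenoid_embed x = solenoid_embed y"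
  shows "x = y"
proof
  fix k
  show "x k = y k"
  proof (cases "k = 0")
    case True
    then show ?thesis using sol_0[OF assms(1)] sol_0[OF assms(2)] by (simp only:)
  next
    case False
    then have "k \<ge> 1" by simp
    then show ?thesis using fun_cong[OF assms(3), of k] by (simp only: solenoid_embed_nth option.inject)
  qed
qed

lemma solenoid_embed_chart:
  assumes x: "x \<in> sol" shows "solenoid_embed x \<in> topspace (chart_domain c)"
proof -
  have "solenoid_embed x \<noteq> cusp_point c'" for c'
  proof
    assume "solenoid_embed x = cusp_point c'"
    from fun_cong[OF this, of 1] show False
      using sol_nonzero[OF x, of 1] by (cases c') (simp_all add: solenoid_embed_nth)
  qed
  moreover have "solenoid_embed x \<in> topspace adelic_sphere"
  proof -
    have c: "solenoid_embed x n = map_option (\<lambda>z. z ^ (m div n)) (solenoid_embed x m)"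
      if "n \<ge> 1" "m \<ge> 1" "n dvd m" for n m
    proof -
      have "\<forall>n\<ge>1. \<forall>m\<ge>1. n dvd m \<longrightarrow> x n = x m ^ (m div n)" using x unfolding sol_eq by blast
      then have "x n = x m ^ (m div n)" using that by blast
      then show ?thesis
        unfolding solenoid_embed_nth[OF that(1)] solenoid_embed_nth[OF that(2)] option.map by (rule arg_cong)
    qed
    have p: "solenoid_embed x \<in> PiE {1..} (\<lambda>n. topspace riemann_sphere)"
      by (simp add: solenoid_embed_def riemann_sphere_def)
    show ?thesis
      unfolding adelic_sphere_def divisibility_limit_def topspace_subtopology topspace_product_topology
      by (intro IntI CollectI p allI impI c)
  qed
  ultimately show ?thesis unfolding chart_domain_def by auto
qed

lemma trivial_pieces_point:
  assumes "x \<in> sol" "v \<in> carrier_vec n"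
  shows "(c, solenoid_embed x, v) \<in> topspace (trivial_pieces n)"
  using solenoid_embed_chart[OF assms(1), of c] assms(2)
  by (simp add: trivial_pieces_def vec_topology_def topspace_pullback_topology)

lemma eq_mat_of_mult_vec:
  fixes A B :: "complex mat"
  assumes A: "A \<in> carrier_mat n n" and B: "B \<in> carrier_mat n n"
    and eq: "\<And>v. v \<in> carrier_vec n \<Longrightarrow> A *\<^sub>v v = B *\<^sub>v v"
  shows "A = B"
proof (rule eq_matI)
  fix i j assume "i < dim_row B" "j < dim_col B"
  then have ij: "i < n" "j < n" using B by auto
  have "vec_index (A *\<^sub>v unit_vec n j) i = vec_index (B *\<^sub>v unit_vec n j) i" by (simp add: eq)
  then show "A $$ (i, j) = B $$ (i, j)" using ij A B by (simp add: scalar_prod_right_unit)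
qed (use A B in auto)

text \<open>
  A point over the solenoid has exactly one representative in each of the two pieces.
\<close>

lemma glue_trivialisation:
  assumes f: "hol n f" and x: "x \<in> sol" and v: "v \<in> carrier_vec n" and w: "w \<in> carrier_vec n"
  shows "trivialisation (glue n f) Zero_Cusp (solenoid_embed x, v) =
      trivialisation (glue n f) Infinity_Cusp (solenoid_embed x, w) \<longleftrightarrow> w = f x *\<^sub>v v"
proof -
  let ?e = "solenoid_embed x"
  note fx = holD[OF f x]
  note i = mat_inv[OF fx]
  have inj: "v = v'" if "f x *\<^sub>v v = f x *\<^sub>v v'" "v' \<in> carrier_vec n" for v'
  proof -
    have "mat_inv (f x) *\<^sub>v (f x *\<^sub>v v) = mat_inv (f x) *\<^sub>v (f x *\<^sub>v v')" using that by simp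
    then show ?thesis using v that(2)
      by (simp add: assoc_mult_mat_vec[OF i(1) fx(1), symmetric] i(3))
  qed
  have Z: "trivialisation (glue n f) Zero_Cusp (?e, v) = {(Zero_Cusp, ?e, v), (Infinity_Cusp, ?e, f x *\<^sub>v v)}"
    using trivial_pieces_point[OF x v, of Zero_Cusp] x v
    by (auto simp: glue_def clutching_equivalence_def clutching_identification_def Id_on_def
        sol_def[symmetric] dest: solenoid_embed_inj[OF x])
  have "trivialisation (glue n f) Infinity_Cusp (?e, w) =
      insert (Infinity_Cusp, ?e, w) {(Zero_Cusp, ?e, v') | v'. v' \<in> carrier_vec n \<and> w = f x *\<^sub>v v'}"
    using trivial_pieces_point[OF x w, of Infinity_Cusp] x w
    by (auto simp: glue_def clutching_equivalence_def clutching_identification_def Id_on_def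
        sol_def[symmetric] dest: solenoid_embed_inj[OF x])
  then show ?thesis unfolding Z using inj v by auto
qed

lemma bundle_rank_glue [simp]: "bundle_rank (glue n f) = n"
  by (simp add: glue_def)

lemma clutching_map_glue:
  assumes f: "hol n f" and x: "x \<in> sol"
  shows "clutching_map (glue n f) x = f x"
  unfolding clutching_map_def bundle_rank_glue
proof (rule the_equality)
  note fx = holD[OF f x]
  have c: "A *\<^sub>v v \<in> carrier_vec n" if "A \<in> carrier_mat n n" "v \<in> carrier_vec n" for A :: "complex mat" and v
    using that by (rule mult_mat_vec_carrier)
  show "f x \<in> GL n \<and> (\<forall>v\<in>carrier_vec n. trivialisation (glue n f) Zero_Cusp (solenoid_embed x, v) =
      trivialisation (glue n f) Infinity_Cusp (solenoid_embed x, f x *\<^sub>v v))"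
    using fx by (auto simp: GL_iff glue_trivialisation[OF f x _ c])
  fix A assume A: "A \<in> GL n \<and> (\<forall>v\<in>carrier_vec n. trivialisation (glue n f) Zero_Cusp (solenoid_embed x, v) =
      trivialisation (glue n f) Infinity_Cusp (solenoid_embed x, A *\<^sub>v v))"
  then have Ac: "A \<in> carrier_mat n n" by (simp add: GL_iff)
  show "A = f x"
  proof (rule eq_mat_of_mult_vec[OF Ac fx(1)])
    fix v :: "complex Matrix.vec" assume v: "v \<in> carrier_vec n"
    then show "A *\<^sub>v v = f x *\<^sub>v v" using A glue_trivialisation[OF f x v c[OF Ac v]] by blast
  qed
qed

lemma holomorphic_bundles_iff: "E \<in> holomorphic_bundles \<longleftrightarrow> (\<exists>n f. hol n f \<and> E = glue n f)"
  by (auto simp: holomorphic_bundles_def solenoid_holomorphic_iff)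

lemma hol_clutching_map:
  assumes "E \<in> holomorphic_bundles" shows "hol (bundle_rank E) (clutching_map E)"
proof -
  obtain n f where f: "hol n f" "E = glue n f" using assms by (auto simp: holomorphic_bundles_iff)
  show ?thesis using hol_cong[OF f(1)] by (simp add: f(2) clutching_map_glue[OF f(1)])
qed

subsection \<open>Block sums and Kronecker products\<close>

lemma diag_block_index:
  assumes A: "A \<in> carrier_mat n n" and B: "B \<in> carrier_mat m m"
  shows "diag_block_mat [A, B] \<in> carrier_mat (n + m) (n + m)"
    "i < n + m \<Longrightarrow> j < n + m \<Longrightarrow> diag_block_mat [A, B] $$ (i, j) =
      (if i < n then if j < n then A $$ (i, j) else 0 else if j < n then 0 else B $$ (i - n, j - n))"
proof -
  have e: "diag_block_mat [A, B] = four_block_mat A (0\<^sub>m n m) (0\<^sub>m m n) B" 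
    by (simp only: diag_block_mat.simps(2)[of A "[B]"] diag_block_mat_singleton Let_def carrier_matD[OF A] carrier_matD[OF B])
  show "diag_block_mat [A, B] \<in> carrier_mat (n + m) (n + m)" unfolding e using A B by simp
  show "diag_block_mat [A, B] $$ (i, j) =
      (if i < n then if j < n then A $$ (i, j) else 0 else if j < n then 0 else B $$ (i - n, j - n))"
    if "i < n + m" "j < n + m" unfolding e using A B that by (subst index_mat_four_block) auto
qed

lemma det_diag_block:
  fixes A B :: "complex mat"
  assumes A: "A \<in> carrier_mat n n" and B: "B \<in> carrier_mat m m"
  shows "det (diag_block_mat [A, B]) = det A * det B"
proof -
  have e: "diag_block_mat [A, B] = four_block_mat A (0\<^sub>m n m) (0\<^sub>m m n) B" 
    by (simp only: diag_block_mat.simps(2)[of A "[B]"] diag_block_mat_singleton Let_def carrier_matD[OF A] carrier_matD[OF B])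
  show ?thesis unfolding e by (rule det_four_block_mat_upper_right_zero[OF A refl _ B]) simp
qed

lemma glh_diag_block:
  assumes F: "glh n D F" and G: "glh m D G"
  shows "glh (n + m) D (\<lambda>p. diag_block_mat [F p, G p])"
  unfolding glh_def
proof (intro conjI ballI mlhI)
  show D: "D \<subseteq> sol \<times> UNIV" by (rule glhD(2)[OF F])
  show "diag_block_mat [F p, G p] \<in> carrier_mat (n + m) (n + m)" if "p \<in> D" for p
    by (rule diag_block_index[OF glhD(3)[OF F that] glhD(3)[OF G that]])
  show "det (diag_block_mat [F p, G p]) \<noteq> 0" if "p \<in> D" for p
    using glhD(4)[OF F that] glhD(4)[OF G that]
    by (simp only: det_diag_block[OF glhD(3)[OF F that] glhD(3)[OF G that]] mult_eq_0_iff) simp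
  fix i j assume ij: "i < n + m" "j < n + m"
  have "lh D (\<lambda>p. if i < n then if j < n then F p $$ (i, j) else 0 else if j < n then 0 else G p $$ (i - n, j - n))"
    using ij glhD(5)[OF F, of i j] glhD(5)[OF G, of "i - n" "j - n"] lh_const[OF D, of 0]
    by (cases "i < n"; cases "j < n") simp_all
  then show "lh D (\<lambda>p. diag_block_mat [F p, G p] $$ (i, j))"
    by (rule lh_cong) (simp only: diag_block_index(2)[OF glhD(3)[OF F] glhD(3)[OF G] ij])
qed

lemma sum_div_mod:
  fixes f :: "nat \<Rightarrow> nat \<Rightarrow> 'a::comm_monoid_add"
  shows "(\<Sum>k<n * m. f (k div m) (k mod m)) = (\<Sum>a<n. \<Sum>b<m. f a b)"
proof -
  have "(\<Sum>a<n. \<Sum>b<m. f a b) = (\<Sum>(a, b)\<in>{..<n} \<times> {..<m}. f a b)" by (simp add: sum.cartesian_product)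
  also have "\<dots> = (\<Sum>k<n * m. f (k div m) (k mod m))"
  proof (rule sum.reindex_bij_witness[of _ "\<lambda>k. (k div m, k mod m)" "\<lambda>(a, b). a * m + b"])
    fix k assume k: "k \<in> {..<n * m}"
    then have "m > 0" by (cases m) auto
    then show "(k div m, k mod m) \<in> {..<n} \<times> {..<m}" using k by (simp add: less_mult_imp_div_less)
    show "(case (k div m, k mod m) of (a, b) \<Rightarrow> a * m + b) = k" by simp
  next
    fix p assume "p \<in> {..<n} \<times> {..<m}"
    then obtain a b where p: "p = (a, b)" "a < n" "b < m" by auto
    have "a * m + b < Suc a * m" using p by simp
    also have "\<dots> \<le> n * m" using p by (intro mult_le_mono1) simp
    finally show "(case p of (a, b) \<Rightarrow> a * m + b) \<in> {..<n * m}" using p by simp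
    show "((case p of (a, b) \<Rightarrow> a * m + b) div m, (case p of (a, b) \<Rightarrow> a * m + b) mod m) = p"
      using p by simp
    then show "f ((case p of (a, b) \<Rightarrow> a * m + b) div m) ((case p of (a, b) \<Rightarrow> a * m + b) mod m) = (case p of (a, b) \<Rightarrow> f a b)"
      using p by simp
  qed
  finally show ?thesis by simp
qed

lemma kronecker_index:
  assumes A: "A \<in> carrier_mat n n" and B: "B \<in> carrier_mat m m"
  shows "kronecker_product A B \<in> carrier_mat (n * m) (n * m)"
    "i < n * m \<Longrightarrow> j < n * m \<Longrightarrow> kronecker_product A B $$ (i, j) = A $$ (i div m, j div m) * B $$ (i mod m, j mod m)"
  using A B by (simp_all add: kronecker_product_def)

lemma div_mod_bounds:
  fixes i :: nat assumes "i < n * m" shows "i div m < n" "i mod m < m"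
proof -
  have "m > 0" using assms by (cases m) auto
  then show "i div m < n" "i mod m < m" using assms by (simp_all add: less_mult_imp_div_less)
qed

lemma kronecker_mult:
  assumes A: "A \<in> carrier_mat n n" "A' \<in> carrier_mat n n" and B: "B \<in> carrier_mat m m" "B' \<in> carrier_mat m m"
  shows "kronecker_product A B * kronecker_product A' B' = kronecker_product (A * A') (B * B')"
proof (rule eq_matI)
  note k = kronecker_index[OF A(1) B(1)] and k' = kronecker_index[OF A(2) B(2)]
  have AA: "A * A' \<in> carrier_mat n n" and BB: "B * B' \<in> carrier_mat m m"
    using A B by (auto intro: mult_carrier_mat)
  note kk = kronecker_index[OF AA BB]
  fix i j assume "i < dim_row (kronecker_product (A * A') (B * B'))" "j < dim_col (kronecker_product (A * A') (B * B'))"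
  then have ij: "i < n * m" "j < n * m" using kk(1) by auto
  note bi = div_mod_bounds[OF ij(1)] and bj = div_mod_bounds[OF ij(2)]
  have "(kronecker_product A B * kronecker_product A' B') $$ (i, j) =
      (\<Sum>l<n * m. (A $$ (i div m, l div m) * B $$ (i mod m, l mod m)) * (A' $$ (l div m, j div m) * B' $$ (l mod m, j mod m)))"
    unfolding mat_mult_index[OF k(1) k'(1) ij] by (intro sum.cong refl) (simp only: k(2)[OF ij(1)] k'(2)[OF _ ij(2)] lessThan_iff)
  also have "\<dots> = (\<Sum>a<n. \<Sum>b<m. (A $$ (i div m, a) * B $$ (i mod m, b)) * (A' $$ (a, j div m) * B' $$ (b, j mod m)))"
    by (rule sum_div_mod)
  also have "\<dots> = (\<Sum>a<n. A $$ (i div m, a) * A' $$ (a, j div m)) * (\<Sum>b<m. B $$ (i mod m, b) * B' $$ (b, j mod m))"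
    by (simp add: sum_product mult_ac)
  also have "\<dots> = kronecker_product (A * A') (B * B') $$ (i, j)"
    by (simp only: kk(2)[OF ij] mat_mult_index[OF A bi(1) bj(1)] mat_mult_index[OF B bi(2) bj(2)])
  finally show "(kronecker_product A B * kronecker_product A' B') $$ (i, j) = kronecker_product (A * A') (B * B') $$ (i, j)" .
qed (use assms kronecker_index(1)[OF A(1) B(1)] kronecker_index(1)[OF A(2) B(2)] in \<open>simp_all add: kronecker_product_def\<close>)

lemma kronecker_one: "kronecker_product (1\<^sub>m n) (1\<^sub>m m) = 1\<^sub>m (n * m)"
proof (rule eq_matI)
  fix i j assume "i < dim_row (1\<^sub>m (n * m) :: complex mat)" "j < dim_col (1\<^sub>m (n * m) :: complex mat)"
  then have ij: "i < n * m" "j < n * m" by auto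
  have "i = j \<longleftrightarrow> i div m = j div m \<and> i mod m = j mod m" by (metis div_mult_mod_eq)
  then show "kronecker_product (1\<^sub>m n) (1\<^sub>m m) $$ (i, j) = 1\<^sub>m (n * m) $$ (i, j)"
    using ij div_mod_bounds[OF ij(1)] div_mod_bounds[OF ij(2)] by (simp add: kronecker_product_def)
qed (simp_all add: kronecker_product_def)

lemma glh_kronecker:
  assumes F: "glh n D F" and G: "glh m D G"
  shows "glh (n * m) D (\<lambda>p. kronecker_product (F p) (G p))"
  unfolding glh_def
proof (intro conjI ballI mlhI)
  show D: "D \<subseteq> sol \<times> UNIV" by (rule glhD(2)[OF F])
  show "kronecker_product (F p) (G p) \<in> carrier_mat (n * m) (n * m)" if "p \<in> D" for p
    by (rule kronecker_index[OF glhD(3)[OF F that] glhD(3)[OF G that]])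
  show "det (kronecker_product (F p) (G p)) \<noteq> 0" if "p \<in> D" for p
  proof -
    note Fp = glhD(3)[OF F that] and Gp = glhD(3)[OF G that]
    note i = mat_inv[OF Fp glhD(4)[OF F that]] and j = mat_inv[OF Gp glhD(4)[OF G that]]
    have "kronecker_product (F p) (G p) * kronecker_product (mat_inv (F p)) (mat_inv (G p)) = 1\<^sub>m (n * m)"
      unfolding kronecker_mult[OF Fp i(1) Gp j(1)] i(2) j(2) by (rule kronecker_one)
    then show ?thesis by (rule det_nonzero_of_mult_eq_1[OF kronecker_index(1)[OF Fp Gp] kronecker_index(1)[OF i(1) j(1)]])
  qed
  fix i j assume ij: "i < n * m" "j < n * m"
  have "lh D (\<lambda>p. F p $$ (i div m, j div m) * G p $$ (i mod m, j mod m))"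
    using ij div_mod_bounds by (intro lh_mult glhD(5)[OF F] glhD(5)[OF G]) auto
  then show "lh D (\<lambda>p. kronecker_product (F p) (G p) $$ (i, j))"
    by (rule lh_cong) (simp only: kronecker_index(2)[OF glhD(3)[OF F] glhD(3)[OF G] ij])
qed

lemma isotopic_binary:
  assumes op: "\<And>F G. glh n cyl F \<Longrightarrow> glh m cyl G \<Longrightarrow> glh l cyl (\<lambda>p. op (F p) (G p))"
    and "isotopic n f f'" "isotopic m g g'"
  shows "isotopic l (\<lambda>x. op (f x) (g x)) (\<lambda>x. op (f' x) (g' x))"
proof -
  obtain H where H: "glh n cyl H" "\<And>x. x \<in> sol \<Longrightarrow> H (x, 0) = f x" "\<And>x. x \<in> sol \<Longrightarrow> H (x, 1) = f' x"
    using assms(2) by (auto simp: isotopic_def)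
  obtain G where G: "glh m cyl G" "\<And>x. x \<in> sol \<Longrightarrow> G (x, 0) = g x" "\<And>x. x \<in> sol \<Longrightarrow> G (x, 1) = g' x"
    using assms(3) by (auto simp: isotopic_def)
  show ?thesis by (rule isotopicI[OF op[OF H(1) G(1)]]) (simp_all add: H G)
qed

lemmas isotopic_diag_block = isotopic_binary[OF glh_diag_block]
lemmas isotopic_kronecker = isotopic_binary[OF glh_kronecker]

lemma hol_diag_block: "hol n f \<Longrightarrow> hol m g \<Longrightarrow> hol (n + m) (\<lambda>x. diag_block_mat [f x, g x])"
  unfolding hol_def by (rule glh_diag_block)

lemma hol_kronecker: "hol n f \<Longrightarrow> hol m g \<Longrightarrow> hol (n * m) (\<lambda>x. kronecker_product (f x) (g x))"
  unfolding hol_def by (rule glh_kronecker)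

subsection \<open>The degree of a clutching map\<close>

text \<open>
  In rank \<open>0\<close> all maps agree, so the degree is normalised to \<open>0\<close> there.
\<close>

definition has_degree :: "nat \<Rightarrow> ((nat \<Rightarrow> complex) \<Rightarrow> complex mat) \<Rightarrow> rat \<Rightarrow> bool" where
  "has_degree n f q \<longleftrightarrow> isotopic n f (std n q) \<and> (n = 0 \<longrightarrow> q = 0)"

lemma has_degree_unique: "has_degree n f q \<Longrightarrow> has_degree n f p \<Longrightarrow> q = p"
proof -
  assume a: "has_degree n f q" "has_degree n f p"
  show "q = p"
  proof (cases "n = 0")
    case False
    have "isotopic n (std n q) (std n p)" using a unfolding has_degree_def by (blast intro: isotopic_sym isotopic_trans)
    then show ?thesis by (rule std_isotopic_imp_eq) (use False in simp)
  qed (use a in \<open>simp add: has_degree_def\<close>)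
qed

lemma has_degree_exists:
  assumes "hol n f" shows "\<exists>q. has_degree n f q"
proof (cases "n = 0")
  case True
  have "isotopic n f (std n 0)"
  proof (rule isotopic_cong[OF isotopic_refl[OF assms]])
    fix x assume "x \<in> sol"
    then have "f x \<in> carrier_mat n n" using holD[OF assms] by blast
    then show "f x = std n 0 x" by (intro eq_matI) (use True in \<open>auto simp: std_def diag_of_def\<close>)
  qed simp
  then show ?thesis by (auto simp: has_degree_def)
next
  case False
  then have "n \<ge> 1" by simp
  from isotopic_std_exists[OF assms this] obtain q where "isotopic n f (std n q)" .
  then show ?thesis using False by (auto simp: has_degree_def)
qed

lemma has_degree_isotopic: "isotopic n f g \<Longrightarrow> has_degree n f q \<longleftrightarrow> has_degree n g q"
  unfolding has_degree_def by (blast intro: isotopic_sym isotopic_trans)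

lemma has_degree_std: "n \<ge> 1 \<Longrightarrow> has_degree n (std n q) q"
  unfolding has_degree_def using isotopic_refl[OF hol_std] by simp

lemma sum_concentrated:
  fixes q :: rat and n :: nat assumes "n = 0 \<longrightarrow> q = 0" shows "(\<Sum>i<n. if i = 0 then q else 0) = q"
  using assms sum.delta[of "{..<n}" 0 "\<lambda>_. q"] by (cases "n = 0") simp_all

lemma has_degree_diag_block:
  assumes f: "has_degree n f q" and g: "has_degree m g p"
  shows "has_degree (n + m) (\<lambda>x. diag_block_mat [f x, g x]) (q + p)"
proof -
  define r where "r i = (if i < n then if i = 0 then q else 0 else if i - n = 0 then p else 0)" for i
  have "isotopic (n + m) (\<lambda>x. diag_block_mat [f x, g x]) (\<lambda>x. diag_block_mat [std n q x, std m p x])"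
    using f g by (intro isotopic_diag_block) (auto simp: has_degree_def)
  moreover have "diag_block_mat [std n q x, std m p x] = diag_of (n + m) (\<lambda>i. chi (r i) x)" for x
  proof (rule eq_matI)
    have c: "std n q x \<in> carrier_mat n n" "std m p x \<in> carrier_mat m m" by (simp_all add: std_def)
    note d = diag_block_index[OF c]
    show "dim_row (diag_block_mat [std n q x, std m p x]) = dim_row (diag_of (n + m) (\<lambda>i. chi (r i) x))"
      "dim_col (diag_block_mat [std n q x, std m p x]) = dim_col (diag_of (n + m) (\<lambda>i. chi (r i) x))"
      using carrier_matD[OF d(1)] carrier_matD[OF diag_of_carrier] by metis+
    fix i j assume "i < dim_row (diag_of (n + m) (\<lambda>i. chi (r i) x))" "j < dim_col (diag_of (n + m) (\<lambda>i. chi (r i) x))"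
    then have ij: "i < n + m" "j < n + m" by (simp_all add: diag_of_def)
    show "diag_block_mat [std n q x, std m p x] $$ (i, j) = diag_of (n + m) (\<lambda>i. chi (r i) x) $$ (i, j)"
      unfolding d(2)[OF ij] using ij by (cases "i < n"; cases "j < n") (auto simp: std_eq diag_of_def r_def)
  qed
  ultimately have "isotopic (n + m) (\<lambda>x. diag_block_mat [f x, g x]) (std (n + m) (\<Sum>i<n + m. r i))"
    using isotopic_trans[OF _ isotopic_chi_diag_of_std[of "n + m" r]] by simp
  moreover have "(\<Sum>i<n + m. r i) = q + p"
  proof -
    have "(\<Sum>i<n + m. r i) = (\<Sum>i<n. r i) + (\<Sum>i<m. r (n + i))"
      by (induction m) (simp_all add: add.assoc)
    also have "(\<Sum>i<n. r i) = (\<Sum>i<n. if i = 0 then q else 0)" by (intro sum.cong) (auto simp: r_def)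
    also have "(\<Sum>i<m. r (n + i)) = (\<Sum>i<m. if i = 0 then p else 0)" by (intro sum.cong) (auto simp: r_def)
    finally show ?thesis using sum_concentrated[of n q] sum_concentrated[of m p] f g by (simp add: has_degree_def)
  qed
  ultimately show ?thesis using f g by (auto simp: has_degree_def)
qed

text \<open>
  The entries of a product of two diagonal matrices of characters are the products of the characters,
  so every character of one factor occurs as often as the other factor has rows.
\<close>

lemma has_degree_kronecker:
  assumes f: "has_degree n f q" and g: "has_degree m g p"
  shows "has_degree (n * m) (\<lambda>x. kronecker_product (f x) (g x)) (of_nat m * q + of_nat n * p)"
proof -
  define r where "r i = (if i div m = 0 then q else 0) + (if i mod m = 0 then p else 0)" for i
  have "isotopic (n * m) (\<lambda>x. kronecker_product (f x) (g x)) (\<lambda>x. kronecker_product (std n q x) (std m p x))"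
    using f g by (intro isotopic_kronecker) (auto simp: has_degree_def)
  then have "isotopic (n * m) (\<lambda>x. kronecker_product (f x) (g x)) (\<lambda>x. diag_of (n * m) (\<lambda>i. chi (r i) x))"
  proof (rule isotopic_cong)
    fix x assume x: "x \<in> sol"
    have c: "std n q x \<in> carrier_mat n n" "std m p x \<in> carrier_mat m m" by (simp_all add: std_def)
    note d = kronecker_index[OF c]
    show "kronecker_product (std n q x) (std m p x) = diag_of (n * m) (\<lambda>i. chi (r i) x)"
    proof (rule eq_matI)
      show "dim_row (kronecker_product (std n q x) (std m p x)) = dim_row (diag_of (n * m) (\<lambda>i. chi (r i) x))"
        "dim_col (kronecker_product (std n q x) (std m p x)) = dim_col (diag_of (n * m) (\<lambda>i. chi (r i) x))"
        using carrier_matD[OF d(1)] carrier_matD[OF diag_of_carrier] by metis+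
      fix i j assume "i < dim_row (diag_of (n * m) (\<lambda>i. chi (r i) x))" "j < dim_col (diag_of (n * m) (\<lambda>i. chi (r i) x))"
      then have ij: "i < n * m" "j < n * m" by (simp_all add: diag_of_def)
      note b = div_mod_bounds[OF ij(1)] div_mod_bounds[OF ij(2)]
      have eq: "i = j \<longleftrightarrow> i div m = j div m \<and> i mod m = j mod m" by (metis div_mult_mod_eq)
      have "kronecker_product (std n q x) (std m p x) $$ (i, j) =
          (if i div m = j div m then chi (if i div m = 0 then q else 0) x else 0) *
          (if i mod m = j mod m then chi (if i mod m = 0 then p else 0) x else 0)"
        unfolding d(2)[OF ij] using b by (simp add: std_eq diag_of_def)
      also have "\<dots> = (if i = j then chi (r i) x else 0)"
        by (simp only: eq r_def chi_add[OF x]) simp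
      finally show "kronecker_product (std n q x) (std m p x) $$ (i, j) = diag_of (n * m) (\<lambda>i. chi (r i) x) $$ (i, j)"
        using ij by (simp add: diag_of_def)
    qed
  qed simp
  from isotopic_trans[OF this isotopic_chi_diag_of_std]
  have "isotopic (n * m) (\<lambda>x. kronecker_product (f x) (g x)) (std (n * m) (\<Sum>i<n * m. r i))" .
  moreover have "(\<Sum>i<n * m. r i) = of_nat m * q + of_nat n * p"
  proof -
    have "(\<Sum>i<n * m. r i) = (\<Sum>a<n. \<Sum>b<m. (if a = 0 then q else 0) + (if b = 0 then p else 0))"
      unfolding r_def by (rule sum_div_mod)
    also have "\<dots> = of_nat m * (\<Sum>a<n. if a = 0 then q else 0) + of_nat n * (\<Sum>b<m. if b = 0 then p else 0)"
      by (simp only: sum.distrib sum_constant card_lessThan sum_distrib_left)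
    finally show ?thesis using sum_concentrated[of n q] sum_concentrated[of m p] f g by (simp add: has_degree_def)
  qed
  ultimately show ?thesis using f g by (auto simp: has_degree_def)
qed

subsection \<open>Quotients by the kernel of an invariant\<close>

definition fibre :: "'a set \<Rightarrow> ('a \<Rightarrow> 'b) \<Rightarrow> 'b \<Rightarrow> 'a set" where
  "fibre A g t = {x \<in> A. g x = t}"

text \<open>
  Both equivalence relations that occur, isotopy of bundles and equality of formal differences,
  turn out to be of this form.  The classes are then indexed by the values of \<open>g\<close>.
\<close>

definition same_value :: "'a set \<Rightarrow> ('a \<Rightarrow> 'b) \<Rightarrow> ('a \<times> 'a) set" where
  "same_value A g = {(x, y). x \<in> A \<and> y \<in> A \<and> g x = g y}"

lemma same_value_class: "x \<in> A \<Longrightarrow> same_value A g `` {x} = fibre A g (g x)"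
  by (auto simp: same_value_def fibre_def)

lemma same_value_quotient: "A // same_value A g = fibre A g ` (g ` A)"
proof -
  have "A // same_value A g = (\<lambda>x. same_value A g `` {x}) ` A" by (auto simp: quotient_def)
  also have "\<dots> = (\<lambda>x. fibre A g (g x)) ` A" by (intro image_cong refl same_value_class)
  finally show ?thesis by (simp add: image_image)
qed

lemma inj_on_fibre: "inj_on (fibre A g) (g ` A)"
  by (auto simp: inj_on_def fibre_def)

lemma lift_to_classes_fibre:
  assumes f: "\<And>x y. x \<in> A \<Longrightarrow> y \<in> A \<Longrightarrow> f x y \<in> A \<and> g (f x y) = F (g x) (g y)"
    and "s \<in> g ` A" "t \<in> g ` A"
  shows "lift_to_classes (same_value A g) f (fibre A g s) (fibre A g t) = fibre A g (F s t)"
proof -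
  have eq: "same_value A g `` {f x y} = fibre A g (F s t)" if "x \<in> fibre A g s" "y \<in> fibre A g t" for x y
    using f[of x y] that same_value_class[of "f x y" A g] by (simp add: fibre_def)
  obtain x y where "x \<in> fibre A g s" "y \<in> fibre A g t" using assms(2,3) by (auto simp: fibre_def)
  then show ?thesis unfolding lift_to_classes_def using eq by blast
qed

lemma type_ring_simps [simp]:
  "carrier (ring_of_type_algebra :: 'a::comm_ring_1 ring) = UNIV"
  "x \<otimes>\<^bsub>ring_of_type_algebra\<^esub> y = x * (y :: 'a)"
  "x \<oplus>\<^bsub>ring_of_type_algebra\<^esub> y = x + y"
  "\<one>\<^bsub>ring_of_type_algebra\<^esub> = (1 :: 'a)" "\<zero>\<^bsub>ring_of_type_algebra\<^esub> = (0 :: 'a)"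
  by (simp_all add: ring_of_type_algebra_def)

text \<open>
  Since \<open>\<phi>\<close> is injective, addition is cancellative, and two formal differences are equal exactly when
  the differences of their values are.  The isomorphism is constructed from the ring side, as
  \<open>t \<mapsto> {(x, y). \<phi> x - \<phi> y = t}\<close>, and the ring axioms are transported along it.
\<close>

lemma grothendieck_ring_iso:
  fixes R :: "'a ring" and \<phi> :: "'a \<Rightarrow> 'b::comm_ring_1"
  assumes inj: "inj_on \<phi> (carrier R)"
    and zero: "\<zero>\<^bsub>R\<^esub> \<in> carrier R" "\<phi> \<zero>\<^bsub>R\<^esub> = 0" and one: "\<one>\<^bsub>R\<^esub> \<in> carrier R" "\<phi> \<one>\<^bsub>R\<^esub> = 1"
    and add: "\<And>x y. x \<in> carrier R \<Longrightarrow> y \<in> carrier R \<Longrightarrow> x \<oplus>\<^bsub>R\<^esub> y \<in> carrier R \<and> \<phi> (x \<oplus>\<^bsub>R\<^esub> y) = \<phi> x + \<phi> y"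
    and mult: "\<And>x y. x \<in> carrier R \<Longrightarrow> y \<in> carrier R \<Longrightarrow> x \<otimes>\<^bsub>R\<^esub> y \<in> carrier R \<and> \<phi> (x \<otimes>\<^bsub>R\<^esub> y) = \<phi> x * \<phi> y"
    and onto: "\<And>t. \<exists>x\<in>carrier R. \<exists>y\<in>carrier R. t = \<phi> x - \<phi> y"
  shows "ring (grothendieck_ring R)" "grothendieck_ring R \<simeq> (ring_of_type_algebra :: 'b ring)"
proof -
  let ?T = "ring_of_type_algebra :: 'b ring" and ?K = "grothendieck_ring R"
  let ?A = "carrier R \<times> carrier R"
  define g where "g p = \<phi> (fst p) - \<phi> (snd p)" for p
  have rel: "grothendieck_rel R = same_value ?A g"
  proof -
    have key: "(\<exists>k\<in>carrier R. (a \<oplus>\<^bsub>R\<^esub> d) \<oplus>\<^bsub>R\<^esub> k = (c \<oplus>\<^bsub>R\<^esub> b) \<oplus>\<^bsub>R\<^esub> k) \<longleftrightarrow> \<phi> a - \<phi> b = \<phi> c - \<phi> d"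
      if c: "a \<in> carrier R" "b \<in> carrier R" "c \<in> carrier R" "d \<in> carrier R" for a b c d
    proof
      assume "\<exists>k\<in>carrier R. (a \<oplus>\<^bsub>R\<^esub> d) \<oplus>\<^bsub>R\<^esub> k = (c \<oplus>\<^bsub>R\<^esub> b) \<oplus>\<^bsub>R\<^esub> k"
      then obtain k where k: "k \<in> carrier R" "(a \<oplus>\<^bsub>R\<^esub> d) \<oplus>\<^bsub>R\<^esub> k = (c \<oplus>\<^bsub>R\<^esub> b) \<oplus>\<^bsub>R\<^esub> k" by blast
      from arg_cong[OF k(2), of \<phi>] have "\<phi> a + \<phi> d + \<phi> k = \<phi> c + \<phi> b + \<phi> k" using c k(1) by (simp add: add)
      then show "\<phi> a - \<phi> b = \<phi> c - \<phi> d" by (simp add: algebra_simps)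
    next
      assume "\<phi> a - \<phi> b = \<phi> c - \<phi> d"
      then have "\<phi> (a \<oplus>\<^bsub>R\<^esub> d) = \<phi> (c \<oplus>\<^bsub>R\<^esub> b)" using c by (simp add: add algebra_simps)
      then have "a \<oplus>\<^bsub>R\<^esub> d = c \<oplus>\<^bsub>R\<^esub> b" using c add by (intro inj_onD[OF inj]) auto
      then show "\<exists>k\<in>carrier R. (a \<oplus>\<^bsub>R\<^esub> d) \<oplus>\<^bsub>R\<^esub> k = (c \<oplus>\<^bsub>R\<^esub> b) \<oplus>\<^bsub>R\<^esub> k" using zero by auto
    qed
    then have "(a \<in> carrier R \<and> b \<in> carrier R \<and> c \<in> carrier R \<and> d \<in> carrier R \<and>
        (\<exists>k\<in>carrier R. (a \<oplus>\<^bsub>R\<^esub> d) \<oplus>\<^bsub>R\<^esub> k = (c \<oplus>\<^bsub>R\<^esub> b) \<oplus>\<^bsub>R\<^esub> k)) \<longleftrightarrow>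
      a \<in> carrier R \<and> b \<in> carrier R \<and> c \<in> carrier R \<and> d \<in> carrier R \<and> \<phi> a - \<phi> b = \<phi> c - \<phi> d" for a b c d
      using key by blast
    then show ?thesis by (simp only: grothendieck_rel_def) (auto simp: same_value_def g_def)
  qed
  have gA: "g ` ?A = UNIV"
  proof -
    have "t \<in> g ` ?A" for t
    proof -
      obtain x y where "x \<in> carrier R" "y \<in> carrier R" "t = \<phi> x - \<phi> y" using onto by blast
      then show ?thesis by (intro image_eqI[of _ _ "(x, y)"]) (auto simp: g_def)
    qed
    then show ?thesis by blast
  qed
  have gI: "t \<in> g ` ?A" for t by (simp only: gA UNIV_I)
  let ?h = "fibre ?A g"
  have car: "carrier ?K = range ?h" by (simp add: grothendieck_ring_def rel same_value_quotient gA)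
  have "?h \<in> ring_iso ?T ?K"
  proof (rule ring_iso_memI)
    fix s t :: 'b
    have "lift_to_classes (same_value ?A g) (\<lambda>(a, b) (c, d).
        ((a \<otimes>\<^bsub>R\<^esub> c) \<oplus>\<^bsub>R\<^esub> (b \<otimes>\<^bsub>R\<^esub> d), (a \<otimes>\<^bsub>R\<^esub> d) \<oplus>\<^bsub>R\<^esub> (b \<otimes>\<^bsub>R\<^esub> c))) (?h s) (?h t) = ?h (s * t)"
      by (rule lift_to_classes_fibre[OF _ gI gI]) (auto simp: g_def add mult algebra_simps)
    then show "?h (s \<otimes>\<^bsub>?T\<^esub> t) = ?h s \<otimes>\<^bsub>?K\<^esub> ?h t" by (simp add: grothendieck_ring_def rel)
    have "lift_to_classes (same_value ?A g) (\<lambda>(a, b) (c, d). (a \<oplus>\<^bsub>R\<^esub> c, b \<oplus>\<^bsub>R\<^esub> d)) (?h s) (?h t) = ?h (s + t)"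
      by (rule lift_to_classes_fibre[OF _ gI gI]) (auto simp: g_def add algebra_simps)
    then show "?h (s \<oplus>\<^bsub>?T\<^esub> t) = ?h s \<oplus>\<^bsub>?K\<^esub> ?h t" by (simp add: grothendieck_ring_def rel)
  next
    show "?h \<one>\<^bsub>?T\<^esub> = \<one>\<^bsub>?K\<^esub>"
      using same_value_class[of "(\<one>\<^bsub>R\<^esub>, \<zero>\<^bsub>R\<^esub>)" ?A g] zero one by (simp add: grothendieck_ring_def rel g_def)
    show "bij_betw ?h (carrier ?T) (carrier ?K)"
      using inj_on_fibre[of ?A g] by (simp add: car gA bij_betw_def)
  qed (simp add: car)
  then have iso: "?h \<in> ring_iso ?T ?K" .
  have z: "?h \<zero>\<^bsub>?T\<^esub> = \<zero>\<^bsub>?K\<^esub>"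
    using same_value_class[of "(\<zero>\<^bsub>R\<^esub>, \<zero>\<^bsub>R\<^esub>)" ?A g] zero by (simp add: grothendieck_ring_def rel g_def)
  have T: "ring ?T" by (rule ring_from_type_algebra)
  from ring.ring_iso_imp_img_ring[OF T iso] show "ring ?K" unfolding z by simp
  show "?K \<simeq> ?T" using ring_iso_sym[OF T] iso unfolding is_ring_iso_def by blast
qed

subsection \<open>The ring of ranks and degrees\<close>

text \<open>
  The pairs of a rank \<open>a\<close> and a degree \<open>u\<close>, multiplied like the dual numbers \<open>a + u \<epsilon>\<close> with \<open>\<epsilon>\<^sup>2 = 0\<close>.
\<close>

datatype rank_degree = Rank_Degree (rank_part: int) (degree_part: rat)

instantiation rank_degree :: comm_ring_1
begin

definition "0 = Rank_Degree 0 0"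
definition "1 = Rank_Degree 1 0"
definition "s + t = Rank_Degree (rank_part s + rank_part t) (degree_part s + degree_part t)"
definition "- s = Rank_Degree (- rank_part s) (- degree_part s)"
definition "s - t = Rank_Degree (rank_part s - rank_part t) (degree_part s - degree_part t)"
definition "s * t = Rank_Degree (rank_part s * rank_part t)
  (of_int (rank_part t) * degree_part s + of_int (rank_part s) * degree_part t)"

instance
  by standard (simp_all add: zero_rank_degree_def one_rank_degree_def plus_rank_degree_def
      uminus_rank_degree_def minus_rank_degree_def times_rank_degree_def algebra_simps)

end

lemmas rank_degree_defs = zero_rank_degree_def one_rank_degree_def plus_rank_degree_def
  uminus_rank_degree_def minus_rank_degree_def times_rank_degree_def

lemma of_int_rank_degree: "of_int a = Rank_Degree a 0"
proof -
  have n: "of_nat k = Rank_Degree (int k) 0" for k by (induction k) (simp_all add: rank_degree_defs)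
  show ?thesis by (cases a) (simp_all add: n rank_degree_defs del: of_nat_Suc)
qed

subsection \<open>The group ring modulo the square of the augmentation ideal\<close>

text \<open>
  The group ring is generated as an additive group by the powers of \<open>x\<close>.
\<close>

lemma group_ring_induct [case_names xpow add uminus]:
  assumes x: "\<And>q. P (xpow q)" and a: "\<And>p r. P p \<Longrightarrow> P r \<Longrightarrow> P (p + r)" and u: "\<And>p. P p \<Longrightarrow> P (- p)"
  shows "P p"
proof -
  have 0: "P 0" using a[OF x[of 0] u[OF x[of 0]]] by simp
  have n: "P (Poly_Mapping.single q (int k))" for q k
    by (induction k) (simp_all add: 0 single_add a x[unfolded xpow_def])
  have s: "P (Poly_Mapping.single q v)" for q v
  proof (cases v)
    case (neg k)
    then show ?thesis using u[OF n[of q "Suc k"]] by (simp add: single_uminus[symmetric])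
  qed (simp add: n)
  have "P (\<Sum>q\<in>Q. Poly_Mapping.single q (Poly_Mapping.lookup p q))" if "finite Q" for Q
    using that by (induction Q rule: finite_induct) (simp_all add: 0 a s)
  moreover have "p = (\<Sum>q\<in>Poly_Mapping.keys p. Poly_Mapping.single q (Poly_Mapping.lookup p q))"
    by (rule poly_mapping_eqI) (auto simp: lookup_sum lookup_single when_def in_keys_iff)
  ultimately show ?thesis by (metis finite_keys)
qed

definition augmentation_degree :: "(rat \<Rightarrow>\<^sub>0 int) \<Rightarrow> rank_degree" where
  "augmentation_degree p = (\<Sum>q\<in>Poly_Mapping.keys p. of_int (Poly_Mapping.lookup p q) * Rank_Degree 1 q)"

lemma augmentation_degree_add: "augmentation_degree (p + r) = augmentation_degree p + augmentation_degree r"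
  unfolding augmentation_degree_def
  by (rule setsum_keys_plus_distrib) (simp_all add: algebra_simps)

lemma augmentation_degree_single: "augmentation_degree (Poly_Mapping.single q a) = of_int a * Rank_Degree 1 q"
  by (simp add: augmentation_degree_def)

lemma augmentation_degree_xpow: "augmentation_degree (xpow q) = Rank_Degree 1 q"
  by (simp add: augmentation_degree_single xpow_def)

lemma augmentation_degree_uminus: "augmentation_degree (- p) = - augmentation_degree p"
proof -
  have "augmentation_degree 0 = 0" by (simp add: augmentation_degree_def)
  then have "augmentation_degree (- p) + augmentation_degree p = 0" by (simp flip: augmentation_degree_add)
  then show ?thesis by (simp add: add_eq_0_iff2)
qed

lemma xpow_add: "xpow (p + q) = xpow p * xpow q"
  by (simp add: xpow_def mult_single)

lemma xpow_0: "xpow 0 = 1"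
  by (simp add: xpow_def)

lemma augmentation_degree_mult: "augmentation_degree (p * r) = augmentation_degree p * augmentation_degree r"
proof (induction p rule: group_ring_induct)
  case (xpow q)
  show ?case
  proof (induction r rule: group_ring_induct)
    case (xpow r)
    show ?case by (simp add: xpow_add[symmetric] augmentation_degree_xpow) (simp add: rank_degree_defs)
  qed (simp_all add: augmentation_degree_add augmentation_degree_uminus algebra_simps)
qed (simp_all add: augmentation_degree_add augmentation_degree_uminus algebra_simps)

lemma ideal_of_type_ring:
  fixes I :: "'a::comm_ring_1 set"
  assumes "ideal I (ring_of_type_algebra :: 'a ring)"
  shows "x \<in> I \<Longrightarrow> y \<in> I \<Longrightarrow> x + y \<in> I" "x \<in> I \<Longrightarrow> - x \<in> I" "0 \<in> I"
proof -
  let ?T = "ring_of_type_algebra :: 'a ring"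
  interpret ideal I ?T by (rule assms)
  show "x + y \<in> I" if "x \<in> I" "y \<in> I" using additive_subgroup.a_closed[OF additive_subgroup_axioms that] by simp
  show "- x \<in> I" if "x \<in> I" using I_l_closed[OF that, of "- 1"] by simp
  show "0 \<in> I" using additive_subgroup.zero_closed[OF additive_subgroup_axioms] by simp
qed

text \<open>
  The ideal generated by the \<open>x\<^sup>q - 1\<close> is the augmentation ideal, and the ideal here is its square.
\<close>

definition augmentation_square :: "(rat \<Rightarrow>\<^sub>0 int) set" where
  "augmentation_square = Idl\<^bsub>rat_group_ring\<^esub> {(xpow q - 1) * (xpow p - 1) | q p :: rat. True}"

text \<open>
  The normal form is respected by sums because
  \<open>x\<^sup>p\<^sup>+\<^sup>q - x\<^sup>p - x\<^sup>q + 1 = (x\<^sup>p - 1) (x\<^sup>q - 1)\<close>, and by negation because of the case \<open>q = - p\<close>.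
\<close>

lemma group_ring_normal_form:
  "p - Poly_Mapping.single 0 (rank_part (augmentation_degree p)) - xpow (degree_part (augmentation_degree p)) + 1
     \<in> augmentation_square" (is "?N p \<in> _")
proof -
  have R: "ring rat_group_ring" unfolding rat_group_ring_def by (rule ring_from_type_algebra)
  have "ideal augmentation_square rat_group_ring"
    unfolding augmentation_square_def by (rule ring.genideal_ideal[OF R]) (simp add: rat_group_ring_def)
  note I = ideal_of_type_ring[OF this[unfolded rat_group_ring_def]]
  have gen: "(xpow q - 1) * (xpow r - 1) \<in> augmentation_square" for q r
  proof -
    have "{(xpow q - 1) * (xpow p - 1) | q p :: rat. True} \<subseteq> augmentation_square"
      unfolding augmentation_square_def by (rule ring.genideal_self[OF R]) (simp add: rat_group_ring_def)
    then show ?thesis by blast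
  qed
  show ?thesis
  proof (induction p rule: group_ring_induct)
    case (xpow q)
    have "?N (xpow q) = 0" by (simp add: augmentation_degree_xpow xpow_0)
    then show ?case using I(3) by simp
  next
    case (add p r)
    let ?d = "degree_part (augmentation_degree p)" and ?e = "degree_part (augmentation_degree r)"
    have d: "degree_part (augmentation_degree (p + r)) = ?d + ?e"
      "rank_part (augmentation_degree (p + r)) = rank_part (augmentation_degree p) + rank_part (augmentation_degree r)"
      by (simp_all add: augmentation_degree_add plus_rank_degree_def)
    have eq: "?N (p + r) = (?N p + ?N r) + - ((xpow ?d - 1) * (xpow ?e - 1))"
      unfolding d single_add xpow_add by (simp add: algebra_simps)
    show ?case unfolding eq by (rule I(1)[OF I(1)[OF add] I(2)[OF gen]])
  next
    case (uminus p)
    let ?d = "degree_part (augmentation_degree p)"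
    have "xpow ?d * xpow (- ?d) = 1" by (simp add: xpow_add[symmetric] xpow_0)
    moreover have d: "degree_part (augmentation_degree (- p)) = - ?d"
      "rank_part (augmentation_degree (- p)) = - rank_part (augmentation_degree p)"
      by (simp_all add: augmentation_degree_uminus uminus_rank_degree_def)
    ultimately have eq: "?N (- p) = - ?N p + (xpow ?d - 1) * (xpow (- ?d) - 1)"
      unfolding d single_uminus by (simp add: algebra_simps)
    show ?case unfolding eq by (rule I(1)[OF I(2)[OF uminus] gen])
  qed
qed

lemma group_ring_quotient_iso:
  "rat_group_ring Quot augmentation_square \<simeq> (ring_of_type_algebra :: rank_degree ring)"
  "ring (rat_group_ring Quot augmentation_square)"
proof -
  let ?T = "ring_of_type_algebra :: rank_degree ring"
  have R: "ring rat_group_ring" unfolding rat_group_ring_def by (rule ring_from_type_algebra)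
  have T: "ring ?T" by (rule ring_from_type_algebra)
  have h: "ring_hom_ring rat_group_ring ?T augmentation_degree"
    by (rule ring_hom_ringI[OF R T])
       (simp_all add: rat_group_ring_def augmentation_degree_mult augmentation_degree_add
          augmentation_degree_xpow[of 0, unfolded xpow_0] one_rank_degree_def)
  have ker: "a_kernel rat_group_ring ?T augmentation_degree = {p. augmentation_degree p = 0}"
    by (simp add: a_kernel_def' rat_group_ring_def)
  have "augmentation_degree ((xpow q - 1) * (xpow p - 1)) = 0" for q p
    using augmentation_degree_add[of "xpow q" "- 1"] augmentation_degree_add[of "xpow p" "- 1"]
    by (simp add: augmentation_degree_mult augmentation_degree_uminus augmentation_degree_xpow
        augmentation_degree_xpow[of 0, unfolded xpow_0]) (simp add: rank_degree_defs)
  then have "{(xpow q - 1) * (xpow p - 1) | q p :: rat. True} \<subseteq> {p. augmentation_degree p = 0}" by blast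
  then have "augmentation_square \<subseteq> {p. augmentation_degree p = 0}"
    using ring.genideal_minimal[OF R ring_hom_ring.kernel_is_ideal[OF h]]
    unfolding augmentation_square_def ker by simp
  moreover have "{p. augmentation_degree p = 0} \<subseteq> augmentation_square"
  proof
    fix p assume "p \<in> {p. augmentation_degree p = 0}"
    then show "p \<in> augmentation_square"
      using group_ring_normal_form[of p] by (simp add: zero_rank_degree_def xpow_0)
  qed
  ultimately have eq: "a_kernel rat_group_ring ?T augmentation_degree = augmentation_square" unfolding ker by blast
  have "augmentation_degree ` carrier rat_group_ring = carrier ?T"
  proof -
    have "t \<in> range augmentation_degree" for t
    proof (cases t)
      case (Rank_Degree a u)
      have "augmentation_degree (Poly_Mapping.single 0 a + (xpow u + - xpow 0)) = t"
        by (simp only: augmentation_degree_add augmentation_degree_uminus augmentation_degree_single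
            augmentation_degree_xpow of_int_rank_degree Rank_Degree) (simp add: rank_degree_defs)
      then show ?thesis by blast
    qed
    then show ?thesis by (auto simp: rat_group_ring_def)
  qed
  from ring_hom_ring.FactRing_iso[OF h this] show "rat_group_ring Quot augmentation_square \<simeq> ?T" unfolding eq .
  show "ring (rat_group_ring Quot augmentation_square)"
    using ideal.quotient_is_ring[OF ring_hom_ring.kernel_is_ideal[OF h]] unfolding eq .
qed

subsection \<open>Classes of bundles\<close>

definition bundle_degree :: "glued_bundle \<Rightarrow> rat" where
  "bundle_degree E = (THE q. has_degree (bundle_rank E) (clutching_map E) q)"

definition bundle_invariant :: "glued_bundle \<Rightarrow> rank_degree" where
  "bundle_invariant E = Rank_Degree (int (bundle_rank E)) (bundle_degree E)"

lemma bundle_degree_iff: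
  assumes "E \<in> holomorphic_bundles"
  shows "bundle_degree E = q \<longleftrightarrow> has_degree (bundle_rank E) (clutching_map E) q"
proof -
  obtain q' where q': "has_degree (bundle_rank E) (clutching_map E) q'"
    using has_degree_exists[OF hol_clutching_map[OF assms]] by blast
  then have "bundle_degree E = q'" unfolding bundle_degree_def by (blast intro: has_degree_unique)
  then show ?thesis using q' has_degree_unique by metis
qed

lemma bundle_invariant_glue:
  assumes f: "hol n f" and q: "has_degree n f q"
  shows "glue n f \<in> holomorphic_bundles" "bundle_invariant (glue n f) = Rank_Degree (int n) q"
proof -
  show b: "glue n f \<in> holomorphic_bundles" using f by (auto simp: holomorphic_bundles_iff)
  have "isotopic n f (clutching_map (glue n f))"
    by (rule isotopic_cong[OF isotopic_refl[OF f]]) (simp_all add: clutching_map_glue[OF f])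
  then have "has_degree n (clutching_map (glue n f)) q" using q has_degree_isotopic by blast
  then have "bundle_degree (glue n f) = q" using bundle_degree_iff[OF b] by simp
  then show "bundle_invariant (glue n f) = Rank_Degree (int n) q" by (simp add: bundle_invariant_def)
qed

text \<open>
  Rank and degree form a complete invariant: isotopic maps have the same degree, and maps of equal
  degree are isotopic to the same standard map.
\<close>

lemma bundle_iso_eq: "bundle_iso = same_value holomorphic_bundles bundle_invariant"
proof -
  have "bundle_rank E = bundle_rank F \<and> holomorphic_isotopic (bundle_rank E) (clutching_map E) (clutching_map F) \<longleftrightarrow>
      bundle_invariant E = bundle_invariant F" if EF: "E \<in> holomorphic_bundles" "F \<in> holomorphic_bundles" for E F
  proof (cases "bundle_rank E = bundle_rank F")
    case True
    let ?n = "bundle_rank F" and ?f = "clutching_map E" and ?g = "clutching_map F"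
    have d: "has_degree ?n ?f (bundle_degree E)" "has_degree ?n ?g (bundle_degree F)"
      using bundle_degree_iff[OF EF(1)] bundle_degree_iff[OF EF(2)] True by auto
    have "isotopic ?n ?f ?g \<longleftrightarrow> bundle_degree E = bundle_degree F"
    proof
      assume "isotopic ?n ?f ?g"
      then show "bundle_degree E = bundle_degree F" using d has_degree_isotopic has_degree_unique by blast
    next
      assume "bundle_degree E = bundle_degree F"
      then show "isotopic ?n ?f ?g" using d unfolding has_degree_def by (metis isotopic_sym isotopic_trans)
    qed
    then show ?thesis using True by (simp add: holomorphic_isotopic_iff bundle_invariant_def)
  qed (simp add: bundle_invariant_def)
  then show ?thesis unfolding bundle_iso_def same_value_def by blast
qed

lemma bundle_sum_invariant:
  assumes "E \<in> holomorphic_bundles" "F \<in> holomorphic_bundles"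
  shows "bundle_sum E F \<in> holomorphic_bundles \<and> bundle_invariant (bundle_sum E F) = bundle_invariant E + bundle_invariant F"
  using bundle_invariant_glue[OF hol_diag_block[OF hol_clutching_map[OF assms(1)] hol_clutching_map[OF assms(2)]]
      has_degree_diag_block[OF iffD1[OF bundle_degree_iff[OF assms(1)] refl] iffD1[OF bundle_degree_iff[OF assms(2)] refl]]]
  unfolding bundle_sum_def by (simp add: bundle_invariant_def plus_rank_degree_def)

lemma bundle_tensor_invariant:
  assumes "E \<in> holomorphic_bundles" "F \<in> holomorphic_bundles"
  shows "bundle_tensor E F \<in> holomorphic_bundles \<and> bundle_invariant (bundle_tensor E F) = bundle_invariant E * bundle_invariant F"
  using bundle_invariant_glue[OF hol_kronecker[OF hol_clutching_map[OF assms(1)] hol_clutching_map[OF assms(2)]]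
      has_degree_kronecker[OF iffD1[OF bundle_degree_iff[OF assms(1)] refl] iffD1[OF bundle_degree_iff[OF assms(2)] refl]]]
  unfolding bundle_tensor_def by (simp add: bundle_invariant_def times_rank_degree_def)

lemma trivial_bundle_invariant:
  "trivial_bundle n \<in> holomorphic_bundles" "bundle_invariant (trivial_bundle n) = Rank_Degree (int n) 0"
proof -
  have "std n 0 = (\<lambda>x. 1\<^sub>m n)" unfolding std_def[abs_def] by (rule ext, rule eq_matI) (auto simp: diag_of_def chi_0)
  then have "has_degree n (\<lambda>x. 1\<^sub>m n) 0" unfolding has_degree_def using isotopic_refl[OF hol_std[of n 0]] by simp
  from bundle_invariant_glue[OF hol_one this]
  show "trivial_bundle n \<in> holomorphic_bundles" "bundle_invariant (trivial_bundle n) = Rank_Degree (int n) 0"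
    unfolding trivial_bundle_def by auto
qed

text \<open>
  A degree can be attained in every positive rank; subtracting a trivial bundle corrects the rank.
\<close>

lemma bundle_invariant_differences:
  "\<exists>s\<in>bundle_invariant ` holomorphic_bundles. \<exists>t\<in>bundle_invariant ` holomorphic_bundles. r = s - t"
proof (cases r)
  case (Rank_Degree a u)
  define n where "n = nat (max a 0) + 1"
  define m where "m = nat (int n - a)"
  have nm: "int n - int m = a" "n \<ge> 1" by (auto simp: n_def m_def)
  have "Rank_Degree (int n) u \<in> bundle_invariant ` holomorphic_bundles"
    using bundle_invariant_glue[OF hol_std has_degree_std[OF nm(2)], of u] by (metis image_eqI)
  moreover have "Rank_Degree (int m) 0 \<in> bundle_invariant ` holomorphic_bundles"
    using trivial_bundle_invariant[of m] by (metis image_eqI)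
  moreover have "r = Rank_Degree (int n) u - Rank_Degree (int m) 0"
    using nm by (simp add: Rank_Degree minus_rank_degree_def)
  ultimately show ?thesis by blast
qed

text \<open>
  The classes are the fibres of the invariant, and reading off the value of a fibre is an injective map
  into the ring of ranks and degrees which preserves both operations.
\<close>

theorem K_adelic_sphere_iso:
  "ring K_adelic_sphere" "K_adelic_sphere \<simeq> (ring_of_type_algebra :: rank_degree ring)"
proof -
  let ?B = holomorphic_bundles and ?g = bundle_invariant
  let ?c = "fibre ?B ?g" and ?S = bundle_semiring
  let ?M = "?g ` ?B"
  have inj: "inj_on ?c ?M" by (rule inj_on_fibre)
  define \<phi> where "\<phi> = the_inv_into ?M ?c"
  have \<phi>: "\<phi> (?c t) = t" if "t \<in> ?M" for t unfolding \<phi>_def by (rule the_inv_into_f_f[OF inj that])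
  have car: "carrier ?S = ?c ` ?M" by (simp add: bundle_semiring_def bundle_iso_eq same_value_quotient)
  have triv: "bundle_iso `` {trivial_bundle n} = ?c (Rank_Degree (int n) 0)" "Rank_Degree (int n) 0 \<in> ?M" for n
    using same_value_class[OF trivial_bundle_invariant(1), of ?g n] trivial_bundle_invariant[of n]
    by (auto simp: bundle_iso_eq intro!: image_eqI)
  have add: "s + t \<in> ?M \<and> ?c s \<oplus>\<^bsub>?S\<^esub> ?c t = ?c (s + t)" if "s \<in> ?M" "t \<in> ?M" for s t
  proof
    show "s + t \<in> ?M" using that bundle_sum_invariant by (force intro: image_eqI[rotated])
    show "?c s \<oplus>\<^bsub>?S\<^esub> ?c t = ?c (s + t)"
      using lift_to_classes_fibre[of ?B bundle_sum ?g "(+)", OF bundle_sum_invariant that]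
      by (simp add: bundle_semiring_def bundle_iso_eq)
  qed
  have mult: "s * t \<in> ?M \<and> ?c s \<otimes>\<^bsub>?S\<^esub> ?c t = ?c (s * t)" if "s \<in> ?M" "t \<in> ?M" for s t
  proof
    show "s * t \<in> ?M" using that bundle_tensor_invariant by (force intro: image_eqI[rotated])
    show "?c s \<otimes>\<^bsub>?S\<^esub> ?c t = ?c (s * t)"
      using lift_to_classes_fibre[of ?B bundle_tensor ?g "(*)", OF bundle_tensor_invariant that]
      by (simp add: bundle_semiring_def bundle_iso_eq)
  qed
  have zero: "\<zero>\<^bsub>?S\<^esub> = ?c 0" "0 \<in> ?M" and one: "\<one>\<^bsub>?S\<^esub> = ?c 1" "1 \<in> ?M"
    using triv[of 0] triv[of 1] by (simp_all add: bundle_semiring_def zero_rank_degree_def one_rank_degree_def)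
  have inj\<phi>: "inj_on \<phi> (carrier ?S)" unfolding car \<phi>_def using bij_betw_the_inv_into[of ?c ?M "?c ` ?M"] inj
    by (auto simp: bij_betw_def)
  have onto: "\<exists>x\<in>carrier ?S. \<exists>y\<in>carrier ?S. t = \<phi> x - \<phi> y" for t
  proof -
    obtain s r where "s \<in> ?M" "r \<in> ?M" "t = s - r" using bundle_invariant_differences[of t] by blast
    then show ?thesis unfolding car by (intro bexI[of _ "?c s"] bexI[of _ "?c r"]) (simp_all add: \<phi>)
  qed
  have z: "\<zero>\<^bsub>?S\<^esub> \<in> carrier ?S" "\<phi> \<zero>\<^bsub>?S\<^esub> = 0" and o: "\<one>\<^bsub>?S\<^esub> \<in> carrier ?S" "\<phi> \<one>\<^bsub>?S\<^esub> = 1"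
    unfolding car zero(1) one(1) using zero(2) one(2) \<phi> by auto
  have a: "x \<oplus>\<^bsub>?S\<^esub> y \<in> carrier ?S \<and> \<phi> (x \<oplus>\<^bsub>?S\<^esub> y) = \<phi> x + \<phi> y" if xy: "x \<in> carrier ?S" "y \<in> carrier ?S" for x y
  proof -
    obtain s t where s: "s \<in> ?M" "x = ?c s" and t: "t \<in> ?M" "y = ?c t" using xy unfolding car by blast
    note st = add[OF s(1) t(1)]
    then have "x \<oplus>\<^bsub>?S\<^esub> y = ?c (s + t)" by (simp only: s t)
    then show ?thesis unfolding car using st by (simp only: s(2) t(2) \<phi> s(1) t(1)) blast
  qed
  have m: "x \<otimes>\<^bsub>?S\<^esub> y \<in> carrier ?S \<and> \<phi> (x \<otimes>\<^bsub>?S\<^esub> y) = \<phi> x * \<phi> y" if xy: "x \<in> carrier ?S" "y \<in> carrier ?S" for x y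
  proof -
    obtain s t where s: "s \<in> ?M" "x = ?c s" and t: "t \<in> ?M" "y = ?c t" using xy unfolding car by blast
    note st = mult[OF s(1) t(1)]
    then have "x \<otimes>\<^bsub>?S\<^esub> y = ?c (s * t)" by (simp only: s t)
    then show ?thesis unfolding car using st by (simp only: s(2) t(2) \<phi> s(1) t(1)) blast
  qed
  show "ring K_adelic_sphere" "K_adelic_sphere \<simeq> (ring_of_type_algebra :: rank_degree ring)"
    unfolding K_adelic_sphere_def by (rule grothendieck_ring_iso[OF inj\<phi> z o a m onto]; assumption)+
qed

theorem corollary5p5:
  shows "ring K_adelic_sphere \<and>
    K_adelic_sphere \<simeq>
      rat_group_ring Quot
        (Idl\<^bsub>rat_group_ring\<^esub> {(xpow q - 1) * (xpow p - 1) | q p :: rat. True})"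
  using K_adelic_sphere_iso(1)
    ring_iso_trans[OF K_adelic_sphere_iso(2) ring_iso_sym[OF group_ring_quotient_iso(2,1)]]
  unfolding augmentation_square_def by blast

end
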